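(* Let $x\neq0$, let $n,t\in\mathbb{N}$ with $1\le t\le n$, and let $\lambda\vdash n-t$. Then there is an exact sequence of $\mathbb{A}_{n-1}$-modules $$0\longrightarrow \bigoplus_{\alpha\sqsubseteq\lambda}\mathscr{M}_{\mathbb{A}_{n-1}}(\alpha)\longrightarrow \operatorname{res}_{n-1}\big(\mathscr{M}_{\mathbb{A}_n}(\lambda)\big)\longrightarrow \bigoplus_{\lambda\sqsubset\beta}\mathscr{M}_{\mathbb{A}_{n-1}}(\beta)\longrightarrow 0,$$ where a summand $\mathscr{M}_{\mathbb{A}_{n-1}}(\beta)$ with $|\beta|>n-1$ is interpreted as $0$.
   Context: Let $K$ be a field, $x$ an element transcendental or algebraic over $K$, $F=K(x)$ of characteristic zero. $\mathscr{A}_n$ is the set of graphs on $\{1,\dots,n\}\cup\{1',\dots,n'\}$ (top row $1..n$, bottom row $1'..n'$) with all vertex degrees $0$ or $1$; degree-$0$ vertices carry loops; arcs within a row are horizontal, between rows vertical. Product: stack $\mathfrak a$ above $\mathfrak b$ identifying bottom vertex $i'$ of $\mathfrak a$ with top vertex $i$ of $\mathfrak b$; $\ell(\mathfrak a,\mathfrak b)$ = number of components lying entirely in the middle row; $G'(\mathfrak a,\mathfrak b)$ = diagram on the outer rows joining two vertices iff connected by a path; $\mathfrak a\mathfrak b=x^{\ell(\mathfrak a,\mathfrak b)}G'(\mathfrak a,\mathfrak b)$. This gives the algebra $\mathbb{A}_n$ with basis $\mathscr{A}_n$. $S_n$ = diagrams with $n$ vertical arcs; $S_{n-t}\subset S_n$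 = permutations fixing $n-t+1,\dots,n$. $\epsilon_n\colon\mathbb{A}_{n-1}\to\mathbb{A}_n$ adds vertices $n,n'$ joined by the arc $(n,n')$, and $\operatorname{res}_{n-1}(M)$ is an $\mathbb{A}_n$-module $M$ regarded as $\mathbb{A}_{n-1}$-module via $\epsilon_n$. For $0\le m\le n$, $\mathbb{A}_n^m$ = span of diagrams with at most $m$ vertical arcs ($\mathbb{A}_n^{-1}=0$), $\mathbb{I}_n^m=\mathbb{A}_n^m/\mathbb{A}_n^{m-1}$ (basis: diagrams with exactly $m$ vertical arcs; products with fewer vertical arcs are $0$). $\mathfrak u_{n,t}$ = diagram with arcs $(i,i')$, $1\le i\le n-t$, other vertices isolated. For $\lambda\vdash n-t$ ($0\le t\le n$) with Specht module $S^\lambda$ over $F$, and $x\neq 0$, $\mathscr{M}_{\mathbb{A}_n}(\lambda)=\mathbb{I}_n^{n-t}\mathfrak u_{n,t}\otimes_{F[S_{n-t}]}S^\lambda$, an $\mathbb{A}_n$-module via $\mathfrak b\cdot(\mathfrak a\otimes v)=(\mathfrak b\mathfrak a)\otimes v$ (product in $\mathbb{I}_n^{n-t}$). For partitions: $\alpha\sqsubset\lambda$ means $\alpha$ is obtained from $\lambda$ by removing one box (an inner corner); $\lambda\sqsubset\beta$ means $\beta$ is obtained from $\lambda$ by adding one box; $\alpha\sqsubseteq\lambda$ means $\alpha\sqsubset\lambda$ or $\alpha=\lambda$. *)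

theory Defs
  imports "HOL-Combinatorics.Permutations" "HOL-Library.FuncSet"
begin

definition is_partition :: "nat \<Rightarrow> nat list \<Rightarrow> bool" where
  "is_partition m lam \<longleftrightarrow> sorted (rev lam) \<and> 0 \<notin> set lam \<and> sum_list lam = m"

definition cells :: "nat list \<Rightarrow> (nat \<times> nat) set" where
  "cells lam = {(r, c). r < length lam \<and> c < lam ! r}"

definition removes_box :: "nat list \<Rightarrow> nat list \<Rightarrow> bool" where
  "removes_box al lam \<longleftrightarrow> is_partition (sum_list al) al \<and> is_partition (sum_list lam) lam
     \<and> cells al \<subseteq> cells lam \<and> card (cells lam - cells al) = 1"

definition part_le :: "nat list \<Rightarrow> nat list \<Rightarrow> bool" where
  "part_le al lam \<longleftrightarrow> removes_box al lam \<or> al = lam"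

datatype vtx = Top nat | Bot nat

type_synonym diagram = "vtx set set"

definition verts :: "nat \<Rightarrow> vtx set" where
  "verts n = Top ` {1..n} \<union> Bot ` {1..n}"

text \<open>Graphs on the 2n vertices with all degrees 0 or 1 (edge sets; isolated vertices carry loops).\<close>
definition diagrams :: "nat \<Rightarrow> diagram set" where
  "diagrams n = {D. (\<forall>e\<in>D. \<exists>u v. e = {u, v} \<and> u \<noteq> v \<and> u \<in> verts n \<and> v \<in> verts n)
                   \<and> (\<forall>e\<in>D. \<forall>e'\<in>D. e \<inter> e' \<noteq> {} \<longrightarrow> e = e')}"

definition vertical :: "vtx set \<Rightarrow> bool" where
  "vertical e \<longleftrightarrow> (\<exists>i j. e = {Top i, Bot j})"

definition nvert :: "diagram \<Rightarrow> nat" where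
  "nvert D = card {e \<in> D. vertical e}"

text \<open>Stacking: three rows U (top of a), Mid (identified middle row), L (bottom of b).\<close>
datatype v3 = U nat | Mid nat | L nat

fun upper :: "vtx \<Rightarrow> v3" where
  "upper (Top i) = U i" | "upper (Bot i) = Mid i"
fun lower :: "vtx \<Rightarrow> v3" where
  "lower (Top i) = Mid i" | "lower (Bot i) = L i"
fun outer :: "v3 \<Rightarrow> vtx" where
  "outer (U i) = Top i" | "outer (L i) = Bot i" | "outer (Mid i) = Top 0"

definition stack_rel :: "diagram \<Rightarrow> diagram \<Rightarrow> (v3 \<times> v3) set" where
  "stack_rel a b = {(p, q). {p, q} \<in> (image upper) ` a \<union> (image lower) ` b}"

definition conn :: "diagram \<Rightarrow> diagram \<Rightarrow> v3 \<Rightarrow> v3 set" where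
  "conn a b p = {q. (p, q) \<in> (stack_rel a b)\<^sup>*}"

definition ell :: "nat \<Rightarrow> diagram \<Rightarrow> diagram \<Rightarrow> nat" where
  "ell n a b = card {C. \<exists>i\<in>{1..n}. C = conn a b (Mid i) \<and> C \<subseteq> range Mid}"

definition Gprime :: "diagram \<Rightarrow> diagram \<Rightarrow> diagram" where
  "Gprime a b = {{outer p, outer q} | p q. p \<noteq> q \<and> p \<notin> range Mid \<and> q \<notin> range Mid
                     \<and> (p, q) \<in> (stack_rel a b)\<^sup>*}"

text \<open>Elements of I_n^m are coefficient functions supported on diagrams with exactly m vertical arcs.\<close>
definition Ibasis :: "nat \<Rightarrow> nat \<Rightarrow> diagram set" where
  "Ibasis n m = {d \<in> diagrams n. nvert d = m}"

definition Ispace :: "nat \<Rightarrow> nat \<Rightarrow> (diagram \<Rightarrow> 'a::field) set" where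
  "Ispace n m = {f. \<forall>d. f d \<noteq> 0 \<longrightarrow> d \<in> Ibasis n m}"

text \<open>product of two diagrams, computed in I_n^m (zero if fewer than m vertical arcs)\<close>
definition prodI :: "'a::field \<Rightarrow> nat \<Rightarrow> nat \<Rightarrow> diagram \<Rightarrow> diagram \<Rightarrow> diagram \<Rightarrow> 'a" where
  "prodI x n m a b = (\<lambda>e. if nvert (Gprime a b) = m \<and> e = Gprime a b then x ^ ell n a b else 0)"

definition Ileft :: "'a::field \<Rightarrow> nat \<Rightarrow> nat \<Rightarrow> diagram \<Rightarrow> (diagram \<Rightarrow> 'a) \<Rightarrow> (diagram \<Rightarrow> 'a)" where
  "Ileft x n m b f = (\<lambda>e. \<Sum>d\<in>Ibasis n m. f d * prodI x n m b d e)"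

definition Iright :: "'a::field \<Rightarrow> nat \<Rightarrow> nat \<Rightarrow> (diagram \<Rightarrow> 'a) \<Rightarrow> diagram \<Rightarrow> (diagram \<Rightarrow> 'a)" where
  "Iright x n m f b = (\<lambda>e. \<Sum>d\<in>Ibasis n m. f d * prodI x n m d b e)"

definition u_diag :: "nat \<Rightarrow> diagram" where
  "u_diag m = {{Top i, Bot i} | i. i \<in> {1..m}}"

definition left_ideal :: "'a::field \<Rightarrow> nat \<Rightarrow> nat \<Rightarrow> (diagram \<Rightarrow> 'a) set" where
  "left_ideal x n m = {Iright x n m f (u_diag m) | f. f \<in> Ispace n m}"

text \<open>the permutation diagram of sigma (a group homomorphism S_n \<rightarrow> diagrams)\<close>
definition perm_diag :: "nat \<Rightarrow> (nat \<Rightarrow> nat) \<Rightarrow> diagram" where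
  "perm_diag n \<sigma> = {{Top (\<sigma> i), Bot i} | i. i \<in> {1..n}}"

definition lspan :: "('b \<Rightarrow> 'a::field) set \<Rightarrow> ('b \<Rightarrow> 'a) set" where
  "lspan S = {v. \<exists>A c. finite A \<and> A \<subseteq> S \<and> v = (\<lambda>z. \<Sum>s\<in>A. c s * s z)}"

definition vadd :: "('b \<Rightarrow> 'a::field) \<Rightarrow> ('b \<Rightarrow> 'a) \<Rightarrow> ('b \<Rightarrow> 'a)" where
  "vadd f g = (\<lambda>z. f z + g z)"

definition vsmul :: "'a::field \<Rightarrow> ('b \<Rightarrow> 'a) \<Rightarrow> ('b \<Rightarrow> 'a)" where
  "vsmul c f = (\<lambda>z. c * f z)"

section \<open>Specht modules (Sagan's construction via polytabloids)\<close>

definition tableaux :: "nat list \<Rightarrow> (nat \<times> nat \<Rightarrow> nat) set" where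
  "tableaux lam = {T. bij_betw T (cells lam) {1..sum_list lam}}"

text \<open>tabloid {T}: entry i \<mapsto> row containing i\<close>
definition tabloid_of :: "nat list \<Rightarrow> (nat \<times> nat \<Rightarrow> nat) \<Rightarrow> nat \<Rightarrow> nat" where
  "tabloid_of lam T = (\<lambda>i. if i \<in> {1..sum_list lam} then fst (inv_into (cells lam) T i) else 0)"

definition col_group :: "nat list \<Rightarrow> (nat \<times> nat \<Rightarrow> nat) \<Rightarrow> (nat \<Rightarrow> nat) set" where
  "col_group lam T = {\<sigma>. \<sigma> permutes {1..sum_list lam} \<and>
      (\<forall>i\<in>{1..sum_list lam}. snd (inv_into (cells lam) T (\<sigma> i)) = snd (inv_into (cells lam) T i))}"

definition polytabloid :: "nat list \<Rightarrow> (nat \<times> nat \<Rightarrow> nat) \<Rightarrow> (nat \<Rightarrow> nat) \<Rightarrow> 'a::field" where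
  "polytabloid lam T = (\<lambda>\<tau>. \<Sum>\<sigma>\<in>{\<sigma> \<in> col_group lam T. tabloid_of lam (\<sigma> \<circ> T) = \<tau>}. of_int (sign \<sigma>))"

definition specht :: "nat list \<Rightarrow> ((nat \<Rightarrow> nat) \<Rightarrow> 'a::field) set" where
  "specht lam = lspan (polytabloid lam ` tableaux lam)"

text \<open>left action of a permutation on the permutation module: \<pi>{T} = {\<pi> \<circ> T}\<close>
definition perm_act :: "(nat \<Rightarrow> nat) \<Rightarrow> ((nat \<Rightarrow> nat) \<Rightarrow> 'a) \<Rightarrow> ((nat \<Rightarrow> nat) \<Rightarrow> 'a)" where
  "perm_act \<pi> h = (\<lambda>\<tau>. h (\<tau> \<circ> \<pi>))"

record ('e, 'a, 'd) amod =
  mcar :: "'e set"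
  madd :: "'e \<Rightarrow> 'e \<Rightarrow> 'e"
  mzero :: 'e
  msmul :: "'a \<Rightarrow> 'e \<Rightarrow> 'e"
  mact :: "'d \<Rightarrow> 'e \<Rightarrow> 'e"

text \<open>F-linear maps commuting with the action of every diagram in D (hence with the algebra spanned by D)\<close>
definition is_hom :: "'d set \<Rightarrow> ('e, 'a, 'd) amod \<Rightarrow> ('f, 'a, 'd) amod \<Rightarrow> ('e \<Rightarrow> 'f) \<Rightarrow> bool" where
  "is_hom D M N f \<longleftrightarrow> (\<forall>v\<in>mcar M. f v \<in> mcar N)
     \<and> (\<forall>u\<in>mcar M. \<forall>v\<in>mcar M. f (madd M u v) = madd N (f u) (f v))
     \<and> (\<forall>c. \<forall>v\<in>mcar M. f (msmul M c v) = msmul N c (f v))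
     \<and> (\<forall>d\<in>D. \<forall>v\<in>mcar M. f (mact M d v) = mact N d (f v))"

definition short_exact :: "'d set \<Rightarrow> ('e1, 'a, 'd) amod \<Rightarrow> ('e2, 'a, 'd) amod \<Rightarrow> ('e3, 'a, 'd) amod
     \<Rightarrow> ('e1 \<Rightarrow> 'e2) \<Rightarrow> ('e2 \<Rightarrow> 'e3) \<Rightarrow> bool" where
  "short_exact D A B C f g \<longleftrightarrow> is_hom D A B f \<and> is_hom D B C g \<and> inj_on f (mcar A)
     \<and> g ` mcar B = mcar C \<and> f ` mcar A = {v \<in> mcar B. g v = mzero C}"

definition dsum :: "'i set \<Rightarrow> ('i \<Rightarrow> ('e, 'a, 'd) amod) \<Rightarrow> ('i \<Rightarrow> 'e, 'a, 'd) amod" where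
  "dsum I Ms = \<lparr> mcar = PiE I (\<lambda>i. mcar (Ms i)),
      madd = (\<lambda>\<phi> \<psi>. restrict (\<lambda>i. madd (Ms i) (\<phi> i) (\<psi> i)) I),
      mzero = restrict (\<lambda>i. mzero (Ms i)) I,
      msmul = (\<lambda>c \<phi>. restrict (\<lambda>i. msmul (Ms i) c (\<phi> i)) I),
      mact = (\<lambda>d \<phi>. restrict (\<lambda>i. mact (Ms i) d (\<phi> i)) I) \<rparr>"

definition eps :: "nat \<Rightarrow> diagram \<Rightarrow> diagram" where
  "eps n d = insert {Top n, Bot n} d"

definition restr :: "nat \<Rightarrow> ('e, 'a, diagram) amod \<Rightarrow> ('e, 'a, diagram) amod" where
  "restr n M = M\<lparr>mact := (\<lambda>d. mact M (eps n d))\<rparr>"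

section \<open>Tensor product V \<otimes>_{F[G]} W as a quotient of the free vector space on V \<times> W\<close>

definition fspace :: "'v set \<Rightarrow> 'w set \<Rightarrow> ('v \<times> 'w \<Rightarrow> 'a::field) set" where
  "fspace V W = {h. finite {p. h p \<noteq> 0} \<and> (\<forall>p. h p \<noteq> 0 \<longrightarrow> fst p \<in> V \<and> snd p \<in> W)}"

definition pt :: "'v \<Rightarrow> 'w \<Rightarrow> ('v \<times> 'w \<Rightarrow> 'a::field)" where
  "pt v w = (\<lambda>p. if p = (v, w) then 1 else 0)"

definition tens_rels :: "('b \<Rightarrow> 'a::field) set \<Rightarrow> ('c \<Rightarrow> 'a) set \<Rightarrow> 'g set
     \<Rightarrow> (('b \<Rightarrow> 'a) \<Rightarrow> 'g \<Rightarrow> ('b \<Rightarrow> 'a)) \<Rightarrow> ('g \<Rightarrow> ('c \<Rightarrow> 'a) \<Rightarrow> ('c \<Rightarrow> 'a))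
     \<Rightarrow> (('b \<Rightarrow> 'a) \<times> ('c \<Rightarrow> 'a) \<Rightarrow> 'a) set" where
  "tens_rels V W G ract lact =
     {(\<lambda>p. pt (vadd v v') w p - pt v w p - pt v' w p) | v v' w. v \<in> V \<and> v' \<in> V \<and> w \<in> W}
   \<union> {(\<lambda>p. pt v (vadd w w') p - pt v w p - pt v w' p) | v w w'. v \<in> V \<and> w \<in> W \<and> w' \<in> W}
   \<union> {(\<lambda>p. pt (vsmul c v) w p - c * pt v w p) | c v w. v \<in> V \<and> w \<in> W}
   \<union> {(\<lambda>p. pt v (vsmul c w) p - c * pt v w p) | c v w. v \<in> V \<and> w \<in> W}
   \<union> {(\<lambda>p. pt (ract v g) w p - pt v (lact g w) p) | v w g. v \<in> V \<and> w \<in> W \<and> g \<in> G}"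

definition coset :: "('p \<Rightarrow> 'a::field) set \<Rightarrow> ('p \<Rightarrow> 'a) \<Rightarrow> ('p \<Rightarrow> 'a) set" where
  "coset N h = {k. (\<lambda>p. k p - h p) \<in> N}"

text \<open>left action of b on the free space, induced by v \<otimes> w \<mapsto> (b v) \<otimes> w\<close>
definition tact :: "(('b \<Rightarrow> 'a) \<Rightarrow> ('b \<Rightarrow> 'a)) \<Rightarrow> (('b \<Rightarrow> 'a) \<times> 'w \<Rightarrow> 'a::field)
     \<Rightarrow> (('b \<Rightarrow> 'a) \<times> 'w \<Rightarrow> 'a)" where
  "tact Lm h = (\<lambda>q. \<Sum>p\<in>{p. h p \<noteq> 0 \<and> (Lm (fst p), snd p) = q}. h p)"

type_synonym 'a Melt = "((diagram \<Rightarrow> 'a) \<times> ((nat \<Rightarrow> nat) \<Rightarrow> 'a) \<Rightarrow> 'a) set"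

text \<open>MA x n lam = M_{A_n}(lam) = I_n^{n-t} u_{n,t} \<otimes>_{F[S_{n-t}]} S^lam, where lam \<turnstile> n - t\<close>
definition MA :: "'a::field \<Rightarrow> nat \<Rightarrow> nat list \<Rightarrow> ('a Melt, 'a, diagram) amod" where
  "MA x n lam =
    (let m = sum_list lam;
         V = left_ideal x n m;
         W = specht lam;
         G = {\<sigma>. \<sigma> permutes {1..m}};
         N = lspan (tens_rels V W G (\<lambda>v \<sigma>. Iright x n m v (perm_diag n \<sigma>)) perm_act)
     in \<lparr> mcar = {coset N h | h. h \<in> fspace V W},
          madd = (\<lambda>C D. {k. \<exists>h\<in>C. \<exists>h'\<in>D. (\<lambda>p. k p - h p - h' p) \<in> N}),
          mzero = N,
          msmul = (\<lambda>c C. {k. \<exists>h\<in>C. (\<lambda>p. k p - c * h p) \<in> N}),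
          mact = (\<lambda>b C. {k. \<exists>h\<in>C. (\<lambda>p. k p - tact (Ileft x n m b) h p) \<in> N}) \<rparr>)"

end

theory Submission
  imports Defs "HOL-Library.Function_Algebras" "HOL.Vector_Spaces"
begin

text \<open>Let \<open>m = n - t\<close>. Since \<open>x \<noteq> 0\<close>, the module of \<open>lam\<close> is the space of \<open>S\<^sub>m\<close>-equivariant functions with
  values in the Specht module on the diagrams with \<open>m\<close> vertical arcs that end exactly at the bottom
  vertices \<open>1, \<dots>, m\<close>. Such diagrams are of three kinds, according to whether the last top vertex is
  isolated, on a vertical arc or on a horizontal arc. Moving that vertex to the bottom row turns the
  diagrams of the third kind into those on \<open>n - 1\<close> points with \<open>m + 1\<close> vertical arcs; restricting to
  them is a homomorphism, and by the branching rule for induction its image is the sum over the \<open>be\<close>.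
  Its kernel is the space of functions on the first two kinds: the first gives the module of \<open>lam\<close>,
  the second the restriction of the Specht module to \<open>S\<^bsub>m-1\<^esub>\<close>, that is the sum over the smaller \<open>al\<close>.
  The branching rules come from the filtration of a Specht module by the column of the largest entry:
  the sum of all transpositions acts by different scalars on its factors.\<close>

section \<open>Partitions and their Young diagrams\<close>

text \<open>The function model avoids representatives for the orbits of diagrams: a value is chosen
  separately at each diagram considered, and injectivity of the branching maps then forces the
  choices to be equivariant. The obstacle in the induction rule is surjectivity. It is obtained by
  counting: the numbers of standard tableaux of the shapes covering \<open>lam\<close> add up to
  \<open>m + 1\<close> times that of \<open>lam\<close>, so an injective map already fills the
  induced module. Injectivity separates the summands by eigenvalues and then needs irreducible
  Specht modules, which come from an induction along the restriction rule. Straightening has to be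
  carried out for abstract families of vectors modulo a subspace, because fixing the largest entry
  at a corner reproduces the relations of the smaller shape only up to tableaux in which that entry
  lies further right. Characteristic zero enters by dividing by factorials, which permits
  antisymmetrising over full symmetric groups in place of coset representatives, and by keeping the
  contents of different corners distinct.\<close>

definition young :: "(nat \<times> nat) set \<Rightarrow> bool" where
  "young D \<longleftrightarrow> finite D \<and> (\<forall>r c r' c'. (r, c) \<in> D \<longrightarrow> r' \<le> r \<longrightarrow> c' \<le> c \<longrightarrow> (r', c') \<in> D)"

lemma youngD: "young D \<Longrightarrow> (r, c) \<in> D \<Longrightarrow> r' \<le> r \<Longrightarrow> c' \<le> c \<Longrightarrow> (r', c') \<in> D"
  unfolding young_def by blast

lemma cells_Sigma: "cells lam = Sigma {..<length lam} (\<lambda>r. {..<lam ! r})"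
  by (auto simp: cells_def)

lemma finite_cells [simp]: "finite (cells lam)"
  by (simp add: cells_Sigma)

lemma card_cells: "card (cells lam) = sum_list lam"
  by (simp add: cells_Sigma sum_list_sum_nth atLeast0LessThan)

lemma young_cells:
  assumes "is_partition m lam" shows "young (cells lam)"
proof -
  have "lam ! r \<le> lam ! r'" if "r' \<le> r" "r < length lam" for r r'
  proof -
    have "sorted_wrt (\<ge>) lam"
      using assms by (simp add: is_partition_def sorted_wrt_rev)
    then show ?thesis using that
      by (cases "r = r'") (auto simp: sorted_wrt_iff_nth_less)
  qed
  then show ?thesis unfolding young_def using finite_cells[of lam]
    by (auto simp: cells_def intro: le_less_trans less_le_trans)
qed

text \<open>Parts are nonzero, so the length of the list can be read off the first column; trailing
  zeros would be invisible in the diagram.\<close>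

lemma cells_inj:
  assumes "is_partition m lam" "is_partition m' mu" "cells lam = cells mu"
  shows "lam = mu"
proof -
  have len: "r < length l \<longleftrightarrow> (r, 0) \<in> cells l" if "is_partition k l" for r k l
    using that by (auto simp: cells_def is_partition_def) (metis gr0I nth_mem)
  have "r < length lam \<longleftrightarrow> r < length mu" for r
    using len[OF assms(1)] len[OF assms(2)] assms(3) by blast
  then have l: "length lam = length mu" by (metis linorder_neqE_nat less_irrefl)
  have "lam ! r = mu ! r" if "r < length lam" for r
  proof -
    have "c < lam ! r \<longleftrightarrow> c < mu ! r" for c
      using assms(3) that l by (auto simp: cells_def set_eq_iff)
    then show ?thesis by (metis linorder_neqE_nat less_irrefl)
  qed
  with l show ?thesis by (intro nth_equalityI) auto
qed

lemma downset_lessThan: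
  assumes "finite (A :: nat set)" "\<And>r r'. r \<in> A \<Longrightarrow> r' \<le> r \<Longrightarrow> r' \<in> A"
  shows "A = {..<card A}"
proof (cases "A = {}")
  case False
  have "A = {..Max A}"
    using assms False by (auto intro: Max_ge assms(2)[OF Max_in])
  then show ?thesis by (metis card_atMost lessThan_Suc_atMost)
qed simp

text \<open>Closure towards the origin makes every row and the first column an initial segment; the
  partition consists of the row lengths.\<close>

lemma partition_of_young:
  assumes "young D" obtains lam where "is_partition (card D) lam" "cells lam = D"
proof -
  define rl where "rl r = card {c. (r, c) \<in> D}" for r
  have finr: "finite {c. (r, c) \<in> D}" for r
    by (rule finite_subset[of _ "snd ` D"]) (use assms in \<open>force simp: young_def\<close>)+
  have finc: "finite {r. (r, 0) \<in> D}"
    by (rule finite_subset[of _ "fst ` D"]) (use assms in \<open>force simp: young_def\<close>)+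
  have row: "{c. (r, c) \<in> D} = {..<rl r}" for r
    unfolding rl_def by (rule downset_lessThan[OF finr]) (use youngD[OF assms] in blast)
  define h where "h = card {r. (r, 0) \<in> D}"
  have col: "{r. (r, 0) \<in> D} = {..<h}"
    unfolding h_def by (rule downset_lessThan[OF finc]) (use youngD[OF assms] in blast)
  define lam where "lam = map rl [0..<h]"
  have cells: "cells lam = D"
  proof -
    have "(r, c) \<in> D \<longleftrightarrow> r < h \<and> c < rl r" for r c
      using row col youngD[OF assms, of r c r 0] by (auto simp: set_eq_iff)
    then show ?thesis by (auto simp: cells_def lam_def)
  qed
  have mono: "rl r' \<le> rl r" if "r \<le> r'" for r r'
    unfolding rl_def by (rule card_mono[OF finr]) (use that youngD[OF assms] in blast)
  have "sorted (rev lam)"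
    unfolding lam_def sorted_wrt_rev by (auto simp: sorted_wrt_map sorted_wrt_iff_nth_less intro: mono)
  moreover have "0 \<notin> set lam"
  proof
    assume "0 \<in> set lam"
    then obtain r where "r < h" "rl r = 0" by (auto simp: lam_def)
    then show False using row[of r] col by (auto simp: set_eq_iff)
  qed
  moreover have "sum_list lam = card D" using card_cells[of lam] cells by simp
  ultimately show thesis using that cells by (auto simp: is_partition_def)
qed

lemma removes_box_iff:
  "removes_box al lam \<longleftrightarrow> is_partition (sum_list al) al \<and> is_partition (sum_list lam) lam
     \<and> (\<exists>b. b \<notin> cells al \<and> cells lam = insert b (cells al))"
  unfolding removes_box_def by (auto simp: card_1_singleton_iff)

text \<open>The larger shape comes first, against the argument order of \<open>removes_box\<close>.
  The value is meaningful only if the two shapes differ by exactly one cell.\<close>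

definition box :: "nat list \<Rightarrow> nat list \<Rightarrow> nat \<times> nat" where
  "box lam al = the_elem (cells lam - cells al)"

lemma removes_boxD:
  assumes "removes_box al lam"
  shows "is_partition (sum_list al) al" "is_partition (sum_list lam) lam"
    "box lam al \<notin> cells al" "cells lam = insert (box lam al) (cells al)"
    "sum_list lam = Suc (sum_list al)"
proof -
  obtain b where b: "b \<notin> cells al" "cells lam = insert b (cells al)"
    and p: "is_partition (sum_list al) al" "is_partition (sum_list lam) lam"
    using assms by (auto simp: removes_box_iff)
  have "cells lam - cells al = {b}" using b by auto
  then have bb: "box lam al = b" by (simp add: box_def)
  show "is_partition (sum_list al) al" "is_partition (sum_list lam) lam" by fact+
  show "box lam al \<notin> cells al" "cells lam = insert (box lam al) (cells al)"
    using b bb by auto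
  show "sum_list lam = Suc (sum_list al)"
    using b by (metis card_cells card_insert_disjoint finite_cells)
qed

definition down :: "nat list \<Rightarrow> nat list set" where
  "down lam = {al. removes_box al lam}"

definition up :: "nat list \<Rightarrow> nat list set" where
  "up lam = {be. removes_box lam be}"

lemma in_down: "al \<in> down lam \<longleftrightarrow> removes_box al lam" by (simp add: down_def)

lemma in_up: "be \<in> up lam \<longleftrightarrow> removes_box lam be" by (simp add: up_def)

lemma is_partition_sum: "is_partition m lam \<Longrightarrow> sum_list lam = m"
  by (simp add: is_partition_def)

section \<open>Column lengths, removable corners and addable boxes\<close>

definition ht :: "nat list \<Rightarrow> nat \<Rightarrow> nat" where
  "ht lam c = card {r. (r, c) \<in> cells lam}"

lemma finite_col [simp]: "finite {r. (r, c) \<in> cells lam}"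
  by (rule finite_subset[of _ "fst ` cells lam"]) force+

lemma in_cells_ht:
  assumes "is_partition m lam" shows "(r, c) \<in> cells lam \<longleftrightarrow> r < ht lam c"
proof -
  have "{r. (r, c) \<in> cells lam} = {..<ht lam c}"
    unfolding ht_def by (rule downset_lessThan) (use youngD[OF young_cells[OF assms]] in auto)
  then show ?thesis by auto
qed

lemma ht_antimono:
  assumes "is_partition m lam" "c \<le> c'" shows "ht lam c' \<le> ht lam c"
  unfolding ht_def by (rule card_mono) (use assms youngD[OF young_cells[OF assms(1)]] in auto)

text \<open>The box is the lowest cell of its column, and nothing lies to its right. The inequality
  in the third claim later makes the contents of corners distinct and lets \<open>th\<close> kill
  the columns further right.\<close>

lemma box_corner:
  assumes "removes_box al lam" "box lam al = (r, c)"
  shows "ht lam c = Suc r" "ht al c = r" "ht lam (Suc c) \<le> r"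
    "\<And>c'. c' \<noteq> c \<Longrightarrow> ht lam c' = ht al c'"
proof -
  note D = removes_boxD[OF assms(1)]
  have 1: "{r'. (r', c) \<in> cells lam} = insert r {r'. (r', c) \<in> cells al}"
    using D(4) assms(2) by auto
  have nin: "(r, c) \<notin> cells al" using D(3) assms(2) by simp
  have le: "ht al c \<le> r" using in_cells_ht[OF D(1), of r c] nin by simp
  have "r < ht lam c" using in_cells_ht[OF D(2), of r c] D(4) assms(2) by auto
  moreover have s: "ht lam c = Suc (ht al c)" unfolding ht_def 1 using nin by simp
  ultimately show "ht lam c = Suc r" "ht al c = r" using le by auto
  show "ht lam (Suc c) \<le> r"
  proof (rule ccontr)
    assume "\<not> ?thesis"
    then have "(r, Suc c) \<in> cells lam" using in_cells_ht[OF D(2)] by simp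
    then have "(r, Suc c) \<in> cells al" using D(4) assms(2) by auto
    then have "(r, c) \<in> cells al" using youngD[OF young_cells[OF D(1)]] by (meson le_refl le_SucI)
    with nin show False by simp
  qed
  show "ht lam c' = ht al c'" if "c' \<noteq> c" for c'
    unfolding ht_def using D(4) assms(2) that by (intro arg_cong[where f=card]) auto
qed

text \<open>A strict drop between two neighbouring columns leaves the lowest cell of the first one
  without a neighbour below or to the right, so deleting it keeps the diagram closed towards the
  origin.\<close>

lemma corner_removable:
  assumes "is_partition m lam" "ht lam (Suc c) < ht lam c"
  obtains al where "removes_box al lam" "box lam al = (ht lam c - 1, c)"
proof -
  let ?b = "(ht lam c - 1, c)"
  have b: "?b \<in> cells lam" using assms in_cells_ht[OF assms(1)] by simp
  have n1: "(Suc r, c) \<notin> cells lam" "(r, Suc c) \<notin> cells lam" if "ht lam c - 1 \<le> r" for r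
    using assms(2) in_cells_ht[OF assms(1)] that by auto
  have "young (cells lam - {?b})"
    unfolding young_def
  proof (intro conjI allI impI)
    fix r c1 r' c' assume *: "(r, c1) \<in> cells lam - {?b}" "r' \<le> r" "c' \<le> c1"
    have "(r', c') \<noteq> ?b"
    proof
      assume e: "(r', c') = ?b"
      have "Suc r' \<le> r \<or> Suc c' \<le> c1" using * e by auto
      then have "(Suc r', c') \<in> cells lam \<or> (r', Suc c') \<in> cells lam"
        using * youngD[OF young_cells[OF assms(1)], of r c1] by auto
      with n1[of r'] e show False by auto
    qed
    then show "(r', c') \<in> cells lam - {?b}"
      using * youngD[OF young_cells[OF assms(1)], of r c1] by auto
  qed simp
  then obtain al where al: "is_partition (card (cells lam - {?b})) al" "cells al = cells lam - {?b}"
    by (rule partition_of_young)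
  have "removes_box al lam"
    unfolding removes_box_iff using al b assms(1) is_partition_sum by (metis Diff_iff insert_Diff insertI1)
  moreover have "box lam al = ?b"
    unfolding box_def al(2) using b by (simp add: double_diff)
  ultimately show thesis by (rule that)
qed

text \<open>A column has only one lowest cell. Columns can therefore serve as names for corners,
  which is how the filtration indexes its layers.\<close>

lemma down_eq_if_same_col:
  assumes "removes_box al lam" "removes_box al' lam" "snd (box lam al) = snd (box lam al')"
  shows "al = al'"
proof -
  obtain r c r' where b: "box lam al = (r, c)" "box lam al' = (r', c)"
    using assms(3) by (metis prod.collapse)
  have "r = r'" using box_corner(1)[OF assms(1) b(1)] box_corner(1)[OF assms(2) b(2)] by simp
  then have "cells al = cells al'"
    using removes_boxD(3,4)[OF assms(1)] removes_boxD(3,4)[OF assms(2)] b by auto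
  then show ?thesis using cells_inj removes_boxD(1) assms by blast
qed

lemma up_eq_if_same_col:
  assumes "removes_box lam be" "removes_box lam be'" "snd (box be lam) = snd (box be' lam)"
  shows "be = be'"
proof -
  obtain r c r' where b: "box be lam = (r, c)" "box be' lam = (r', c)"
    using assms(3) by (metis prod.collapse)
  have "r = r'" using box_corner(2)[OF assms(1) b(1)] box_corner(2)[OF assms(2) b(2)] by simp
  then have "cells be = cells be'"
    using removes_boxD(4)[OF assms(1)] removes_boxD(4)[OF assms(2)] b by auto
  then show ?thesis using cells_inj removes_boxD(2) assms by blast
qed

lemma down_cols_subset: "(\<lambda>al. snd (box lam al)) ` down lam \<subseteq> snd ` cells lam"
  using removes_boxD(4) by (auto simp: in_down)

lemma finite_down [simp]: "finite (down lam)"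
proof -
  have "inj_on (\<lambda>al. snd (box lam al)) (down lam)"
    by (auto simp: inj_on_def in_down intro: down_eq_if_same_col)
  then show ?thesis
    using down_cols_subset[of lam] by (meson finite_cells finite_imageD finite_imageI finite_subset)
qed

lemma up_addable:
  assumes "is_partition m lam" "c = 0 \<or> ht lam c < ht lam (c - 1)"
  obtains be where "removes_box lam be" "box be lam = (ht lam c, c)"
proof -
  let ?b = "(ht lam c, c)"
  have b: "?b \<notin> cells lam" using in_cells_ht[OF assms(1)] by simp
  have "young (insert ?b (cells lam))"
    unfolding young_def
  proof (intro conjI allI impI)
    fix r c1 r' c' assume *: "(r, c1) \<in> insert ?b (cells lam)" "r' \<le> r" "c' \<le> c1"
    show "(r', c') \<in> insert ?b (cells lam)"
    proof (cases "(r, c1) \<in> cells lam")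
      case True then show ?thesis using * youngD[OF young_cells[OF assms(1)], of r c1] by auto
    next
      case False
      then have e: "r = ht lam c" "c1 = c" using * by auto
      show ?thesis
      proof (cases "c' = c")
        case True then show ?thesis using * e in_cells_ht[OF assms(1)] by auto
      next
        case False
        then have "c' \<le> c - 1" "c \<noteq> 0" using * e by auto
        then have "ht lam c < ht lam c'" using assms(2) ht_antimono[OF assms(1)] by (meson less_le_trans)
        then show ?thesis using * e in_cells_ht[OF assms(1)] by auto
      qed
    qed
  qed simp
  then obtain be where be: "is_partition (card (insert ?b (cells lam))) be" "cells be = insert ?b (cells lam)"
    by (rule partition_of_young)
  have "removes_box lam be"
    unfolding removes_box_iff using be b assms(1) is_partition_sum by metis
  moreover have "box be lam = ?b"
    unfolding box_def be(2) using b by (simp add: insert_Diff_if)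
  ultimately show thesis by (rule that)
qed

text \<open>A box fits at the foot of a column \<open>c > 0\<close> exactly when column
  \<open>c - 1\<close> is strictly longer, that is when column \<open>c - 1\<close> ends in a
  removable corner; column \<open>0\<close> always accepts one.\<close>

lemma up_cols:
  assumes "is_partition m lam"
  shows "(\<lambda>be. snd (box be lam)) ` up lam = insert 0 (Suc ` (\<lambda>al. snd (box lam al)) ` down lam)"
proof (intro set_eqI iffI)
  fix c assume "c \<in> (\<lambda>be. snd (box be lam)) ` up lam"
  then obtain be r where be: "removes_box lam be" "box be lam = (r, c)"
    by (auto simp: in_up) (metis prod.collapse)
  show "c \<in> insert 0 (Suc ` (\<lambda>al. snd (box lam al)) ` down lam)"
  proof (cases c)
    case (Suc c')
    have "ht be c \<le> ht be c'" using ht_antimono[OF removes_boxD(2)[OF be(1)], of c' c] Suc by simp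
    then have "ht lam (Suc c') < ht lam c'"
      using box_corner(1,2)[OF be] box_corner(4)[OF be, of c'] Suc by simp
    then obtain al where "removes_box al lam" "box lam al = (ht lam c' - 1, c')"
      by (rule corner_removable[OF assms])
    then show ?thesis using Suc by (force simp: in_down)
  qed simp
next
  fix c assume "c \<in> insert 0 (Suc ` (\<lambda>al. snd (box lam al)) ` down lam)"
  then have "c = 0 \<or> ht lam c < ht lam (c - 1)"
  proof
    assume "c \<in> Suc ` (\<lambda>al. snd (box lam al)) ` down lam"
    then obtain al r c' where al: "removes_box al lam" "box lam al = (r, c')" "c = Suc c'"
      by (auto simp: in_down) (metis prod.collapse)
    then show ?thesis using box_corner(1,3)[OF al(1,2)] by simp
  qed simp
  then obtain be where "removes_box lam be" "box be lam = (ht lam c, c)"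
    by (rule up_addable[OF assms])
  then show "c \<in> (\<lambda>be. snd (box be lam)) ` up lam" by (force simp: in_up)
qed

lemma up_inj: "inj_on (\<lambda>be. snd (box be lam)) (up lam)"
  by (auto simp: inj_on_def in_up intro: up_eq_if_same_col)

lemma down_inj: "inj_on (\<lambda>al. snd (box lam al)) (down lam)"
  by (auto simp: inj_on_def in_down intro: down_eq_if_same_col)

lemma finite_up: "is_partition m lam \<Longrightarrow> finite (up lam)"
  using up_cols up_inj by (metis finite_down finite_imageD finite_imageI finite_insert)

text \<open>The diagonal entry of the relation \<open>D U - U D = 1\<close> between the operators
  that add and remove a box on Young's lattice. The surplus of one is the box that can always be
  added in column \<open>0\<close>.\<close>

lemma card_up:
  assumes "is_partition m lam" shows "card (up lam) = Suc (card (down lam))"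
proof -
  have "card (up lam) = card (insert 0 (Suc ` (\<lambda>al. snd (box lam al)) ` down lam))"
    using card_image[OF up_inj[of lam]] up_cols[OF assms] by simp
  also have "\<dots> = Suc (card (Suc ` (\<lambda>al. snd (box lam al)) ` down lam))"
    by (subst card_insert_disjoint) auto
  also have "card (Suc ` (\<lambda>al. snd (box lam al)) ` down lam) = card (down lam)"
    using card_image[OF down_inj[of lam]] by (simp add: card_image)
  finally show ?thesis .
qed

lemma young_Int: "young A \<Longrightarrow> young B \<Longrightarrow> young (A \<inter> B)"
  unfolding young_def by blast

lemma young_Un: "young A \<Longrightarrow> young B \<Longrightarrow> young (A \<union> B)"
  unfolding young_def by blast

lemma insert_card_iff:
  assumes "finite B" "A \<subseteq> B"
  shows "(\<exists>b. b \<notin> A \<and> B = insert b A) \<longleftrightarrow> card B = Suc (card A)"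
proof
  assume "card B = Suc (card A)"
  then have "card (B - A) = 1" using assms by (simp add: card_Diff_subset finite_subset)
  then obtain b where "B - A = {b}" by (auto simp: card_1_singleton_iff)
  then show "\<exists>b. b \<notin> A \<and> B = insert b A" using assms by (intro exI[of _ b]) auto
qed (use assms in \<open>auto simp: finite_subset\<close>)

text \<open>The off-diagonal entry of the same relation. A common cover can only be the union of the
  two diagrams and a common lower neighbour only their intersection. The sizes of union and
  intersection add up to \<open>m + m\<close>, so one neighbour exists exactly when the other
  does.\<close>

lemma common_covers:
  assumes "is_partition m lam" "is_partition m mu" "lam \<noteq> mu"
  shows "card (up lam \<inter> up mu) = card (down lam \<inter> down mu)"
proof -
  let ?A = "cells lam" and ?B = "cells mu"
  have cA: "card ?A = m" "card ?B = m" using assms card_cells is_partition_sum by auto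
  have ne: "?A \<noteq> ?B" using assms cells_inj by blast
  have sub: "\<not> ?A \<subseteq> ?B" "\<not> ?B \<subseteq> ?A" using ne cA by (metis card_subset_eq finite_cells)+
  have rb: "removes_box a b \<longleftrightarrow> cells a \<subseteq> cells b \<and> card (cells b) = Suc (card (cells a))"
    if "is_partition k a" "is_partition l b" for a b k l
    using that insert_card_iff[OF finite_cells, of "cells a" b] is_partition_sum
    unfolding removes_box_iff by blast
  have ups: "be \<in> up lam \<inter> up mu \<longleftrightarrow> is_partition (Suc m) be \<and> cells be = ?A \<union> ?B \<and> card (?A \<union> ?B) = Suc m" for be
  proof
    assume "be \<in> up lam \<inter> up mu"
    then have r: "removes_box lam be" "removes_box mu be" by (auto simp: in_up)
    then have p: "is_partition (sum_list be) be" and s: "sum_list be = Suc m"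
      using removes_boxD(2,5) assms is_partition_sum by metis+
    have sb: "?A \<union> ?B \<subseteq> cells be" using r removes_boxD(4) by blast
    have "card (cells be) = Suc m" using card_cells s by metis
    moreover have "m < card (?A \<union> ?B)" using sub cA by (metis Un_upper1 finite_UnI finite_cells psubsetI psubset_card_mono sup.absorb_iff1)
    ultimately have "cells be = ?A \<union> ?B"
      using card_seteq[OF finite_cells sb] by simp
    then show "is_partition (Suc m) be \<and> cells be = ?A \<union> ?B \<and> card (?A \<union> ?B) = Suc m"
      using p s \<open>card (cells be) = Suc m\<close> by simp
  next
    assume *: "is_partition (Suc m) be \<and> cells be = ?A \<union> ?B \<and> card (?A \<union> ?B) = Suc m"
    then show "be \<in> up lam \<inter> up mu" using rb[OF assms(1)] rb[OF assms(2)] cA by (auto simp: in_up)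
  qed
  have downs: "al \<in> down lam \<inter> down mu \<longleftrightarrow> (\<exists>k. is_partition k al) \<and> cells al = ?A \<inter> ?B \<and> Suc (card (?A \<inter> ?B)) = m" for al
  proof
    assume "al \<in> down lam \<inter> down mu"
    then have r: "removes_box al lam" "removes_box al mu" by (auto simp: in_down)
    then have p: "is_partition (sum_list al) al" and s: "m = Suc (sum_list al)"
      using removes_boxD(1,5) assms is_partition_sum by metis+
    have sb: "cells al \<subseteq> ?A \<inter> ?B" using r removes_boxD(4) by blast
    have c: "Suc (card (cells al)) = m" using card_cells s by metis
    moreover have "card (?A \<inter> ?B) < m" using sub cA by (metis Int_lower1 finite_cells le_iff_inf psubsetI psubset_card_mono)
    ultimately have "cells al = ?A \<inter> ?B"
      using card_seteq[OF _ sb] by simp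
    then show "(\<exists>k. is_partition k al) \<and> cells al = ?A \<inter> ?B \<and> Suc (card (?A \<inter> ?B)) = m"
      using p c by auto
  next
    assume *: "(\<exists>k. is_partition k al) \<and> cells al = ?A \<inter> ?B \<and> Suc (card (?A \<inter> ?B)) = m"
    then show "al \<in> down lam \<inter> down mu" using rb[OF _ assms(1)] rb[OF _ assms(2)] cA by (auto simp: in_down)
  qed
  have tot: "card (?A \<union> ?B) + card (?A \<inter> ?B) = m + m" using card_Un_Int[of ?A ?B] cA by simp
  note Y = young_cells[OF assms(1)] young_cells[OF assms(2)]
  obtain be where be: "is_partition (card (?A \<union> ?B)) be" "cells be = ?A \<union> ?B"
    using partition_of_young[OF young_Un[OF Y]] by blast
  obtain al where al: "is_partition (card (?A \<inter> ?B)) al" "cells al = ?A \<inter> ?B"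
    using partition_of_young[OF young_Int[OF Y]] by blast
  show ?thesis
  proof (cases "card (?A \<union> ?B) = Suc m")
    case True
    then have "Suc (card (?A \<inter> ?B)) = m" using tot by simp
    have "up lam \<inter> up mu = {be}"
      using ups be True cells_inj by (metis (no_types, lifting) is_singletonI' is_singleton_the_elem singleton_iff emptyE)
    moreover have "down lam \<inter> down mu = {al}"
      using downs al \<open>Suc _ = m\<close> cells_inj by (metis (no_types, lifting) is_singletonI' is_singleton_the_elem singleton_iff emptyE)
    ultimately show ?thesis by simp
  next
    case False
    then have "up lam \<inter> up mu = {}" "down lam \<inter> down mu = {}" using ups downs tot by auto
    then show ?thesis by simp
  qed
qed

section \<open>Standard tableaux and their number\<close>

fun std :: "nat \<Rightarrow> nat list \<Rightarrow> (nat \<times> nat \<Rightarrow> nat) set" where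
  "std 0 lam = {\<lambda>_. 0}"
| "std (Suc m) lam = (\<Union>al\<in>down lam. (\<lambda>T. T(box lam al := Suc m)) ` std m al)"

lemma down_partition:
  assumes "is_partition (Suc m) lam" "al \<in> down lam" shows "is_partition m al"
  using assms removes_boxD(1,5)[of al lam] is_partition_sum by (metis in_down nat.inject)

lemma up_partition:
  assumes "is_partition m lam" "be \<in> up lam" shows "is_partition (Suc m) be"
  using assms removes_boxD(2,5)[of lam be] is_partition_sum by (metis in_up)

lemma cells_Nil [simp]: "cells [] = {}" by (simp add: cells_def)

lemma is_partition_0: "is_partition 0 lam \<longleftrightarrow> lam = []"
  by (cases lam) (auto simp: is_partition_def)

lemma tableaux_extend:
  assumes "is_partition (Suc m) lam" "al \<in> down lam" "S \<in> tableaux al"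
  shows "S(box lam al := Suc m) \<in> tableaux lam"
proof -
  define T where "T = S(box lam al := Suc m)"
  have pa: "is_partition m al" by (rule down_partition[OF assms(1,2)])
  note D = removes_boxD[OF assms(2)[unfolded in_down]]
  have "bij_betw S (cells al) {1..m}" using assms(3) pa is_partition_sum by (simp add: tableaux_def)
  then have "bij_betw T (cells al) {1..m}"
    unfolding T_def by (rule bij_betw_cong[THEN iffD1, rotated]) (use D(3) in auto)
  then have "bij_betw T (insert (box lam al) (cells al)) (insert (T (box lam al)) {1..m})"
    by (rule notIn_Un_bij_betw[rotated 2, simplified]) (use D(3) T_def in auto)
  moreover have "insert (T (box lam al)) {1..m} = {1..Suc m}" using T_def by auto
  ultimately show ?thesis
    using D(4) is_partition_sum[OF assms(1)] by (simp add: tableaux_def T_def)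
qed

text \<open>The function is kept unchanged: \<open>tableaux\<close> looks only at the cells of the
  shape, so the entry left over at the removed box does no harm.\<close>

lemma tableaux_restrict:
  assumes "is_partition (Suc m) lam" "al \<in> down lam" "T \<in> tableaux lam" "T (box lam al) = Suc m"
  shows "T \<in> tableaux al"
proof -
  have pa: "is_partition m al" by (rule down_partition[OF assms(1,2)])
  note D = removes_boxD[OF assms(2)[unfolded in_down]]
  have T: "bij_betw T (insert (box lam al) (cells al)) {1..Suc m}"
    using assms(3) D(4) is_partition_sum[OF assms(1)] by (simp add: tableaux_def)
  have "bij_betw T (cells al) ({1..Suc m} - {T (box lam al)})"
    using bij_betw_DiffI[OF T, of "{box lam al}" "{T (box lam al)}"] D(3) assms(4) by simp
  moreover have "{1..Suc m} - {T (box lam al)} = {1..m}" using assms(4) by auto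
  ultimately show ?thesis using is_partition_sum[OF pa] by (simp add: tableaux_def)
qed

text \<open>The value \<open>0\<close> outside the diagram makes a standard tableau determined by
  its entries; the counting of tableaux relies on this.\<close>

lemma std_tableaux:
  "is_partition m lam \<Longrightarrow> T \<in> std m lam \<Longrightarrow> T \<in> tableaux lam \<and> (\<forall>p. p \<notin> cells lam \<longrightarrow> T p = 0)"
proof (induction m arbitrary: lam T)
  case 0 then show ?case by (auto simp: is_partition_0 tableaux_def bij_betw_def)
next
  case (Suc m)
  from Suc.prems(2) obtain al S where al: "al \<in> down lam" "S \<in> std m al" "T = S(box lam al := Suc m)"
    by auto
  have pa: "is_partition m al" by (rule down_partition[OF Suc.prems(1) al(1)])
  have IH: "S \<in> tableaux al" "\<forall>p. p \<notin> cells al \<longrightarrow> S p = 0" using Suc.IH[OF pa al(2)] by auto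
  note D = removes_boxD[OF al(1)[unfolded in_down]]
  have "T p = 0" if "p \<notin> cells lam" for p
    using that IH(2) D(4) unfolding al(3) by (metis fun_upd_other insertCI)
  then show ?case using tableaux_extend[OF Suc.prems(1) al(1) IH(1)] al(3) by blast
qed

lemma finite_std [simp]: "finite (std m lam)"
  by (induction m arbitrary: lam) auto

lemma std_box_inj:
  assumes "is_partition (Suc m) lam" "al \<in> down lam" 
  shows "inj_on (\<lambda>T. T(box lam al := Suc m)) (std m al)"
proof (rule inj_onI, rule ext)
  fix S T p assume S: "S \<in> std m al" "T \<in> std m al" "S(box lam al := Suc m) = T(box lam al := Suc m)"
  have pa: "is_partition m al" by (rule down_partition[OF assms])
  show "S p = T p"
  proof (cases "p = box lam al")
    case True
    have "box lam al \<notin> cells al" using removes_boxD(3) assms by (simp add: in_down)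
    then show ?thesis using std_tableaux[OF pa] S True by metis
  next
    case False then show ?thesis using S(3) by (metis fun_upd_other)
  qed
qed

lemma tableau_pos_eq:
  assumes "T \<in> tableaux lam" "p \<in> cells lam" "q \<in> cells lam" "T p = T q" shows "p = q"
  using assms by (auto simp: tableaux_def bij_betw_def inj_on_def)

lemma std_box_disjoint:
  assumes "is_partition (Suc m) lam" "al \<in> down lam" "al' \<in> down lam" "al \<noteq> al'"
  shows "(\<lambda>T. T(box lam al := Suc m)) ` std m al \<inter> (\<lambda>T. T(box lam al' := Suc m)) ` std m al' = {}"
proof (rule ccontr)
  assume "\<not> ?thesis"
  then obtain T where T: "T \<in> (\<lambda>T. T(box lam al := Suc m)) ` std m al" "T \<in> (\<lambda>T. T(box lam al' := Suc m)) ` std m al'"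
    by auto
  then have "T \<in> std (Suc m) lam" using assms by auto
  then have "T \<in> tableaux lam" using std_tableaux assms by blast
  moreover have "T (box lam al) = T (box lam al')" using T by (auto simp del: fun_upd_apply) (metis fun_upd_same)
  moreover have "box lam al \<in> cells lam" "box lam al' \<in> cells lam"
    using removes_boxD(4) assms(2,3) by (metis in_down insertI1)+
  ultimately have "box lam al = box lam al'" using tableau_pos_eq by blast
  then show False using down_eq_if_same_col assms by (metis in_down)
qed

lemma card_std_Suc:
  assumes "is_partition (Suc m) lam"
  shows "card (std (Suc m) lam) = (\<Sum>al\<in>down lam. card (std m al))"
proof -
  have "card (std (Suc m) lam) = (\<Sum>al\<in>down lam. card ((\<lambda>T. T(box lam al := Suc m)) ` std m al))"
    unfolding std.simps
    by (rule card_UN_disjoint) (use std_box_disjoint[OF assms] in auto)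
  also have "\<dots> = (\<Sum>al\<in>down lam. card (std m al))"
    by (rule sum.cong) (auto intro: card_image std_box_inj[OF assms])
  finally show ?thesis .
qed

lemma down_nonempty:
  assumes be: "is_partition (Suc m) be" shows "down be \<noteq> {}"
proof -
  have "card (cells be) = Suc m" using be card_cells is_partition_sum by metis
  then obtain p where "p \<in> cells be" by (metis card.empty ex_in_conv nat.distinct(1))
  then have "(0, 0) \<in> cells be" using youngD[OF young_cells[OF be], of "fst p" "snd p"] by auto
  then have h0: "0 < ht be 0" using in_cells_ht[OF be] by simp
  \<comment> \<open>Column lengths that never drop would stay positive, and the first row would be
    infinite.\<close>
  have "\<exists>c. ht be (Suc c) < ht be c"
  proof (rule ccontr)
    assume "\<not> ?thesis"
    then have ge: "ht be c \<le> ht be (Suc c)" for c by (meson not_less)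
    have "0 < ht be c" for c
    proof (induction c)
      case (Suc c) then show ?case using ge[of c] by simp
    qed (rule h0)
    then have "(0, c) \<in> cells be" for c using in_cells_ht[OF be] by simp
    then have "range (\<lambda>c. (0::nat, c)) \<subseteq> cells be" by auto
    then have "finite (range (\<lambda>c::nat. (0::nat, c)))" using finite_cells finite_subset by blast
    then show False using finite_imageD[of "\<lambda>c::nat. (0::nat, c)" UNIV] by (auto simp: inj_on_def)
  qed
  then obtain c where "ht be (Suc c) < ht be c" by blast
  then obtain al where "removes_box al be" by (rule corner_removable[OF be])
  then show ?thesis unfolding down_def by blast
qed

lemma finite_partitions: "finite {lam. is_partition m lam}"
proof (induction m)
  case 0 then show ?case by (simp add: is_partition_0)
next
  case (Suc m)
  have "\<exists>al\<in>{lam. is_partition m lam}. be \<in> up al" if be: "is_partition (Suc m) be" for be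
  proof -
    obtain al where al: "al \<in> down be" using down_nonempty[OF be] by blast
    show ?thesis using down_partition[OF be al] al unfolding in_down in_up by blast
  qed
  then have "{lam. is_partition (Suc m) lam} \<subseteq> (\<Union>al\<in>{lam. is_partition m lam}. up al)" by auto
  moreover have "finite (\<Union>al\<in>{lam. is_partition m lam}. up al)" using Suc finite_up by auto
  ultimately show ?case by (rule finite_subset)
qed

lemma std_nonempty: "is_partition m lam \<Longrightarrow> std m lam \<noteq> {}"
proof (induction m arbitrary: lam)
  case (Suc m)
  obtain al where al: "al \<in> down lam" using down_nonempty[OF Suc.prems] by blast
  have "std m al \<noteq> {}" by (rule Suc.IH[OF down_partition[OF Suc.prems al]])
  then show ?case using al by auto
qed simp

text \<open>The dimension count behind the induction rule: the right-hand side is the index of the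
  smaller symmetric group times the dimension of the Specht module. It follows from
  \<open>D U - U D = 1\<close> by induction, as in every differential poset.\<close>

lemma sum_card_std_up:
  "is_partition m lam \<Longrightarrow> (\<Sum>be\<in>up lam. card (std (Suc m) be)) = Suc m * card (std m lam)"
proof (induction m arbitrary: lam)
  case 0
  then have lam: "lam = []" by (simp add: is_partition_0)
  have d: "down lam = {}"
  proof -
    have "\<not> removes_box al lam" for al using removes_boxD(5)[of al lam] lam by auto
    then show ?thesis by (simp add: down_def)
  qed
  then have "card (up lam) = 1" using card_up[OF 0] by simp
  then obtain be where be: "up lam = {be}" by (auto simp: card_1_singleton_iff)
  have pbe: "is_partition (Suc 0) be" using up_partition[OF 0] be by simp
  have "down be = {lam}"
  proof -
    have "al = lam" if "al \<in> down be" for al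
      using down_partition[OF pbe that] lam by (simp add: is_partition_0)
    moreover have "lam \<in> down be" using be by (auto simp: in_down in_up set_eq_iff)
    ultimately show ?thesis by blast
  qed
  then show ?case unfolding be by (simp add: card_std_Suc[OF pbe] del: std.simps(2))
next
  case (Suc m)
  let ?P = "{mu. is_partition (Suc m) mu}"
  define f where "f = (\<lambda>mu. card (std (Suc m) mu))"
  have fin: "finite ?P" by (rule finite_partitions)
  have downP: "down be \<subseteq> ?P" if "be \<in> up lam" for be
    using down_partition up_partition[OF Suc.prems that] by auto
  have upP: "up nu \<subseteq> ?P" if "nu \<in> down lam" for nu
    using up_partition down_partition[OF Suc.prems that] by auto
  have "(\<Sum>be\<in>up lam. card (std (Suc (Suc m)) be)) = (\<Sum>be\<in>up lam. \<Sum>mu\<in>down be. f mu)"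
    unfolding f_def by (rule sum.cong[OF refl]) (rule card_std_Suc[OF up_partition[OF Suc.prems]])
  also have "\<dots> = (\<Sum>be\<in>up lam. \<Sum>mu\<in>?P. if mu \<in> down be then f mu else 0)"
    by (rule sum.cong[OF refl]) (use downP fin in \<open>simp add: sum.If_cases Int_absorb1\<close>)
  also have "\<dots> = (\<Sum>mu\<in>?P. \<Sum>be\<in>up lam. if be \<in> up mu then f mu else 0)"
    by (subst sum.swap) (simp add: in_down in_up)
  also have "\<dots> = (\<Sum>mu\<in>?P. card (up lam \<inter> up mu) * f mu)"
    by (rule sum.cong[OF refl]) (use finite_up[OF Suc.prems] in \<open>simp add: sum.If_cases Int_commute\<close>)
  also have "\<dots> = card (up lam) * f lam + (\<Sum>mu\<in>?P - {lam}. card (up lam \<inter> up mu) * f mu)"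
    using Suc.prems fin by (subst sum.remove[of _ lam]) auto
  \<comment> \<open>The commutation relation is applied entry by entry; the surplus on the diagonal
    contributes the single term \<open>f lam\<close>.\<close>
  also have "\<dots> = Suc (card (down lam)) * f lam + (\<Sum>mu\<in>?P - {lam}. card (down lam \<inter> down mu) * f mu)"
    using common_covers[OF Suc.prems] card_up[OF Suc.prems] by (simp add: eq_commute)
  also have "\<dots> = f lam + (\<Sum>mu\<in>?P. card (down lam \<inter> down mu) * f mu)"
    using Suc.prems fin by (subst (2) sum.remove[of _ lam]) auto
  also have "(\<Sum>mu\<in>?P. card (down lam \<inter> down mu) * f mu) = (\<Sum>mu\<in>?P. \<Sum>nu\<in>down lam. if nu \<in> down mu then f mu else 0)"
    by (rule sum.cong[OF refl]) (simp add: sum.If_cases Int_commute)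
  also have "\<dots> = (\<Sum>nu\<in>down lam. \<Sum>mu\<in>?P. if mu \<in> up nu then f mu else 0)"
    by (subst sum.swap) (simp add: in_down in_up)
  also have "\<dots> = (\<Sum>nu\<in>down lam. \<Sum>mu\<in>up nu. f mu)"
    by (rule sum.cong[OF refl]) (use upP fin in \<open>simp add: sum.If_cases Int_absorb1\<close>)
  also have "\<dots> = (\<Sum>nu\<in>down lam. Suc m * card (std m nu))"
    unfolding f_def by (rule sum.cong[OF refl]) (rule Suc.IH[OF down_partition[OF Suc.prems]])
  also have "\<dots> = Suc m * f lam"
    by (simp only: f_def card_std_Suc[OF Suc.prems] sum_distrib_left)
  finally show ?case by (simp add: f_def)
qed

section \<open>Linear algebra in spaces of functions\<close>

interpretation fv: vector_space "vsmul :: 'a::field \<Rightarrow> ('b \<Rightarrow> 'a) \<Rightarrow> ('b \<Rightarrow> 'a)"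
  by unfold_locales (auto simp: vsmul_def algebra_simps fun_eq_iff)

interpretation fp: vector_space_pair "vsmul :: 'a::field \<Rightarrow> ('b \<Rightarrow> 'a) \<Rightarrow> ('b \<Rightarrow> 'a)"
    "vsmul :: 'a::field \<Rightarrow> ('c \<Rightarrow> 'a) \<Rightarrow> ('c \<Rightarrow> 'a)"
  by unfold_locales

abbreviation flin :: "(('b \<Rightarrow> 'a::field) \<Rightarrow> ('c \<Rightarrow> 'a)) \<Rightarrow> bool" where
  "flin \<equiv> Vector_Spaces.linear vsmul vsmul"

lemma flinI:
  assumes "\<And>u v. f (u + v) = f u + f v" "\<And>c v. f (vsmul c v) = vsmul c (f v)"
  shows "flin f"
  by unfold_locales (use assms in auto)

lemma flin_add: "flin f \<Longrightarrow> f (u + v) = f u + f v"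
  and flin_scale: "flin f \<Longrightarrow> f (vsmul c v) = vsmul c (f v)"
  and flin_0: "flin f \<Longrightarrow> f 0 = 0"
  and flin_diff: "flin f \<Longrightarrow> f (u - v) = f u - f v"
  and flin_sum: "flin f \<Longrightarrow> f (sum g A) = (\<Sum>a\<in>A. f (g a))"
  by (rule fp.linear_add fp.linear_scale fp.linear_0 fp.linear_diff fp.linear_sum; assumption)+

lemma flin_comp: "flin f \<Longrightarrow> flin g \<Longrightarrow> flin (\<lambda>v. f (g v))"
  by (rule flinI) (simp_all only: flin_add[of g] flin_scale[of g] flin_add[of f] flin_scale[of f])

lemma flin_plus:
  assumes "flin f" "flin g" shows "flin (\<lambda>v. f v + g v)"
proof (rule flinI)
  show "f (u + v) + g (u + v) = f u + g u + (f v + g v)" for u v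
    unfolding flin_add[OF assms(1)] flin_add[OF assms(2)] by (rule add.assoc[THEN trans]) (simp only: ac_simps)
  show "f (vsmul c v) + g (vsmul c v) = vsmul c (f v + g v)" for c v
    unfolding flin_scale[OF assms(1)] flin_scale[OF assms(2)] fv.scale_right_distrib ..
qed

lemma flin_scaled:
  assumes "flin f" shows "flin (\<lambda>v. vsmul c (f v))"
proof (rule flinI)
  show "vsmul c (f (u + v)) = vsmul c (f u) + vsmul c (f v)" for u v
    unfolding flin_add[OF assms] fv.scale_right_distrib ..
  show "vsmul c (f (vsmul d v)) = vsmul d (vsmul c (f v))" for d v
    unfolding flin_scale[OF assms] by (simp add: mult.commute)
qed

lemma flin_sum_fun:
  assumes "\<And>i. i \<in> A \<Longrightarrow> flin (f i)" shows "flin (\<lambda>v. \<Sum>i\<in>A. f i v)"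
proof (rule flinI)
  show "(\<Sum>i\<in>A. f i (u + v)) = (\<Sum>i\<in>A. f i u) + (\<Sum>i\<in>A. f i v)" for u v
    unfolding sum.distrib[symmetric] by (rule sum.cong[OF refl]) (rule flin_add[OF assms])
  show "(\<Sum>i\<in>A. f i (vsmul c v)) = vsmul c (\<Sum>i\<in>A. f i v)" for c v
    unfolding fv.scale_sum_right by (rule sum.cong[OF refl]) (rule flin_scale[OF assms])
qed

lemma flin_minus:
  assumes "flin f" "flin g" shows "flin (\<lambda>v. f v - g v)"
  using flin_plus[OF assms(1) flin_scaled[OF assms(2), of "-1"]] by simp

lemma flin_id: "flin (\<lambda>v. v)"
  by (rule flinI) simp_all

lemma flin_span:
  assumes "flin f" "v \<in> fv.span S" "\<And>s. s \<in> S \<Longrightarrow> f s \<in> W" "fv.subspace W"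
  shows "f v \<in> W"
proof -
  have "f v \<in> fv.span (f ` S)" using fp.linear_span_image[OF assms(1)] assms(2) by blast
  then show ?thesis using fv.span_minimal[OF _ assms(4), of "f ` S"] assms(3) by blast
qed

lemma sum_fun_apply: "(sum f A) z = (\<Sum>i\<in>A. f i z)"
  by (induction A rule: infinite_finite_induct) auto

lemma vsmul_apply: "vsmul c f z = c * f z"
  by (simp add: vsmul_def)

lemma vadd_eq: "vadd f g = f + g"
  by (simp add: vadd_def fun_eq_iff)

lemma lspan_eq: "lspan S = fv.span S"
  unfolding lspan_def fv.span_explicit
  by (auto simp: sum_fun_apply vsmul_apply fun_eq_iff)

lemma fv_scale_cancel:
  assumes "fv.subspace W" "vsmul c v \<in> W" "c \<noteq> 0" shows "v \<in> W"
  using fv.subspace_scale[OF assms(1,2), of "inverse c"] assms(3) by simp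

definition dlt :: "'b \<Rightarrow> 'b \<Rightarrow> 'a::field" where
  "dlt t = (\<lambda>s. if s = t then 1 else 0)"

abbreviation sg :: "(nat \<Rightarrow> nat) \<Rightarrow> 'a::field" where
  "sg \<sigma> \<equiv> of_int (sign \<sigma>)"

lemma sg_comp: "\<sigma> permutes A \<Longrightarrow> \<rho> permutes B \<Longrightarrow> finite A \<Longrightarrow> finite B \<Longrightarrow> sg (\<sigma> \<circ> \<rho>) = (sg \<sigma> * sg \<rho> :: 'a::field)"
  by (subst sign_compose) (auto simp: permutation_permutes)

lemma sg_sq: "sg \<sigma> * sg \<sigma> = (1 :: 'a::field)"
  by (metis of_int_1 of_int_mult sign_idempotent)

section \<open>Polytabloids\<close>

lemma flin_perm_act: "flin (perm_act \<pi> :: ((nat \<Rightarrow> nat) \<Rightarrow> 'a::field) \<Rightarrow> _)"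
  by (rule flinI) (auto simp: perm_act_def vsmul_def fun_eq_iff)

lemmas perm_act_lin = flin_add[OF flin_perm_act] flin_scale[OF flin_perm_act] flin_0[OF flin_perm_act]
  flin_diff[OF flin_perm_act] flin_sum[OF flin_perm_act]

lemma perm_act_comp: "perm_act \<pi> (perm_act \<rho> h) = perm_act (\<pi> \<circ> \<rho>) h"
  by (simp add: perm_act_def comp_assoc)

lemma perm_act_id [simp]: "perm_act id h = h"
  by (simp add: perm_act_def)

lemma perm_act_inv:
  assumes "\<pi> permutes A" shows "perm_act (inv \<pi>) (perm_act \<pi> h) = h" "perm_act \<pi> (perm_act (inv \<pi>) h) = h"
  using permutes_inv_o[OF assms] by (simp_all add: perm_act_comp)

text \<open>Precomposition moves the basis vector of a tabloid \<open>t\<close> to that of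
  \<open>t \<circ> inv \<pi>\<close>, the tabloid whose entries have been renamed by
  \<open>\<pi>\<close>. This is why \<open>perm_act\<close> is a left action.\<close>

lemma perm_act_dlt:
  assumes "\<pi> permutes A" shows "perm_act \<pi> (dlt t) = (dlt (t \<circ> inv \<pi>) :: _ \<Rightarrow> 'a::field)"
proof -
  have "s \<circ> \<pi> = t \<longleftrightarrow> s = t \<circ> inv \<pi>" for s :: "nat \<Rightarrow> nat"
    using permutes_inv_o[OF assms] by (metis comp_assoc comp_id)
  then show ?thesis by (simp add: perm_act_def dlt_def)
qed

definition pos :: "nat list \<Rightarrow> (nat \<times> nat \<Rightarrow> nat) \<Rightarrow> nat \<Rightarrow> nat \<times> nat" where
  "pos lam T i = inv_into (cells lam) T i"

lemma tableaux_image: "T \<in> tableaux lam \<Longrightarrow> T ` cells lam = {1..sum_list lam}"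
  by (auto simp: tableaux_def bij_betw_def)

lemma tableaux_inj: "T \<in> tableaux lam \<Longrightarrow> inj_on T (cells lam)"
  by (auto simp: tableaux_def bij_betw_def)

lemma pos_cell:
  assumes "T \<in> tableaux lam" "i \<in> {1..sum_list lam}"
  shows "pos lam T i \<in> cells lam" "T (pos lam T i) = i"
  using assms unfolding pos_def tableaux_image[OF assms(1), symmetric]
  by (simp_all add: inv_into_into f_inv_into_f)

lemma pos_T: "T \<in> tableaux lam \<Longrightarrow> p \<in> cells lam \<Longrightarrow> pos lam T (T p) = p"
  unfolding pos_def by (rule inv_into_f_f[OF tableaux_inj])

lemma tableaux_comp:
  assumes "T \<in> tableaux lam" "\<pi> permutes {1..sum_list lam}" shows "\<pi> \<circ> T \<in> tableaux lam"
  using assms bij_betw_trans permutes_imp_bij unfolding tableaux_def by blast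

lemma pos_comp:
  assumes "T \<in> tableaux lam" "\<pi> permutes {1..sum_list lam}" "i \<in> {1..sum_list lam}"
  shows "pos lam (\<pi> \<circ> T) i = pos lam T (inv \<pi> i)"
proof -
  have "inv \<pi> i \<in> {1..sum_list lam}" using permutes_inv[OF assms(2)] assms(3) permutes_in_image by fastforce
  note p = pos_cell[OF assms(1) this]
  have "(\<pi> \<circ> T) (pos lam T (inv \<pi> i)) = i" using p(2) permutes_inverses[OF assms(2)] by simp
  then show ?thesis using pos_T[OF tableaux_comp[OF assms(1,2)] p(1)] by simp
qed

lemma tabloid_of_alt: "tabloid_of lam T = (\<lambda>i. if i \<in> {1..sum_list lam} then fst (pos lam T i) else 0)"
  by (simp add: tabloid_of_def pos_def cong: if_cong)

lemma col_group_alt: "col_group lam T = {\<sigma>. \<sigma> permutes {1..sum_list lam} \<and>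
      (\<forall>i\<in>{1..sum_list lam}. snd (pos lam T (\<sigma> i)) = snd (pos lam T i))}"
  by (simp add: col_group_def pos_def)

lemma tabloid_of_comp:
  assumes "T \<in> tableaux lam" "\<pi> permutes {1..sum_list lam}"
  shows "tabloid_of lam (\<pi> \<circ> T) = tabloid_of lam T \<circ> inv \<pi>"
proof
  fix i
  have "inv \<pi> i \<in> {1..sum_list lam} \<longleftrightarrow> i \<in> {1..sum_list lam}"
    using permutes_in_image[OF permutes_inv[OF assms(2)]] .
  then show "tabloid_of lam (\<pi> \<circ> T) i = (tabloid_of lam T \<circ> inv \<pi>) i"
    using pos_comp[OF assms] by (simp add: tabloid_of_alt)
qed

lemma col_group_permutes: "\<sigma> \<in> col_group lam T \<Longrightarrow> \<sigma> permutes {1..sum_list lam}"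
  by (simp add: col_group_def)

lemma finite_col_group [simp]: "finite (col_group lam T)"
  by (rule finite_subset[OF _ finite_permutations[of "{1..sum_list lam}"]]) (auto simp: col_group_def)

lemma polytabloid_alt:
  "polytabloid lam T = (\<Sum>\<sigma>\<in>col_group lam T. vsmul (sg \<sigma>) (dlt (tabloid_of lam (\<sigma> \<circ> T))))"
  by (simp add: polytabloid_def fun_eq_iff sum_fun_apply vsmul_apply dlt_def sum.inter_filter if_distrib eq_commute cong: if_cong)

lemma col_group_comp:
  assumes "\<sigma> \<in> col_group lam T" "\<rho> \<in> col_group lam T" shows "\<sigma> \<circ> \<rho> \<in> col_group lam T"
proof -
  have "\<rho> i \<in> {1..sum_list lam} \<longleftrightarrow> i \<in> {1..sum_list lam}" for i
    using permutes_in_image[OF col_group_permutes[OF assms(2)]] .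
  then show ?thesis
    using assms permutes_compose[OF col_group_permutes[OF assms(2)] col_group_permutes[OF assms(1)]]
    by (simp add: col_group_alt)
qed

lemma col_group_inv:
  assumes "\<sigma> \<in> col_group lam T" shows "inv \<sigma> \<in> col_group lam T"
proof -
  note p = col_group_permutes[OF assms]
  have "snd (pos lam T (inv \<sigma> i)) = snd (pos lam T i)" if "i \<in> {1..sum_list lam}" for i
  proof -
    have "inv \<sigma> i \<in> {1..sum_list lam}" using permutes_in_image[OF permutes_inv[OF p]] that by blast
    then have "snd (pos lam T (\<sigma> (inv \<sigma> i))) = snd (pos lam T (inv \<sigma> i))"
      using assms unfolding col_group_alt by blast
    then show ?thesis using permutes_inverses[OF p] by simp
  qed
  then show ?thesis using permutes_inv[OF p] by (simp add: col_group_alt)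
qed

lemma col_group_left_bij:
  assumes "\<sigma> \<in> col_group lam T" shows "bij_betw (\<lambda>\<rho>. \<sigma> \<circ> \<rho>) (col_group lam T) (col_group lam T)"
proof (rule bij_betwI[where g="\<lambda>\<rho>. inv \<sigma> \<circ> \<rho>"])
  note o = permutes_inv_o[OF col_group_permutes[OF assms]]
  show "inv \<sigma> \<circ> (\<sigma> \<circ> x) = x" "\<sigma> \<circ> (inv \<sigma> \<circ> x) = x" for x
    by (simp_all add: comp_assoc[symmetric] o)
qed (use assms col_group_comp col_group_inv in blast)+

lemma col_group_conj:
  assumes "T \<in> tableaux lam" "\<pi> permutes {1..sum_list lam}"
  shows "bij_betw (\<lambda>\<sigma>. \<pi> \<circ> \<sigma> \<circ> inv \<pi>) (col_group lam T) (col_group lam (\<pi> \<circ> T))"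
proof -
  let ?n = "{1..sum_list lam}"
  note o = permutes_inv_o[OF assms(2)]
  have pi: "inv \<pi> permutes ?n" by (rule permutes_inv[OF assms(2)])
  \<comment> \<open>Formulated for an arbitrary tableau and permutation, so that the inverse
    permutation yields the reverse inclusion.\<close>
  have key: "\<pi>' \<circ> \<sigma> \<circ> inv \<pi>' \<in> col_group lam (\<pi>' \<circ> S)"
    if S: "S \<in> tableaux lam" and p: "\<pi>' permutes ?n" and s: "\<sigma> \<in> col_group lam S" for S \<pi>' \<sigma>
  proof -
    have q: "\<pi>' \<circ> \<sigma> \<circ> inv \<pi>' permutes ?n"
      using p col_group_permutes[OF s] by (intro permutes_compose permutes_inv)
    have "snd (pos lam (\<pi>' \<circ> S) ((\<pi>' \<circ> \<sigma> \<circ> inv \<pi>') i)) = snd (pos lam (\<pi>' \<circ> S) i)" if "i \<in> ?n" for i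
    proof -
      have a: "inv \<pi>' i \<in> ?n" using permutes_in_image[OF permutes_inv[OF p]] that by blast
      have b: "(\<pi>' \<circ> \<sigma> \<circ> inv \<pi>') i \<in> ?n" using permutes_in_image[OF q] that by blast
      have "pos lam (\<pi>' \<circ> S) ((\<pi>' \<circ> \<sigma> \<circ> inv \<pi>') i) = pos lam S (\<sigma> (inv \<pi>' i))"
        using pos_comp[OF S p b] permutes_inverses[OF p] by simp
      then show ?thesis using pos_comp[OF S p that] s a by (simp add: col_group_alt)
    qed
    then show ?thesis using q by (simp add: col_group_alt)
  qed
  show ?thesis
  proof (rule bij_betwI[where g="\<lambda>\<sigma>. inv \<pi> \<circ> \<sigma> \<circ> \<pi>"])
    show "(\<lambda>\<sigma>. \<pi> \<circ> \<sigma> \<circ> inv \<pi>) \<in> col_group lam T \<rightarrow> col_group lam (\<pi> \<circ> T)"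
      using key[OF assms] by blast
    show "(\<lambda>\<sigma>. inv \<pi> \<circ> \<sigma> \<circ> \<pi>) \<in> col_group lam (\<pi> \<circ> T) \<rightarrow> col_group lam T"
      using key[OF tableaux_comp[OF assms] pi] permutes_inv_inv[OF assms(2)] o
      by (auto simp: comp_assoc[symmetric])
    show "inv \<pi> \<circ> (\<pi> \<circ> \<sigma> \<circ> inv \<pi>) \<circ> \<pi> = \<sigma>" for \<sigma>
      using o by (metis comp_assoc comp_id id_comp)
    show "\<pi> \<circ> (inv \<pi> \<circ> \<sigma> \<circ> \<pi>) \<circ> inv \<pi> = \<sigma>" for \<sigma>
      using o by (metis comp_assoc comp_id id_comp)
  qed
qed

text \<open>The column group of \<open>\<pi> \<circ> T\<close> is a conjugate of that of
  \<open>T\<close>, and conjugation preserves signs; the defining sum is reindexed along it.\<close>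

lemma perm_act_polytabloid:
  assumes "T \<in> tableaux lam" "\<pi> permutes {1..sum_list lam}"
  shows "perm_act \<pi> (polytabloid lam T) = (polytabloid lam (\<pi> \<circ> T) :: _ \<Rightarrow> 'a::field)"
proof -
  let ?n = "{1..sum_list lam}"
  note o = permutes_inv_o[OF assms(2)]
  have "(polytabloid lam (\<pi> \<circ> T) :: _ \<Rightarrow> 'a) =
     (\<Sum>\<sigma>\<in>col_group lam T. vsmul (sg (\<pi> \<circ> \<sigma> \<circ> inv \<pi>)) (dlt (tabloid_of lam ((\<pi> \<circ> \<sigma> \<circ> inv \<pi>) \<circ> (\<pi> \<circ> T)))))"
    unfolding polytabloid_alt by (rule sum.reindex_bij_betw[OF col_group_conj[OF assms], symmetric])
  also have "\<dots> = (\<Sum>\<sigma>\<in>col_group lam T. perm_act \<pi> (vsmul (sg \<sigma>) (dlt (tabloid_of lam (\<sigma> \<circ> T)))))"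
  proof (rule sum.cong[OF refl])
    fix \<sigma> assume s: "\<sigma> \<in> col_group lam T"
    note ps = col_group_permutes[OF s]
    have 1: "(\<pi> \<circ> \<sigma> \<circ> inv \<pi>) \<circ> (\<pi> \<circ> T) = \<pi> \<circ> (\<sigma> \<circ> T)" using o by (metis comp_assoc comp_id)
    have "(sg (\<pi> \<circ> \<sigma> \<circ> inv \<pi>) :: 'a) = sg \<pi> * sg \<sigma> * sg (inv \<pi>)"
      using sg_comp[OF permutes_compose[OF ps assms(2)] permutes_inv[OF assms(2)], where 'a='a]
        sg_comp[OF assms(2) ps, where 'a='a] by simp
    also have "sg (inv \<pi>) = (sg \<pi> :: 'a)"
      using sign_inverse[of \<pi>] assms(2) permutation_permutes by (metis finite_atLeastAtMost)
    also have "sg \<pi> * sg \<sigma> * sg \<pi> = (sg \<sigma> :: 'a)"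
      using sg_sq[of \<pi>, where 'a='a] by (simp add: mult.commute mult.left_commute)
    finally have 2: "sg (\<pi> \<circ> \<sigma> \<circ> inv \<pi>) = (sg \<sigma> :: 'a)" .
    show "vsmul (sg (\<pi> \<circ> \<sigma> \<circ> inv \<pi>)) (dlt (tabloid_of lam ((\<pi> \<circ> \<sigma> \<circ> inv \<pi>) \<circ> (\<pi> \<circ> T)))) =
        perm_act \<pi> (vsmul (sg \<sigma>) (dlt (tabloid_of lam (\<sigma> \<circ> T))) :: _ \<Rightarrow> 'a)"
      unfolding 1 2 by (simp add: perm_act_lin perm_act_dlt[OF assms(2)] tabloid_of_comp[OF tableaux_comp[OF assms(1) ps] assms(2)])
  qed
  also have "\<dots> = perm_act \<pi> (polytabloid lam T)"
    by (simp add: polytabloid_alt perm_act_lin)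
  finally show ?thesis ..
qed

text \<open>Left translation by \<open>\<sigma>\<close> permutes the column group and multiplies
  every sign by that of \<open>\<sigma>\<close>.\<close>

lemma polytabloid_col:
  assumes "T \<in> tableaux lam" "\<sigma> \<in> col_group lam T"
  shows "polytabloid lam (\<sigma> \<circ> T) = vsmul (sg \<sigma>) (polytabloid lam T :: _ \<Rightarrow> 'a::field)"
proof -
  note ps = col_group_permutes[OF assms(2)]
  let ?f = "\<lambda>\<rho>. vsmul (sg \<rho>) (dlt (tabloid_of lam (\<rho> \<circ> T))) :: _ \<Rightarrow> 'a"
  have "polytabloid lam (\<sigma> \<circ> T) = perm_act \<sigma> (polytabloid lam T)"
    by (rule perm_act_polytabloid[OF assms(1) ps, symmetric])
  also have "\<dots> = (\<Sum>\<rho>\<in>col_group lam T. vsmul (sg \<sigma>) (?f (\<sigma> \<circ> \<rho>)))"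
    unfolding polytabloid_alt perm_act_lin
  proof (rule sum.cong[OF refl])
    fix \<rho> assume r: "\<rho> \<in> col_group lam T"
    note pr = col_group_permutes[OF r]
    have "sg \<rho> = (sg \<sigma> * sg (\<sigma> \<circ> \<rho>) :: 'a)"
      using sg_comp[OF ps pr, where 'a='a] sg_sq[of \<sigma>, where 'a='a] by (simp add: mult.assoc[symmetric])
    moreover have "tabloid_of lam (\<sigma> \<circ> \<rho> \<circ> T) = tabloid_of lam (\<rho> \<circ> T) \<circ> inv \<sigma>"
      using tabloid_of_comp[OF tableaux_comp[OF assms(1) pr] ps] by (simp add: comp_assoc)
    ultimately show "vsmul (sg \<rho>) (perm_act \<sigma> (dlt (tabloid_of lam (\<rho> \<circ> T)))) = vsmul (sg \<sigma>) (?f (\<sigma> \<circ> \<rho>))"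
      by (simp add: perm_act_dlt[OF ps])
  qed
  also have "\<dots> = vsmul (sg \<sigma>) (\<Sum>\<rho>\<in>col_group lam T. ?f (\<sigma> \<circ> \<rho>))" by (simp add: fv.scale_sum_right)
  also have "(\<Sum>\<rho>\<in>col_group lam T. ?f (\<sigma> \<circ> \<rho>)) = polytabloid lam T"
    unfolding polytabloid_alt by (rule sum.reindex_bij_betw[OF col_group_left_bij[OF assms(2)]])
  finally show ?thesis .
qed

section \<open>Antisymmetry within a column and the Garnir relations\<close>

lemma col_perm_in_col_group:
  assumes "T \<in> tableaux lam" "A \<subseteq> cells lam" "snd ` A \<subseteq> {c}" "\<pi> permutes T ` A"
  shows "\<pi> \<in> col_group lam T"
proof -
  have sub: "T ` A \<subseteq> {1..sum_list lam}" using assms(1,2) tableaux_image by blast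
  have "snd (pos lam T (\<pi> i)) = snd (pos lam T i)" if "i \<in> {1..sum_list lam}" for i
  proof (cases "i \<in> T ` A")
    case True
    then have "\<pi> i \<in> T ` A" using permutes_in_image[OF assms(4)] by blast
    moreover have "snd (pos lam T j) = c" if j: "j \<in> T ` A" for j
    proof -
      obtain p where "p \<in> A" "j = T p" using j by blast
      moreover have "pos lam T (T p) = p" using pos_T[OF assms(1)] assms(2) calculation(1) by blast
      ultimately show ?thesis using assms(3) by auto
    qed
    ultimately show ?thesis using True by simp
  qed (simp add: permutes_not_in[OF assms(4)])
  then show ?thesis using permutes_subset[OF assms(4) sub] by (simp add: col_group_alt)
qed

text \<open>The transposition of \<open>a\<close> and \<open>b\<close> fixes \<open>t\<close> but
  reverses signs, so right multiplication by it turns the sum into its own negative.\<close>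

lemma alternating_sum_zero:
  fixes t :: "nat \<Rightarrow> nat"
  assumes "finite X" "a \<in> X" "b \<in> X" "a \<noteq> b" "t a = t b"
  shows "(\<Sum>\<pi> | \<pi> permutes X. vsmul (sg \<pi>) (perm_act \<pi> (dlt t))) = (0 :: _ \<Rightarrow> 'a::field_char_0)"
proof -
  let ?f = "\<lambda>\<pi>. vsmul (sg \<pi>) (perm_act \<pi> (dlt t)) :: _ \<Rightarrow> 'a"
  have tr: "transpose a b permutes X" using assms by (simp add: permutes_swap_id)
  have tt: "t \<circ> transpose a b = t" using assms(5) by (auto simp: fun_eq_iff transpose_def)
  have "sum ?f {\<pi>. \<pi> permutes X} = (\<Sum>\<pi> | \<pi> permutes X. ?f (\<pi> \<circ> transpose a b))"
    by (rule sum_permutations_compose_right[OF tr])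
  also have "\<dots> = (\<Sum>\<pi> | \<pi> permutes X. - ?f \<pi>)"
  proof (rule sum.cong[OF refl])
    fix \<pi> assume "\<pi> \<in> {\<pi>. \<pi> permutes X}"
    then have p: "\<pi> permutes X" by simp
    have "sg (\<pi> \<circ> transpose a b) = (- sg \<pi> :: 'a)"
      using sg_comp[OF p tr assms(1,1)] assms(4) by (simp add: sign_swap_id)
    moreover have "perm_act (\<pi> \<circ> transpose a b) (dlt t) = (perm_act \<pi> (dlt t) :: _ \<Rightarrow> 'a)"
      unfolding perm_act_comp[symmetric] perm_act_dlt[OF tr] by (simp add: tt)
    ultimately show "?f (\<pi> \<circ> transpose a b) = - ?f \<pi>" by simp
  qed
  also have "\<dots> = - sum ?f {\<pi>. \<pi> permutes X}" by (simp add: sum_negf)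
  \<comment> \<open>A vector equal to its negative vanishes because \<open>2\<close> is
    invertible.\<close>
  finally have "sum ?f {\<pi>. \<pi> permutes X} + sum ?f {\<pi>. \<pi> permutes X} = 0" by (simp only: eq_neg_iff_add_eq_0)
  then show ?thesis by (auto simp: fun_eq_iff)
qed

text \<open>The pigeonhole principle puts two of the permuted entries into one row of every tabloid in the polytabloid.\<close>

lemma garnir_polytabloid:
  assumes lam: "is_partition m lam" and T: "T \<in> tableaux lam"
    and AB: "A \<union> B \<subseteq> cells lam" "snd ` A \<subseteq> {c1}" "snd ` B \<subseteq> {c2}" "c1 < c2"
    and big: "ht lam c1 < card A + card B"
  shows "(\<Sum>\<pi> | \<pi> permutes T ` (A \<union> B). vsmul (sg \<pi>) (polytabloid lam (\<pi> \<circ> T))) = (0 :: _ \<Rightarrow> 'a::field_char_0)"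
proof -
  let ?X = "T ` (A \<union> B)"
  have sub: "?X \<subseteq> {1..sum_list lam}" using AB(1) T tableaux_image by blast
  have finAB: "finite A" "finite B" using AB(1) finite_cells finite_subset by (metis Un_subset_iff)+
  have fin: "finite ?X" using finAB by simp
  have inj: "inj_on T (A \<union> B)" using tableaux_inj[OF T] AB(1) inj_on_subset by blast
  have "A \<inter> B = {}" using AB(2-4) by fastforce
  then have cX: "card ?X = card A + card B" using card_image[OF inj] finAB by (simp add: card_Un_disjoint)
  have two: "\<exists>a\<in>?X. \<exists>b\<in>?X. a \<noteq> b \<and> tabloid_of lam (\<sigma> \<circ> T) a = tabloid_of lam (\<sigma> \<circ> T) b"
    if s: "\<sigma> \<in> col_group lam T" for \<sigma>
  proof -
    note ps = col_group_permutes[OF s]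
    \<comment> \<open>A column permutation keeps each entry in its column, and the later column is
      no longer than the earlier one, so only row indices less than \<open>ht lam c1\<close>
      occur.\<close>
    have "tabloid_of lam (\<sigma> \<circ> T) ` ?X \<subseteq> {..<ht lam c1}"
    proof
      fix y assume "y \<in> tabloid_of lam (\<sigma> \<circ> T) ` ?X"
      then obtain p where p: "p \<in> A \<union> B" "y = tabloid_of lam (\<sigma> \<circ> T) (T p)" by auto
      have Tp: "T p \<in> {1..sum_list lam}" using p sub by blast
      have iTp: "inv \<sigma> (T p) \<in> {1..sum_list lam}" using permutes_in_image[OF permutes_inv[OF ps]] Tp by blast
      have y: "y = fst (pos lam T (inv \<sigma> (T p)))" using p(2) Tp pos_comp[OF T ps Tp] by (simp add: tabloid_of_alt)
      have "snd (pos lam T (inv \<sigma> (T p))) = snd p"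
      proof -
        have "snd (pos lam T (inv \<sigma> (T p))) = snd (pos lam T (T p))"
          using col_group_inv[OF s] Tp unfolding col_group_alt by blast
        then show ?thesis using pos_T[OF T, of p] p(1) AB(1) by auto
      qed
      then have "(y, snd p) \<in> cells lam" using pos_cell(1)[OF T iTp] y by (metis prod.collapse)
      then have "y < ht lam (snd p)" using in_cells_ht[OF lam] by blast
      also have "snd p = c1 \<or> snd p = c2" using p(1) AB(2,3) by auto
      then have "ht lam (snd p) \<le> ht lam c1" using ht_antimono[OF lam, of c1 c2] AB(4) by auto
      finally show "y \<in> {..<ht lam c1}" by simp
    qed
    then have "card (tabloid_of lam (\<sigma> \<circ> T) ` ?X) \<le> card {..<ht lam c1}" by (intro card_mono) auto
    then have "card (tabloid_of lam (\<sigma> \<circ> T) ` ?X) < card ?X" using big cX by simp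
    then have "\<not> inj_on (tabloid_of lam (\<sigma> \<circ> T)) ?X" using pigeonhole by blast
    then show ?thesis by (auto simp: inj_on_def)
  qed
  have "(\<Sum>\<pi> | \<pi> permutes ?X. vsmul (sg \<pi>) (polytabloid lam (\<pi> \<circ> T))) =
    (\<Sum>\<pi> | \<pi> permutes ?X. vsmul (sg \<pi>) (perm_act \<pi> (polytabloid lam T)) :: _ \<Rightarrow> 'a)"
    by (rule sum.cong[OF refl]) (use perm_act_polytabloid[OF T permutes_subset[OF _ sub], where 'a='a] in simp)
  also have "\<dots> = (\<Sum>\<pi> | \<pi> permutes ?X. \<Sum>\<sigma>\<in>col_group lam T. vsmul (sg \<sigma>) (vsmul (sg \<pi>) (perm_act \<pi> (dlt (tabloid_of lam (\<sigma> \<circ> T))))))"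
    by (simp add: polytabloid_alt perm_act_lin fv.scale_sum_right mult.commute)
  \<comment> \<open>Exchanging the sums isolates, for each column permutation, the
    antisymmetrisation of a single tabloid.\<close>
  also have "\<dots> = (\<Sum>\<sigma>\<in>col_group lam T. vsmul (sg \<sigma>) (\<Sum>\<pi> | \<pi> permutes ?X. vsmul (sg \<pi>) (perm_act \<pi> (dlt (tabloid_of lam (\<sigma> \<circ> T))))))"
    by (subst sum.swap) (simp add: fv.scale_sum_right)
  also have "\<dots> = (\<Sum>\<sigma>\<in>col_group lam T. vsmul (sg \<sigma>) 0)"
  proof (rule sum.cong[OF refl])
    fix \<sigma> assume "\<sigma> \<in> col_group lam T"
    from two[OF this] obtain a b where "a \<in> ?X" "b \<in> ?X" "a \<noteq> b" "tabloid_of lam (\<sigma> \<circ> T) a = tabloid_of lam (\<sigma> \<circ> T) b"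
      by blast
    then have z: "(\<Sum>\<pi> | \<pi> permutes ?X. vsmul (sg \<pi>) (perm_act \<pi> (dlt (tabloid_of lam (\<sigma> \<circ> T))))) = (0 :: _ \<Rightarrow> 'a)"
      by (rule alternating_sum_zero[OF fin])
    show "vsmul (sg \<sigma>) (\<Sum>\<pi> | \<pi> permutes ?X. vsmul (sg \<pi>) (perm_act \<pi> (dlt (tabloid_of lam (\<sigma> \<circ> T))))) = vsmul (sg \<sigma>) (0 :: _ \<Rightarrow> 'a)"
      by (simp only: z)
  qed
  also have "\<dots> = 0" by simp
  finally show ?thesis .
qed

lemma polytabloid_cong:
  assumes "T \<in> tableaux lam" "T' \<in> tableaux lam" "\<forall>p\<in>cells lam. T p = T' p"
  shows "polytabloid lam T = polytabloid lam T'"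
proof -
  have "pos lam T i = pos lam T' i" if "i \<in> {1..sum_list lam}" for i
    using pos_cell[OF assms(1) that] pos_T[OF assms(2)] assms(3) by metis
  then have "col_group lam T = col_group lam T'"
    unfolding col_group_alt by (metis (no_types, opaque_lifting) permutes_in_image)
  moreover have "tabloid_of lam (\<sigma> \<circ> T) = tabloid_of lam (\<sigma> \<circ> T')" if "\<sigma> \<in> col_group lam T" for \<sigma>
    using tabloid_of_comp[OF _ col_group_permutes[OF that]] assms(1,2) \<open>\<And>i. _ \<Longrightarrow> pos lam T i = _\<close>
    by (simp add: tabloid_of_alt cong: if_cong)
  ultimately show ?thesis by (simp add: polytabloid_alt)
qed

lemma fv_sum_const: "(\<Sum>i\<in>A. v) = vsmul (of_nat (card A)) (v :: 'b \<Rightarrow> 'a::field)"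
proof (induction A rule: infinite_finite_induct)
  case (insert x F)
  have "(\<Sum>i\<in>insert x F. v) = v + (\<Sum>i\<in>F. v)" by (rule sum.insert[OF insert(1,2)])
  then show ?case using insert by (simp only: card_insert_disjoint[OF insert(1,2)] of_nat_Suc fv.scale_left_distrib fv.scale_one)
qed simp_all

section \<open>Straightening modulo a subspace\<close>

text \<open>The relations between polytabloids, taken as axioms for any family of vectors indexed by
  tableaux, modulo \<open>W\<close>. The members need not be polytabloids of shape
  \<open>lam\<close>: in the recursion they are polytabloids of a larger shape with some entries
  frozen. Summing over all permutations of the chosen entries multiplies the usual Garnir relation
  between polytabloids only by a nonzero number.\<close>

definition garnir_rel :: "nat list \<Rightarrow> ((nat \<times> nat \<Rightarrow> nat) \<Rightarrow> 'b \<Rightarrow> 'a::field_char_0) \<Rightarrow> ('b \<Rightarrow> 'a) set \<Rightarrow> bool" where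
  "garnir_rel lam \<phi> W \<longleftrightarrow> fv.subspace W
    \<and> (\<forall>T\<in>tableaux lam. \<forall>T'\<in>tableaux lam. (\<forall>p\<in>cells lam. T p = T' p) \<longrightarrow> \<phi> T = \<phi> T')
    \<and> (\<forall>T\<in>tableaux lam. \<forall>A c \<pi>. A \<subseteq> cells lam \<longrightarrow> snd ` A \<subseteq> {c} \<longrightarrow> \<pi> permutes T ` A
         \<longrightarrow> \<phi> (\<pi> \<circ> T) - vsmul (sg \<pi>) (\<phi> T) \<in> W)
    \<and> (\<forall>T\<in>tableaux lam. \<forall>A B c1 c2. A \<union> B \<subseteq> cells lam \<longrightarrow> snd ` A \<subseteq> {c1} \<longrightarrow> snd ` B \<subseteq> {c2}
         \<longrightarrow> c1 < c2 \<longrightarrow> ht lam c1 < card A + card B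
         \<longrightarrow> (\<Sum>\<pi> | \<pi> permutes T ` (A \<union> B). vsmul (sg \<pi>) (\<phi> (\<pi> \<circ> T))) \<in> W)"

lemma garnir_relD:
  assumes "garnir_rel lam \<phi> W"
  shows "fv.subspace W"
    "\<And>T T'. T \<in> tableaux lam \<Longrightarrow> T' \<in> tableaux lam \<Longrightarrow> (\<And>p. p \<in> cells lam \<Longrightarrow> T p = T' p) \<Longrightarrow> \<phi> T = \<phi> T'"
    "\<And>T A c \<pi>. T \<in> tableaux lam \<Longrightarrow> A \<subseteq> cells lam \<Longrightarrow> snd ` A \<subseteq> {c} \<Longrightarrow> \<pi> permutes T ` A
         \<Longrightarrow> \<phi> (\<pi> \<circ> T) - vsmul (sg \<pi>) (\<phi> T) \<in> W"
    "\<And>T A B c1 c2. T \<in> tableaux lam \<Longrightarrow> A \<union> B \<subseteq> cells lam \<Longrightarrow> snd ` A \<subseteq> {c1} \<Longrightarrow> snd ` B \<subseteq> {c2}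
         \<Longrightarrow> c1 < c2 \<Longrightarrow> ht lam c1 < card A + card B
         \<Longrightarrow> (\<Sum>\<pi> | \<pi> permutes T ` (A \<union> B). vsmul (sg \<pi>) (\<phi> (\<pi> \<circ> T))) \<in> W"
proof -
  note r = assms[unfolded garnir_rel_def]
  note r1 = r[THEN conjunct1] and r2 = r[THEN conjunct2, THEN conjunct1, rule_format]
    and r3 = r[THEN conjunct2, THEN conjunct2, THEN conjunct1, rule_format]
    and r4 = r[THEN conjunct2, THEN conjunct2, THEN conjunct2, rule_format]
  show "fv.subspace W" by (rule r1)
  show "\<phi> T = \<phi> T'" if "T \<in> tableaux lam" "T' \<in> tableaux lam" "\<And>p. p \<in> cells lam \<Longrightarrow> T p = T' p" for T T'
    by (rule r2) (use that in auto)
  show "\<phi> (\<pi> \<circ> T) - vsmul (sg \<pi>) (\<phi> T) \<in> W"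
    if "T \<in> tableaux lam" "A \<subseteq> cells lam" "snd ` A \<subseteq> {c}" "\<pi> permutes T ` A" for T A c \<pi>
    by (rule r3[OF that])
  show "(\<Sum>\<pi> | \<pi> permutes T ` (A \<union> B). vsmul (sg \<pi>) (\<phi> (\<pi> \<circ> T))) \<in> W"
    if "T \<in> tableaux lam" "A \<union> B \<subseteq> cells lam" "snd ` A \<subseteq> {c1}" "snd ` B \<subseteq> {c2}" "c1 < c2"
      "ht lam c1 < card A + card B" for T A B c1 c2
    by (rule r4[OF that])
qed

lemma garnir_rel_polytabloid:
  assumes "is_partition m lam"
  shows "garnir_rel lam (polytabloid lam) {0 :: _ \<Rightarrow> 'a::field_char_0}"
  unfolding garnir_rel_def
proof (intro conjI ballI allI impI)
  show "fv.subspace {0 :: _ \<Rightarrow> 'a}" by (rule fv.subspace_single_0)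
  show "polytabloid lam (\<pi> \<circ> T) - vsmul (sg \<pi>) (polytabloid lam T) \<in> {0 :: _ \<Rightarrow> 'a}"
    if "T \<in> tableaux lam" "A \<subseteq> cells lam" "snd ` A \<subseteq> {c}" "\<pi> permutes T ` A" for T A c \<pi>
    using polytabloid_col[OF that(1) col_perm_in_col_group[OF that], where 'a='a] by simp
  show "(\<Sum>\<pi> | \<pi> permutes T ` (A \<union> B). vsmul (sg \<pi>) (polytabloid lam (\<pi> \<circ> T))) \<in> {0 :: _ \<Rightarrow> 'a}"
    if "T \<in> tableaux lam" "A \<union> B \<subseteq> cells lam" "snd ` A \<subseteq> {c1}" "snd ` B \<subseteq> {c2}" "c1 < c2"
      "ht lam c1 < card A + card B" for T A B c1 c2
    unfolding singleton_iff by (rule garnir_polytabloid[OF assms that])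
qed (rule polytabloid_cong)

lemma tableaux_perm:
  assumes "T \<in> tableaux lam" "A \<subseteq> cells lam" "\<pi> permutes T ` A" shows "\<pi> \<circ> T \<in> tableaux lam"
proof -
  have "T ` A \<subseteq> {1..sum_list lam}" using assms(1,2) tableaux_image by blast
  then show ?thesis using tableaux_comp[OF assms(1) permutes_subset[OF assms(3)]] by blast
qed

lemma garnir_rel_swap:
  assumes "garnir_rel lam \<phi> W" "T \<in> tableaux lam" "p \<in> cells lam" "q \<in> cells lam" "p \<noteq> q" "snd p = snd q"
  shows "\<phi> (transpose (T p) (T q) \<circ> T) + \<phi> T \<in> W"
proof -
  have "transpose (T p) (T q) permutes T ` {p, q}" by (simp add: permutes_swap_id)
  moreover have "T p \<noteq> T q" using assms tableau_pos_eq by blast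
  ultimately show ?thesis
    using garnir_relD(3)[OF assms(1,2), of "{p, q}" "snd q" "transpose (T p) (T q)"] assms(3-6)
    by (simp add: sign_swap_id)
qed

text \<open>The symmetric group on \<open>insert a Y\<close> is cut into cosets of the one on
  \<open>Y\<close>, represented by the identity and by the transpositions of \<open>a\<close> with
  elements of \<open>Y\<close>; the latter account for the minus sign.\<close>

lemma sum_permutes_insert:
  fixes \<phi> :: "(nat \<times> nat \<Rightarrow> nat) \<Rightarrow> 'b \<Rightarrow> 'a::field_char_0"
  assumes "finite Y" "a \<notin> Y"
  shows "(\<Sum>\<pi> | \<pi> permutes insert a Y. vsmul (sg \<pi>) (\<phi> (\<pi> \<circ> T))) =
    (\<Sum>p | p permutes Y. vsmul (sg p) (\<phi> (p \<circ> T)))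
     - (\<Sum>p | p permutes Y. vsmul (sg p) (\<Sum>b\<in>Y. \<phi> (transpose a b \<circ> (p \<circ> T))))"
proof -
  let ?P = "{p. p permutes Y}"
  let ?f = "\<lambda>b p. vsmul (sg (transpose a b \<circ> p)) (\<phi> (transpose a b \<circ> p \<circ> T))"
  have "(\<Sum>\<pi> | \<pi> permutes insert a Y. vsmul (sg \<pi>) (\<phi> (\<pi> \<circ> T))) = (\<Sum>b\<in>insert a Y. \<Sum>p\<in>?P. ?f b p)"
    by (rule sum_over_permutations_insert[OF assms])
  also have "\<dots> = (\<Sum>p\<in>?P. ?f a p) + (\<Sum>b\<in>Y. \<Sum>p\<in>?P. ?f b p)"
    using assms by simp
  also have "(\<Sum>p\<in>?P. ?f a p) = (\<Sum>p\<in>?P. vsmul (sg p) (\<phi> (p \<circ> T)))"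
    by simp
  also have "(\<Sum>b\<in>Y. \<Sum>p\<in>?P. ?f b p) = (\<Sum>b\<in>Y. \<Sum>p\<in>?P. - vsmul (sg p) (\<phi> (transpose a b \<circ> (p \<circ> T))))"
  proof (rule sum.cong[OF refl], rule sum.cong[OF refl])
    fix b p assume b: "b \<in> Y" and "p \<in> ?P"
    then have p: "p permutes Y" by simp
    have "transpose a b permutes {a, b}" by (simp add: permutes_swap_id)
    from sg_comp[OF this p _ assms(1), where 'a='a]
    have "sg (transpose a b \<circ> p) = (- sg p :: 'a)" using assms(2) b by (simp add: sign_swap_id split: if_splits)
    then show "?f b p = - vsmul (sg p) (\<phi> (transpose a b \<circ> (p \<circ> T)))"
      by (simp only: comp_assoc fv.scale_minus_left)
  qed
  also have "\<dots> = - (\<Sum>p\<in>?P. vsmul (sg p) (\<Sum>b\<in>Y. \<phi> (transpose a b \<circ> (p \<circ> T))))"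
    by (subst sum.swap) (simp only: sum_negf fv.scale_sum_right)
  finally show ?thesis by (simp only: diff_conv_add_uminus)
qed

lemma card_col: "card {p \<in> cells lam. snd p = c} = ht lam c"
proof -
  have "{p \<in> cells lam. snd p = c} = (\<lambda>r. (r, c)) ` {r. (r, c) \<in> cells lam}" by auto
  then show ?thesis by (simp add: ht_def card_image inj_on_def)
qed

section \<open>Moving the largest entry to the right\<close>

definition high :: "nat list \<Rightarrow> nat \<Rightarrow> ((nat \<times> nat \<Rightarrow> nat) \<Rightarrow> 'b) \<Rightarrow> nat \<Rightarrow> 'b set" where
  "high lam k \<phi> c = {\<phi> T | T p. T \<in> tableaux lam \<and> p \<in> cells lam \<and> T p = k \<and> c \<le> snd p}"

lemma highI: "T \<in> tableaux lam \<Longrightarrow> p \<in> cells lam \<Longrightarrow> T p = k \<Longrightarrow> c \<le> snd p \<Longrightarrow> \<phi> T \<in> high lam k \<phi> c"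
  unfolding high_def by blast

lemma transpose_pos:
  assumes "T \<in> tableaux lam" "p \<in> cells lam" "q \<in> cells lam"
  shows "transpose (T p) (T q) \<circ> T \<in> tableaux lam" "(transpose (T p) (T q) \<circ> T) q = T p"
  using tableaux_perm[OF assms(1), of "{p, q}" "transpose (T p) (T q)"] assms by (auto simp: permutes_swap_id)

text \<open>The Garnir relation is applied to the cell \<open>q\<close> together with the whole next
  column, which is one cell more than the column of \<open>q\<close> has. Either \<open>k\<close>
  stays in place and antisymmetry gives a multiple of \<open>\<phi> T\<close>, or \<open>k\<close>
  is exchanged into the next column.\<close>

lemma garnir_move:
  fixes \<phi> :: "(nat \<times> nat \<Rightarrow> nat) \<Rightarrow> 'b \<Rightarrow> 'a::field_char_0"
  assumes rel: "garnir_rel lam \<phi> W" and T: "T \<in> tableaux lam" and q: "q \<in> cells lam" "T q = k"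
    and h: "ht lam (Suc (snd q)) = ht lam (snd q)"
  shows "\<phi> T \<in> fv.span (W \<union> high lam k \<phi> (Suc (snd q)))"
proof -
  let ?S = "fv.span (W \<union> high lam k \<phi> (Suc (snd q)))"
  have WS: "W \<subseteq> ?S" using fv.span_superset by blast
  have sub: "fv.subspace ?S" by (rule fv.subspace_span)
  define B where "B = {p \<in> cells lam. snd p = Suc (snd q)}"
  define Y where "Y = T ` B"
  have BS: "B \<subseteq> cells lam" "snd ` B \<subseteq> {Suc (snd q)}" "q \<notin> B" by (auto simp: B_def)
  have fin: "finite B" "finite Y" by (simp_all add: Y_def B_def)
  have kY: "k \<notin> Y"
    using tableau_pos_eq[OF T _ q(1)] BS q(2) by (auto simp: Y_def)
  have X: "T ` ({q} \<union> B) = insert k Y" using q(2) by (auto simp: Y_def)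
  have "(\<Sum>\<pi> | \<pi> permutes T ` ({q} \<union> B). vsmul (sg \<pi>) (\<phi> (\<pi> \<circ> T))) \<in> W"
    by (rule garnir_relD(4)[OF rel T, of _ _ "snd q" "Suc (snd q)"])
      (use BS q h in \<open>auto simp: B_def card_col\<close>)
  then have 1: "(\<Sum>p | p permutes Y. vsmul (sg p) (\<phi> (p \<circ> T)))
     - (\<Sum>p | p permutes Y. vsmul (sg p) (\<Sum>b\<in>Y. \<phi> (transpose k b \<circ> (p \<circ> T)))) \<in> ?S"
    unfolding X sum_permutes_insert[OF fin(2) kY] using WS by blast
  have pT: "p \<circ> T \<in> tableaux lam" "(p \<circ> T) q = k" "(p \<circ> T) ` B = Y" if "p permutes Y" for p
  proof -
    show "p \<circ> T \<in> tableaux lam" using that tableaux_perm[OF T BS(1)] by (simp add: Y_def)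
    show "(p \<circ> T) q = k" using q(2) kY that by (simp add: permutes_not_in)
    show "(p \<circ> T) ` B = Y" unfolding image_comp[symmetric] Y_def[symmetric] by (rule permutes_image[OF that])
  qed
  have "(\<Sum>p | p permutes Y. vsmul (sg p) (\<Sum>b\<in>Y. \<phi> (transpose k b \<circ> (p \<circ> T)))) \<in> ?S"
  proof (intro fv.span_sum fv.span_scale)
    fix p b assume "p \<in> {p. p permutes Y}" and b: "b \<in> Y"
    then have p: "p permutes Y" by simp
    obtain s where s: "s \<in> B" "(p \<circ> T) s = b" using b pT(3)[OF p] by blast
    have sc: "s \<in> cells lam" "snd s = Suc (snd q)" using s(1) BS by auto
    note t = transpose_pos[OF pT(1)[OF p] q(1) sc(1), unfolded pT(2)[OF p] s(2)]
    have "\<phi> (transpose k b \<circ> (p \<circ> T)) \<in> high lam k \<phi> (Suc (snd q))"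
      by (rule highI[OF t(1) sc(1) t(2)]) (simp add: sc)
    then show "\<phi> (transpose k b \<circ> (p \<circ> T)) \<in> ?S" by (blast intro: fv.span_base)
  qed
  from fv.span_add[OF 1 this] have 2: "(\<Sum>p | p permutes Y. vsmul (sg p) (\<phi> (p \<circ> T))) \<in> ?S" by simp
  \<comment> \<open>Every permutation of the next column alone reproduces \<open>\<phi> T\<close> up
    to its sign modulo the span, so the sum amounts to \<open>fact (card Y)\<close> times
    \<open>\<phi> T\<close>.\<close>
  have "(\<Sum>p | p permutes Y. vsmul (sg p) (\<phi> (p \<circ> T) - vsmul (sg p) (\<phi> T))) \<in> ?S"
  proof (intro fv.span_sum fv.span_scale)
    fix p assume "p \<in> {p. p permutes Y}"
    then show "\<phi> (p \<circ> T) - vsmul (sg p) (\<phi> T) \<in> ?S"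
      using garnir_relD(3)[OF rel T BS(1,2), of p] WS by (auto simp: Y_def)
  qed
  from fv.span_diff[OF 2 this] have "(\<Sum>p | p permutes Y. \<phi> T) \<in> ?S"
    by (simp add: fv.scale_right_diff_distrib sum_subtractf[symmetric] sg_sq)
  moreover have "(\<Sum>p | p permutes Y. \<phi> T) = vsmul (of_nat (fact (card Y))) (\<phi> T)"
    by (simp only: fv_sum_const card_permutations[OF refl fin(2)])
  ultimately show ?thesis by (auto intro: fv_scale_cancel[OF sub])
qed

text \<open>Fixing the largest entry at a corner gives a family that satisfies the relations of the smaller
  shape modulo the tableaux in which that entry lies in a later column.\<close>

lemma garnir_inherit:
  fixes \<phi> :: "(nat \<times> nat \<Rightarrow> nat) \<Rightarrow> 'b \<Rightarrow> 'a::field_char_0"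
  assumes lam: "is_partition (Suc m) lam" and al: "al \<in> down lam" and rel: "garnir_rel lam \<phi> W"
  shows "garnir_rel al (\<lambda>T. \<phi> (T(box lam al := Suc m)))
    (fv.span (W \<union> high lam (Suc m) \<phi> (Suc (snd (box lam al)))))"
proof -
  let ?b = "box lam al"
  let ?S = "fv.span (W \<union> high lam (Suc m) \<phi> (Suc (snd ?b)))"
  note D = removes_boxD[OF al[unfolded in_down]]
  have pal: "is_partition m al" by (rule down_partition[OF lam al])
  have WS: "W \<subseteq> ?S" using fv.span_superset by blast
  have sub: "fv.subspace ?S" by (rule fv.subspace_span)
  have cal: "cells al \<subseteq> cells lam" "?b \<in> cells lam" using D(4) by auto
  have ext: "T(?b := Suc m) \<in> tableaux lam" if "T \<in> tableaux al" for T
    by (rule tableaux_extend[OF lam al that])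
  have im: "(T(?b := Suc m)) ` A = T ` A" if "A \<subseteq> cells al" for T A
    by (rule image_cong) (use that D(3) in auto)
  have TA: "T ` A \<subseteq> {1..m}" if "T \<in> tableaux al" "A \<subseteq> cells al" for T A
    using tableaux_image[OF that(1)] that(2) is_partition_sum[OF pal] by blast
  have cmp: "(\<pi> \<circ> T)(?b := Suc m) = \<pi> \<circ> T(?b := Suc m)"
    if "T \<in> tableaux al" "A \<subseteq> cells al" "\<pi> permutes T ` A" for \<pi> T A
  proof -
    have "Suc m \<notin> T ` A" using TA[OF that(1,2)] by auto
    then show ?thesis using permutes_not_in[OF that(3)] by (auto simp: fun_eq_iff)
  qed
  obtain r c where b: "?b = (r, c)" by (cases ?b)
  note corner = box_corner[OF al[unfolded in_down] b]
  show ?thesis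
    unfolding garnir_rel_def
  proof (intro conjI ballI allI impI sub)
    fix T T' assume "T \<in> tableaux al" "T' \<in> tableaux al" "\<forall>p\<in>cells al. T p = T' p"
    then show "\<phi> (T(?b := Suc m)) = \<phi> (T'(?b := Suc m))"
      by (intro garnir_relD(2)[OF rel] ext) (use D(4) in auto)
  next
    fix T A c \<pi> assume *: "T \<in> tableaux al" "A \<subseteq> cells al" "snd ` A \<subseteq> {c}" "\<pi> permutes T ` A"
    have "\<phi> (\<pi> \<circ> T(?b := Suc m)) - vsmul (sg \<pi>) (\<phi> (T(?b := Suc m))) \<in> W"
      by (rule garnir_relD(3)[OF rel ext[OF *(1)] _ *(3)]) (use * cal im in auto)
    then show "\<phi> ((\<pi> \<circ> T)(?b := Suc m)) - vsmul (sg \<pi>) (\<phi> (T(?b := Suc m))) \<in> ?S"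
      using WS cmp[OF *(1,2,4)] by auto
  next
    fix T A B c1 c2 assume T: "T \<in> tableaux al" and AB: "A \<union> B \<subseteq> cells al" "snd ` A \<subseteq> {c1}" "snd ` B \<subseteq> {c2}"
      "c1 < c2" "ht al c1 < card A + card B"
    define T1 where "T1 = T(?b := Suc m)"
    have T1: "T1 \<in> tableaux lam" unfolding T1_def by (rule ext[OF T])
    have eq: "(\<Sum>\<pi> | \<pi> permutes T ` (A \<union> B). vsmul (sg \<pi>) (\<phi> ((\<pi> \<circ> T)(?b := Suc m)))) =
        (\<Sum>\<pi> | \<pi> permutes T ` (A \<union> B). vsmul (sg \<pi>) (\<phi> (\<pi> \<circ> T1)))"
      using cmp[OF T AB(1)] by (intro sum.cong refl) (simp add: T1_def)
    have "(\<Sum>\<pi> | \<pi> permutes T ` (A \<union> B). vsmul (sg \<pi>) (\<phi> (\<pi> \<circ> T1))) \<in> ?S"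
    \<comment> \<open>Only the column of the corner has different lengths in the two shapes; any
      other choice of \<open>c1\<close> inherits its relation directly.\<close>
    proof (cases "c1 = c")
      case False
      then have "(\<Sum>\<pi> | \<pi> permutes T1 ` (A \<union> B). vsmul (sg \<pi>) (\<phi> (\<pi> \<circ> T1))) \<in> W"
        by (intro garnir_relD(4)[OF rel T1 _ AB(2-4)]) (use AB cal corner(4)[OF False] in auto)
      then show ?thesis using WS im[OF AB(1), of T] unfolding T1_def by auto
    next
      case True
      define Y where "Y = T1 ` (A \<union> B)"
      have YT: "Y = T ` (A \<union> B)" unfolding Y_def T1_def by (rule im[OF AB(1)])
      have finAB: "finite A" "finite B" using AB(1) finite_cells finite_subset by (metis Un_subset_iff)+
      then have finY: "finite Y" by (simp add: Y_def)
      have kY: "Suc m \<notin> Y" using TA[OF T AB(1)] YT by auto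
      have T1b: "T1 ?b = Suc m" by (simp add: T1_def)
      have bAB: "?b \<notin> A \<union> B" using AB(1) D(3) by blast
      have dAB: "A \<inter> B = {}" using AB(2-4) by fastforce
      have X: "T1 ` (insert ?b A \<union> B) = insert (Suc m) Y" using T1b by (auto simp: Y_def)
      \<comment> \<open>The column of the corner is one cell longer in \<open>lam\<close>; adding
        the corner to \<open>A\<close> restores the required cardinality.\<close>
      have "(\<Sum>\<pi> | \<pi> permutes T1 ` (insert ?b A \<union> B). vsmul (sg \<pi>) (\<phi> (\<pi> \<circ> T1))) \<in> W"
        by (rule garnir_relD(4)[OF rel T1 _ _ AB(3,4)])
          (use AB cal b True corner(1,2) bAB finAB in auto)
      then have 1: "(\<Sum>p | p permutes Y. vsmul (sg p) (\<phi> (p \<circ> T1)))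
         - (\<Sum>p | p permutes Y. vsmul (sg p) (\<Sum>y\<in>Y. \<phi> (transpose (Suc m) y \<circ> (p \<circ> T1)))) \<in> ?S" (is "?A - ?B \<in> _")
        unfolding X sum_permutes_insert[OF finY kY] using WS by blast
      \<comment> \<open>Exchanging the largest entry with one of \<open>A\<close> stays inside the
        column of the corner and gives the negative vector, once for each element of
        \<open>A\<close>. Exchanging it with one of \<open>B\<close> moves it to a later
        column.\<close>
      have "(\<Sum>y\<in>Y. \<phi> (transpose (Suc m) y \<circ> (p \<circ> T1))) + vsmul (of_nat (card A)) (\<phi> (p \<circ> T1)) \<in> ?S"
        if p: "p permutes Y" for p
      proof -
        define T2 where "T2 = p \<circ> T1"
        have T2: "T2 \<in> tableaux lam"
          unfolding T2_def by (rule tableaux_perm[OF T1 _ p[unfolded Y_def]]) (use AB(1) cal in blast)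
        have T2b: "T2 ?b = Suc m" using T1b kY p by (simp add: T2_def permutes_not_in)
        have "inj_on T2 (A \<union> B)" using tableaux_inj[OF T2] AB(1) cal(1) by (meson inj_on_subset subset_trans)
        moreover have "T2 ` (A \<union> B) = Y" unfolding T2_def image_comp[symmetric] Y_def[symmetric] by (rule permutes_image[OF p])
        ultimately have "(\<Sum>y\<in>Y. \<phi> (transpose (Suc m) y \<circ> T2)) = (\<Sum>q\<in>A \<union> B. \<phi> (transpose (Suc m) (T2 q) \<circ> T2))"
          using sum.reindex[of T2 "A \<union> B" "\<lambda>y. \<phi> (transpose (Suc m) y \<circ> T2)"] by simp
        also have "\<dots> = (\<Sum>q\<in>A. \<phi> (transpose (Suc m) (T2 q) \<circ> T2)) + (\<Sum>q\<in>B. \<phi> (transpose (Suc m) (T2 q) \<circ> T2))"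
          by (rule sum.union_disjoint[OF finAB dAB])
        finally have "(\<Sum>y\<in>Y. \<phi> (transpose (Suc m) y \<circ> T2)) + vsmul (of_nat (card A)) (\<phi> T2)
          = (\<Sum>q\<in>A. \<phi> (transpose (Suc m) (T2 q) \<circ> T2) + \<phi> T2) + (\<Sum>q\<in>B. \<phi> (transpose (Suc m) (T2 q) \<circ> T2))"
          by (simp only: sum.distrib fv_sum_const ac_simps)
        also have "\<dots> \<in> ?S"
        proof (rule fv.span_add; rule fv.span_sum)
          fix q assume q: "q \<in> A"
          then have "\<phi> (transpose (T2 ?b) (T2 q) \<circ> T2) + \<phi> T2 \<in> W"
            by (intro garnir_rel_swap[OF rel T2 cal(2)]) (use AB cal b True bAB in auto)
          then show "\<phi> (transpose (Suc m) (T2 q) \<circ> T2) + \<phi> T2 \<in> ?S" using T2b WS by auto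
        next
          fix q assume q: "q \<in> B"
          then have qc: "q \<in> cells lam" "Suc (snd ?b) \<le> snd q" using AB cal b True by auto
          note t = transpose_pos[OF T2 cal(2) qc(1), unfolded T2b]
          have "\<phi> (transpose (Suc m) (T2 q) \<circ> T2) \<in> high lam (Suc m) \<phi> (Suc (snd ?b))"
            by (rule highI[OF t(1) qc(1) t(2) qc(2)])
          then show "\<phi> (transpose (Suc m) (T2 q) \<circ> T2) \<in> ?S" by (blast intro: fv.span_base)
        qed
        finally show ?thesis unfolding T2_def .
      qed
      then have "(\<Sum>p | p permutes Y. vsmul (sg p) ((\<Sum>y\<in>Y. \<phi> (transpose (Suc m) y \<circ> (p \<circ> T1))) + vsmul (of_nat (card A)) (\<phi> (p \<circ> T1)))) \<in> ?S"
        by (intro fv.span_sum fv.span_scale) blast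
      then have "?B + vsmul (of_nat (card A)) ?A \<in> ?S"
        by (simp add: fv.scale_right_distrib sum.distrib fv.scale_sum_right mult.commute)
      \<comment> \<open>The identity coset and the exchanges with \<open>A\<close> together give
        \<open>1 + card A\<close> copies of the wanted sum, a nonzero multiple.\<close>
      from fv.span_add[OF 1 this] have "vsmul (1 + of_nat (card A)) ?A \<in> ?S"
        by (simp add: fv.scale_left_distrib)
      moreover have "(1 + of_nat (card A) :: 'a) \<noteq> 0" by (metis of_nat_Suc of_nat_neq_0)
      ultimately have "?A \<in> ?S" by (rule fv_scale_cancel[OF sub])
      then show ?thesis using YT by simp
    qed
    then show "(\<Sum>\<pi> | \<pi> permutes T ` (A \<union> B). vsmul (sg \<pi>) (\<phi> ((\<pi> \<circ> T)(?b := Suc m)))) \<in> ?S"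
      using eq by simp
  qed
qed

lemma tableau_max_cell:
  assumes "is_partition (Suc m) lam" "T \<in> tableaux lam" obtains q where "q \<in> cells lam" "T q = Suc m"
  using pos_cell[OF assms(2), of "Suc m"] is_partition_sum[OF assms(1)] by auto

lemma finite_high_col: "q \<in> cells lam \<Longrightarrow> snd q \<le> Max (snd ` cells lam)"
  by simp

text \<open>Inside the column of a corner, one transposition brings the largest entry to the corner;
  the alternative \<open>T' = T\<close> covers the case that it is already there.\<close>

lemma garnir_corner_move:
  fixes \<phi> :: "(nat \<times> nat \<Rightarrow> nat) \<Rightarrow> 'b \<Rightarrow> 'a::field_char_0"
  assumes lam: "is_partition (Suc m) lam" and al: "al \<in> down lam" and rel: "garnir_rel lam \<phi> W"
    and T: "T \<in> tableaux lam" "q \<in> cells lam" "T q = Suc m" "snd q = snd (box lam al)"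
  obtains T' where "T' \<in> tableaux lam" "T' (box lam al) = Suc m" "\<phi> T + \<phi> T' \<in> W \<or> T' = T"
proof (cases "q = box lam al")
  case True
  then show thesis using that[of T] T by simp
next
  case False
  let ?b = "box lam al"
  have b: "?b \<in> cells lam" using removes_boxD(4)[OF al[unfolded in_down]] by auto
  note t = transpose_pos[OF T(1,2) b]
  have "\<phi> (transpose (T q) (T ?b) \<circ> T) + \<phi> T \<in> W"
    by (rule garnir_rel_swap[OF rel T(1,2) b False T(4)])
  then show thesis using that[OF t(1)] t(2) T(3) by (simp add: add.commute)
qed

text \<open>Induction on \<open>m\<close> for all families and all subspaces at once, since the step
  passes to a smaller shape with a larger subspace. An inner induction treats the possible columns
  of the largest entry from the last one backwards.\<close>

lemma std_span:
  fixes \<phi> :: "(nat \<times> nat \<Rightarrow> nat) \<Rightarrow> 'b \<Rightarrow> 'a::field_char_0"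
  shows "is_partition m lam \<Longrightarrow> garnir_rel lam \<phi> W \<Longrightarrow> T \<in> tableaux lam \<Longrightarrow> \<phi> T \<in> fv.span (\<phi> ` std m lam \<union> W)"
proof (induction m arbitrary: lam \<phi> W T)
  case 0
  have "(\<lambda>_. 0) \<in> tableaux lam" using 0(1) by (simp add: is_partition_0 tableaux_def bij_betw_def)
  then have "\<phi> T = \<phi> (\<lambda>_. 0)" by (rule garnir_relD(2)[OF 0(2,3)]) (use 0(1) in \<open>simp add: is_partition_0\<close>)
  then show ?case by (auto intro: fv.span_base)
next
  case (Suc m)
  note lam = Suc.prems(1) and rel = Suc.prems(2)
  let ?S = "fv.span (\<phi> ` std (Suc m) lam \<union> W)"
  have WS: "W \<subseteq> ?S" using fv.span_superset by blast
  let ?N = "Max (snd ` cells lam)"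
  have "\<phi> T \<in> ?S" if "T \<in> tableaux lam" "q \<in> cells lam" "T q = Suc m" for q T
    using that
  proof (induction "?N - snd q" arbitrary: q T rule: less_induct)
    case less
    have high: "high lam (Suc m) \<phi> (Suc (snd q)) \<subseteq> ?S"
    proof
      fix v assume "v \<in> high lam (Suc m) \<phi> (Suc (snd q))"
      then obtain S p where S: "v = \<phi> S" "S \<in> tableaux lam" "p \<in> cells lam" "S p = Suc m" "Suc (snd q) \<le> snd p"
        unfolding high_def by blast
      have "?N - snd p < ?N - snd q" using finite_high_col[OF S(3)] S(5) by linarith
      from less.hyps[OF this S(2-4)] show "v \<in> ?S" unfolding S(1) .
    qed
    then have sub: "fv.span (W \<union> high lam (Suc m) \<phi> (Suc (snd q))) \<subseteq> ?S"
      by (intro fv.span_minimal) (use WS in auto)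
    show ?case
    \<comment> \<open>Without a corner in this column the largest entry can be moved further right;
      with one, it is fixed there and the smaller shape is straightened.\<close>
    proof (cases "ht lam (Suc (snd q)) = ht lam (snd q)")
      case True
      then show ?thesis using garnir_move[OF rel less.prems] sub by blast
    next
      case False
      then have "ht lam (Suc (snd q)) < ht lam (snd q)" using ht_antimono[OF lam, of "snd q" "Suc (snd q)"] by simp
      then obtain al where rb: "removes_box al lam" "box lam al = (ht lam (snd q) - 1, snd q)"
        by (rule corner_removable[OF lam])
      then have al: "al \<in> down lam" "snd (box lam al) = snd q" by (simp_all add: in_down)
      from garnir_corner_move[OF lam al(1) rel less.prems al(2)[symmetric]] obtain T' where
        T': "T' \<in> tableaux lam" "T' (box lam al) = Suc m" "\<phi> T + \<phi> T' \<in> W \<or> T' = T" by blast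
      \<comment> \<open>The correction terms left by the smaller shape have their largest entry
        further right and are covered by the inner induction.\<close>
      have "\<phi> (T'(box lam al := Suc m)) \<in> fv.span ((\<lambda>T. \<phi> (T(box lam al := Suc m))) ` std m al
          \<union> fv.span (W \<union> high lam (Suc m) \<phi> (Suc (snd (box lam al)))))"
        by (rule Suc.IH[OF down_partition[OF lam al(1)] garnir_inherit[OF lam al(1) rel] tableaux_restrict[OF lam al(1) T'(1,2)]])
      also have "\<dots> \<subseteq> ?S"
      proof (rule fv.span_minimal)
        have "(\<lambda>T. \<phi> (T(box lam al := Suc m))) ` std m al \<subseteq> \<phi> ` std (Suc m) lam" using al(1) by auto
        then show "(\<lambda>T. \<phi> (T(box lam al := Suc m))) ` std m al
          \<union> fv.span (W \<union> high lam (Suc m) \<phi> (Suc (snd (box lam al)))) \<subseteq> ?S"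
          using sub fv.span_superset[of "\<phi> ` std (Suc m) lam \<union> W"] unfolding al(2) by blast
      qed simp
      finally have "\<phi> T' \<in> ?S" using T'(2) by (metis fun_upd_triv)
      then show ?thesis using T'(3)
      proof (elim disjE)
        assume "\<phi> T + \<phi> T' \<in> W"
        then have "\<phi> T + \<phi> T' \<in> ?S" using WS by blast
        from fv.span_diff[OF this \<open>\<phi> T' \<in> ?S\<close>] show ?thesis by simp
      qed simp
    qed
  qed
  then show ?case using tableau_max_cell[OF lam Suc.prems(3)] Suc.prems(3) by blast
qed

section \<open>The branching filtration of a Specht module\<close>

lemma specht_eq: "specht lam = fv.span (polytabloid lam ` tableaux lam)"
  by (simp add: specht_def lspan_eq)

lemma specht_subspace: "fv.subspace (specht lam)"
  unfolding specht_eq by (rule fv.subspace_span)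

lemma polytabloid_specht: "T \<in> tableaux lam \<Longrightarrow> polytabloid lam T \<in> specht lam"
  unfolding specht_eq by (blast intro: fv.span_base)

lemma perm_act_specht:
  assumes "\<pi> permutes {1..sum_list lam}" "v \<in> specht lam"
  shows "perm_act \<pi> v \<in> (specht lam :: (_ \<Rightarrow> 'a::field) set)"
proof (rule flin_span[OF flin_perm_act assms(2)[unfolded specht_eq] _ specht_subspace])
  fix s :: "_ \<Rightarrow> 'a" assume "s \<in> polytabloid lam ` tableaux lam"
  then obtain T where "T \<in> tableaux lam" "s = polytabloid lam T" by blast
  then show "perm_act \<pi> s \<in> specht lam"
    using perm_act_polytabloid[OF _ assms(1)] tableaux_comp[OF _ assms(1)] polytabloid_specht by metis
qed

text \<open>A filtration decreasing in \<open>c\<close>. The shape is meant to have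
  \<open>Suc m\<close> cells, so that the symmetric group on \<open>m\<close> letters acts on every
  step.\<close>

definition Vc :: "nat list \<Rightarrow> nat \<Rightarrow> nat \<Rightarrow> ((nat \<Rightarrow> nat) \<Rightarrow> 'a::field_char_0) set" where
  "Vc lam m c = fv.span (high lam (Suc m) (polytabloid lam) c)"

lemma Vc_subspace: "fv.subspace (Vc lam m c)"
  unfolding Vc_def by (rule fv.subspace_span)

lemma Vc_0:
  assumes "is_partition (Suc m) lam" shows "Vc lam m 0 = (specht lam :: (_ \<Rightarrow> 'a::field_char_0) set)"
proof -
  have "high lam (Suc m) (polytabloid lam) 0 = (polytabloid lam :: _ \<Rightarrow> _ \<Rightarrow> 'a) ` tableaux lam"
    using tableau_max_cell[OF assms] unfolding high_def by blast
  then show ?thesis by (simp add: Vc_def specht_eq)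
qed

lemma Vc_mono: "c \<le> c' \<Longrightarrow> Vc lam m c' \<subseteq> Vc lam m c"
  unfolding Vc_def by (rule fv.span_mono) (unfold high_def, use le_trans in blast)

lemma Vc_specht: "is_partition (Suc m) lam \<Longrightarrow> v \<in> Vc lam m c \<Longrightarrow> v \<in> specht lam"
  using Vc_mono[of 0 c lam m] Vc_0 by blast

lemma Vc_top:
  assumes "\<And>p. p \<in> cells lam \<Longrightarrow> snd p < c" shows "Vc lam m c = {0 :: _ \<Rightarrow> 'a::field_char_0}"
proof -
  have "high lam (Suc m) (polytabloid lam :: _ \<Rightarrow> _ \<Rightarrow> 'a) c = {}" using assms by (fastforce simp: high_def)
  then show ?thesis by (simp add: Vc_def)
qed

text \<open>Where a column is as long as the next one, the largest entry can be moved on; only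
  columns that end in a corner contribute a layer.\<close>

lemma Vc_step:
  assumes "is_partition (Suc m) lam" "ht lam (Suc c) = ht lam c"
  shows "(Vc lam m c :: (_ \<Rightarrow> 'a::field_char_0) set) \<subseteq> Vc lam m (Suc c)"
  unfolding Vc_def
proof (rule fv.span_minimal[OF _ fv.subspace_span], rule subsetI)
  fix v :: "_ \<Rightarrow> 'a" assume "v \<in> high lam (Suc m) (polytabloid lam) c"
  then obtain T p where T: "v = polytabloid lam T" "T \<in> tableaux lam" "p \<in> cells lam" "T p = Suc m" "c \<le> snd p"
    unfolding high_def by blast
  show "v \<in> fv.span (high lam (Suc m) (polytabloid lam) (Suc c))"
  proof (cases "snd p = c")
    case True
    then show ?thesis
      using garnir_move[OF garnir_rel_polytabloid[OF assms(1), where 'a='a] T(2-4)] assms(2) T(1) by simp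
  next
    case False
    then show ?thesis using highI[OF T(2-4), of "Suc c"] T(1,5) by (auto intro: fv.span_base)
  qed
qed

text \<open>Straightening the smaller shape modulo the next step bounds the layer from above by the
  standard tableaux of \<open>al\<close>. That these remain independent in the layer is the business
  of \<open>th\<close>.\<close>

lemma Vc_corner:
  assumes lam: "is_partition (Suc m) lam" and al: "al \<in> down lam"
  shows "(Vc lam m (snd (box lam al)) :: (_ \<Rightarrow> 'a::field_char_0) set) \<subseteq>
    fv.span ((\<lambda>T. polytabloid lam (T(box lam al := Suc m))) ` std m al \<union> Vc lam m (Suc (snd (box lam al))))"
    (is "_ \<subseteq> ?S")
  unfolding Vc_def[of lam m "snd (box lam al)"]
proof (rule fv.span_minimal[OF _ fv.subspace_span], rule subsetI)
  let ?b = "box lam al"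
  note rel = garnir_rel_polytabloid[OF lam, where 'a='a]
  fix v :: "_ \<Rightarrow> 'a" assume "v \<in> high lam (Suc m) (polytabloid lam) (snd ?b)"
  then obtain T p where T: "v = polytabloid lam T" "T \<in> tableaux lam" "p \<in> cells lam" "T p = Suc m" "snd ?b \<le> snd p"
    unfolding high_def by blast
  show "v \<in> ?S"
  proof (cases "snd p = snd ?b")
    case True
    from garnir_corner_move[OF lam al rel T(2-4) True] obtain T' where
      T': "T' \<in> tableaux lam" "T' ?b = Suc m" "polytabloid lam T + polytabloid lam T' \<in> {0 :: _ \<Rightarrow> 'a} \<or> T' = T"
      by blast
    have "polytabloid lam (T'(?b := Suc m)) \<in> fv.span ((\<lambda>T. polytabloid lam (T(?b := Suc m))) ` std m al
        \<union> fv.span ({0 :: _ \<Rightarrow> 'a} \<union> high lam (Suc m) (polytabloid lam) (Suc (snd ?b))))"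
      by (rule std_span[OF down_partition[OF lam al] garnir_inherit[OF lam al rel] tableaux_restrict[OF lam al T'(1,2)]])
    then have "polytabloid lam T' \<in> ?S" using T'(2) by (simp add: Vc_def fun_upd_idem)
    moreover have "v = polytabloid lam T' \<or> v = - polytabloid lam T'"
      using T'(3) T(1) by (metis eq_neg_iff_add_eq_0 singletonD)
    ultimately show ?thesis using fv.span_neg by auto
  next
    case False
    then have "v \<in> high lam (Suc m) (polytabloid lam) (Suc (snd ?b))"
      unfolding T(1) by (intro highI[OF T(2-4)]) (use T(5) in simp)
    then have "v \<in> Vc lam m (Suc (snd ?b))" unfolding Vc_def by (rule fv.span_base)
    then show ?thesis by (blast intro: fv.span_base)
  qed
qed

lemma permutes_Suc: "\<pi> permutes {1..m} \<Longrightarrow> \<pi> permutes {1..Suc m}"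
  by (erule permutes_subset) auto

lemma permutes_fix_Suc: "\<pi> permutes {1..m} \<Longrightarrow> \<pi> (Suc m) = Suc m"
  by (rule permutes_not_in) auto

text \<open>Permutations of the smaller entries leave the cell of the largest entry alone.\<close>

lemma Vc_perm:
  assumes lam: "is_partition (Suc m) lam" and p: "\<pi> permutes {1..m}" and v: "v \<in> Vc lam m c"
  shows "perm_act \<pi> v \<in> (Vc lam m c :: (_ \<Rightarrow> 'a::field_char_0) set)"
proof (rule flin_span[OF flin_perm_act v[unfolded Vc_def] _ Vc_subspace])
  fix s :: "_ \<Rightarrow> 'a" assume "s \<in> high lam (Suc m) (polytabloid lam) c"
  then obtain T q where T: "s = polytabloid lam T" "T \<in> tableaux lam" "q \<in> cells lam" "T q = Suc m" "c \<le> snd q"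
    unfolding high_def by blast
  have p': "\<pi> permutes {1..sum_list lam}" using permutes_Suc[OF p] is_partition_sum[OF lam] by simp
  have "perm_act \<pi> s = polytabloid lam (\<pi> \<circ> T)" unfolding T(1) by (rule perm_act_polytabloid[OF T(2) p'])
  also have "\<dots> \<in> high lam (Suc m) (polytabloid lam) c"
    by (rule highI[OF tableaux_comp[OF T(2) p'] T(3) _ T(5)]) (simp add: T(4) permutes_fix_Suc[OF p])
  finally show "perm_act \<pi> s \<in> Vc lam m c" unfolding Vc_def by (rule fv.span_base)
qed

text \<open>Deletes the largest entry from the tabloids that have it in row \<open>r\<close> and annihilates the others.\<close>

definition th :: "nat \<Rightarrow> nat \<Rightarrow> ((nat \<Rightarrow> nat) \<Rightarrow> 'a::field_char_0) \<Rightarrow> (nat \<Rightarrow> nat) \<Rightarrow> 'a" where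
  "th m r h = (\<lambda>t. if t (Suc m) = 0 then h (t(Suc m := r)) else 0)"

lemma flin_th: "flin (th m r)"
  by (rule flinI) (auto simp: th_def vsmul_def fun_eq_iff)

lemma th_perm_act:
  assumes "\<pi> permutes {1..m}" shows "th m r (perm_act \<pi> h) = perm_act \<pi> (th m r h)"
proof -
  have "(t(Suc m := r)) \<circ> \<pi> = (t \<circ> \<pi>)(Suc m := r)" for t
    using permutes_fix_Suc[OF assms] permutes_inj[OF assms] by (auto simp: fun_eq_iff) (metis injD)
  then show ?thesis using permutes_fix_Suc[OF assms] by (simp add: th_def perm_act_def cong: if_cong)
qed

text \<open>A column permutation that leaves the largest entry in row \<open>r\<close> must fix it,
  because the corner is the only cell of its column in that row. The permutations fixing it form the
  column group of the smaller tableau.\<close>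

lemma th_polytabloid:
  assumes lam: "is_partition (Suc m) lam" and al: "al \<in> down lam" and b: "box lam al = (r, c)"
    and T: "T \<in> tableaux lam" "T (box lam al) = Suc m"
  shows "th m r (polytabloid lam T) = (polytabloid al T :: _ \<Rightarrow> 'a::field_char_0)"
proof -
  have Tal: "T \<in> tableaux al" by (rule tableaux_restrict[OF lam al T])
  have s: "sum_list lam = Suc m" "sum_list al = m"
    using is_partition_sum lam down_partition[OF lam al] by blast+
  note D = removes_boxD[OF al[unfolded in_down]]
  have bc: "box lam al \<in> cells lam" using D(4) by auto
  have pos: "pos al T i = pos lam T i" if "i \<in> {1..m}" for i
    using pos_cell[OF Tal] that s pos_T[OF T(1)] D(4) by (metis insertCI)
  have posS: "pos lam T (Suc m) = (r, c)" using pos_T[OF T(1) bc] T(2) b by simp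
  have keyA: "(\<sigma> \<in> col_group lam T \<and> \<sigma> (Suc m) = Suc m) \<longleftrightarrow> \<sigma> \<in> col_group al T" for \<sigma>
  proof
    assume a: "\<sigma> \<in> col_group lam T \<and> \<sigma> (Suc m) = Suc m"
    then have p: "\<sigma> permutes {1..Suc m}" using col_group_permutes[of \<sigma> lam T] s by simp
    have pm: "\<sigma> permutes {1..m}"
      by (rule permutes_superset[OF p]) (use a in \<open>auto simp: le_Suc_eq\<close>)
    have "\<sigma> i \<in> {1..m}" if "i \<in> {1..m}" for i using permutes_in_image[OF pm] that by blast
    then show "\<sigma> \<in> col_group al T" using a pm pos s by (simp add: col_group_alt)
  next
    assume a: "\<sigma> \<in> col_group al T"
    then have pm: "\<sigma> permutes {1..m}" using col_group_permutes[of \<sigma> al T] s by simp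
    have im: "\<sigma> i \<in> {1..m}" if "i \<in> {1..m}" for i using permutes_in_image[OF pm] that by blast
    have "snd (pos lam T (\<sigma> i)) = snd (pos lam T i)" if "i \<in> {1..Suc m}" for i
    proof (cases "i = Suc m")
      case False
      then have "i \<in> {1..m}" using that by auto
      then show ?thesis using a im pos s by (simp add: col_group_alt)
    qed (simp add: permutes_fix_Suc[OF pm])
    then show "\<sigma> \<in> col_group lam T \<and> \<sigma> (Suc m) = Suc m"
      using permutes_Suc[OF pm] permutes_fix_Suc[OF pm] s by (simp add: col_group_alt)
  qed
  have keyB: "\<sigma> (Suc m) = Suc m" if g: "\<sigma> \<in> col_group lam T" and t: "tabloid_of lam (\<sigma> \<circ> T) (Suc m) = r" for \<sigma>
  proof -
    note p = col_group_permutes[OF g]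
    have Sm: "Suc m \<in> {1..sum_list lam}" using s by simp
    have i: "inv \<sigma> (Suc m) \<in> {1..sum_list lam}" using permutes_in_image[OF permutes_inv[OF p]] Sm by blast
    have "fst (pos lam T (inv \<sigma> (Suc m))) = r"
      using t pos_comp[OF T(1) p Sm] Sm by (simp add: tabloid_of_alt)
    moreover have "snd (pos lam T (inv \<sigma> (Suc m))) = c"
      using col_group_inv[OF g] Sm posS unfolding col_group_alt by fastforce
    ultimately have "pos lam T (inv \<sigma> (Suc m)) = box lam al" using b by (simp add: prod_eq_iff)
    then have "inv \<sigma> (Suc m) = Suc m" using pos_cell(2)[OF T(1) i] T(2) by simp
    then show ?thesis using permutes_inverses(1)[OF p, of "Suc m"] by simp
  qed
  have tab: "tabloid_of lam (\<sigma> \<circ> T) = (tabloid_of al (\<sigma> \<circ> T))(Suc m := r)" if g: "\<sigma> \<in> col_group al T" for \<sigma>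
  proof
    fix i
    have g': "\<sigma> \<in> col_group lam T" using keyA g by blast
    note p = col_group_permutes[OF g, unfolded s] and p' = col_group_permutes[OF g', unfolded s]
    show "tabloid_of lam (\<sigma> \<circ> T) i = ((tabloid_of al (\<sigma> \<circ> T))(Suc m := r)) i"
    proof (cases "i = Suc m")
      case True
      have "inv \<sigma> (Suc m) = Suc m" by (rule permutes_fix_Suc[OF permutes_inv[OF p]])
      then show ?thesis using True pos_comp[OF T(1) p'[folded s(1)], of "Suc m"] posS s by (simp add: tabloid_of_alt)
    next
      case False
      show ?thesis
      proof (cases "i \<in> {1..m}")
        case True
        have "inv \<sigma> i \<in> {1..m}" using permutes_in_image[OF permutes_inv[OF p]] True by blast
        then show ?thesis using True False pos s
            pos_comp[OF T(1) p'[folded s(1)], of i] pos_comp[OF Tal p[folded s(2)], of i] by (simp add: tabloid_of_alt)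
      qed (use False s in \<open>auto simp: tabloid_of_alt\<close>)
    qed
  qed
  \<comment> \<open>Tabloids of the smaller shape vanish at \<open>Suc m\<close>, which is why
    \<open>th\<close> tests for the value \<open>0\<close> there.\<close>
  have tabS: "tabloid_of al S (Suc m) = 0" for S using s by (simp add: tabloid_of_alt)
  have sets: "{\<sigma> \<in> col_group lam T. tabloid_of lam (\<sigma> \<circ> T) = t(Suc m := r)} = {\<sigma> \<in> col_group al T. tabloid_of al (\<sigma> \<circ> T) = t}"
    if t0: "t (Suc m) = 0" for t
  proof (intro set_eqI iffI)
    fix \<sigma> assume "\<sigma> \<in> {\<sigma> \<in> col_group lam T. tabloid_of lam (\<sigma> \<circ> T) = t(Suc m := r)}"
    then have g: "\<sigma> \<in> col_group lam T" and e: "tabloid_of lam (\<sigma> \<circ> T) = t(Suc m := r)" by auto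
    have g': "\<sigma> \<in> col_group al T" using keyA[of \<sigma>] keyB[OF g] e g by auto
    have "(tabloid_of al (\<sigma> \<circ> T))(Suc m := r) = t(Suc m := r)" using tab[OF g'] e by simp
    then have "tabloid_of al (\<sigma> \<circ> T) = t" using tabS[of "\<sigma> \<circ> T"] t0 by (metis fun_upd_triv fun_upd_upd)
    then show "\<sigma> \<in> {\<sigma> \<in> col_group al T. tabloid_of al (\<sigma> \<circ> T) = t}" using g' by simp
  next
    fix \<sigma> assume "\<sigma> \<in> {\<sigma> \<in> col_group al T. tabloid_of al (\<sigma> \<circ> T) = t}"
    then show "\<sigma> \<in> {\<sigma> \<in> col_group lam T. tabloid_of lam (\<sigma> \<circ> T) = t(Suc m := r)}"
      using keyA tab by auto
  qed
  have empty: "{\<sigma> \<in> col_group al T. tabloid_of al (\<sigma> \<circ> T) = t} = {}" if "t (Suc m) \<noteq> 0" for t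
    using tabS that by auto
  show ?thesis
  proof
    fix t show "th m r (polytabloid lam T) t = (polytabloid al T t :: 'a)"
    proof (cases "t (Suc m) = 0")
      case True then show ?thesis unfolding th_def polytabloid_def sets[of t, OF True] by simp
    next
      case False then show ?thesis unfolding th_def polytabloid_def empty[of t, OF False] by simp
    qed
  qed
qed

text \<open>A column permutation keeps the largest entry in a column to the right of the corner, and
  such a column does not reach down to row \<open>r\<close>.\<close>

lemma th_high:
  assumes lam: "is_partition (Suc m) lam" and al: "al \<in> down lam" and b: "box lam al = (r, c)"
    and T: "T \<in> tableaux lam" "p \<in> cells lam" "T p = Suc m" "c < snd p"
  shows "th m r (polytabloid lam T) = (0 :: _ \<Rightarrow> 'a::field_char_0)"
proof -
  have s: "sum_list lam = Suc m" using is_partition_sum lam by blast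
  have "tabloid_of lam (\<sigma> \<circ> T) (Suc m) \<noteq> r" if g: "\<sigma> \<in> col_group lam T" for \<sigma>
  proof
    assume t: "tabloid_of lam (\<sigma> \<circ> T) (Suc m) = r"
    note ps = col_group_permutes[OF g]
    have Sm: "Suc m \<in> {1..sum_list lam}" using s by simp
    have i: "inv \<sigma> (Suc m) \<in> {1..sum_list lam}" using permutes_in_image[OF permutes_inv[OF ps]] Sm by blast
    have f: "fst (pos lam T (inv \<sigma> (Suc m))) = r"
      using t pos_comp[OF T(1) ps Sm] Sm by (simp add: tabloid_of_alt)
    have "snd (pos lam T (inv \<sigma> (Suc m))) = snd (pos lam T (Suc m))"
      using col_group_inv[OF g] Sm unfolding col_group_alt by blast
    then have "snd (pos lam T (inv \<sigma> (Suc m))) = snd p" using pos_T[OF T(1,2)] T(3) by simp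
    then have "(r, snd p) \<in> cells lam" using f pos_cell(1)[OF T(1) i] by (metis prod.collapse)
    then have "r < ht lam (snd p)" using in_cells_ht[OF lam] by blast
    also have "\<dots> \<le> ht lam (Suc c)" using ht_antimono[OF lam] T(4) by simp
    also have "\<dots> \<le> r" using box_corner(3)[OF al[unfolded in_down] b] .
    finally show False by simp
  qed
  then have e: "{\<sigma> \<in> col_group lam T. tabloid_of lam (\<sigma> \<circ> T) = t(Suc m := r)} = {}" for t
    by (metis (mono_tags, lifting) Collect_empty_eq fun_upd_same)
  show ?thesis
    by (rule ext) (simp add: th_def polytabloid_def e del: fun_upd_apply)
qed

lemma th_Vc_0:
  assumes lam: "is_partition (Suc m) lam" and al: "al \<in> down lam" and b: "box lam al = (r, c)"
    and v: "v \<in> Vc lam m (Suc c)"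
  shows "th m r v = (0 :: _ \<Rightarrow> 'a::field_char_0)"
proof -
  have "th m r v \<in> {0 :: _ \<Rightarrow> 'a}"
    by (rule flin_span[OF flin_th v[unfolded Vc_def] _ fv.subspace_single_0])
      (use th_high[OF lam al b] in \<open>auto simp: high_def Suc_le_eq\<close>)
  then show ?thesis by simp
qed

lemma th_std:
  assumes lam: "is_partition (Suc m) lam" and al: "al \<in> down lam" and b: "box lam al = (r, c)"
    and T: "T \<in> tableaux al"
  shows "th m r (polytabloid lam (T((r, c) := Suc m))) = (polytabloid al T :: _ \<Rightarrow> 'a::field_char_0)"
proof -
  have T1: "T((r, c) := Suc m) \<in> tableaux lam" using tableaux_extend[OF lam al T] b by simp
  have 1: "th m r (polytabloid lam (T((r, c) := Suc m))) = (polytabloid al (T((r, c) := Suc m)) :: _ \<Rightarrow> 'a)"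
    by (rule th_polytabloid[OF lam al b T1]) (simp add: b)
  have "T((r, c) := Suc m) \<in> tableaux al"
    by (rule tableaux_restrict[OF lam al T1]) (simp add: b)
  then have "(polytabloid al (T((r, c) := Suc m)) :: _ \<Rightarrow> 'a) = polytabloid al T"
    by (rule polytabloid_cong[OF _ T]) (use removes_boxD(3)[OF al[unfolded in_down]] b in auto)
  with 1 show ?thesis by simp
qed

lemma th_Vc_specht:
  assumes lam: "is_partition (Suc m) lam" and al: "al \<in> down lam" and b: "box lam al = (r, c)"
    and v: "v \<in> Vc lam m c"
  shows "th m r v \<in> specht al"
proof (rule flin_span[OF flin_th _ _ specht_subspace])
  show "v \<in> fv.span ((\<lambda>T. polytabloid lam (T((r, c) := Suc m))) ` std m al \<union> Vc lam m (Suc c))"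
    using Vc_corner[OF lam al] v b by auto
  fix s :: "(nat \<Rightarrow> nat) \<Rightarrow> 'a"
  assume "s \<in> (\<lambda>T. polytabloid lam (T((r, c) := Suc m))) ` std m al \<union> Vc lam m (Suc c)"
  then show "th m r s \<in> specht al"
  proof
    assume "s \<in> (\<lambda>T. polytabloid lam (T((r, c) := Suc m))) ` std m al"
    then obtain T where "T \<in> std m al" "s = polytabloid lam (T((r, c) := Suc m))" by blast
    then show ?thesis
      using th_std[OF lam al b] std_tableaux[OF down_partition[OF lam al]] polytabloid_specht by metis
  next
    assume "s \<in> Vc lam m (Suc c)"
    then show ?thesis using th_Vc_0[OF lam al b] fv.subspace_0[OF specht_subspace] by metis
  qed
qed

lemma th_surj:
  assumes lam: "is_partition (Suc m) lam" and al: "al \<in> down lam" and b: "box lam al = (r, c)"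
    and w: "w \<in> (specht al :: ((nat \<Rightarrow> nat) \<Rightarrow> 'a::field_char_0) set)"
  obtains v where "v \<in> Vc lam m c" "th m r v = w"
proof -
  let ?S = "(\<lambda>T. polytabloid lam (T((r, c) := Suc m)) :: _ \<Rightarrow> 'a) ` tableaux al"
  have "th m r ` ?S = polytabloid al ` tableaux al"
    unfolding image_image by (rule image_cong[OF refl]) (rule th_std[OF lam al b])
  then have "specht al = th m r ` fv.span ?S"
    unfolding specht_eq by (metis fp.linear_span_image[OF flin_th])
  with w have "w \<in> th m r ` fv.span ?S" by (simp only:)
  then have "\<exists>v\<in>fv.span ?S. w = th m r v" by (simp only: image_iff)
  then obtain v where v: "v \<in> fv.span ?S" "w = th m r v" by (elim bexE)
  have rc: "(r, c) \<in> cells lam" using removes_boxD(4)[OF al[unfolded in_down]] b by auto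
  have "?S \<subseteq> high lam (Suc m) (polytabloid lam) c"
  proof (rule image_subsetI)
    fix T assume "T \<in> tableaux al"
    then have "T((r, c) := Suc m) \<in> tableaux lam" using tableaux_extend[OF lam al, of T] b by simp
    then show "polytabloid lam (T((r, c) := Suc m)) \<in> high lam (Suc m) (polytabloid lam) c"
      by (rule highI[OF _ rc]) simp_all
  qed
  from subsetD[OF fv.span_mono[OF this] v(1)] have "v \<in> Vc lam m c" unfolding Vc_def .
  then show thesis using v(2)[symmetric] by (rule that)
qed

lemma sum_std_Suc:
  fixes g :: "_ \<Rightarrow> 'c::comm_monoid_add"
  assumes "is_partition (Suc m) lam"
  shows "(\<Sum>T\<in>std (Suc m) lam. g T) = (\<Sum>al\<in>down lam. \<Sum>T\<in>std m al. g (T(box lam al := Suc m)))"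
proof -
  have "(\<Sum>T\<in>std (Suc m) lam. g T) = (\<Sum>al\<in>down lam. \<Sum>T\<in>(\<lambda>T. T(box lam al := Suc m)) ` std m al. g T)"
    unfolding std.simps by (rule sum.UNION_disjoint) (use std_box_disjoint[OF assms] in auto)
  also have "\<dots> = (\<Sum>al\<in>down lam. \<Sum>T\<in>std m al. g (T(box lam al := Suc m)))"
    by (rule sum.cong[OF refl]) (simp add: sum.reindex[OF std_box_inj[OF assms]])
  finally show ?thesis .
qed

text \<open>Corners are treated from left to right. The map \<open>th\<close> of a corner kills the
  standard tableaux with the largest entry further right, those with it further left already have
  coefficient zero, and what remains is a relation for the smaller shape.\<close>

lemma std_indep:
  fixes k :: "_ \<Rightarrow> 'a::field_char_0"
  shows "is_partition m lam \<Longrightarrow> (\<Sum>T\<in>std m lam. vsmul (k T) (polytabloid lam T)) = 0 \<Longrightarrow> T \<in> std m lam \<Longrightarrow> k T = 0"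
proof (induction m arbitrary: lam k T)
  case 0
  have "col_group lam (\<lambda>_. 0) = {id}" using 0(1) by (auto simp: is_partition_0 col_group_def)
  then have "polytabloid lam (\<lambda>_. 0) (tabloid_of lam (id \<circ> (\<lambda>_. 0))) = (1 :: 'a)"
    by (simp add: polytabloid_alt vsmul_apply dlt_def)
  moreover have "vsmul (k (\<lambda>_. 0)) (polytabloid lam (\<lambda>_. 0)) = 0"
    using 0(2) unfolding std.simps by (simp only: sum.insert finite.emptyI empty_iff not_False_eq_True sum.empty add_0_right)
  ultimately have "k (\<lambda>_. 0) = 0" by (metis fv.scale_eq_0_iff zero_fun_def zero_neq_one)
  then show ?case using 0(3) by simp
next
  case (Suc m)
  note lam = Suc.prems(1)
  let ?e = "\<lambda>al T. T(box lam al := Suc m)"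
  have main: "\<forall>T\<in>std m al. k (?e al T) = 0" if "al \<in> down lam" for al
    using that
  proof (induction "snd (box lam al)" arbitrary: al rule: less_induct)
    case less
    note al = less.prems
    obtain r c where b: "box lam al = (r, c)" by (cases "box lam al")
    have "0 = th m r (\<Sum>T\<in>std (Suc m) lam. vsmul (k T) (polytabloid lam T))"
      using Suc.prems(2) flin_0[OF flin_th] by metis
    also have "\<dots> = (\<Sum>al'\<in>down lam. \<Sum>T\<in>std m al'. vsmul (k (?e al' T)) (th m r (polytabloid lam (?e al' T))))"
      by (simp only: sum_std_Suc[OF lam] flin_sum[OF flin_th] flin_scale[OF flin_th])
    also have "\<dots> = (\<Sum>al'\<in>down lam. if al' = al then (\<Sum>T\<in>std m al. vsmul (k (?e al T)) (polytabloid al T)) else 0)"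
    proof (rule sum.cong[OF refl])
      fix al' assume al': "al' \<in> down lam"
      have tab: "T \<in> tableaux al'" if "T \<in> std m al'" for T using std_tableaux[OF down_partition[OF lam al']] that by blast
      have bc: "box lam al' \<in> cells lam" using removes_boxD(4)[OF al'[unfolded in_down]] by auto
      consider "al' = al" | "snd (box lam al') < c" | "al' \<noteq> al" "c < snd (box lam al')"
        using down_eq_if_same_col al al' b by (metis in_down linorder_neqE_nat snd_conv)
      then show "(\<Sum>T\<in>std m al'. vsmul (k (?e al' T)) (th m r (polytabloid lam (?e al' T)))) =
         (if al' = al then (\<Sum>T\<in>std m al. vsmul (k (?e al T)) (polytabloid al T)) else 0)"
      proof cases
        case 1
        have "th m r (polytabloid lam (?e al T)) = (polytabloid al T :: _ \<Rightarrow> 'a)" if "T \<in> std m al" for T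
          unfolding b by (rule th_std[OF lam al b]) (use tab that 1 in blast)
        then show ?thesis using 1 by (simp cong: sum.cong)
      next
        case 2
        then have "k (?e al' T) = 0" if "T \<in> std m al'" for T using less.hyps[of al'] al' b that by simp
        then show ?thesis using 2 b by (auto intro: sum.neutral)
      next
        case 3
        have "th m r (polytabloid lam (?e al' T)) = (0 :: _ \<Rightarrow> 'a)" if "T \<in> std m al'" for T
          by (rule th_high[OF lam al b tableaux_extend[OF lam al' tab[OF that]] bc _ 3(2)]) simp
        then show ?thesis using 3 by (simp cong: sum.cong)
      qed
    qed
    also have "\<dots> = (\<Sum>T\<in>std m al. vsmul (k (?e al T)) (polytabloid al T))"
      using al by simp
    finally have "(\<Sum>T\<in>std m al. vsmul (k (?e al T)) (polytabloid al T)) = 0" by simp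
    then show ?case using Suc.IH[OF down_partition[OF lam al], of "\<lambda>T. k (?e al T)"] by blast
  qed
  then show ?case using Suc.prems(3) by auto
qed

text \<open>The layer is spanned by the images of polytabloids indexed by the standard tableaux of
  \<open>al\<close>, and \<open>th\<close> sends them to independent vectors; so it is injective on
  the layer.\<close>

lemma th_ker:
  assumes lam: "is_partition (Suc m) lam" and al: "al \<in> down lam" and b: "box lam al = (r, c)"
    and v: "v \<in> (Vc lam m c :: ((nat \<Rightarrow> nat) \<Rightarrow> 'a::field_char_0) set)" and z: "th m r v = 0"
  shows "v \<in> Vc lam m (Suc c)"
proof -
  let ?f = "\<lambda>T. polytabloid lam (T((r, c) := Suc m)) :: _ \<Rightarrow> 'a"
  have "v \<in> fv.span (?f ` std m al \<union> Vc lam m (Suc c))"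
    using Vc_corner[OF lam al] v b by auto
  then obtain x y where xy: "v = x + y" "x \<in> fv.span (?f ` std m al)" "y \<in> Vc lam m (Suc c)"
    using fv.span_Un fv.span_eq_iff Vc_subspace by (smt (verit, best) mem_Collect_eq)
  have fs: "finite (?f ` std m al)" by simp
  obtain k where "x = (\<Sum>s\<in>?f ` std m al. vsmul (k s) s)"
    using xy(2) unfolding fv.span_finite[OF fs] by blast
  moreover have tab: "T \<in> tableaux al" if "T \<in> std m al" for T using std_tableaux[OF down_partition[OF lam al]] that by blast
  \<comment> \<open>The coefficients obtained from the span are indexed by vectors; distinctness of
    these vectors turns them into coefficients indexed by tableaux.\<close>
  have inj: "inj_on ?f (std m al)"
  proof (rule inj_onI)
    fix S T assume ST: "S \<in> std m al" "T \<in> std m al" "?f S = ?f T"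
    then have e: "polytabloid al S = (polytabloid al T :: _ \<Rightarrow> 'a)" using th_std[OF lam al b tab] by metis
    show "S = T"
    proof (rule ccontr)
      assume ne: "S \<noteq> T"
      define k :: "_ \<Rightarrow> 'a" where "k = (\<lambda>X. if X = S then 1 else if X = T then - 1 else 0)"
      have "(\<Sum>X\<in>std m al. vsmul (k X) (polytabloid al X)) = (\<Sum>X\<in>{S, T}. vsmul (k X) (polytabloid al X))"
        by (rule sum.mono_neutral_right) (use ST in \<open>auto simp: k_def\<close>)
      also have "\<dots> = 0" using ne e by (simp add: k_def)
      finally show False using std_indep[OF down_partition[OF lam al] _ ST(1), of k] by (simp add: k_def)
    qed
  qed
  ultimately have x: "x = (\<Sum>T\<in>std m al. vsmul (k (?f T)) (?f T))" by (simp add: sum.reindex)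
  have "0 = th m r x" using z xy(1) th_Vc_0[OF lam al b xy(3)] flin_add[OF flin_th, of m r x y] by simp
  also have "\<dots> = (\<Sum>T\<in>std m al. vsmul (k (?f T)) (polytabloid al T))"
    unfolding x flin_sum[OF flin_th] flin_scale[OF flin_th]
    by (rule sum.cong[OF refl]) (simp only: th_std[OF lam al b tab])
  finally have "(\<Sum>T\<in>std m al. vsmul (k (?f T)) (polytabloid al T)) = 0" ..
  then have "k (?f T) = 0" if "T \<in> std m al" for T
    using std_indep[OF down_partition[OF lam al], of "\<lambda>T. k (?f T)"] that by blast
  then have "x = 0" unfolding x by (intro sum.neutral) simp
  then show ?thesis using xy by simp
qed

section \<open>The sum of all transpositions\<close>

lemma tableaux_in: "T \<in> tableaux lam \<Longrightarrow> p \<in> cells lam \<Longrightarrow> T p \<in> {1..sum_list lam}"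
  using tableaux_image by blast

text \<open>The Garnir relation for a whole column and one cell to its right. Permutations of the
  column alone act by signs, so after division by their number one term for the identity and one for
  each exchange remain.\<close>

lemma garnir_one:
  assumes lam: "is_partition m lam" and T: "T \<in> tableaux lam" and q: "q \<in> cells lam" and c: "c < snd q"
  shows "(\<Sum>p\<in>{p \<in> cells lam. snd p = c}. polytabloid lam (transpose (T p) (T q) \<circ> T))
    = (polytabloid lam T :: _ \<Rightarrow> 'a::field_char_0)"
proof -
  let ?e = "polytabloid lam :: _ \<Rightarrow> _ \<Rightarrow> 'a"
  define A where "A = {p \<in> cells lam. snd p = c}"
  define Y where "Y = T ` A"
  have A: "A \<subseteq> cells lam" "snd ` A \<subseteq> {c}" "finite A" "q \<notin> A" "card A = ht lam c"
    using c card_col by (auto simp: A_def)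
  have finY: "finite Y" using A(3) by (simp add: Y_def)
  have qY: "T q \<notin> Y" using tableau_pos_eq[OF T _ q] A(1,4) by (auto simp: Y_def)
  have X: "T ` (A \<union> {q}) = insert (T q) Y" by (auto simp: Y_def)
  let ?P = "{p. p permutes Y}"
  have perm: "p \<in> col_group lam T" if "p \<in> ?P" for p
    using col_perm_in_col_group[OF T A(1,2)] that by (simp add: Y_def)
  have tr: "transpose (T q) b permutes {1..sum_list lam}" if "b \<in> Y" for b
  proof -
    obtain p where "p \<in> cells lam" "b = T p" using \<open>b \<in> Y\<close> A(1) unfolding Y_def by blast
    then show ?thesis using tableaux_in[OF T] q by (intro permutes_swap_id) blast+
  qed
  define R where "R = (\<Sum>b\<in>Y. ?e (transpose (T q) b \<circ> T))"
  have "(\<Sum>\<pi> | \<pi> permutes T ` (A \<union> {q}). vsmul (sg \<pi>) (?e (\<pi> \<circ> T))) = 0"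
    by (rule garnir_polytabloid[OF lam T, of A "{q}" c "snd q"]) (use A q c in auto)
  then have "(\<Sum>p\<in>?P. vsmul (sg p) (?e (p \<circ> T))) = (\<Sum>p\<in>?P. vsmul (sg p) (\<Sum>b\<in>Y. ?e (transpose (T q) b \<circ> (p \<circ> T))))"
    unfolding X sum_permutes_insert[OF finY qY] by (simp only: right_minus_eq)
  moreover have "vsmul (sg p) (?e (p \<circ> T)) = ?e T" if "p \<in> ?P" for p
    unfolding polytabloid_col[OF T perm[OF that]] by (simp add: sg_sq)
  moreover have "vsmul (sg p) (\<Sum>b\<in>Y. ?e (transpose (T q) b \<circ> (p \<circ> T))) = R" if p: "p \<in> ?P" for p
  proof -
    have "?e (transpose (T q) b \<circ> (p \<circ> T)) = vsmul (sg p) (?e (transpose (T q) b \<circ> T))" if "b \<in> Y" for b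
    proof -
      have "?e (transpose (T q) b \<circ> (p \<circ> T)) = perm_act (transpose (T q) b) (?e (p \<circ> T))"
        by (rule perm_act_polytabloid[OF tableaux_comp[OF T col_group_permutes[OF perm[OF p]]] tr[OF that], symmetric])
      also have "\<dots> = vsmul (sg p) (perm_act (transpose (T q) b) (?e T))"
        unfolding polytabloid_col[OF T perm[OF p]] perm_act_lin ..
      also have "\<dots> = vsmul (sg p) (?e (transpose (T q) b \<circ> T))"
        unfolding perm_act_polytabloid[OF T tr[OF that]] ..
      finally show ?thesis .
    qed
    then have "(\<Sum>b\<in>Y. ?e (transpose (T q) b \<circ> (p \<circ> T))) = vsmul (sg p) R"
      unfolding R_def fv.scale_sum_right by (rule sum.cong[OF refl])
    then show ?thesis by (simp add: sg_sq)
  qed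
  ultimately have "(\<Sum>p\<in>?P. ?e T) = (\<Sum>p\<in>?P. R)" by (simp only: cong: sum.cong)
  then have "vsmul (of_nat (card ?P)) (?e T - R) = 0"
    unfolding fv_sum_const by (simp add: fv.scale_right_diff_distrib)
  moreover have "card ?P \<noteq> 0" using card_permutations[OF refl finY] by simp
  ultimately have "?e T = R" by simp
  also have "R = (\<Sum>p\<in>A. ?e (transpose (T q) (T p) \<circ> T))"
    unfolding R_def Y_def using tableaux_inj[OF T] A(1) by (subst sum.reindex) (auto intro: inj_on_subset)
  finally show ?thesis unfolding A_def by (simp only: transpose_commute)
qed

text \<open>Ordered pairs are summed so that conjugation by a permutation becomes a reindexing of
  both sums.\<close>

definition Tsum :: "nat \<Rightarrow> ((nat \<Rightarrow> nat) \<Rightarrow> 'a::field_char_0) \<Rightarrow> (nat \<Rightarrow> nat) \<Rightarrow> 'a" where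
  "Tsum m h = (\<Sum>i\<in>{1..m}. \<Sum>j\<in>{1..m}. perm_act (transpose i j) h)"

text \<open>Twice the content of each cell; the summand \<open>1\<close> accounts for the pairs \<open>i = j\<close> in \<open>Tsum\<close>.\<close>

definition ev :: "nat list \<Rightarrow> 'a::field_char_0" where
  "ev lam = (\<Sum>p\<in>cells lam. of_int (2 * int (snd p) - 2 * int (fst p) + 1))"

lemma flin_Tsum: "flin (Tsum m)"
  unfolding Tsum_def by (intro flin_sum_fun flin_perm_act)

lemma Tsum_perm_act:
  assumes p: "\<pi> permutes {1..m}" shows "Tsum m (perm_act \<pi> h) = perm_act \<pi> (Tsum m h)"
proof -
  have conj: "transpose (\<pi> i) (\<pi> j) \<circ> \<pi> = \<pi> \<circ> transpose i j" for i j
    using permutes_inj[OF p] by (auto simp: fun_eq_iff transpose_def inj_eq)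
  have bij: "bij_betw \<pi> {1..m} {1..m}" by (rule permutes_imp_bij[OF p])
  have "Tsum m (perm_act \<pi> h) = (\<Sum>i\<in>{1..m}. \<Sum>j\<in>{1..m}. perm_act (transpose (\<pi> i) (\<pi> j)) (perm_act \<pi> h))"
    unfolding Tsum_def sum.reindex_bij_betw[OF bij, of "\<lambda>j. perm_act (transpose (\<pi> _) j) (perm_act \<pi> h)"]
    by (rule sum.reindex_bij_betw[OF bij, symmetric, of "\<lambda>i. \<Sum>j\<in>{1..m}. perm_act (transpose i j) (perm_act \<pi> h)"])
  also have "\<dots> = perm_act \<pi> (Tsum m h)"
    unfolding Tsum_def perm_act_lin perm_act_comp conj ..
  finally show ?thesis .
qed

text \<open>Off the diagonal each unordered pair occurs twice; both occurrences are charged to its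
  larger element.\<close>

lemma sum_pairs_symmetric:
  fixes F :: "'c \<Rightarrow> 'c \<Rightarrow> 'd::comm_monoid_add"
  assumes "finite C" "\<And>p q. F p q = F q p" "\<And>p. \<not> lt p p" "\<And>p q. lt p q \<Longrightarrow> \<not> lt q p" "\<And>p q. p \<noteq> q \<Longrightarrow> lt p q \<or> lt q p"
  shows "(\<Sum>q\<in>C. \<Sum>p\<in>C. F p q) = (\<Sum>q\<in>C. F q q + ((\<Sum>p\<in>{p \<in> C. lt p q}. F p q) + (\<Sum>p\<in>{p \<in> C. lt p q}. F p q)))"
proof -
  have "(\<Sum>p\<in>C. F p q) = F q q + ((\<Sum>p\<in>C. if lt p q then F p q else 0) + (\<Sum>p\<in>C. if lt q p then F p q else 0))"
    if "q \<in> C" for q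
  proof -
    have "(\<Sum>p\<in>C. F p q) = (\<Sum>p\<in>C. (if p = q then F p q else 0) + ((if lt p q then F p q else 0) + (if lt q p then F p q else 0)))"
    proof (rule sum.cong[OF refl])
      fix p show "F p q = (if p = q then F p q else 0) + ((if lt p q then F p q else 0) + (if lt q p then F p q else 0))"
        using assms(3)[of q] assms(4)[of p q] assms(5)[of p q] by auto
    qed
    then show ?thesis using that assms(1) by (simp add: sum.distrib)
  qed
  moreover have "(\<Sum>q\<in>C. \<Sum>p\<in>C. if lt q p then F p q else 0) = (\<Sum>q\<in>C. \<Sum>p\<in>C. if lt p q then F p q else 0)"
    by (subst sum.swap) (simp only: assms(2))
  ultimately show ?thesis by (simp add: sum.distrib sum.inter_filter[OF assms(1)])
qed

text \<open>For a cell \<open>q\<close>, an exchange with a cell above it in its column contributes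
  \<open>-1\<close>, and the exchanges with all cells of an earlier column contribute
  \<open>1\<close> in total. This gives the content \<open>snd q - fst q\<close>, doubled because
  pairs are ordered.\<close>

lemma Tsum_polytabloid:
  assumes lam: "is_partition m lam" and T: "T \<in> tableaux lam"
  shows "Tsum m (polytabloid lam T) = vsmul (ev lam) (polytabloid lam T :: _ \<Rightarrow> 'a::field_char_0)"
proof -
  let ?e = "polytabloid lam T :: _ \<Rightarrow> 'a"
  define F where "F = (\<lambda>p q. polytabloid lam (transpose (T p) (T q) \<circ> T) :: _ \<Rightarrow> 'a)"
  \<comment> \<open>Ordering cells by columns first, a predecessor of \<open>q\<close> lies either
    in an earlier column, where \<open>garnir_one\<close> applies, or above \<open>q\<close> in its
    own column, where antisymmetry does.\<close>
  define lt where "lt = (\<lambda>p q :: nat \<times> nat. snd p < snd q \<or> (snd p = snd q \<and> fst p < fst q))"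
  have s: "sum_list lam = m" by (rule is_partition_sum[OF lam])
  have bij: "bij_betw T (cells lam) {1..m}" using T s by (simp add: tableaux_def)
  have F: "perm_act (transpose (T q) (T p)) ?e = F q p" if "p \<in> cells lam" "q \<in> cells lam" for p q
    unfolding F_def using that tableaux_in[OF T] by (intro perm_act_polytabloid[OF T] permutes_swap_id) blast+
  have "Tsum m ?e = (\<Sum>q\<in>cells lam. \<Sum>p\<in>cells lam. perm_act (transpose (T q) (T p)) ?e)"
    unfolding Tsum_def sum.reindex_bij_betw[OF bij, of "\<lambda>j. perm_act (transpose (T _) j) ?e"]
    by (rule sum.reindex_bij_betw[OF bij, symmetric, of "\<lambda>i. \<Sum>j\<in>{1..m}. perm_act (transpose i j) ?e"])
  also have "\<dots> = (\<Sum>q\<in>cells lam. \<Sum>p\<in>cells lam. F q p)"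
    by (intro sum.cong refl F)
  also have "\<dots> = (\<Sum>q\<in>cells lam. \<Sum>p\<in>cells lam. F p q)" by (rule sum.swap)
  also have "\<dots> = (\<Sum>q\<in>cells lam. F q q + ((\<Sum>p\<in>{p \<in> cells lam. lt p q}. F p q) + (\<Sum>p\<in>{p \<in> cells lam. lt p q}. F p q)))"
    by (rule sum_pairs_symmetric) (auto simp: F_def lt_def transpose_commute prod_eq_iff)
  also have "\<dots> = (\<Sum>q\<in>cells lam. vsmul (of_int (2 * int (snd q) - 2 * int (fst q) + 1)) ?e)"
  proof (rule sum.cong[OF refl])
    fix q assume q: "q \<in> cells lam"
    have S: "{p \<in> cells lam. lt p q} = {p \<in> cells lam. snd p < snd q} \<union> {p \<in> cells lam. snd p = snd q \<and> fst p < fst q}"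
      by (auto simp: lt_def)
    have "(\<Sum>p\<in>{p \<in> cells lam. snd p < snd q}. F p q)
        = (\<Sum>c\<in>{..<snd q}. \<Sum>p\<in>{x \<in> {p \<in> cells lam. snd p < snd q}. snd x = c}. F p q)"
      by (rule sum.group[symmetric]) auto
    also have "\<dots> = (\<Sum>c\<in>{..<snd q}. ?e)"
    proof (rule sum.cong[OF refl])
      fix c assume "c \<in> {..<snd q}"
      then have c: "c < snd q" and e: "{x \<in> {p \<in> cells lam. snd p < snd q}. snd x = c} = {p \<in> cells lam. snd p = c}" by auto
      show "(\<Sum>p\<in>{x \<in> {p \<in> cells lam. snd p < snd q}. snd x = c}. F p q) = ?e"
        unfolding e F_def by (rule garnir_one[OF lam T q c])
    qed
    also have "\<dots> = vsmul (of_nat (snd q)) ?e" unfolding fv_sum_const by simp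
    finally have 1: "(\<Sum>p\<in>{p \<in> cells lam. snd p < snd q}. F p q) = vsmul (of_nat (snd q)) ?e" .
    have "(\<Sum>p\<in>{p \<in> cells lam. snd p = snd q \<and> fst p < fst q}. F p q) = (\<Sum>p\<in>{p \<in> cells lam. snd p = snd q \<and> fst p < fst q}. - ?e)"
    proof (rule sum.cong[OF refl])
      fix p assume "p \<in> {p \<in> cells lam. snd p = snd q \<and> fst p < fst q}"
      then have "F p q + ?e \<in> {0}" unfolding F_def
        by (intro garnir_rel_swap[OF garnir_rel_polytabloid[OF lam] T _ q]) auto
      then show "F p q = - ?e" by (simp only: singleton_iff eq_neg_iff_add_eq_0)
    qed
    also have "\<dots> = vsmul (of_nat (card {p \<in> cells lam. snd p = snd q \<and> fst p < fst q})) (- ?e)"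
      by (rule fv_sum_const)
    also have "card {p \<in> cells lam. snd p = snd q \<and> fst p < fst q} = fst q"
    proof -
      have "{p \<in> cells lam. snd p = snd q \<and> fst p < fst q} = (\<lambda>r. (r, snd q)) ` {..<fst q}"
        using youngD[OF young_cells[OF lam], of "fst q" "snd q" _ "snd q"] q by auto
      then show ?thesis by (simp add: card_image inj_on_def)
    qed
    finally have 2: "(\<Sum>p\<in>{p \<in> cells lam. snd p = snd q \<and> fst p < fst q}. F p q) = - vsmul (of_nat (fst q)) ?e"
      by (simp only: fv.scale_minus_right)
    have 3: "(\<Sum>p\<in>{p \<in> cells lam. lt p q}. F p q) = vsmul (of_nat (snd q)) ?e - vsmul (of_nat (fst q)) ?e"
      unfolding S by (subst sum.union_disjoint) (auto simp: 1 2)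
    have 4: "F q q = ?e" by (simp add: F_def)
    show "F q q + ((\<Sum>p\<in>{p \<in> cells lam. lt p q}. F p q) + (\<Sum>p\<in>{p \<in> cells lam. lt p q}. F p q)) =
        vsmul (of_int (2 * int (snd q) - 2 * int (fst q) + 1)) ?e"
      unfolding 3 4 by (simp add: fun_eq_iff vsmul_apply algebra_simps)
  qed
  also have "\<dots> = vsmul (ev lam) ?e" unfolding ev_def fv.scale_sum_left ..
  finally show ?thesis .
qed

lemma Tsum_specht:
  assumes lam: "is_partition m lam" and v: "v \<in> (specht lam :: (_ \<Rightarrow> 'a::field_char_0) set)"
  shows "Tsum m v = vsmul (ev lam) v"
proof -
  have "Tsum m v - vsmul (ev lam) v \<in> {0 :: _ \<Rightarrow> 'a}"
    by (rule flin_span[OF flin_minus[OF flin_Tsum flin_scaled[OF flin_id]] v[unfolded specht_eq] _ fv.subspace_single_0])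
      (use Tsum_polytabloid[OF lam] in auto)
  then show ?thesis by simp
qed

lemma ev_box:
  assumes "removes_box al lam" "box lam al = (r, c)"
  shows "(ev lam :: 'a::field_char_0) = of_int (2 * int c - 2 * int r + 1) + ev al"
  unfolding ev_def removes_boxD(4)[OF assms(1)] using removes_boxD(3)[OF assms(1)] assms(2) by simp

text \<open>A removable corner further right lies strictly higher, so its content is strictly
  larger; in characteristic zero the difference survives in the field.\<close>

lemma ev_down_distinct:
  assumes lam: "is_partition (Suc m) lam" and al: "al \<in> down lam" "al' \<in> down lam" "al \<noteq> al'"
  shows "(ev al :: 'a::field_char_0) \<noteq> ev al'"
proof -
  have "ev al \<noteq> (ev al' :: 'a)" if a: "al \<in> down lam" "al' \<in> down lam" "snd (box lam al) < snd (box lam al')" for al al'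
  proof
    assume e: "ev al = (ev al' :: 'a)"
    obtain r c r' c' where b: "box lam al = (r, c)" "box lam al' = (r', c')" by (metis prod.collapse)
    note rb = a(1)[unfolded in_down] and rb' = a(2)[unfolded in_down]
    have "c < c'" using a b by simp
    have "Suc r' \<le> ht lam (Suc c)" using box_corner(1)[OF rb' b(2)] ht_antimono[OF lam, of "Suc c" c'] \<open>c < c'\<close> by simp
    then have "r' < r" using box_corner(3)[OF rb b(1)] by simp
    have "of_int (2 * int c - 2 * int r + 1) = (of_int (2 * int c' - 2 * int r' + 1) :: 'a)"
      using ev_box[OF rb b(1), where 'a='a] ev_box[OF rb' b(2), where 'a='a] e by simp
    then have "2 * int c - 2 * int r + 1 = 2 * int c' - 2 * int r' + 1" by (simp only: of_int_eq_iff)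
    then show False using \<open>c < c'\<close> \<open>r' < r\<close> by simp
  qed
  from this[of al al'] this[of al' al] show ?thesis
    using down_eq_if_same_col[of al lam al'] al unfolding in_down by (metis linorder_neqE_nat)
qed

text \<open>An addable box further right lies no lower, so again the contents increase strictly from
  left to right.\<close>

lemma ev_up_distinct:
  assumes lam: "is_partition m lam" and be: "be \<in> up lam" "be' \<in> up lam" "be \<noteq> be'"
  shows "(ev be :: 'a::field_char_0) \<noteq> ev be'"
proof -
  have "ev be \<noteq> (ev be' :: 'a)" if a: "be \<in> up lam" "be' \<in> up lam" "snd (box be lam) < snd (box be' lam)" for be be'
  proof
    assume e: "ev be = (ev be' :: 'a)"
    obtain r c r' c' where b: "box be lam = (r, c)" "box be' lam = (r', c')" by (metis prod.collapse)
    note rb = a(1)[unfolded in_up] and rb' = a(2)[unfolded in_up]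
    have "c < c'" using a b by simp
    have "r' \<le> r" using box_corner(2)[OF rb b(1)] box_corner(2)[OF rb' b(2)] ht_antimono[OF lam, of c c'] \<open>c < c'\<close> by simp
    have "of_int (2 * int c - 2 * int r + 1) = (of_int (2 * int c' - 2 * int r' + 1) :: 'a)"
      using ev_box[OF rb b(1), where 'a='a] ev_box[OF rb' b(2), where 'a='a] e by simp
    then have "2 * int c - 2 * int r + 1 = 2 * int c' - 2 * int r' + 1" by (simp only: of_int_eq_iff)
    then show False using \<open>c < c'\<close> \<open>r' \<le> r\<close> by simp
  qed
  from this[of be be'] this[of be' be] show ?thesis
    using up_eq_if_same_col[of lam be be'] be unfolding in_up by (metis linorder_neqE_nat)
qed

section \<open>Restriction of Specht modules\<close>

definition corner_shape :: "nat list \<Rightarrow> nat \<Rightarrow> nat list" where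
  "corner_shape lam c = (SOME al. al \<in> down lam \<and> snd (box lam al) = c)"

lemma corner_shape: "al \<in> down lam \<Longrightarrow> corner_shape lam (snd (box lam al)) = al"
  unfolding corner_shape_def
  by (rule some_equality) (auto simp: in_down intro: down_eq_if_same_col)

text \<open>The product of the operators \<open>Tsum m - ev al\<close> over the corners left of column \<open>c\<close>.\<close>

primrec Pc :: "nat list \<Rightarrow> nat \<Rightarrow> nat \<Rightarrow> ((nat \<Rightarrow> nat) \<Rightarrow> 'a::field_char_0) \<Rightarrow> (nat \<Rightarrow> nat) \<Rightarrow> 'a" where
  "Pc lam m 0 v = v"
| "Pc lam m (Suc c) v = (if \<exists>al\<in>down lam. snd (box lam al) = c
     then Tsum m (Pc lam m c v) - vsmul (ev (corner_shape lam c)) (Pc lam m c v) else Pc lam m c v)"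

lemma flin_Pc: "flin (Pc lam m c :: (_ \<Rightarrow> 'a::field_char_0) \<Rightarrow> _)"
proof (induction c)
  case 0 show ?case using flin_id by (simp add: fun_eq_iff[symmetric] eta_contract_eq)
next
  case (Suc c)
  show ?case
  proof (cases "\<exists>al\<in>down lam. snd (box lam al) = c")
    case True
    then have eq: "Pc lam m (Suc c) = (\<lambda>v :: _ \<Rightarrow> 'a. Tsum m (Pc lam m c v) - vsmul (ev (corner_shape lam c)) (Pc lam m c v))"
      by (intro ext) simp
    show ?thesis unfolding eq by (rule flin_minus[OF flin_comp[OF flin_Tsum Suc] flin_scaled[OF Suc]])
  next
    case False
    then have eq: "Pc lam m (Suc c) = (Pc lam m c :: (_ \<Rightarrow> 'a) \<Rightarrow> _)" by (intro ext) simp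
    show ?thesis unfolding eq by (rule Suc)
  qed
qed

lemma Pc_perm_act: "\<pi> permutes {1..m} \<Longrightarrow> Pc lam m c (perm_act \<pi> v) = perm_act \<pi> (Pc lam m c v)"
  by (induction c) (simp_all add: Tsum_perm_act perm_act_lin)

lemma Vc_Tsum:
  assumes "is_partition (Suc m) lam" "v \<in> Vc lam m c" shows "Tsum m v \<in> Vc lam m c"
  unfolding Tsum_def
  by (intro fv.subspace_sum[OF Vc_subspace] Vc_perm[OF assms(1) _ assms(2)] permutes_swap_id) auto

lemma Pc_Vc: "is_partition (Suc m) lam \<Longrightarrow> v \<in> Vc lam m k \<Longrightarrow> Pc lam m c v \<in> Vc lam m k"
  by (induction c) (simp_all add: fv.subspace_diff[OF Vc_subspace] fv.subspace_scale[OF Vc_subspace] Vc_Tsum)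

text \<open>Only letters up to \<open>m\<close> are transposed, so the operator commutes with
  \<open>th\<close> and acts on the layer as it does on the Specht module of
  \<open>al\<close>.\<close>

lemma th_Tsum:
  assumes lam: "is_partition (Suc m) lam" and al: "al \<in> down lam" and b: "box lam al = (r, c)"
    and v: "v \<in> Vc lam m c"
  shows "th m r (Tsum m v) = vsmul (ev al) (th m r v :: _ \<Rightarrow> 'a::field_char_0)"
proof -
  have "th m r (Tsum m v) = Tsum m (th m r v)"
    unfolding Tsum_def flin_sum[OF flin_th]
    by (intro sum.cong refl th_perm_act permutes_swap_id) auto
  then show ?thesis using Tsum_specht[OF down_partition[OF lam al] th_Vc_specht[OF lam al b v]] by simp
qed

lemma no_corner_step:
  assumes lam: "is_partition (Suc m) lam" and "\<not> (\<exists>al\<in>down lam. snd (box lam al) = c)" and v: "v \<in> Vc lam m c"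
  shows "v \<in> Vc lam m (Suc c)"
proof -
  have "\<not> ht lam (Suc c) < ht lam c"
  proof
    assume "ht lam (Suc c) < ht lam c"
    then obtain al where "removes_box al lam" "box lam al = (ht lam c - 1, c)" by (rule corner_removable[OF lam])
    then show False using assms(2) in_down by (metis snd_conv)
  qed
  then have "ht lam (Suc c) = ht lam c" using ht_antimono[OF lam, of c "Suc c"] by simp
  from Vc_step[OF lam this] v show ?thesis by (rule subsetD)
qed

text \<open>Each factor of \<open>Pc\<close> annihilates one layer and thereby pushes the vector one
  step down the filtration.\<close>

lemma Pc_specht:
  assumes lam: "is_partition (Suc m) lam" and v: "v \<in> specht lam"
  shows "Pc lam m c v \<in> Vc lam m c"
proof (induction c)
  case 0 then show ?case using Vc_0[OF lam] v by auto
next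
  case (Suc c)
  show ?case
  proof (cases "\<exists>al\<in>down lam. snd (box lam al) = c")
    case True
    then obtain al r where al: "al \<in> down lam" and b: "box lam al = (r, c)" by (metis prod.collapse)
    have cs: "corner_shape lam c = al" using corner_shape[OF al] b by simp
    have "th m r (Tsum m (Pc lam m c v) - vsmul (ev al) (Pc lam m c v)) = 0"
      unfolding flin_diff[OF flin_th] flin_scale[OF flin_th] th_Tsum[OF lam al b Suc] by simp
    then have "Tsum m (Pc lam m c v) - vsmul (ev al) (Pc lam m c v) \<in> Vc lam m (Suc c)"
      by (intro th_ker[OF lam al b] fv.subspace_diff[OF Vc_subspace] fv.subspace_scale[OF Vc_subspace] Vc_Tsum[OF lam] Suc)
    moreover have "Pc lam m (Suc c) v = Tsum m (Pc lam m c v) - vsmul (ev al) (Pc lam m c v)" using True cs by simp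
    ultimately show ?thesis by (simp only:)
  next
    case False
    then have "Pc lam m (Suc c) v = Pc lam m c v" by simp
    then show ?thesis using no_corner_step[OF lam False Suc] by (simp only:)
  qed
qed

text \<open>The factors involved belong to corners further left. On the layer considered they act by
  differences of eigenvalues of distinct corners, which are nonzero.\<close>

lemma th_Pc:
  assumes lam: "is_partition (Suc m) lam" and al: "al \<in> down lam" and b: "box lam al = (r, c)"
  shows "k \<le> c \<Longrightarrow> \<exists>\<kappa>\<noteq>0. \<forall>v\<in>Vc lam m c. th m r (Pc lam m k v) = vsmul \<kappa> (th m r v :: _ \<Rightarrow> 'a::field_char_0)"
proof (induction k)
  case 0 show ?case by (intro exI[of _ 1]) simp
next
  case (Suc k)
  then obtain \<kappa> :: 'a where k: "\<kappa> \<noteq> 0" "\<And>v. v \<in> Vc lam m c \<Longrightarrow> th m r (Pc lam m k v) = vsmul \<kappa> (th m r v)" by auto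
  show ?case
  proof (cases "\<exists>al\<in>down lam. snd (box lam al) = k")
    case True
    then obtain al' where al': "al' \<in> down lam" "snd (box lam al') = k" by blast
    have cs: "corner_shape lam k = al'" using corner_shape[OF al'(1)] al'(2) by simp
    have "al \<noteq> al'" using al'(2) b Suc.prems by auto
    then have d: "ev al - ev al' \<noteq> (0 :: 'a)" using ev_down_distinct[OF lam al al'(1), where 'a='a] by simp
    have "th m r (Pc lam m (Suc k) v) = vsmul ((ev al - ev al') * \<kappa>) (th m r v)" if v: "v \<in> Vc lam m c" for v
    proof -
      have "th m r (Pc lam m (Suc k) v) = th m r (Tsum m (Pc lam m k v)) - vsmul (ev al') (th m r (Pc lam m k v))"
        using True cs by (simp add: flin_diff[OF flin_th] flin_scale[OF flin_th])
      also have "\<dots> = vsmul (ev al - ev al') (th m r (Pc lam m k v))"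
        unfolding th_Tsum[OF lam al b Pc_Vc[OF lam v]] fv.scale_left_diff_distrib ..
      finally show ?thesis using k(2)[OF v] by simp
    qed
    then show ?thesis using d k(1) by (metis mult_eq_0_iff)
  next
    case False
    then show ?thesis using k by auto
  qed
qed

text \<open>\<open>Pc\<close> first carries the whole Specht module into the step of the filtration
  whose layer \<open>th\<close> reads off. The result is an equivariant map on all of
  \<open>specht lam\<close>, and these maps together split the filtration.\<close>

definition psi :: "nat list \<Rightarrow> nat list \<Rightarrow> ((nat \<Rightarrow> nat) \<Rightarrow> 'a::field_char_0) \<Rightarrow> (nat \<Rightarrow> nat) \<Rightarrow> 'a" where
  "psi lam al v = th (sum_list al) (fst (box lam al)) (Pc lam (sum_list al) (snd (box lam al)) v)"

lemma flin_psi: "flin (psi lam al)"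
  unfolding psi_def[abs_def] by (rule flin_comp[OF flin_th flin_Pc])

lemma psi_perm_act: "\<pi> permutes {1..sum_list al} \<Longrightarrow> psi lam al (perm_act \<pi> v) = perm_act \<pi> (psi lam al v)"
  by (simp add: psi_def Pc_perm_act th_perm_act)

lemma psi_alt:
  assumes "is_partition (Suc m) lam" "al \<in> down lam" "box lam al = (r, c)"
  shows "psi lam al v = th m r (Pc lam m c v)"
  using is_partition_sum[OF down_partition[OF assms(1,2)]] assms(3) by (simp add: psi_def)

lemma psi_specht:
  assumes "is_partition (Suc m) lam" "al \<in> down lam" "v \<in> specht lam"
  shows "psi lam al v \<in> specht al"
proof -
  obtain r c where b: "box lam al = (r, c)" by (cases "box lam al")
  show ?thesis unfolding psi_alt[OF assms(1,2) b]
    by (rule th_Vc_specht[OF assms(1,2) b Pc_specht[OF assms(1,3)]])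
qed

lemma Vc_big: "Vc lam m (Suc (Max (snd ` cells lam))) = {0}"
  by (rule Vc_top) (simp add: le_imp_less_Suc finite_high_col)

text \<open>A vector with all projections zero descends the filtration step by step: at a corner,
  \<open>psi\<close> is a nonzero multiple of \<open>th\<close> on the current step, and the kernel
  of \<open>th\<close> is the next step.\<close>

lemma psi_inj:
  assumes lam: "is_partition (Suc m) lam" and v: "v \<in> specht lam"
    and z: "\<And>al. al \<in> down lam \<Longrightarrow> psi lam al v = 0"
  shows "v = (0 :: _ \<Rightarrow> 'a::field_char_0)"
proof -
  have "v \<in> Vc lam m c" for c
  proof (induction c)
    case 0 then show ?case using v Vc_0[OF lam, where 'a='a] by simp
  next
    case (Suc c)
    show ?case
    proof (cases "\<exists>al\<in>down lam. snd (box lam al) = c")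
      case True
      then obtain al r where al: "al \<in> down lam" and b: "box lam al = (r, c)" by (metis prod.collapse)
      obtain \<kappa> :: 'a where k: "\<kappa> \<noteq> 0" "\<forall>v\<in>Vc lam m c. th m r (Pc lam m c v) = vsmul \<kappa> (th m r v)"
        using th_Pc[OF lam al b, of c, where 'a='a] by auto
      have "vsmul \<kappa> (th m r v) = 0" using k(2) Suc z[OF al] psi_alt[OF lam al b] by metis
      then have "th m r v = 0" using k(1) by simp
      then show ?thesis by (rule th_ker[OF lam al b Suc])
    next
      case False
      then show ?thesis by (rule no_corner_step[OF lam _ Suc])
    qed
  qed
  then show ?thesis using Vc_big by blast
qed

text \<open>Downward induction along the filtration, as in solving a triangular system: one vector
  realises the component at column \<open>c\<close>, and a deeper vector corrects the components
  further right without disturbing it.\<close>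

lemma psi_surj:
  assumes lam: "is_partition (Suc m) lam"
    and w: "\<And>al. al \<in> down lam \<Longrightarrow> w al \<in> (specht al :: (_ \<Rightarrow> 'a::field_char_0) set)"
  obtains v where "v \<in> specht lam" "\<And>al. al \<in> down lam \<Longrightarrow> psi lam al v = w al"
proof -
  let ?N = "Suc (Max (snd ` cells lam))"
  have "\<forall>w. (\<forall>al\<in>down lam. w al \<in> (specht al :: (_ \<Rightarrow> 'a) set)) \<longrightarrow>
     (\<exists>v\<in>Vc lam m 0. \<forall>al\<in>down lam. 0 \<le> snd (box lam al) \<longrightarrow> psi lam al v = w al)"
  proof (rule inc_induct[of 0 ?N "\<lambda>c. \<forall>w. (\<forall>al\<in>down lam. w al \<in> (specht al :: (_ \<Rightarrow> 'a) set)) \<longrightarrow>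
     (\<exists>v\<in>Vc lam m c. \<forall>al\<in>down lam. c \<le> snd (box lam al) \<longrightarrow> psi lam al v = w al)"])
    show "\<forall>w. (\<forall>al\<in>down lam. w al \<in> (specht al :: (_ \<Rightarrow> 'a) set)) \<longrightarrow>
     (\<exists>v\<in>Vc lam m ?N. \<forall>al\<in>down lam. ?N \<le> snd (box lam al) \<longrightarrow> psi lam al v = w al)"
    proof (intro allI impI bexI[of _ 0] ballI)
      fix w :: "_ \<Rightarrow> _ \<Rightarrow> 'a" and al assume "al \<in> down lam" "?N \<le> snd (box lam al)"
      moreover have "box lam al \<in> cells lam" using removes_boxD(4) calculation(1) unfolding in_down by blast
      ultimately show "psi lam al 0 = w al" using finite_high_col by fastforce
    qed (rule fv.subspace_0[OF Vc_subspace])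
  next
    fix c assume "c < ?N" and IH: "\<forall>w. (\<forall>al\<in>down lam. w al \<in> (specht al :: (_ \<Rightarrow> 'a) set)) \<longrightarrow>
     (\<exists>v\<in>Vc lam m (Suc c). \<forall>al\<in>down lam. Suc c \<le> snd (box lam al) \<longrightarrow> psi lam al v = w al)"
    show "\<forall>w. (\<forall>al\<in>down lam. w al \<in> (specht al :: (_ \<Rightarrow> 'a) set)) \<longrightarrow>
     (\<exists>v\<in>Vc lam m c. \<forall>al\<in>down lam. c \<le> snd (box lam al) \<longrightarrow> psi lam al v = w al)"
    proof (intro allI impI)
      fix w :: "_ \<Rightarrow> _ \<Rightarrow> 'a" assume w: "\<forall>al\<in>down lam. w al \<in> specht al"
      show "\<exists>v\<in>Vc lam m c. \<forall>al\<in>down lam. c \<le> snd (box lam al) \<longrightarrow> psi lam al v = w al"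
      proof (cases "\<exists>al\<in>down lam. snd (box lam al) = c")
        case False
        obtain v where v: "v \<in> Vc lam m (Suc c)" "\<forall>al\<in>down lam. Suc c \<le> snd (box lam al) \<longrightarrow> psi lam al v = w al"
          using IH[rule_format, of w] w by metis
        have "v \<in> Vc lam m c" using v(1) Vc_mono[of c "Suc c" lam m] by (meson le_SucI order_refl subsetD)
        moreover have "psi lam al v = w al" if "al \<in> down lam" "c \<le> snd (box lam al)" for al
          using v(2) that False by (metis Suc_leI le_neq_implies_less)
        ultimately show ?thesis by metis
      next
        case True
        then obtain al0 r where al0: "al0 \<in> down lam" and b: "box lam al0 = (r, c)" by (metis prod.collapse)
        obtain \<kappa> :: 'a where k: "\<kappa> \<noteq> 0" "\<And>v. v \<in> Vc lam m c \<Longrightarrow> th m r (Pc lam m c v) = vsmul \<kappa> (th m r v)"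
          using th_Pc[OF lam al0 b, of c, where 'a='a] by auto
        \<comment> \<open>The factor \<open>inverse \<kappa>\<close> compensates the scalar that
          \<open>Pc\<close> contributes on this layer.\<close>
        have "vsmul (inverse \<kappa>) (w al0) \<in> specht al0" using w al0 fv.subspace_scale[OF specht_subspace] by metis
        then obtain v2 where v2: "v2 \<in> Vc lam m c" "th m r v2 = vsmul (inverse \<kappa>) (w al0)"
          by (rule th_surj[OF lam al0 b])
        have p2: "psi lam al0 v2 = w al0" unfolding psi_alt[OF lam al0 b] k(2)[OF v2(1)] v2(2) using k(1) by simp
        have s2: "v2 \<in> specht lam" by (rule Vc_specht[OF lam v2(1)])
        have "\<forall>al\<in>down lam. w al - psi lam al v2 \<in> specht al"
          using w psi_specht[OF lam _ s2] fv.subspace_diff[OF specht_subspace] by metis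
        then obtain v1 where v1: "v1 \<in> Vc lam m (Suc c)"
          "\<forall>al\<in>down lam. Suc c \<le> snd (box lam al) \<longrightarrow> psi lam al v1 = w al - psi lam al v2"
          using IH[rule_format, of "\<lambda>al. w al - psi lam al v2"] by metis
        have p1: "psi lam al0 v1 = 0"
          unfolding psi_alt[OF lam al0 b] by (rule th_Vc_0[OF lam al0 b Pc_Vc[OF lam v1(1)]])
        have "v1 + v2 \<in> Vc lam m c"
          using v1(1) v2(1) Vc_mono[of c "Suc c" lam m] by (meson fv.subspace_add[OF Vc_subspace] le_SucI order_refl subsetD)
        moreover have "psi lam al (v1 + v2) = w al" if a: "al \<in> down lam" "c \<le> snd (box lam al)" for al
        proof (cases "snd (box lam al) = c")
          case True
          then have "al = al0" using corner_shape[OF a(1)] corner_shape[OF al0] b by simp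
          then show ?thesis unfolding flin_add[OF flin_psi] using p1 p2 by simp
        next
          case False
          then have "psi lam al v1 = w al - psi lam al v2" using v1(2) a by simp
          then show ?thesis unfolding flin_add[OF flin_psi] by simp
        qed
        ultimately show ?thesis by metis
      qed
    qed
  qed simp
  from this[rule_format, of w] w obtain v where "v \<in> Vc lam m 0" "\<forall>al\<in>down lam. psi lam al v = w al"
    by auto
  then show thesis using that Vc_specht[OF lam] by metis
qed

section \<open>Irreducibility\<close>

lemma tableaux_nonempty: obtains T where "T \<in> tableaux lam"
proof -
  have "card (cells lam) = card {1..sum_list lam}" by (simp add: card_cells)
  then obtain T where "bij_betw T (cells lam) {1..sum_list lam}"
    using finite_same_card_bij[OF finite_cells] by blast
  then show thesis using that by (simp add: tableaux_def)
qed

lemma tableaux_transitive: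
  assumes "S \<in> tableaux lam" "T \<in> tableaux lam"
  obtains \<pi> where "\<pi> permutes {1..sum_list lam}" "\<And>p. p \<in> cells lam \<Longrightarrow> (\<pi> \<circ> T) p = S p"
proof -
  define \<pi> where "\<pi> i = (if i \<in> {1..sum_list lam} then S (pos lam T i) else i)" for i
  have b: "bij_betw (S \<circ> inv_into (cells lam) T) {1..sum_list lam} {1..sum_list lam}"
    using assms by (auto simp: tableaux_def intro: bij_betw_trans bij_betw_inv_into)
  have "bij_betw \<pi> {1..sum_list lam} {1..sum_list lam}"
    by (rule bij_betw_cong[THEN iffD1, OF _ b]) (simp add: \<pi>_def pos_def)
  then have "\<pi> permutes {1..sum_list lam}"
    by (rule bij_imp_permutes) (auto simp: \<pi>_def)
  moreover have "(\<pi> \<circ> T) p = S p" if "p \<in> cells lam" for p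
    using tableaux_in[OF assms(2) that] pos_T[OF assms(2) that] by (simp add: \<pi>_def)
  ultimately show thesis by (rule that)
qed

text \<open>The symmetric group is transitive on the tableaux of a shape; hence any single
  polytabloid generates the Specht module.\<close>

lemma polytabloid_orbit:
  assumes "S \<in> tableaux lam" "T \<in> tableaux lam"
  obtains \<pi> where "\<pi> permutes {1..sum_list lam}" "polytabloid lam S = perm_act \<pi> (polytabloid lam T :: _ \<Rightarrow> 'a::field_char_0)"
proof -
  obtain \<pi> where p: "\<pi> permutes {1..sum_list lam}" "\<And>p. p \<in> cells lam \<Longrightarrow> (\<pi> \<circ> T) p = S p"
    using tableaux_transitive[OF assms] by blast
  have "polytabloid lam S = (polytabloid lam (\<pi> \<circ> T) :: _ \<Rightarrow> 'a)"
    by (rule polytabloid_cong[OF assms(1) tableaux_comp[OF assms(2) p(1)]]) (use p(2) in auto)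
  then show thesis using that[OF p(1)] perm_act_polytabloid[OF assms(2) p(1), where 'a='a] by simp
qed

lemma polytabloid_nonzero:
  assumes "is_partition m lam" obtains T where "T \<in> tableaux lam" "polytabloid lam T \<noteq> (0 :: _ \<Rightarrow> 'a::field_char_0)"
proof -
  obtain T where T: "T \<in> std m lam" using std_nonempty[OF assms] by blast
  have "polytabloid lam T \<noteq> (0 :: _ \<Rightarrow> 'a)"
  proof
    assume z: "polytabloid lam T = (0 :: _ \<Rightarrow> 'a)"
    have "vsmul (if S = T then 1 else 0) (polytabloid lam S) = (0 :: _ \<Rightarrow> 'a)" for S using z by simp
    then have "(\<Sum>S\<in>std m lam. vsmul (if S = T then 1 else 0) (polytabloid lam S)) = (0 :: _ \<Rightarrow> 'a)"
      by (intro sum.neutral ballI)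
    from std_indep[OF assms this T] show False by simp
  qed
  then show thesis using that std_tableaux[OF assms T] by blast
qed

text \<open>All conditions are imposed on \<open>specht lam\<close> only: the map transported to the
  smaller shape in the induction is defined by a choice and is controlled nowhere else.\<close>

definition specht_end :: "nat \<Rightarrow> nat list \<Rightarrow> (((nat \<Rightarrow> nat) \<Rightarrow> 'a::field_char_0) \<Rightarrow> ((nat \<Rightarrow> nat) \<Rightarrow> 'a)) \<Rightarrow> bool" where
  "specht_end m lam f \<longleftrightarrow> (\<forall>v\<in>specht lam. f v \<in> specht lam)
    \<and> (\<forall>u\<in>specht lam. \<forall>v\<in>specht lam. f (u + v) = f u + f v)
    \<and> (\<forall>c. \<forall>v\<in>specht lam. f (vsmul c v) = vsmul c (f v))
    \<and> (\<forall>\<pi>. \<forall>v\<in>specht lam. \<pi> permutes {1..m} \<longrightarrow> f (perm_act \<pi> v) = perm_act \<pi> (f v))"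

text \<open>An endomorphism preserves the eigenspace of \<open>Tsum\<close> belonging to the last corner, a copy of a
  smaller Specht module, and this eigenspace generates the whole module.\<close>

lemma specht_endomorphism_scalar:
  fixes f :: "((nat \<Rightarrow> nat) \<Rightarrow> 'a::field_char_0) \<Rightarrow> ((nat \<Rightarrow> nat) \<Rightarrow> 'a)"
  shows "is_partition m lam \<Longrightarrow> specht_end m lam f \<Longrightarrow> \<exists>a. \<forall>v\<in>specht lam. f v = vsmul a v"
proof (induction m arbitrary: lam f)
  case 0
  then have lam: "lam = []" by (simp add: is_partition_0)
  have all: "T \<in> tableaux lam" for T by (simp add: lam tableaux_def bij_betw_def)
  define e :: "(nat \<Rightarrow> nat) \<Rightarrow> 'a" where "e = polytabloid lam (\<lambda>_. 0)"
  have "polytabloid lam T = e" for T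
    unfolding e_def by (rule polytabloid_cong[OF all all]) (simp add: lam)
  then have "polytabloid lam ` tableaux lam = {e}" using all by auto
  then have sp: "specht lam = {vsmul k e | k. True}"
    unfolding specht_eq by (auto simp: fv.span_singleton)
  have "e \<in> specht lam" unfolding e_def by (rule polytabloid_specht[OF all])
  then have "f e \<in> specht lam" using 0(2) unfolding specht_end_def by blast
  then obtain a where a: "f e = vsmul a e" using sp by auto
  have "f v = vsmul a v" if v: "v \<in> specht lam" for v
  proof -
    obtain k where "v = vsmul k e" using v sp by auto
    moreover have "f (vsmul k e) = vsmul k (f e)"
      using 0(2) \<open>e \<in> specht lam\<close> unfolding specht_end_def by blast
    ultimately show ?thesis using a by (simp add: mult.commute)
  qed
  then show ?case by blast
next
  case (Suc m)
  note lam = Suc.prems(1) and E = Suc.prems(2)[unfolded specht_end_def]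
  note fS = E[THEN conjunct1, rule_format] and fadd = E[THEN conjunct2, THEN conjunct1, rule_format]
    and fsc = E[THEN conjunct2, THEN conjunct2, THEN conjunct1, rule_format]
  have fp: "f (perm_act \<pi> v) = perm_act \<pi> (f v)" if "\<pi> permutes {1..Suc m}" "v \<in> specht lam" for \<pi> v
    using E that by blast
  let ?S = "specht lam :: (_ \<Rightarrow> 'a) set"
  have s: "sum_list lam = Suc m" by (rule is_partition_sum[OF lam])
  note sub = specht_subspace[of lam, where 'a='a]
  let ?c = "Max (snd ` cells lam)"
  have ne: "cells lam \<noteq> {}" using card_cells[of lam] s by auto
  \<comment> \<open>The last nonempty column is followed by an empty one and therefore ends in a
    corner. Its step of the filtration is the last nonzero one, so \<open>th\<close> is injective on
    it.\<close>
  have "\<exists>al\<in>down lam. snd (box lam al) = ?c"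
  proof (rule ccontr)
    assume n: "\<not> ?thesis"
    have "?c \<in> snd ` cells lam" by (rule Max_in) (use ne in auto)
    then obtain r where "(r, ?c) \<in> cells lam" by force
    then have "0 < ht lam ?c" using in_cells_ht[OF lam, of r ?c] by simp
    moreover have "ht lam (Suc ?c) = 0"
    proof (rule ccontr)
      assume "ht lam (Suc ?c) \<noteq> 0"
      then have "(0, Suc ?c) \<in> cells lam" using in_cells_ht[OF lam] by simp
      from finite_high_col[OF this] show False by simp
    qed
    ultimately have "ht lam (Suc ?c) < ht lam ?c" by simp
    then obtain al where "removes_box al lam" "box lam al = (ht lam ?c - 1, ?c)" by (rule corner_removable[OF lam])
    then show False using n in_down by (metis snd_conv)
  qed
  then obtain al r where al: "al \<in> down lam" and b: "box lam al = (r, ?c)" by (metis prod.collapse)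
  let ?E = "Vc lam m ?c :: (_ \<Rightarrow> 'a) set"
  have ES: "v \<in> ?S" if "v \<in> ?E" for v by (rule Vc_specht[OF lam that])
  have thinj: "u = v" if "u \<in> ?E" "v \<in> ?E" "th m r u = th m r v" for u v
  proof -
    have "th m r (u - v) = 0" using that(3) flin_diff[OF flin_th, of m r u v] by simp
    then have "u - v \<in> Vc lam m (Suc ?c)" by (rule th_ker[OF lam al b fv.subspace_diff[OF Vc_subspace that(1,2)]])
    then show ?thesis using Vc_big[of lam m, where 'a='a] by simp
  qed
  have eig: "Tsum m v = vsmul (ev al) v" if v: "v \<in> ?E" for v
  proof (rule thinj[OF Vc_Tsum[OF lam v] fv.subspace_scale[OF Vc_subspace v]])
    show "th m r (Tsum m v) = th m r (vsmul (ev al) v)"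
      unfolding th_Tsum[OF lam al b v] flin_scale[OF flin_th] ..
  qed
  \<comment> \<open>Conversely, an eigenvector for this scalar has no component in an earlier layer,
    where \<open>Tsum\<close> acts by a different one.\<close>
  have eigE: "v \<in> ?E" if v: "v \<in> ?S" "Tsum m v = vsmul (ev al) v" for v
  proof -
    have "k \<le> ?c \<Longrightarrow> v \<in> Vc lam m k" for k
    proof (induction k)
      case 0 then show ?case using v(1) Vc_0[OF lam, where 'a='a] by simp
    next
      case (Suc k)
      then have vk: "v \<in> Vc lam m k" by simp
      show ?case
      proof (cases "\<exists>al\<in>down lam. snd (box lam al) = k")
        case True
        then obtain al' r' where al': "al' \<in> down lam" and b': "box lam al' = (r', k)" by (metis prod.collapse)
        have "al \<noteq> al'" using b b' Suc.prems by auto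
        then have d: "ev al - ev al' \<noteq> (0 :: 'a)" using ev_down_distinct[OF lam al al', where 'a='a] by simp
        have "vsmul (ev al') (th m r' v) = vsmul (ev al) (th m r' v)"
          unfolding th_Tsum[OF lam al' b' vk, symmetric] v(2) by (rule flin_scale[OF flin_th])
        from this[symmetric] have "vsmul (ev al - ev al') (th m r' v) = 0"
          by (simp only: fv.scale_left_diff_distrib right_minus_eq)
        then have "th m r' v = 0" using d by simp
        then show ?thesis by (rule th_ker[OF lam al' b' vk])
      next
        case False
        then show ?thesis by (rule no_corner_step[OF lam _ vk])
      qed
    qed
    then show ?thesis by simp
  qed
  have f0: "f 0 = 0" using fsc[OF fv.subspace_0[OF sub], of 0] by simp
  have fsum: "f (sum g A) = (\<Sum>i\<in>A. f (g i))" if "\<And>i. i \<in> A \<Longrightarrow> g i \<in> ?S" for g :: "nat \<Rightarrow> _" and A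
    using that
  proof (induction A rule: infinite_finite_induct)
    case (insert i A)
    have "sum g A \<in> ?S" by (rule fv.subspace_sum[OF sub]) (use insert.prems in blast)
    then have 1: "f (g i + sum g A) = f (g i) + f (sum g A)" using fadd insert.prems by blast
    have 2: "f (sum g A) = (\<Sum>i\<in>A. f (g i))" using insert.IH insert.prems by blast
    show ?case unfolding sum.insert[OF insert(1,2)] 1 2 ..
  qed (simp_all add: f0)
  have pS: "perm_act \<pi> v \<in> ?S" if "\<pi> permutes {1..Suc m}" "v \<in> ?S" for \<pi> v
    using perm_act_specht[of \<pi> lam v] that s by simp
  have fE: "f v \<in> ?E" if v: "v \<in> ?E" for v
  proof (rule eigE[OF fS[OF ES[OF v]]])
    have tr: "transpose i j permutes {1..Suc m}" "transpose i j permutes {1..m}" if "i \<in> {1..m}" "j \<in> {1..m}" for i j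
      using that by (auto intro: permutes_swap_id)
    have i1: "perm_act (transpose i j) v \<in> ?S" if "i \<in> {1..m}" "j \<in> {1..m}" for i j
      by (rule pS[OF tr(1)[OF that] ES[OF v]])
    have "Tsum m (f v) = (\<Sum>i\<in>{1..m}. \<Sum>j\<in>{1..m}. f (perm_act (transpose i j) v))"
      unfolding Tsum_def by (intro sum.cong refl fp[symmetric] tr(1) ES[OF v])
    also have "\<dots> = (\<Sum>i\<in>{1..m}. f (\<Sum>j\<in>{1..m}. perm_act (transpose i j) v))"
      by (rule sum.cong[OF refl]) (rule fsum[symmetric], rule i1)
    also have "\<dots> = f (Tsum m v)"
      unfolding Tsum_def by (rule fsum[symmetric]) (intro fv.subspace_sum[OF sub] i1)
    also have "\<dots> = vsmul (ev al) (f v)" unfolding eig[OF v] by (rule fsc[OF ES[OF v]])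
    finally show "Tsum m (f v) = vsmul (ev al) (f v)" .
  qed
  \<comment> \<open>An inverse of \<open>th\<close> on the last step, through which \<open>f\<close>
    becomes an endomorphism of the smaller Specht module.\<close>
  define g where "g w = (SOME v. v \<in> ?E \<and> th m r v = w)" for w
  have g: "g w \<in> ?E" "th m r (g w) = w" if "w \<in> specht al" for w
  proof -
    have "\<exists>v. v \<in> ?E \<and> th m r v = w" using th_surj[OF lam al b that] by metis
    from someI_ex[OF this] show "g w \<in> ?E" "th m r (g w) = w" unfolding g_def by auto
  qed
  have gth: "g (th m r v) = v" if "v \<in> ?E" for v
    by (rule thinj[OF g(1) that g(2)]) (rule th_Vc_specht[OF lam al b that])+
  note subE = Vc_subspace[of lam m ?c, where 'a='a]
  note suba = specht_subspace[of al, where 'a='a]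
  have "\<exists>a. \<forall>w\<in>specht al. th m r (f (g w)) = vsmul a w"
  proof (rule Suc.IH[OF down_partition[OF lam al]], unfold specht_end_def, intro conjI ballI allI impI)
    show "th m r (f (g v)) \<in> specht al" if "v \<in> specht al" for v
      by (rule th_Vc_specht[OF lam al b fE[OF g(1)[OF that]]])
  next
    fix u v :: "_ \<Rightarrow> 'a" assume uv: "u \<in> specht al" "v \<in> specht al"
    have "g (u + v) = g u + g v"
      by (rule thinj[OF g(1)[OF fv.subspace_add[OF suba uv]] fv.subspace_add[OF subE g(1)[OF uv(1)] g(1)[OF uv(2)]]])
        (simp only: g(2)[OF fv.subspace_add[OF suba uv]] flin_add[OF flin_th] g(2)[OF uv(1)] g(2)[OF uv(2)])
    then show "th m r (f (g (u + v))) = th m r (f (g u)) + th m r (f (g v))"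
      by (simp only: fadd[OF ES[OF g(1)[OF uv(1)]] ES[OF g(1)[OF uv(2)]]] flin_add[OF flin_th])
  next
    fix c and v :: "_ \<Rightarrow> 'a" assume v: "v \<in> specht al"
    have "g (vsmul c v) = vsmul c (g v)"
      by (rule thinj[OF g(1)[OF fv.subspace_scale[OF suba v]] fv.subspace_scale[OF subE g(1)[OF v]]])
        (simp only: g(2)[OF fv.subspace_scale[OF suba v]] flin_scale[OF flin_th] g(2)[OF v])
    then show "th m r (f (g (vsmul c v))) = vsmul c (th m r (f (g v)))"
      by (simp only: fsc[OF ES[OF g(1)[OF v]]] flin_scale[OF flin_th])
  next
    fix \<pi> and v :: "_ \<Rightarrow> 'a" assume p: "\<pi> permutes {1..m}" and v: "v \<in> specht al"
    have "perm_act \<pi> v \<in> specht al"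
      using perm_act_specht[of \<pi> al v] p v is_partition_sum[OF down_partition[OF lam al]] by simp
    note g' = g[OF this]
    have "g (perm_act \<pi> v) = perm_act \<pi> (g v)"
      by (rule thinj[OF g'(1) Vc_perm[OF lam p g(1)[OF v]]]) (simp only: g'(2) th_perm_act[OF p] g(2)[OF v])
    then show "th m r (f (g (perm_act \<pi> v))) = perm_act \<pi> (th m r (f (g v)))"
      by (simp only: fp[OF permutes_Suc[OF p] ES[OF g(1)[OF v]]] th_perm_act[OF p])
  qed
  then obtain a where a: "\<And>w. w \<in> specht al \<Longrightarrow> th m r (f (g w)) = vsmul a w" by blast
  have fa: "f v = vsmul a v" if v: "v \<in> ?E" for v
  proof (rule thinj[OF fE[OF v] fv.subspace_scale[OF subE v]])
    show "th m r (f v) = th m r (vsmul a v)"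
      using a[OF th_Vc_specht[OF lam al b v]] gth[OF v] by (simp only: flin_scale[OF flin_th])
  qed
  obtain T0 where "T0 \<in> tableaux al" by (rule tableaux_nonempty)
  then have T: "T0(box lam al := Suc m) \<in> tableaux lam" (is "?T \<in> _") by (rule tableaux_extend[OF lam al])
  have "box lam al \<in> cells lam" using removes_boxD(4)[OF al[unfolded in_down]] by auto
  then have "polytabloid lam ?T \<in> high lam (Suc m) (polytabloid lam :: _ \<Rightarrow> _ \<Rightarrow> 'a) ?c"
    by (rule highI[OF T]) (simp_all add: b)
  then have eT: "polytabloid lam ?T \<in> ?E" unfolding Vc_def by (rule fv.span_base)
  \<comment> \<open>One polytabloid in the last step is an eigenvector of \<open>f\<close>, and all
    other polytabloids are its translates.\<close>
  have fe: "f (polytabloid lam S) = vsmul a (polytabloid lam S)" if S: "S \<in> tableaux lam" for S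
  proof -
    obtain \<pi> where p: "\<pi> permutes {1..sum_list lam}" "polytabloid lam S = perm_act \<pi> (polytabloid lam ?T :: _ \<Rightarrow> 'a)"
      by (rule polytabloid_orbit[OF S T, where 'a='a])
    show ?thesis unfolding p(2) using fp[OF p(1)[unfolded s] ES[OF eT]] fa[OF eT] by (simp only: perm_act_lin)
  qed
  have "v \<in> {v \<in> ?S. f v = vsmul a v}" if v: "v \<in> ?S" for v
  proof -
    have "fv.subspace {v \<in> ?S. f v = vsmul a v}"
      unfolding fv.subspace_def using fv.subspace_0[OF sub] f0 fv.subspace_add[OF sub] fv.subspace_scale[OF sub] fadd fsc
      by (auto simp: fv.scale_right_distrib mult.commute)
    then have "fv.span (polytabloid lam ` tableaux lam) \<subseteq> {v \<in> ?S. f v = vsmul a v}"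
      by (intro fv.span_minimal) (use fe polytabloid_specht in auto)
    then show ?thesis using v unfolding specht_eq by blast
  qed
  then show ?case by blast
qed

text \<open>Averaging a linear projection onto \<open>W\<close> over the group gives an endomorphism
  with values in \<open>W\<close>, hence a scalar. On \<open>w\<close> it is multiplication by the
  order of the group, so the scalar is nonzero and every vector of the Specht module lies in
  \<open>W\<close>.\<close>

lemma specht_irreducible:
  fixes W :: "((nat \<Rightarrow> nat) \<Rightarrow> 'a::field_char_0) set"
  assumes lam: "is_partition m lam" and W: "fv.subspace W" "W \<subseteq> specht lam" "w \<in> W" "w \<noteq> 0"
    and inv: "\<And>\<pi> v. \<pi> permutes {1..m} \<Longrightarrow> v \<in> W \<Longrightarrow> perm_act \<pi> v \<in> W"
  shows "W = specht lam"
proof -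
  have s: "sum_list lam = m" by (rule is_partition_sum[OF lam])
  \<comment> \<open>Some linear projection onto \<open>W\<close>; equivariance is only produced by
    the averaging.\<close>
  obtain g :: "((nat \<Rightarrow> nat) \<Rightarrow> 'a) \<Rightarrow> _" where g: "g ` UNIV \<subseteq> W" "flin g" "\<forall>v\<in>W. g v = v"
    using fp.linear_exists_left_inverse_on[OF flin_id W(1)] by auto
  let ?P = "{\<pi>. \<pi> permutes {1..m}}"
  define f where "f v = (\<Sum>\<pi>\<in>?P. perm_act \<pi> (g (perm_act (inv \<pi>) v)))" for v
  have flin: "flin f"
    unfolding f_def[abs_def] by (intro flin_sum_fun flin_comp[OF flin_perm_act] flin_comp[OF g(2)] flin_perm_act)
  have fW: "f v \<in> W" for v
    unfolding f_def
  proof (rule fv.subspace_sum[OF W(1)])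
    fix \<pi> assume "\<pi> \<in> ?P"
    then show "perm_act \<pi> (g (perm_act (inv \<pi>) v)) \<in> W" by (intro inv) (use g(1) in auto)
  qed
  have eq: "f (perm_act \<rho> v) = perm_act \<rho> (f v)" if r: "\<rho> permutes {1..m}" for \<rho> v
  proof -
    have "f (perm_act \<rho> v) = (\<Sum>\<pi>\<in>?P. perm_act (\<rho> \<circ> \<pi>) (g (perm_act (inv (\<rho> \<circ> \<pi>)) (perm_act \<rho> v))))"
      unfolding f_def by (rule setum_permutations_compose_left[OF r])
    also have "\<dots> = (\<Sum>\<pi>\<in>?P. perm_act \<rho> (perm_act \<pi> (g (perm_act (inv \<pi>) v))))"
    proof (rule sum.cong[OF refl])
      fix \<pi> assume "\<pi> \<in> ?P"
      then have p: "\<pi> permutes {1..m}" by simp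
      have "inv (\<rho> \<circ> \<pi>) \<circ> \<rho> = inv \<pi>"
        using permutes_inv_o[OF r] o_inv_distrib[OF permutes_bij[OF r] permutes_bij[OF p]] by (simp add: comp_assoc)
      then show "perm_act (\<rho> \<circ> \<pi>) (g (perm_act (inv (\<rho> \<circ> \<pi>)) (perm_act \<rho> v))) = perm_act \<rho> (perm_act \<pi> (g (perm_act (inv \<pi>) v)))"
        by (simp only: perm_act_comp)
    qed
    also have "\<dots> = perm_act \<rho> (f v)" unfolding f_def perm_act_lin ..
    finally show ?thesis .
  qed
  have "\<exists>a. \<forall>v\<in>specht lam. f v = vsmul a v"
  proof (rule specht_endomorphism_scalar[OF lam], unfold specht_end_def, intro conjI ballI allI impI)
    show "f v \<in> specht lam" for v using fW W(2) by blast
  qed (rule flin_add[OF flin] flin_scale[OF flin] eq, assumption?)+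
  then obtain a where a: "\<And>v. v \<in> specht lam \<Longrightarrow> f v = vsmul a v" by blast
  have "f w = (\<Sum>\<pi>\<in>?P. w)"
    unfolding f_def
  proof (rule sum.cong[OF refl])
    fix \<pi> assume "\<pi> \<in> ?P"
    then have p: "\<pi> permutes {1..m}" by simp
    have "g (perm_act (inv \<pi>) w) = perm_act (inv \<pi>) w" using g(3) inv[OF permutes_inv[OF p] W(3)] by simp
    then show "perm_act \<pi> (g (perm_act (inv \<pi>) w)) = w" using perm_act_inv(2)[OF p] by simp
  qed
  then have "vsmul a w = vsmul (of_nat (card ?P)) w"
    using a[OF subsetD[OF W(2,3)]] unfolding fv_sum_const by simp
  then have "a = of_nat (card ?P)" using W(4) by simp
  moreover have "card ?P \<noteq> 0" using card_permutations[OF refl, of "{1..m}"] by simp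
  ultimately have "a \<noteq> 0" by simp
  have "v \<in> W" if "v \<in> specht lam" for v
    using fv_scale_cancel[OF W(1) _ \<open>a \<noteq> 0\<close>, of v] fW[of v] a[OF that] by simp
  then show ?thesis using W(2) by blast
qed

section \<open>Induction of Specht modules\<close>

text \<open>The relation holds for every \<open>\<tau>\<close>, in particular after composing
  \<open>\<tau>\<close> with transpositions, so \<open>Tsum (Suc m)\<close> may be applied to each
  \<open>w be\<close>, where it acts by distinct scalars. Subtracting \<open>ev b0\<close> times the
  original relation removes one summand.\<close>

lemma psi_separate:
  fixes w :: "nat list \<Rightarrow> (nat \<Rightarrow> nat) \<Rightarrow> 'a::field_char_0"
  assumes lam: "is_partition m lam"
  shows "finite J \<Longrightarrow> J \<subseteq> up lam \<Longrightarrow> \<forall>be\<in>J. w be \<in> specht be \<Longrightarrow>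
    \<forall>\<tau>. \<tau> permutes {1..Suc m} \<longrightarrow> (\<Sum>be\<in>J. psi be lam (perm_act \<tau> (w be))) = 0 \<Longrightarrow>
    \<forall>be\<in>J. \<forall>\<tau>. \<tau> permutes {1..Suc m} \<longrightarrow> psi be lam (perm_act \<tau> (w be)) = 0"
proof (induction J arbitrary: w rule: finite_induct)
  case (insert b0 J)
  note sums = insert.prems(3)[rule_format]
  have TS: "Tsum (Suc m) (w be) = vsmul (ev be) (w be)" if "be \<in> insert b0 J" for be
    using Tsum_specht[OF up_partition[OF lam, of be], of "w be"] insert.prems(1,2) that by blast
  have ts: "(\<Sum>be\<in>insert b0 J. vsmul (ev be) (psi be lam (perm_act \<tau> (w be)))) = 0" if t: "\<tau> permutes {1..Suc m}" for \<tau>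
  proof -
    have "(\<Sum>be\<in>insert b0 J. vsmul (ev be) (psi be lam (perm_act \<tau> (w be))))
        = (\<Sum>be\<in>insert b0 J. psi be lam (perm_act \<tau> (Tsum (Suc m) (w be))))"
      by (rule sum.cong[OF refl]) (simp only: TS perm_act_lin flin_scale[OF flin_psi])
    also have "\<dots> = (\<Sum>be\<in>insert b0 J. \<Sum>i\<in>{1..Suc m}. \<Sum>j\<in>{1..Suc m}. psi be lam (perm_act (\<tau> \<circ> transpose i j) (w be)))"
      unfolding Tsum_def perm_act_lin flin_sum[OF flin_psi] perm_act_comp ..
    also have "\<dots> = (\<Sum>i\<in>{1..Suc m}. \<Sum>be\<in>insert b0 J. \<Sum>j\<in>{1..Suc m}. psi be lam (perm_act (\<tau> \<circ> transpose i j) (w be)))"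
      by (rule sum.swap)
    also have "\<dots> = (\<Sum>i\<in>{1..Suc m}. \<Sum>j\<in>{1..Suc m}. \<Sum>be\<in>insert b0 J. psi be lam (perm_act (\<tau> \<circ> transpose i j) (w be)))"
      by (rule sum.cong[OF refl]) (rule sum.swap)
    also have "\<dots> = 0"
      by (intro sum.neutral ballI sums permutes_compose[OF permutes_swap_id t])
    finally show ?thesis .
  qed
  have "\<forall>be\<in>J. \<forall>\<tau>. \<tau> permutes {1..Suc m} \<longrightarrow> psi be lam (perm_act \<tau> (vsmul (ev be - ev b0) (w be))) = 0"
  proof (rule insert.IH)
    show "J \<subseteq> up lam" using insert.prems(1) by blast
    show "\<forall>be\<in>J. vsmul (ev be - ev b0) (w be) \<in> specht be"
      by (intro ballI fv.subspace_scale[OF specht_subspace]) (use insert.prems(2) in blast)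
    show "\<forall>\<tau>. \<tau> permutes {1..Suc m} \<longrightarrow> (\<Sum>be\<in>J. psi be lam (perm_act \<tau> (vsmul (ev be - ev b0) (w be)))) = 0"
    proof (intro allI impI)
      fix \<tau> assume t: "\<tau> permutes {1..Suc m}"
      let ?g = "\<lambda>be. psi be lam (perm_act \<tau> (w be))"
      have "(\<Sum>be\<in>J. psi be lam (perm_act \<tau> (vsmul (ev be - ev b0) (w be)))) = (\<Sum>be\<in>J. vsmul (ev be - ev b0) (?g be))"
        unfolding perm_act_lin flin_scale[OF flin_psi] ..
      also have "\<dots> = (\<Sum>be\<in>insert b0 J. vsmul (ev be - ev b0) (?g be))"
        using insert(1,2) by (simp add: sum.insert[OF insert(1,2)])
      also have "\<dots> = (\<Sum>be\<in>insert b0 J. vsmul (ev be) (?g be)) - vsmul (ev b0) (\<Sum>be\<in>insert b0 J. ?g be)"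
        unfolding fv.scale_left_diff_distrib sum_subtractf fv.scale_sum_right ..
      also have "\<dots> = 0" unfolding ts[OF t] sums[OF t] by simp
      finally show "(\<Sum>be\<in>J. psi be lam (perm_act \<tau> (vsmul (ev be - ev b0) (w be)))) = 0" .
    qed
  qed
  then have J: "psi be lam (perm_act \<tau> (w be)) = 0" if be: "be \<in> J" and t: "\<tau> permutes {1..Suc m}" for be \<tau>
  proof -
    have "vsmul (ev be - ev b0) (psi be lam (perm_act \<tau> (w be))) = 0"
      using \<open>\<forall>be\<in>J. _\<close> be t unfolding perm_act_lin flin_scale[OF flin_psi] by blast
    moreover have "be \<noteq> b0" using be insert(2) by auto
    then have "ev be - ev b0 \<noteq> (0 :: 'a)" using ev_up_distinct[OF lam, of be b0, where 'a='a] be insert.prems(1) by auto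
    ultimately show ?thesis by simp
  qed
  moreover have "psi b0 lam (perm_act \<tau> (w b0)) = 0" if t: "\<tau> permutes {1..Suc m}" for \<tau>
  proof -
    have "(\<Sum>be\<in>J. psi be lam (perm_act \<tau> (w be))) = 0" using J t by (intro sum.neutral) blast
    then show ?thesis using sums[OF t] unfolding sum.insert[OF insert(1,2)] by simp
  qed
  ultimately show ?case by blast
qed simp

text \<open>The vectors killed for every \<open>\<tau>\<close> form a submodule. If it contained a
  nonzero vector it would be the whole Specht module by irreducibility, but \<open>psi\<close> is
  onto a nonzero module.\<close>

lemma psi_faithful:
  assumes lam: "is_partition m lam" and be: "be \<in> up lam" and w: "w \<in> specht be"
    and z: "\<And>\<tau>. \<tau> permutes {1..Suc m} \<Longrightarrow> psi be lam (perm_act \<tau> w) = 0"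
  shows "w = (0 :: _ \<Rightarrow> 'a::field_char_0)"
proof (rule ccontr)
  assume ne: "w \<noteq> 0"
  have pbe: "is_partition (Suc m) be" by (rule up_partition[OF lam be])
  have down: "lam \<in> down be" using be by (simp add: in_up in_down)
  have s: "sum_list be = Suc m" by (rule is_partition_sum[OF pbe])
  define W where "W = {v \<in> specht be. \<forall>\<tau>. \<tau> permutes {1..Suc m} \<longrightarrow> psi be lam (perm_act \<tau> v) = (0 :: _ \<Rightarrow> 'a)}"
  have "W = specht be"
  proof (rule specht_irreducible[OF pbe, of W w])
    show "fv.subspace W"
      unfolding W_def fv.subspace_def
      using fv.subspace_0[OF specht_subspace] fv.subspace_add[OF specht_subspace] fv.subspace_scale[OF specht_subspace]
      by (auto simp: perm_act_lin flin_0[OF flin_psi] flin_add[OF flin_psi] flin_scale[OF flin_psi])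
    show "W \<subseteq> specht be" "w \<in> W" "w \<noteq> 0" using w z ne by (auto simp: W_def)
    fix \<pi> v assume p: "\<pi> permutes {1..Suc m}" and v: "v \<in> W"
    have "perm_act \<pi> v \<in> specht be" using perm_act_specht[of \<pi> be v] p v s by (simp add: W_def)
    moreover have "psi be lam (perm_act \<tau> (perm_act \<pi> v)) = 0" if t: "\<tau> permutes {1..Suc m}" for \<tau>
      unfolding perm_act_comp using v permutes_compose[OF p t] by (simp add: W_def)
    ultimately show "perm_act \<pi> v \<in> W" by (simp add: W_def)
  qed
  then have zero: "psi be lam v = 0" if "v \<in> specht be" for v :: "_ \<Rightarrow> 'a"
    using that permutes_id[of "{1..Suc m}"] unfolding W_def by (metis (mono_tags, lifting) mem_Collect_eq perm_act_id)
  obtain T where T: "T \<in> tableaux lam" "polytabloid lam T \<noteq> (0 :: _ \<Rightarrow> 'a)" by (rule polytabloid_nonzero[OF lam])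
  define u :: "nat list \<Rightarrow> (nat \<Rightarrow> nat) \<Rightarrow> 'a" where "u al = (if al = lam then polytabloid lam T else 0)" for al
  have "u al \<in> specht al" for al
    by (simp add: u_def polytabloid_specht[OF T(1)] fv.subspace_0[OF specht_subspace])
  then obtain v where v: "v \<in> specht be" "\<And>al. al \<in> down be \<Longrightarrow> psi be al v = u al"
    using psi_surj[OF pbe, of u] by metis
  then have "polytabloid lam T = (0 :: _ \<Rightarrow> 'a)" using zero[OF v(1)] v(2)[OF down] by (simp add: u_def)
  then show False using T(2) by simp
qed

text \<open>One half of the induction rule, read through Frobenius reciprocity: a vector
  \<open>w\<close> of a larger Specht module becomes the function
  \<open>\<tau> \<mapsto> psi be lam (perm_act \<tau> w)\<close> in the induced module, and the sum
  of these maps is injective.\<close>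

lemma psi_ind_inj:
  fixes w :: "nat list \<Rightarrow> (nat \<Rightarrow> nat) \<Rightarrow> 'a::field_char_0"
  assumes lam: "is_partition m lam" and w: "\<And>be. be \<in> up lam \<Longrightarrow> w be \<in> specht be"
    and z: "\<And>\<tau>. \<tau> permutes {1..Suc m} \<Longrightarrow> (\<Sum>be\<in>up lam. psi be lam (perm_act \<tau> (w be))) = 0"
    and be: "be \<in> up lam"
  shows "w be = 0"
proof -
  have "\<forall>be\<in>up lam. \<forall>\<tau>. \<tau> permutes {1..Suc m} \<longrightarrow> psi be lam (perm_act \<tau> (w be)) = 0"
    by (rule psi_separate[OF lam finite_up[OF lam] subset_refl]) (use w z in blast)+
  then show ?thesis using psi_faithful[OF lam be w[OF be]] be by blast
qed

section \<open>Surjectivity onto the induced module by counting dimensions\<close>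

lemma family_spans:
  fixes z :: "'j \<Rightarrow> 'b \<Rightarrow> 'a::field"
  assumes fin: "finite J" "finite G" and ind: "\<And>c j. (\<Sum>j\<in>J. vsmul (c j) (z j)) = 0 \<Longrightarrow> j \<in> J \<Longrightarrow> c j = 0"
    and sub: "z ` J \<subseteq> fv.span G" and card: "card G \<le> card J"
    and y: "y \<in> fv.span G"
  obtains c where "y = (\<Sum>j\<in>J. vsmul (c j) (z j))"
proof -
  have inj: "inj_on z J"
  proof (rule inj_onI, rule ccontr)
    fix i j assume ij: "i \<in> J" "j \<in> J" "z i = z j" "i \<noteq> j"
    define c :: "_ \<Rightarrow> 'a" where "c = (\<lambda>k. if k = i then 1 else if k = j then - 1 else 0)"
    have "(\<Sum>k\<in>J. vsmul (c k) (z k)) = (\<Sum>k\<in>{i, j}. vsmul (c k) (z k))"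
      by (rule sum.mono_neutral_right) (use ij fin in \<open>auto simp: c_def\<close>)
    also have "\<dots> = 0" using ij by (simp add: c_def)
    finally show False using ind[of c i] ij by (simp add: c_def)
  qed
  have ind': "fv.independent (z ` J)"
  proof (rule fv.independent_if_scalars_zero)
    fix f x assume "(\<Sum>x\<in>z ` J. vsmul (f x) x) = 0" "x \<in> z ` J"
    then show "f x = 0" using ind[of "\<lambda>j. f (z j)"] by (auto simp: sum.reindex[OF inj])
  qed (simp add: fin)
  \<comment> \<open>A vector of \<open>G\<close> outside the span would yield an independent set
    with more elements than \<open>G\<close>, against the exchange bound.\<close>
  have "g \<in> fv.span (z ` J)" if g: "g \<in> G" for g
  proof (rule ccontr)
    assume n: "g \<notin> fv.span (z ` J)"
    then have "fv.independent (insert g (z ` J))" by (rule fv.independent_insertI[OF _ ind'])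
    moreover have "insert g (z ` J) \<subseteq> fv.span G" using sub g fv.span_base by auto
    ultimately have "card (insert g (z ` J)) \<le> card G" using fv.independent_span_bound[OF fin(2)] by blast
    moreover have "g \<notin> z ` J" using n fv.span_base by blast
    ultimately show False using card fin(1) card_image[OF inj] by simp
  qed
  then have "fv.span G \<subseteq> fv.span (z ` J)" by (intro fv.span_minimal fv.subspace_span subsetI)
  then have "y \<in> fv.span (z ` J)" using y by (rule subsetD)
  then obtain f where "y = (\<Sum>x\<in>z ` J. vsmul (f x) x)"
    unfolding fv.span_finite[OF finite_imageI[OF fin(1)]] by blast
  then have "y = (\<Sum>j\<in>J. vsmul (f (z j)) (z j))" by (simp only: sum.reindex[OF inj] comp_def)
  then show thesis by (rule that)
qed

text \<open>A direct sum of copies of one space is realised by functions on pairs whose first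
  component names the copy.\<close>

definition emb :: "nat \<Rightarrow> ('b \<Rightarrow> 'a::field) \<Rightarrow> nat \<times> 'b \<Rightarrow> 'a" where
  "emb k v = (\<lambda>p. if fst p = k then v (snd p) else 0)"

lemma flin_emb: "flin (emb k)"
  by (rule flinI) (auto simp: emb_def vsmul_def fun_eq_iff)

lemma emb_sum_component:
  assumes "finite K" "k \<in> K" shows "(\<lambda>t. (\<Sum>k\<in>K. emb k (v k)) (k, t)) = v k"
  using assms by (simp add: fun_eq_iff sum_fun_apply emb_def)

text \<open>The preimage of the largest letter determines the coset modulo the subgroup fixing that
  letter.\<close>

lemma coset_rep:
  assumes t: "\<tau> permutes {1..Suc m}"
  obtains k \<rho> where "k \<in> {1..Suc m}" "\<rho> permutes {1..m}" "\<tau> = \<rho> \<circ> transpose k (Suc m)"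
proof -
  define k where "k = inv \<tau> (Suc m)"
  have k: "k \<in> {1..Suc m}" using permutes_in_image[OF permutes_inv[OF t], of "Suc m"] by (simp add: k_def)
  define \<rho> where "\<rho> = \<tau> \<circ> transpose k (Suc m)"
  have tr: "transpose k (Suc m) permutes {1..Suc m}" using k by (intro permutes_swap_id) auto
  have p: "\<rho> permutes {1..Suc m}" unfolding \<rho>_def by (rule permutes_compose[OF tr t])
  have "\<rho> (Suc m) = Suc m" using permutes_inverses(1)[OF t] by (simp add: \<rho>_def k_def)
  then have "\<rho> permutes {1..m}" by (intro permutes_superset[OF p]) (auto simp: le_Suc_eq)
  moreover have "\<tau> = \<rho> \<circ> transpose k (Suc m)" by (simp add: \<rho>_def comp_assoc)
  ultimately show thesis using k by (metis that)
qed

text \<open>The functions \<open>\<chi>\<close> form the induced module and are determined by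
  \<open>Suc m\<close> values, one for each coset. The images of the standard polytabloids of all
  larger shapes are independent by \<open>psi_ind_inj\<close>, and \<open>sum_card_std_up\<close>
  says that there are enough of them to span.\<close>

lemma psi_ind_surj:
  fixes \<chi> :: "(nat \<Rightarrow> nat) \<Rightarrow> (nat \<Rightarrow> nat) \<Rightarrow> 'a::field_char_0"
  assumes lam: "is_partition m lam"
    and chi: "\<And>\<tau>. \<tau> permutes {1..Suc m} \<Longrightarrow> \<chi> \<tau> \<in> specht lam"
      "\<And>\<rho> \<tau>. \<rho> permutes {1..m} \<Longrightarrow> \<tau> permutes {1..Suc m} \<Longrightarrow> \<chi> (\<rho> \<circ> \<tau>) = perm_act \<rho> (\<chi> \<tau>)"
  obtains w where "\<And>be. be \<in> up lam \<Longrightarrow> w be \<in> specht be"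
    "\<And>\<tau>. \<tau> permutes {1..Suc m} \<Longrightarrow> \<chi> \<tau> = (\<Sum>be\<in>up lam. psi be lam (perm_act \<tau> (w be)))"
proof -
  let ?K = "{1..Suc m}"
  define tk where "tk k = transpose k (Suc m)" for k
  have tk: "tk k permutes {1..Suc m}" if "k \<in> ?K" for k
    unfolding tk_def using that by (intro permutes_swap_id) auto
  have sl: "sum_list lam = m" by (rule is_partition_sum[OF lam])
  have pbe: "is_partition (Suc m) be" and sbe: "sum_list be = Suc m" and dn: "lam \<in> down be" if "be \<in> up lam" for be
    using up_partition[OF lam that] is_partition_sum that by (auto simp: in_up in_down)
  define J where "J = (SIGMA be:up lam. std (Suc m) be)"
  \<comment> \<open>The image of one standard polytabloid in the induced module, recorded by its
    values at the coset representatives.\<close>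
  define z where "z = (\<lambda>(be, T). \<Sum>k\<in>?K. emb k (psi be lam (perm_act (tk k) (polytabloid be T))) :: _ \<Rightarrow> 'a)"
  \<comment> \<open>Spans all tuples of \<open>Suc m\<close> vectors of the smaller Specht module;
    its size is the other side of the count.\<close>
  define G where "G = (\<lambda>(k, T). emb k (polytabloid lam T) :: _ \<Rightarrow> 'a) ` (?K \<times> std m lam)"
  define wc where "wc c be = (\<Sum>T\<in>std (Suc m) be. vsmul (c (be, T)) (polytabloid be T :: _ \<Rightarrow> 'a))" for c :: "_ \<Rightarrow> 'a" and be
  have wc: "wc c be \<in> specht be" if "be \<in> up lam" for c be
    unfolding wc_def using std_tableaux[OF pbe[OF that]]
    by (intro fv.subspace_sum[OF specht_subspace] fv.subspace_scale[OF specht_subspace] polytabloid_specht) blast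
  have finJ: "finite J" unfolding J_def using finite_up[OF lam] by auto
  have zsum: "(\<Sum>j\<in>J. vsmul (c j) (z j)) = (\<Sum>k\<in>?K. emb k (\<Sum>be\<in>up lam. psi be lam (perm_act (tk k) (wc c be))))" for c
  proof -
    have "(\<Sum>k\<in>?K. emb k (\<Sum>be\<in>up lam. psi be lam (perm_act (tk k) (wc c be))))
       = (\<Sum>k\<in>?K. \<Sum>be\<in>up lam. \<Sum>T\<in>std (Suc m) be. vsmul (c (be, T)) (emb k (psi be lam (perm_act (tk k) (polytabloid be T)))))"
      unfolding wc_def perm_act_lin flin_sum[OF flin_psi] flin_scale[OF flin_psi] flin_sum[OF flin_emb] flin_scale[OF flin_emb] ..
    also have "\<dots> = (\<Sum>be\<in>up lam. \<Sum>k\<in>?K. \<Sum>T\<in>std (Suc m) be. vsmul (c (be, T)) (emb k (psi be lam (perm_act (tk k) (polytabloid be T)))))"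
      by (rule sum.swap)
    also have "\<dots> = (\<Sum>be\<in>up lam. \<Sum>T\<in>std (Suc m) be. \<Sum>k\<in>?K. vsmul (c (be, T)) (emb k (psi be lam (perm_act (tk k) (polytabloid be T)))))"
      by (rule sum.cong[OF refl]) (rule sum.swap)
    also have "\<dots> = (\<Sum>be\<in>up lam. \<Sum>T\<in>std (Suc m) be. vsmul (c (be, T)) (z (be, T)))"
      by (simp only: z_def fv.scale_sum_right prod.case)
    also have "\<dots> = (\<Sum>(be, T)\<in>J. vsmul (c (be, T)) (z (be, T)))"
      unfolding J_def by (rule sum.Sigma) (use finite_up[OF lam] in auto)
    also have "\<dots> = (\<Sum>j\<in>J. vsmul (c j) (z j))" by (rule sum.cong) auto
    finally show ?thesis ..
  qed
  \<comment> \<open>Equivariance extends identities from the coset representatives to the whole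
    larger group.\<close>
  have transport: "(\<Sum>be\<in>up lam. psi be lam (perm_act (\<rho> \<circ> tk k) (w be))) = perm_act \<rho> (\<Sum>be\<in>up lam. psi be lam (perm_act (tk k) (w be)))"
    if "\<rho> permutes {1..m}" for \<rho> k and w :: "_ \<Rightarrow> _ \<Rightarrow> 'a"
    unfolding perm_act_lin perm_act_comp[symmetric]
    by (rule sum.cong[OF refl], rule psi_perm_act, unfold sl, rule that)
  have "(\<Sum>k\<in>?K. emb k (\<chi> (tk k))) \<in> fv.span G"
    and "\<And>j. j \<in> J \<Longrightarrow> z j \<in> fv.span G"
  proof -
    have embG: "emb k v \<in> fv.span G" if k: "k \<in> ?K" and v: "v \<in> specht lam" for k v
    proof -
      have "polytabloid lam T \<in> fv.span (polytabloid lam ` std m lam :: (_ \<Rightarrow> 'a) set)" if "T \<in> tableaux lam" for T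
        using std_span[OF lam garnir_rel_polytabloid[OF lam] that, where 'a='a] by simp
      then have "specht lam \<subseteq> fv.span (polytabloid lam ` std m lam :: (_ \<Rightarrow> 'a) set)"
        unfolding specht_eq by (intro fv.span_minimal fv.subspace_span) blast
      from subsetD[OF this v] show ?thesis
        by (rule flin_span[OF flin_emb _ _ fv.subspace_span]) (rule fv.span_base, use k in \<open>auto simp: G_def\<close>)
    qed
    show "(\<Sum>k\<in>?K. emb k (\<chi> (tk k))) \<in> fv.span G"
      by (intro fv.span_sum embG chi(1) tk)
    fix j assume "j \<in> J"
    then obtain be T where j: "j = (be, T)" "be \<in> up lam" "T \<in> std (Suc m) be" by (auto simp: J_def)
    have "perm_act (tk k) (polytabloid be T :: _ \<Rightarrow> 'a) \<in> specht be" if "k \<in> ?K" for k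
      using perm_act_specht[of "tk k" be] tk[OF that] sbe[OF j(2)] polytabloid_specht std_tableaux[OF pbe[OF j(2)] j(3)] by metis
    then show "z j \<in> fv.span G"
      unfolding j(1) z_def prod.case by (intro fv.span_sum embG psi_specht[OF pbe[OF j(2)] dn[OF j(2)]])
  qed
  note yG = this(1) and zG = this(2)
  have cardG: "card G \<le> card J"
  proof -
    have "card G \<le> card (?K \<times> std m lam)" unfolding G_def by (rule card_image_le) simp
    also have "\<dots> = (\<Sum>be\<in>up lam. card (std (Suc m) be))"
      using sum_card_std_up[OF lam] by (simp add: card_cartesian_product)
    also have "\<dots> = card J" unfolding J_def using finite_up[OF lam] by (intro card_SigmaI[symmetric]) auto
    finally show ?thesis .
  qed
  have ind: "c j = 0" if zc: "(\<Sum>j\<in>J. vsmul (c j) (z j)) = 0" and j: "j \<in> J" for c j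
  proof -
    have zero: "(\<Sum>be\<in>up lam. psi be lam (perm_act (tk k) (wc c be))) = 0" if k: "k \<in> ?K" for k
    proof -
      have "(\<Sum>be\<in>up lam. psi be lam (perm_act (tk k) (wc c be)))
         = (\<lambda>t. (\<Sum>k\<in>?K. emb k (\<Sum>be\<in>up lam. psi be lam (perm_act (tk k) (wc c be)))) (k, t))"
        by (rule emb_sum_component[symmetric, OF _ k]) simp
      also have "\<dots> = 0" using zc unfolding zsum by (simp add: fun_eq_iff)
      finally show ?thesis .
    qed
    have "(\<Sum>be\<in>up lam. psi be lam (perm_act \<tau> (wc c be))) = 0" if t: "\<tau> permutes {1..Suc m}" for \<tau>
    proof -
      obtain k \<rho> where k: "k \<in> ?K" "\<rho> permutes {1..m}" "\<tau> = \<rho> \<circ> tk k" unfolding tk_def by (rule coset_rep[OF t])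
      show ?thesis unfolding k(3) transport[OF k(2)] zero[OF k(1)] perm_act_lin ..
    qed
    note w0 = psi_ind_inj[OF lam wc this]
    obtain be T where j: "j = (be, T)" "be \<in> up lam" "T \<in> std (Suc m) be" using j by (auto simp: J_def)
    have "(\<Sum>T\<in>std (Suc m) be. vsmul (c (be, T)) (polytabloid be T)) = 0" using w0[OF _ _ j(2)] unfolding wc_def by blast
    from std_indep[OF pbe[OF j(2)] this j(3)] show ?thesis unfolding j(1) .
  qed
  have "\<exists>c. (\<Sum>k\<in>?K. emb k (\<chi> (tk k))) = (\<Sum>j\<in>J. vsmul (c j) (z j))"
  proof (rule family_spans[of J G z "\<Sum>k\<in>?K. emb k (\<chi> (tk k))"])
    show "c j = 0" if "(\<Sum>j\<in>J. vsmul (c j) (z j)) = 0" "j \<in> J" for c j by (rule ind[OF that])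
    show "finite G" unfolding G_def by simp
    show "z ` J \<subseteq> fv.span G" using zG by (rule image_subsetI)
  qed (rule finJ cardG yG exI; assumption?)+
  then obtain c where c: "(\<Sum>k\<in>?K. emb k (\<chi> (tk k))) = (\<Sum>j\<in>J. vsmul (c j) (z j))" by (elim exE)
  have comp: "\<chi> (tk k) = (\<Sum>be\<in>up lam. psi be lam (perm_act (tk k) (wc c be)))" if k: "k \<in> ?K" for k
  proof -
    have "\<chi> (tk k) = (\<lambda>t. (\<Sum>k\<in>?K. emb k (\<chi> (tk k))) (k, t))"
      by (rule emb_sum_component[symmetric, OF _ k]) simp
    also have "\<dots> = (\<Sum>be\<in>up lam. psi be lam (perm_act (tk k) (wc c be)))"
      unfolding c zsum by (rule emb_sum_component[OF _ k]) simp
    finally show ?thesis .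
  qed
  have "\<chi> \<tau> = (\<Sum>be\<in>up lam. psi be lam (perm_act \<tau> (wc c be)))" if t: "\<tau> permutes {1..Suc m}" for \<tau>
  proof -
    obtain k \<rho> where k: "k \<in> ?K" "\<rho> permutes {1..m}" "\<tau> = \<rho> \<circ> tk k" unfolding tk_def by (rule coset_rep[OF t])
    show ?thesis unfolding k(3) transport[OF k(2)] chi(2)[OF k(2) tk[OF k(1)]] comp[OF k(1), symmetric] ..
  qed
  with wc show thesis by (rule that)
qed

section \<open>Stacking diagrams\<close>

lemma diagramsI:
  assumes "\<And>e. e \<in> D \<Longrightarrow> \<exists>u v. e = {u, v} \<and> u \<noteq> v \<and> u \<in> verts n \<and> v \<in> verts n"
    "\<And>e e' u. e \<in> D \<Longrightarrow> e' \<in> D \<Longrightarrow> u \<in> e \<Longrightarrow> u \<in> e' \<Longrightarrow> e = e'"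
  shows "D \<in> diagrams n"
  unfolding diagrams_def
proof (intro CollectI conjI ballI impI)
  fix e e' assume e: "e \<in> D" "e' \<in> D" "e \<inter> e' \<noteq> {}"
  then obtain u where "u \<in> e" "u \<in> e'" by blast
  then show "e = e'" by (rule assms(2)[OF e(1,2)])
qed (rule assms(1))

lemma diagram_edge:
  assumes "D \<in> diagrams n" "e \<in> D"
  obtains u v where "e = {u, v}" "u \<noteq> v" "u \<in> verts n" "v \<in> verts n"
proof -
  have "\<forall>e\<in>D. \<exists>u v. e = {u, v} \<and> u \<noteq> v \<and> u \<in> verts n \<and> v \<in> verts n"
    using assms(1) by (simp add: diagrams_def)
  from bspec[OF this assms(2)] show thesis using that by (elim exE conjE)
qed

lemma diagram_edge_eq:
  assumes "D \<in> diagrams n" "e \<in> D" "e' \<in> D" "u \<in> e" "u \<in> e'" shows "e = e'"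
proof -
  have "\<forall>e\<in>D. \<forall>e'\<in>D. e \<inter> e' \<noteq> {} \<longrightarrow> e = e'" using assms(1) by (simp add: diagrams_def)
  from bspec[OF bspec[OF this assms(2)] assms(3)] show ?thesis using assms(4,5) by blast
qed

lemma diagram_partner:
  assumes "D \<in> diagrams n" "{u, v} \<in> D" "{u, w} \<in> D" shows "v = w"
proof -
  have "{u, v} = {u, w}" by (rule diagram_edge_eq[OF assms, of u]) auto
  then show ?thesis by (auto simp: doubleton_eq_iff)
qed

lemma diagram_verts: "D \<in> diagrams n \<Longrightarrow> {u, v} \<in> D \<Longrightarrow> u \<in> verts n \<and> v \<in> verts n \<and> u \<noteq> v"
  by (erule (1) diagram_edge) (auto simp: doubleton_eq_iff)

lemma diagram_Union:
  assumes "D \<in> diagrams n" "u \<in> \<Union>D" shows "u \<in> verts n"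
proof -
  obtain e where e: "e \<in> D" "u \<in> e" using assms(2) by blast
  show ?thesis using diagram_edge[OF assms(1) e(1)] e(2) by (metis insert_iff singletonD)
qed

lemma finite_verts: "finite (verts n)" by (simp add: verts_def)

lemma finite_diagrams: "finite (diagrams n)"
proof (rule finite_subset)
  show "diagrams n \<subseteq> Pow (Pow (verts n))" using diagram_Union by blast
  show "finite (Pow (Pow (verts n)))" using finite_verts by simp
qed

lemma upper_inj: "upper u = upper v \<longleftrightarrow> u = v" by (cases u; cases v) auto

lemma lower_inj: "lower u = lower v \<longleftrightarrow> u = v" by (cases u; cases v) auto

lemma doubleton_image:
  assumes "\<And>u v. f u = f v \<longleftrightarrow> u = v"
  shows "{p, q} \<in> (image f) ` a \<longleftrightarrow> (\<exists>u v. {u, v} \<in> a \<and> p = f u \<and> q = f v)"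
proof
  assume "{p, q} \<in> (image f) ` a"
  then obtain e where e: "e \<in> a" "{p, q} = f ` e" by blast
  then obtain u v where uv: "u \<in> e" "v \<in> e" "p = f u" "q = f v" by (metis imageE insertI1 insertI2)
  have "e = {u, v}" using e(2) uv assms by auto
  then show "\<exists>u v. {u, v} \<in> a \<and> p = f u \<and> q = f v" using e uv by blast
next
  assume "\<exists>u v. {u, v} \<in> a \<and> p = f u \<and> q = f v"
  then obtain u v where "{u, v} \<in> a" "p = f u" "q = f v" by blast
  then show "{p, q} \<in> (image f) ` a" by (intro image_eqI[of _ _ "{u, v}"]) auto
qed

lemma stack_rel_iff: "(p, q) \<in> stack_rel a b \<longleftrightarrow>
   (\<exists>u v. {u, v} \<in> a \<and> p = upper u \<and> q = upper v) \<or> (\<exists>u v. {u, v} \<in> b \<and> p = lower u \<and> q = lower v)"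
  unfolding stack_rel_def using doubleton_image[of upper, OF upper_inj] doubleton_image[of lower, OF lower_inj] by auto

lemma stack_sym: "sym (stack_rel a b)"
  by (auto simp: sym_def stack_rel_def insert_commute)

lemma stack_rtrancl_sym: "(p, q) \<in> (stack_rel a b)\<^sup>* \<Longrightarrow> (q, p) \<in> (stack_rel a b)\<^sup>*"
  by (meson stack_sym sym_rtrancl symD)

lemma stack_upper: "{u, v} \<in> a \<Longrightarrow> (upper u, upper v) \<in> stack_rel a b"
  by (auto simp: stack_rel_iff)

lemma stack_lower: "{u, v} \<in> b \<Longrightarrow> (lower u, lower v) \<in> stack_rel a b"
  by (auto simp: stack_rel_iff)

fun inn :: "vtx \<Rightarrow> v3" where
  "inn (Top i) = U i" | "inn (Bot i) = L i"

lemma inn_inj: "inn u = inn v \<longleftrightarrow> u = v" by (cases u; cases v) auto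

lemma inn_outer: "p \<notin> range Mid \<Longrightarrow> inn (outer p) = p" by (cases p) auto

lemma outer_inn [simp]: "outer (inn u) = u" by (cases u) auto

lemma inn_notin: "inn u \<notin> range Mid" by (cases u) auto

text \<open>Quantifying over vertices of the product instead of the stacked graph gets rid of the
  dummy value \<open>Top 0\<close> that \<open>outer\<close> assigns to middle vertices.\<close>

lemma Gprime_alt: "Gprime a b = {{u, v} | u v. u \<noteq> v \<and> (inn u, inn v) \<in> (stack_rel a b)\<^sup>*}"
proof (intro set_eqI iffI)
  fix e assume "e \<in> Gprime a b"
  then obtain p q where "e = {outer p, outer q}" "p \<noteq> q" "p \<notin> range Mid" "q \<notin> range Mid" "(p, q) \<in> (stack_rel a b)\<^sup>*"
    unfolding Gprime_def by blast
  then show "e \<in> {{u, v} | u v. u \<noteq> v \<and> (inn u, inn v) \<in> (stack_rel a b)\<^sup>*}"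
    using inn_outer by (metis (mono_tags, lifting) mem_Collect_eq)
next
  fix e assume "e \<in> {{u, v} | u v. u \<noteq> v \<and> (inn u, inn v) \<in> (stack_rel a b)\<^sup>*}"
  then obtain u v where "e = {u, v}" "u \<noteq> v" "(inn u, inn v) \<in> (stack_rel a b)\<^sup>*" by blast
  then show "e \<in> Gprime a b"
    unfolding Gprime_def using inn_notin inn_inj outer_inn by (metis (mono_tags, lifting) mem_Collect_eq)
qed

lemma Gprime_iff: "{u, v} \<in> Gprime a b \<longleftrightarrow> u \<noteq> v \<and> (inn u, inn v) \<in> (stack_rel a b)\<^sup>*"
  unfolding Gprime_alt using stack_rtrancl_sym by (auto simp: doubleton_eq_iff)

lemma Gprime_edge:
  assumes "e \<in> Gprime a b" obtains u v where "e = {u, v}" "u \<noteq> v" "(inn u, inn v) \<in> (stack_rel a b)\<^sup>*"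
  using assms unfolding Gprime_alt by blast

text \<open>The walk is described by sets of possible positions; determinism shows them to have at
  most one element, and the empty set records that the walk has ended.\<close>

primrec walk :: "('v \<Rightarrow> 'v \<Rightarrow> bool) \<Rightarrow> ('v \<Rightarrow> 'v \<Rightarrow> bool) \<Rightarrow> 'v \<Rightarrow> nat \<Rightarrow> 'v set" where
  "walk A B p 0 = {p}"
| "walk A B p (Suc i) = {w. \<exists>v\<in>walk A B p i. if even i then A v w else B v w}"

text \<open>Starting at a vertex that is free in the second matching, the alternating walk is
  deterministic, exhausts the component, and can only stop at another end point.\<close>

lemma alternating_walk:
  fixes A B :: "'v \<Rightarrow> 'v \<Rightarrow> bool"
  assumes symm: "\<And>x y. A x y \<Longrightarrow> A y x" "\<And>x y. B x y \<Longrightarrow> B y x"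
    and fn: "\<And>x y z. A x y \<Longrightarrow> A x z \<Longrightarrow> y = z" "\<And>x y z. B x y \<Longrightarrow> B x z \<Longrightarrow> y = z"
    and p: "\<And>y. \<not> B p y"
    and q: "(\<forall>y. \<not> A q y) \<or> (\<forall>y. \<not> B q y)" and r: "(\<forall>y. \<not> A r y) \<or> (\<forall>y. \<not> B r y)"
    and ne: "q \<noteq> p" "r \<noteq> p"
    and conn: "(p, q) \<in> {(x, y). A x y \<or> B x y}\<^sup>*" "(p, r) \<in> {(x, y). A x y \<or> B x y}\<^sup>*"
  shows "q = r"
proof -
  let ?w = "walk A B p"
  have uniq: "x \<in> ?w i \<Longrightarrow> y \<in> ?w i \<Longrightarrow> x = y" for i x y
  proof (induction i arbitrary: x y)
    case (Suc i)
    then obtain v v' where v: "v \<in> ?w i" "v' \<in> ?w i" "if even i then A v x else B v x" "if even i then A v' y else B v' y"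
      by auto
    then show ?case using Suc.IH[OF v(1,2)] fn by (auto split: if_splits)
  qed simp
  have closed: "\<exists>j. y \<in> ?w j" if xw: "x \<in> ?w i" and xy: "A x y \<or> B x y" for x y i
  proof (cases "if even i then A x y else B x y")
    case True then have "y \<in> ?w (Suc i)" using xw by auto
    then show ?thesis by blast
  next
    case False
    show ?thesis
    proof (cases i)
      case 0 then show ?thesis using xw xy False p by auto
    next
      case (Suc k)
      then obtain v where v: "v \<in> ?w k" "if even k then A v x else B v x" using xw by auto
      moreover have "if even k then A x y else B x y" using False xy Suc by auto
      ultimately have "v = y" using symm fn by (metis (full_types))
      then show ?thesis using v(1) by blast
    qed
  qed
  have reach: "\<exists>j. y \<in> ?w j" if "(p, y) \<in> {(x, y). A x y \<or> B x y}\<^sup>*" for y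
    using that
  proof (induction rule: rtrancl_induct)
    case base have "p \<in> ?w 0" by simp then show ?case by blast
  next
    case (step y z) then show ?case using closed by blast
  qed
  \<comment> \<open>A vertex that misses one of the matchings has been reached through the other,
    and the next step would need the one it misses.\<close>
  have stop: "?w j = {}" if s: "s \<in> ?w (Suc i)" "(\<forall>y. \<not> A s y) \<or> (\<forall>y. \<not> B s y)" "Suc i < j" for s i j
    using that(3)
  proof (induction j)
    case (Suc j)
    show ?case
    proof (cases "j = Suc i")
      case True
      obtain v where v: "if even i then A v s else B v s" using s(1) by auto
      have "\<not> (if even (Suc i) then A s y else B s y)" for y
        using symm(1)[of v s] symm(2)[of v s] v s(2) by (auto split: if_splits)
      then have "w \<notin> ?w (Suc (Suc i))" for w using uniq[OF s(1)] by fastforce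
      then show ?thesis using True by blast
    next
      case False
      then have "?w j = {}" using Suc by simp
      then show ?thesis by simp
    qed
  qed simp
  obtain i j where ij: "q \<in> ?w i" "r \<in> ?w j" using reach conn by blast
  have "i \<noteq> 0" "j \<noteq> 0" using ij ne by (auto intro: ccontr)
  then obtain i' j' where s: "i = Suc i'" "j = Suc j'" by (metis not0_implies_Suc)
  have "i = j" using stop[of q i' j] stop[of r j' i] ij q r s by (metis empty_iff linorder_neqE_nat)
  then show ?thesis using uniq ij by blast
qed

text \<open>An outer vertex lies on an edge of at most one of the two diagrams, so it is the end of
  an alternating path and is connected to at most one other outer vertex.\<close>

lemma Gprime_diagrams:
  assumes a: "a \<in> diagrams n" and b: "b \<in> diagrams n" shows "Gprime a b \<in> diagrams n"
proof -
  define A where "A = (\<lambda>p q. \<exists>u v. {u, v} \<in> a \<and> p = upper u \<and> q = upper v)"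
  define B where "B = (\<lambda>p q. \<exists>u v. {u, v} \<in> b \<and> p = lower u \<and> q = lower v)"
  have R: "stack_rel a b = {(x, y). A x y \<or> B x y}"
    unfolding set_eq_iff split_paired_All stack_rel_iff A_def B_def by simp
  have symm: "A x y \<Longrightarrow> A y x" "B x y \<Longrightarrow> B y x" for x y
    unfolding A_def B_def by (metis insert_commute)+
  have fn: "A x y \<Longrightarrow> A x z \<Longrightarrow> y = z" "B x y \<Longrightarrow> B x z \<Longrightarrow> y = z" for x y z
    unfolding A_def B_def using diagram_partner[OF a] diagram_partner[OF b] upper_inj lower_inj by metis+
  have out: "(\<forall>y. \<not> A (inn u) y) \<or> (\<forall>y. \<not> B (inn u) y)" for u
  proof (cases u)
    case (Top i)
    have "lower v \<noteq> U i" for v by (cases v) auto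
    then show ?thesis using Top by (auto simp: B_def) metis
  next
    case (Bot i)
    have "upper v \<noteq> L i" for v by (cases v) auto
    then show ?thesis using Bot by (auto simp: A_def) metis
  qed
  have partner: "v = w" if "u \<noteq> v" "u \<noteq> w" "(inn u, inn v) \<in> (stack_rel a b)\<^sup>*" "(inn u, inn w) \<in> (stack_rel a b)\<^sup>*" for u v w
  proof -
    have c: "(inn u, inn v) \<in> {(x, y). A x y \<or> B x y}\<^sup>*" "(inn u, inn w) \<in> {(x, y). A x y \<or> B x y}\<^sup>*"
      using that R by auto
    have c': "(inn u, inn v) \<in> {(x, y). B x y \<or> A x y}\<^sup>*" "(inn u, inn w) \<in> {(x, y). B x y \<or> A x y}\<^sup>*"
      using c by (simp_all add: disj_commute)
    have ne: "inn v \<noteq> inn u" "inn w \<noteq> inn u" using that inn_inj by metis+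
    have "inn v = inn w"
    \<comment> \<open>The walk begins in its first matching, so the roles are exchanged if the
      starting vertex carries an edge of the lower diagram.\<close>
    proof (cases "\<forall>y. \<not> B (inn u) y")
      case True
      show ?thesis by (rule alternating_walk[of A B "inn u"]) (erule symm | erule (1) fn | rule out ne c True[rule_format])+
    next
      case False
      then have n: "\<forall>y. \<not> A (inn u) y" using out by blast
      have out': "(\<forall>y. \<not> B (inn u) y) \<or> (\<forall>y. \<not> A (inn u) y)" for u using out by blast
      show ?thesis
        by (rule alternating_walk[of B A "inn u"]) (erule symm | erule (1) fn | rule out' ne c' n[rule_format])+
    qed
    then show ?thesis using inn_inj by blast
  qed
  have vert: "u \<in> verts n" if uv: "u \<noteq> v" "(inn u, inn v) \<in> (stack_rel a b)\<^sup>*" for u v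
  proof -
    have "inn u \<noteq> inn v" using uv inn_inj by blast
    then obtain y where "(inn u, y) \<in> stack_rel a b" using uv(2) by (metis converse_rtranclE)
    then consider u' v' where "{u', v'} \<in> a" "inn u = upper u'" | u' v' where "{u', v'} \<in> b" "inn u = lower u'"
      unfolding stack_rel_iff by blast
    then show ?thesis
    proof cases
      case 1
      then have "u' \<in> verts n" using diagram_verts[OF a] by blast
      moreover have "u = u'" using 1(2) by (cases u; cases u') auto
      ultimately show ?thesis by simp
    next
      case 2
      then have "u' \<in> verts n" using diagram_verts[OF b] by blast
      moreover have "u = u'" using 2(2) by (cases u; cases u') auto
      ultimately show ?thesis by simp
    qed
  qed
  show ?thesis
  proof (rule diagramsI)
    fix e assume "e \<in> Gprime a b"
    then obtain u v where "e = {u, v}" "u \<noteq> v" "(inn u, inn v) \<in> (stack_rel a b)\<^sup>*" by (rule Gprime_edge)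
    then show "\<exists>u v. e = {u, v} \<and> u \<noteq> v \<and> u \<in> verts n \<and> v \<in> verts n"
      using vert stack_rtrancl_sym by metis
  next
    fix e e' u assume ee: "e \<in> Gprime a b" "e' \<in> Gprime a b" and u: "u \<in> e" "u \<in> e'"
    have "\<exists>v. f = {u, v} \<and> u \<noteq> v \<and> (inn u, inn v) \<in> (stack_rel a b)\<^sup>*" if "f \<in> Gprime a b" "u \<in> f" for f
      using that by (metis Gprime_edge insertE insert_commute singletonD stack_rtrancl_sym)
    then obtain v v' where "e = {u, v}" "u \<noteq> v" "(inn u, inn v) \<in> (stack_rel a b)\<^sup>*"
      "e' = {u, v'}" "u \<noteq> v'" "(inn u, inn v') \<in> (stack_rel a b)\<^sup>*" using ee(1,2) u by metis
    then show "e = e'" using partner by blast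
  qed
qed

subsection \<open>Transfer along maps of stacked graphs\<close>

lemma rtrancl_map:
  assumes "\<And>x y. (x, y) \<in> R \<Longrightarrow> (k x, k y) \<in> S\<^sup>*" "(x, y) \<in> R\<^sup>*" shows "(k x, k y) \<in> S\<^sup>*"
  using assms(2) by (induction rule: rtrancl_induct) (auto intro: rtrancl_trans assms(1))

definition vmap :: "(vtx \<Rightarrow> vtx) \<Rightarrow> diagram \<Rightarrow> diagram" where
  "vmap f d = (image f) ` d"

lemma vmap_iff: "inj f \<Longrightarrow> {f u, f v} \<in> vmap f d \<longleftrightarrow> {u, v} \<in> d"
  unfolding vmap_def by (subst doubleton_image) (auto simp: inj_eq)

lemma vmap_mem_iff: "inj f \<Longrightarrow> {p, q} \<in> vmap f d \<longleftrightarrow> (\<exists>u v. {u, v} \<in> d \<and> p = f u \<and> q = f v)"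
  unfolding vmap_def by (subst doubleton_image) (auto simp: inj_eq)

lemma vmap_comp: "vmap f (vmap g d) = vmap (f \<circ> g) d"
  by (simp add: vmap_def image_image image_comp)

lemma vmap_id [simp]: "vmap id d = d" "vmap (\<lambda>u. u) d = d"
  by (simp_all add: vmap_def)

lemma vmap_cong: "(\<And>u. u \<in> \<Union>d \<Longrightarrow> f u = g u) \<Longrightarrow> vmap f d = vmap g d"
  unfolding vmap_def by (intro image_cong refl) auto

lemma vmap_Union: "\<Union>(vmap f d) = f ` \<Union>d"
  by (auto simp: vmap_def)

text \<open>Edges may be sent to paths, and the second map inverts the first on outer vertices only
  up to connectivity; this freedom is what contracting a path calls for.\<close>

lemma Gprime_transfer:
  assumes f: "bij f"
    and k: "\<And>x y. (x, y) \<in> stack_rel a1 b1 \<Longrightarrow> (k x, k y) \<in> (stack_rel a2 b2)\<^sup>*"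
    and s: "\<And>x y. (x, y) \<in> stack_rel a2 b2 \<Longrightarrow> (s x, s y) \<in> (stack_rel a1 b1)\<^sup>*"
    and ki: "\<And>u. k (inn u) = inn (f u)" and si: "\<And>u. (s (inn (f u)), inn u) \<in> (stack_rel a1 b1)\<^sup>*"
  shows "Gprime a2 b2 = vmap f (Gprime a1 b1)"
proof -
  have inj: "inj f" using f by (rule bij_is_inj)
  have "(inn u, inn v) \<in> (stack_rel a1 b1)\<^sup>* \<longleftrightarrow> (inn (f u), inn (f v)) \<in> (stack_rel a2 b2)\<^sup>*" for u v
  proof
    assume "(inn u, inn v) \<in> (stack_rel a1 b1)\<^sup>*"
    from rtrancl_map[of _ k, OF k this] show "(inn (f u), inn (f v)) \<in> (stack_rel a2 b2)\<^sup>*" by (simp add: ki)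
  next
    assume "(inn (f u), inn (f v)) \<in> (stack_rel a2 b2)\<^sup>*"
    from rtrancl_map[of _ s, OF s this] have "(s (inn (f u)), s (inn (f v))) \<in> (stack_rel a1 b1)\<^sup>*" .
    then show "(inn u, inn v) \<in> (stack_rel a1 b1)\<^sup>*" using si stack_rtrancl_sym by (meson rtrancl_trans)
  qed
  then have iff: "{f u, f v} \<in> Gprime a2 b2 \<longleftrightarrow> {u, v} \<in> Gprime a1 b1" for u v
    unfolding Gprime_iff using inj by (auto simp: inj_eq)
  show ?thesis
  proof (intro set_eqI iffI)
    fix e assume "e \<in> Gprime a2 b2"
    moreover from this obtain u v where "e = {u, v}" by (rule Gprime_edge)
    moreover obtain u' v' where "u = f u'" "v = f v'" using f by (metis bij_pointE)
    ultimately show "e \<in> vmap f (Gprime a1 b1)" using iff vmap_iff[OF inj] by metis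
  next
    fix e assume "e \<in> vmap f (Gprime a1 b1)"
    then obtain e' where e': "e' \<in> Gprime a1 b1" "e = f ` e'" by (auto simp: vmap_def)
    moreover from this obtain u v where "e' = {u, v}" by (metis Gprime_edge)
    ultimately show "e \<in> Gprime a2 b2" using iff by auto
  qed
qed

text \<open>\<open>J\<close> is a set of middle vertices that both maps leave alone. Components
  closed off in the middle row have to stay inside it, so they are the same sets in both
  graphs.\<close>

lemma ell_transfer:
  assumes k: "\<And>x y. (x, y) \<in> stack_rel a1 b1 \<Longrightarrow> (k x, k y) \<in> (stack_rel a2 b2)\<^sup>*"
    and s: "\<And>x y. (x, y) \<in> stack_rel a2 b2 \<Longrightarrow> (s x, s y) \<in> (stack_rel a1 b1)\<^sup>*"
    and J: "\<And>i. i \<in> J \<Longrightarrow> k (Mid i) = Mid i" "\<And>i. i \<in> J \<Longrightarrow> s (Mid i) = Mid i"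
    and km: "\<And>x. k x \<in> range Mid \<Longrightarrow> x \<in> Mid ` J" and sm: "\<And>y. s y \<in> Mid ` J \<Longrightarrow> y \<in> Mid ` J"
    and c1: "\<And>i. i \<in> {1..n1} \<Longrightarrow> conn a1 b1 (Mid i) \<subseteq> range Mid \<Longrightarrow> i \<in> {1..n2} \<and> conn a1 b1 (Mid i) \<subseteq> Mid ` J"
    and n2: "{1..n2} \<subseteq> {1..n1}" "{1..n2} \<subseteq> J"
  shows "ell n1 a1 b1 = ell n2 a2 b2"
proof -
  have one: "conn a2 b2 (Mid i) = conn a1 b1 (Mid i)" if i: "i \<in> {1..n2}" and sub: "conn a1 b1 (Mid i) \<subseteq> Mid ` J" for i
  proof
    show "conn a1 b1 (Mid i) \<subseteq> conn a2 b2 (Mid i)"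
    proof
      fix x assume x: "x \<in> conn a1 b1 (Mid i)"
      then have "(k (Mid i), k x) \<in> (stack_rel a2 b2)\<^sup>*" using rtrancl_map[of _ k, OF k] by (simp add: conn_def)
      moreover have "k x = x" using J(1) sub x by auto
      moreover have "k (Mid i) = Mid i" using J(1) i n2(2) by blast
      ultimately show "x \<in> conn a2 b2 (Mid i)" by (simp add: conn_def)
    qed
    show "conn a2 b2 (Mid i) \<subseteq> conn a1 b1 (Mid i)"
    proof
      fix y assume y: "y \<in> conn a2 b2 (Mid i)"
      then have "(s (Mid i), s y) \<in> (stack_rel a1 b1)\<^sup>*" using rtrancl_map[of _ s, OF s] by (simp add: conn_def)
      moreover have "s (Mid i) = Mid i" using J(2) i n2(2) by blast
      ultimately have sy: "s y \<in> conn a1 b1 (Mid i)" by (simp add: conn_def)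
      then have "y \<in> Mid ` J" using sub sm by blast
      then show "y \<in> conn a1 b1 (Mid i)" using sy J(2) by auto
    qed
  qed
  have two: "conn a1 b1 (Mid i) \<subseteq> Mid ` J" if i: "i \<in> {1..n2}" and sub: "conn a2 b2 (Mid i) \<subseteq> range Mid" for i
  proof
    fix x assume "x \<in> conn a1 b1 (Mid i)"
    then have "(k (Mid i), k x) \<in> (stack_rel a2 b2)\<^sup>*" using rtrancl_map[of _ k, OF k] by (simp add: conn_def)
    moreover have "k (Mid i) = Mid i" using J(1) i n2(2) by blast
    ultimately have "k x \<in> conn a2 b2 (Mid i)" by (simp add: conn_def)
    then show "x \<in> Mid ` J" using sub km by blast
  qed
  have "{C. \<exists>i\<in>{1..n1}. C = conn a1 b1 (Mid i) \<and> C \<subseteq> range Mid} = {C. \<exists>i\<in>{1..n2}. C = conn a2 b2 (Mid i) \<and> C \<subseteq> range Mid}"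
  proof (intro set_eqI iffI)
    fix C assume "C \<in> {C. \<exists>i\<in>{1..n1}. C = conn a1 b1 (Mid i) \<and> C \<subseteq> range Mid}"
    then obtain i where "i \<in> {1..n1}" "C = conn a1 b1 (Mid i)" "C \<subseteq> range Mid" by blast
    then show "C \<in> {C. \<exists>i\<in>{1..n2}. C = conn a2 b2 (Mid i) \<and> C \<subseteq> range Mid}" using c1 one by blast
  next
    fix C assume "C \<in> {C. \<exists>i\<in>{1..n2}. C = conn a2 b2 (Mid i) \<and> C \<subseteq> range Mid}"
    then obtain i where "i \<in> {1..n2}" "C = conn a2 b2 (Mid i)" "C \<subseteq> range Mid" by blast
    then show "C \<in> {C. \<exists>i\<in>{1..n1}. C = conn a1 b1 (Mid i) \<and> C \<subseteq> range Mid}" using one two n2 by blast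
  qed
  then show ?thesis by (simp add: ell_def)
qed

subsection \<open>Relabelling the bottom row\<close>

fun mb :: "(nat \<Rightarrow> nat) \<Rightarrow> vtx \<Rightarrow> vtx" where
  "mb \<sigma> (Top i) = Top i" | "mb \<sigma> (Bot j) = Bot (\<sigma> j)"

lemma mb_comp: "mb \<sigma> \<circ> mb \<tau> = mb (\<sigma> \<circ> \<tau>)"
proof
  fix u show "(mb \<sigma> \<circ> mb \<tau>) u = mb (\<sigma> \<circ> \<tau>) u" by (cases u) auto
qed

lemma mb_id: "mb id = id"
proof
  fix u show "mb id u = id u" by (cases u) auto
qed

lemma mb_bij: assumes "bij \<sigma>" shows "bij (mb \<sigma>)"
proof (rule o_bij)
  show "mb (inv \<sigma>) \<circ> mb \<sigma> = id" "mb \<sigma> \<circ> mb (inv \<sigma>) = id"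
    using assms unfolding bij_def inj_iff surj_iff by (simp_all add: mb_comp mb_id)
qed

text \<open>On the diagrams in \<open>bd\<close>, this is right multiplication by the permutation
  diagram of \<open>inv \<sigma>\<close> (see \<open>Gprime_perm\<close>), hence a left
  action.\<close>

definition relab :: "(nat \<Rightarrow> nat) \<Rightarrow> diagram \<Rightarrow> diagram" where
  "relab \<sigma> = vmap (mb \<sigma>)"

lemma relab_comp: "relab \<sigma> (relab \<tau> d) = relab (\<sigma> \<circ> \<tau>) d"
  by (simp add: relab_def vmap_comp mb_comp)

lemma relab_id [simp]: "relab id d = d"
  by (simp add: relab_def mb_id)

lemma relab_inv:
  assumes "\<sigma> permutes S" shows "relab (inv \<sigma>) (relab \<sigma> d) = d" "relab \<sigma> (relab (inv \<sigma>) d) = d"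
  using permutes_inv_o[OF assms] by (simp_all add: relab_comp)

fun lb :: "(nat \<Rightarrow> nat) \<Rightarrow> v3 \<Rightarrow> v3" where
  "lb \<sigma> (U i) = U i" | "lb \<sigma> (Mid i) = Mid i" | "lb \<sigma> (L i) = L (\<sigma> i)"

lemma relab_stack:
  assumes "bij \<sigma>" "(x, y) \<in> stack_rel b d" shows "(lb \<sigma> x, lb \<sigma> y) \<in> stack_rel b (relab \<sigma> d)"
proof -
  have up: "lb \<sigma> (upper u) = upper u" and lo: "lb \<sigma> (lower u) = lower (mb \<sigma> u)" for u by (cases u; simp)+
  have inj: "inj (mb \<sigma>)" using mb_bij[OF assms(1)] by (rule bij_is_inj)
  from assms(2) show ?thesis
    unfolding stack_rel_iff relab_def using up lo vmap_iff[OF inj] by metis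
qed

lemma relab_stack_inv:
  assumes "bij \<sigma>" "(x, y) \<in> stack_rel b (relab \<sigma> d)" shows "(lb (inv \<sigma>) x, lb (inv \<sigma>) y) \<in> stack_rel b d"
proof -
  have "inv \<sigma> \<circ> \<sigma> = id" using assms(1) by (simp add: bij_is_inj)
  then have "relab (inv \<sigma>) (relab \<sigma> d) = d" by (simp add: relab_comp)
  then show ?thesis using relab_stack[OF bij_imp_bij_inv[OF assms(1)] assms(2)] by simp
qed

lemma Gprime_relab:
  assumes "bij \<sigma>" shows "Gprime b (relab \<sigma> d) = relab \<sigma> (Gprime b d)"
proof -
  have "Gprime b (relab \<sigma> d) = vmap (mb \<sigma>) (Gprime b d)"
  proof (rule Gprime_transfer[OF mb_bij[OF assms], where k="lb \<sigma>" and s="lb (inv \<sigma>)"])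
    show "lb \<sigma> (inn u) = inn (mb \<sigma> u)" for u by (cases u) auto
    have "lb (inv \<sigma>) (inn (mb \<sigma> u)) = inn u" for u using assms by (cases u) (auto simp: bij_is_inj)
    then show "(lb (inv \<sigma>) (inn (mb \<sigma> u)), inn u) \<in> (stack_rel b d)\<^sup>*" for u by simp
  qed (use relab_stack[OF assms] relab_stack_inv[OF assms] in blast)+
  then show ?thesis by (simp add: relab_def)
qed

lemma ell_relab:
  assumes "bij \<sigma>" shows "ell n b (relab \<sigma> d) = ell n b d"
proof (rule ell_transfer[symmetric, where k="lb \<sigma>" and s="lb (inv \<sigma>)" and J=UNIV])
  show "x \<in> range Mid" if "lb \<sigma> x \<in> range Mid" for x using that by (cases x) auto
  show "x \<in> range Mid" if "lb (inv \<sigma>) x \<in> range Mid" for x using that by (cases x) auto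
qed (use relab_stack[OF assms] relab_stack_inv[OF assms] in auto)

subsection \<open>The basis of the left ideal\<close>

text \<open>With \<open>m\<close> vertical arcs and no occupied bottom vertex beyond
  \<open>m\<close>, the vertical arcs end exactly at \<open>1, ..., m\<close> and the bottom row
  contains no horizontal arc.\<close>

definition bd :: "nat \<Rightarrow> nat \<Rightarrow> diagram set" where
  "bd n m = {d \<in> diagrams n. nvert d = m \<and> (\<forall>j. Bot j \<in> \<Union>d \<longrightarrow> j \<in> {1..m})}"

lemma bd_diagrams: "d \<in> bd n m \<Longrightarrow> d \<in> diagrams n" by (simp add: bd_def)

lemma finite_bd [simp]: "finite (bd n m)"
  using finite_diagrams by (rule finite_subset[rotated]) (auto simp: bd_def)

text \<open>A vertical arc is determined by its bottom end, because vertices have degree at most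
  one.\<close>

lemma nvert_bots:
  assumes d: "d \<in> diagrams n" shows "nvert d = card {j. \<exists>i. {Top i, Bot j} \<in> d}"
proof -
  have "bij_betw (\<lambda>j. {THE u. {u, Bot j} \<in> d, Bot j}) {j. \<exists>i. {Top i, Bot j} \<in> d} {e \<in> d. vertical e}"
  proof (rule bij_betwI[where g="\<lambda>e. THE j. Bot j \<in> e"])
    have the: "(THE u. {u, Bot j} \<in> d) = Top i" if "{Top i, Bot j} \<in> d" for i j
      using that diagram_partner[OF d] by (intro the_equality) (auto simp: insert_commute)
    have the2: "(THE j'. Bot j' \<in> {Top i, Bot j}) = j" for i j by (rule the_equality) auto
    show "(\<lambda>j. {THE u. {u, Bot j} \<in> d, Bot j}) \<in> {j. \<exists>i. {Top i, Bot j} \<in> d} \<rightarrow> {e \<in> d. vertical e}"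
      using the by (auto simp: vertical_def doubleton_eq_iff)
    show "(\<lambda>e. THE j. Bot j \<in> e) \<in> {e \<in> d. vertical e} \<rightarrow> {j. \<exists>i. {Top i, Bot j} \<in> d}"
      using the2 by (auto simp: vertical_def)
    show "(THE j'. Bot j' \<in> {THE u. {u, Bot j} \<in> d, Bot j}) = j" if "j \<in> {j. \<exists>i. {Top i, Bot j} \<in> d}" for j
      using that the the2 by auto
    show "{THE u. {u, Bot (THE j. Bot j \<in> e)} \<in> d, Bot (THE j. Bot j \<in> e)} = e" if "e \<in> {e \<in> d. vertical e}" for e
      using that the the2 by (auto simp: vertical_def)
  qed
  from bij_betw_same_card[OF this] show ?thesis unfolding nvert_def by (rule sym)
qed

lemma bd_iff: "d \<in> bd n m \<longleftrightarrow> d \<in> diagrams n \<and> (\<forall>j\<in>{1..m}. \<exists>i. {Top i, Bot j} \<in> d) \<and> (\<forall>j. Bot j \<in> \<Union>d \<longrightarrow> j \<in> {1..m})"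
proof (cases "d \<in> diagrams n \<and> (\<forall>j. Bot j \<in> \<Union>d \<longrightarrow> j \<in> {1..m})")
  case True
  then have d: "d \<in> diagrams n" by simp
  have sub: "{j. \<exists>i. {Top i, Bot j} \<in> d} \<subseteq> {1..m}" using True by blast
  have "nvert d = m \<longleftrightarrow> {j. \<exists>i. {Top i, Bot j} \<in> d} = {1..m}"
  proof
    assume "nvert d = m"
    then have "card {j. \<exists>i. {Top i, Bot j} \<in> d} = card {1..m}" unfolding nvert_bots[OF d] by simp
    then show "{j. \<exists>i. {Top i, Bot j} \<in> d} = {1..m}" by (rule card_subset_eq[OF finite_atLeastAtMost sub])
  qed (simp add: nvert_bots[OF d])
  also have "\<dots> \<longleftrightarrow> {1..m} \<subseteq> {j. \<exists>i. {Top i, Bot j} \<in> d}" unfolding set_eq_subset by (simp only: sub simp_thms)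
  also have "\<dots> \<longleftrightarrow> (\<forall>j\<in>{1..m}. \<exists>i. {Top i, Bot j} \<in> d)" unfolding subset_iff mem_Collect_eq Ball_def ..
  finally show ?thesis using True unfolding bd_def mem_Collect_eq by simp
qed (auto simp: bd_def)

text \<open>A path reaches the bottom row only through an edge of the lower diagram.\<close>

lemma Gprime_bot:
  assumes "Bot j \<in> \<Union>(Gprime b c)" shows "Bot j \<in> \<Union>c"
proof -
  obtain e where e: "e \<in> Gprime b c" "Bot j \<in> e" using assms by blast
  obtain u v where uv: "e = {u, v}" "u \<noteq> v" "(inn u, inn v) \<in> (stack_rel b c)\<^sup>*" using e(1) by (rule Gprime_edge)
  have "u = Bot j \<or> v = Bot j" using e(2) uv(1) by auto
  then have "\<exists>w. w \<noteq> Bot j \<and> (L j, inn w) \<in> (stack_rel b c)\<^sup>*"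
  proof
    assume "u = Bot j" then show ?thesis using uv(2,3) by (intro exI[of _ v]) auto
  next
    assume "v = Bot j" then show ?thesis using uv(2) stack_rtrancl_sym[OF uv(3)] by (intro exI[of _ u]) auto
  qed
  then obtain w where w: "w \<noteq> Bot j" "(L j, inn w) \<in> (stack_rel b c)\<^sup>*" by blast
  moreover have "inn w \<noteq> L j" using w(1) by (cases w) auto
  ultimately obtain y where "(L j, y) \<in> stack_rel b c" by (metis converse_rtranclE)
  moreover have "upper u \<noteq> L j" for u by (cases u) auto
  ultimately obtain u v where "{u, v} \<in> c" "L j = lower u" unfolding stack_rel_iff by metis
  moreover from this have "u = Bot j" by (cases u) auto
  ultimately show ?thesis by blast
qed

lemma Gprime_bd:
  assumes "b \<in> diagrams n" "c \<in> diagrams n" "\<And>j. Bot j \<in> \<Union>c \<Longrightarrow> j \<in> {1..m}" "nvert (Gprime b c) = m"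
  shows "Gprime b c \<in> bd n m"
  using assms Gprime_diagrams[OF assms(1,2)] Gprime_bot unfolding bd_def by blast

lemma verts_mb: "\<sigma> permutes {1..m} \<Longrightarrow> m \<le> n \<Longrightarrow> mb \<sigma> u \<in> verts n \<longleftrightarrow> u \<in> verts n"
  by (cases u) (use permutes_in_image[OF permutes_subset[of \<sigma> "{1..m}" "{1..n}"]] in \<open>auto simp: verts_def\<close>)

lemma vmap_diagrams:
  assumes "inj f" "d \<in> diagrams n" "\<And>u. u \<in> \<Union>d \<Longrightarrow> f u \<in> verts n'" shows "vmap f d \<in> diagrams n'"
proof (rule diagramsI)
  fix e assume "e \<in> vmap f d"
  then obtain e' where e': "e' \<in> d" "e = f ` e'" by (auto simp: vmap_def)
  obtain u v where "e' = {u, v}" "u \<noteq> v" using diagram_edge[OF assms(2) e'(1)] by blast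
  then have "e = {f u, f v}" "f u \<noteq> f v" "f u \<in> verts n'" "f v \<in> verts n'"
    using e' assms(1) by (auto simp: inj_eq intro!: assms(3))
  then show "\<exists>u v. e = {u, v} \<and> u \<noteq> v \<and> u \<in> verts n' \<and> v \<in> verts n'" by blast
next
  fix e1 e2 u assume "e1 \<in> vmap f d" "e2 \<in> vmap f d" and u: "u \<in> e1" "u \<in> e2"
  then obtain e1' e2' where e: "e1' \<in> d" "e1 = f ` e1'" "e2' \<in> d" "e2 = f ` e2'" by (auto simp: vmap_def)
  then obtain v where "v \<in> e1'" "v \<in> e2'" using u assms(1) by (auto simp: inj_eq)
  then show "e1 = e2" using e diagram_edge_eq[OF assms(2) e(1,3)] by blast
qed

lemma bd_le: assumes "d \<in> bd n m" shows "m \<le> n"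
proof (cases "m = 0")
  case False
  then have "m \<in> {1..m}" by simp
  then obtain i where "{Top i, Bot m} \<in> d" using assms by (metis bd_iff)
  then have "Bot m \<in> verts n" using diagram_verts[OF bd_diagrams[OF assms]] by blast
  then show ?thesis by (auto simp: verts_def)
qed simp

lemma relab_bd:
  assumes s: "\<sigma> permutes {1..m}" and d: "d \<in> bd n m" shows "relab \<sigma> d \<in> bd n m"
proof -
  have inj: "inj (mb \<sigma>)" using mb_bij[OF permutes_bij[OF s]] by (rule bij_is_inj)
  have mn: "m \<le> n" by (rule bd_le[OF d])
  have "relab \<sigma> d \<in> diagrams n"
    unfolding relab_def by (rule vmap_diagrams[OF inj bd_diagrams[OF d]])
      (use verts_mb[OF s mn] diagram_Union[OF bd_diagrams[OF d]] in blast)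
  moreover have "\<exists>i. {Top i, Bot j} \<in> relab \<sigma> d" if j: "j \<in> {1..m}" for j
  proof -
    have "inv \<sigma> j \<in> {1..m}" using permutes_in_image[OF permutes_inv[OF s]] j by blast
    then obtain i where "{Top i, Bot (inv \<sigma> j)} \<in> d" using d by (metis bd_iff)
    then have "{mb \<sigma> (Top i), mb \<sigma> (Bot (inv \<sigma> j))} \<in> relab \<sigma> d" unfolding relab_def vmap_iff[OF inj] .
    then show ?thesis using permutes_inverses[OF s] by auto
  qed
  moreover have "j \<in> {1..m}" if b: "Bot j \<in> \<Union>(relab \<sigma> d)" for j
  proof -
    obtain u where "u \<in> \<Union>d" "Bot j = mb \<sigma> u" using b unfolding relab_def vmap_Union by blast
    then obtain j' where "Bot j' \<in> \<Union>d" "j = \<sigma> j'" by (cases u) auto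
    then have "j' \<in> {1..m}" using d by (metis bd_iff)
    then show ?thesis using permutes_in_image[OF s] \<open>j = \<sigma> j'\<close> by blast
  qed
  ultimately show ?thesis by (simp add: bd_iff)
qed

lemma relab_bij:
  assumes "\<sigma> permutes {1..m}" shows "bij_betw (relab \<sigma>) (bd n m) (bd n m)"
  by (rule bij_betwI[where g="relab (inv \<sigma>)"])
    (use relab_bd[OF assms] relab_bd[OF permutes_inv[OF assms]] relab_inv[OF assms] in auto)

text \<open>The range \<open>k\<close> is left open to cover both the truncated identity
  \<open>u_diag m\<close> with \<open>k = m\<close> and the full permutation diagram with
  \<open>k = n\<close>; the bottom vertices of \<open>d\<close> beyond \<open>m\<close> are
  isolated.\<close>

lemma Gprime_perm:
  assumes d: "d \<in> bd n m" and s: "\<sigma> permutes {1..m}" and k: "m \<le> k"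
    and c: "c = {{Top (\<sigma> i), Bot i} | i. i \<in> {1..k}}"
  shows "Gprime d c = relab (inv \<sigma>) d"
proof -
  let ?r = "mb (inv \<sigma>)"
  have si: "inv \<sigma> permutes {1..m}" by (rule permutes_inv[OF s])
  have inj: "inj ?r" using mb_bij[OF permutes_bij[OF si]] by (rule bij_is_inj)
  have rd: "relab (inv \<sigma>) d \<in> diagrams n" using relab_bd[OF si d] bd_diagrams by blast
  \<comment> \<open>Sends a middle vertex to the bottom vertex at the other end of its permutation
    arc; connectivity then collapses to single edges of the relabelled diagram.\<close>
  define cls where "cls p = (case p of U a \<Rightarrow> Top a | Mid j \<Rightarrow> Bot (inv \<sigma> j) | L i \<Rightarrow> Bot i)" for p
  have cu: "cls (upper u) = ?r u" for u by (cases u) (auto simp: cls_def)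
  have ci: "cls (inn u) = u" for u by (cases u) (auto simp: cls_def)
  have onestep: "cls x = cls y \<or> {cls x, cls y} \<in> relab (inv \<sigma>) d" if "(x, y) \<in> stack_rel d c" for x y
    using that unfolding stack_rel_iff
  proof
    assume "\<exists>u v. {u, v} \<in> d \<and> x = upper u \<and> y = upper v"
    then show ?thesis using cu vmap_iff[OF inj] unfolding relab_def by metis
  next
    assume "\<exists>u v. {u, v} \<in> c \<and> x = lower u \<and> y = lower v"
    then obtain u v i where uv: "{u, v} = {Top (\<sigma> i), Bot i}" "x = lower u" "y = lower v" unfolding c by blast
    have "cls (lower (Top (\<sigma> i))) = Bot i" using permutes_inverses[OF s] by (simp add: cls_def)
    moreover have "cls (lower (Bot i)) = Bot i" by (simp add: cls_def)
    ultimately show ?thesis using uv by (auto simp: doubleton_eq_iff)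
  qed
  have path: "cls x = cls y \<or> {cls x, cls y} \<in> relab (inv \<sigma>) d" if "(x, y) \<in> (stack_rel d c)\<^sup>*" for x y
    using that
  proof (induction rule: rtrancl_induct)
    case (step y z)
    then show ?case using onestep[OF step(2)] diagram_partner[OF rd]
      by (metis insert_commute)
  qed simp
  have conv: "(inn u, inn v) \<in> (stack_rel d c)\<^sup>*" if uvd: "{u, v} \<in> relab (inv \<sigma>) d" for u v
  proof -
    obtain u' v' where uv: "{u', v'} \<in> d" "u = ?r u'" "v = ?r v'" using uvd unfolding relab_def vmap_mem_iff[OF inj] by blast
    have con: "(upper w, inn (?r w)) \<in> (stack_rel d c)\<^sup>*" if w: "w \<in> \<Union>d" for w
    proof (cases w)
      case (Bot j)
      then have "j \<in> {1..m}" using d w by (metis bd_iff)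
      then have "inv \<sigma> j \<in> {1..k}" using permutes_in_image[OF si, of j] k by auto
      then have "{Top (\<sigma> (inv \<sigma> j)), Bot (inv \<sigma> j)} \<in> c" unfolding c by blast
      then have "(lower (Top j), lower (Bot (inv \<sigma> j))) \<in> stack_rel d c"
        using stack_lower permutes_inverses[OF s] by metis
      then show ?thesis using Bot by simp
    qed simp
    have "u' \<in> \<Union>d" "v' \<in> \<Union>d" using uv(1) by auto
    then show ?thesis using con[of u'] con[of v'] stack_upper[OF uv(1), of c] uv(2,3)
      by (meson r_into_rtrancl rtrancl_trans stack_rtrancl_sym)
  qed
  show ?thesis
  proof (intro set_eqI iffI)
    fix e assume "e \<in> Gprime d c"
    then obtain u v where "e = {u, v}" "u \<noteq> v" "(inn u, inn v) \<in> (stack_rel d c)\<^sup>*" by (rule Gprime_edge)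
    then show "e \<in> relab (inv \<sigma>) d" using path[of "inn u" "inn v"] ci by auto
  next
    fix e assume e: "e \<in> relab (inv \<sigma>) d"
    then obtain u v where "e = {u, v}" "u \<noteq> v" using diagram_edge[OF rd] by blast
    then show "e \<in> Gprime d c" using conv e Gprime_iff by blast
  qed
qed

lemma ell_perm:
  assumes s: "\<sigma> permutes {1..n}" shows "ell n d (perm_diag n \<sigma>) = 0"
proof -
  have "\<not> conn d (perm_diag n \<sigma>) (Mid i) \<subseteq> range Mid" if i: "i \<in> {1..n}" for i
  proof -
    have "inv \<sigma> i \<in> {1..n}" using permutes_in_image[OF permutes_inv[OF s]] i by blast
    then have "{Top (\<sigma> (inv \<sigma> i)), Bot (inv \<sigma> i)} \<in> perm_diag n \<sigma>" unfolding perm_diag_def by blast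
    then have "(lower (Top i), lower (Bot (inv \<sigma> i))) \<in> stack_rel d (perm_diag n \<sigma>)"
      using stack_lower permutes_inverses[OF s] by metis
    then have "L (inv \<sigma> i) \<in> conn d (perm_diag n \<sigma>) (Mid i)" by (auto simp: conn_def)
    then show ?thesis by auto
  qed
  then have "{C. \<exists>i\<in>{1..n}. C = conn d (perm_diag n \<sigma>) (Mid i) \<and> C \<subseteq> range Mid} = {}" by blast
  then show ?thesis unfolding ell_def by simp
qed

section \<open>Equivariant functions on diagrams\<close>

text \<open>The number of arcs, the size of the shape and the range of equivariance are independent
  parameters: all three agree for the modules themselves, while the quotient has
  \<open>m + 1\<close> arcs, a shape of size \<open>m\<close> and equivariance for \<open>m\<close>
  letters. The value \<open>0\<close> outside \<open>bd\<close> makes the functions unique.\<close>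

definition EQ :: "'a::field_char_0 \<Rightarrow> nat \<Rightarrow> nat \<Rightarrow> nat list \<Rightarrow> nat \<Rightarrow> (diagram \<Rightarrow> (nat \<Rightarrow> nat) \<Rightarrow> 'a, 'a, diagram) amod" where
  "EQ x n m lam k = \<lparr> mcar = {F. (\<forall>d. d \<notin> bd n m \<longrightarrow> F d = 0) \<and> (\<forall>d\<in>bd n m. F d \<in> specht lam)
        \<and> (\<forall>\<rho> d. \<rho> permutes {1..k} \<longrightarrow> d \<in> bd n m \<longrightarrow> F (relab \<rho> d) = perm_act \<rho> (F d))},
      madd = (+), mzero = 0, msmul = (\<lambda>c F d. vsmul c (F d)),
      mact = (\<lambda>b F e. \<Sum>d\<in>bd n m. vsmul (prodI x n m b d e) (F d)) \<rparr>"

text \<open>Homomorphisms are controlled on carriers only; inverting one of them requires that the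
  operations stay inside the carrier.\<close>

definition mclosed :: "'d set \<Rightarrow> ('e, 'a, 'd) amod \<Rightarrow> bool" where
  "mclosed D M \<longleftrightarrow> (\<forall>u\<in>mcar M. \<forall>v\<in>mcar M. madd M u v \<in> mcar M) \<and> (\<forall>c. \<forall>v\<in>mcar M. msmul M c v \<in> mcar M)
    \<and> (\<forall>d\<in>D. \<forall>v\<in>mcar M. mact M d v \<in> mcar M)"

lemma in_EQ: "F \<in> mcar (EQ x n m lam k) \<longleftrightarrow> (\<forall>d. d \<notin> bd n m \<longrightarrow> F d = 0) \<and> (\<forall>d\<in>bd n m. F d \<in> specht lam)
        \<and> (\<forall>\<rho> d. \<rho> permutes {1..k} \<longrightarrow> d \<in> bd n m \<longrightarrow> F (relab \<rho> d) = perm_act \<rho> (F d))"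
  by (simp add: EQ_def)

lemma EQ_simps [simp]: "madd (EQ x n m lam k) F G = F + G" "mzero (EQ x n m lam k) = 0"
  "msmul (EQ x n m lam k) c F = (\<lambda>d. vsmul c (F d))"
  "mact (EQ x n m lam k) b F = (\<lambda>e. \<Sum>d\<in>bd n m. vsmul (prodI x n m b d e) (F d))"
  by (simp_all add: EQ_def)

lemma EQ_D:
  assumes "F \<in> mcar (EQ x n m lam k)"
  shows "d \<notin> bd n m \<Longrightarrow> F d = 0" "d \<in> bd n m \<Longrightarrow> F d \<in> specht lam"
    "\<rho> permutes {1..k} \<Longrightarrow> d \<in> bd n m \<Longrightarrow> F (relab \<rho> d) = perm_act \<rho> (F d)"
  using assms unfolding in_EQ by blast+

lemma nvert_relab: "bij \<sigma> \<Longrightarrow> nvert (relab \<sigma> d) = nvert d"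
proof -
  assume s: "bij \<sigma>"
  have inj: "inj (mb \<sigma>)" using mb_bij[OF s] by (rule bij_is_inj)
  have v: "vertical (mb \<sigma> ` e) \<longleftrightarrow> vertical e" for e
  proof
    assume "vertical (mb \<sigma> ` e)"
    then obtain i j where ij: "mb \<sigma> ` e = {Top i, Bot j}" by (auto simp: vertical_def)
    obtain j' where j': "j = \<sigma> j'" using s by (metis bij_pointE)
    have "mb \<sigma> ` e = mb \<sigma> ` {Top i, Bot j'}" using ij j' by simp
    then have "e = {Top i, Bot j'}" using inj by (simp only: inj_image_eq_iff)
    then show "vertical e" by (auto simp: vertical_def)
  next
    assume "vertical e"
    then obtain i j where "e = {Top i, Bot j}" by (auto simp: vertical_def)
    then have "mb \<sigma> ` e = {Top i, Bot (\<sigma> j)}" by simp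
    then show "vertical (mb \<sigma> ` e)" unfolding vertical_def by blast
  qed
  have "{e \<in> relab \<sigma> d. vertical e} = (image (mb \<sigma>)) ` {e \<in> d. vertical e}"
    using v by (auto simp: relab_def vmap_def)
  moreover have "inj_on (image (mb \<sigma>)) {e \<in> d. vertical e}" using inj by (simp add: inj_on_def inj_image_eq_iff)
  ultimately show ?thesis by (simp add: nvert_def card_image)
qed

lemma relab_inj: "\<sigma> permutes S \<Longrightarrow> relab \<sigma> d = relab \<sigma> e \<longleftrightarrow> d = e"
  by (metis relab_inv(1))

text \<open>Left multiplication commutes with relabelling of the bottom row, which is a right
  multiplication.\<close>

lemma prodI_relab:
  assumes "\<sigma> permutes S" shows "prodI x n m b (relab \<sigma> d) (relab \<sigma> e) = prodI x n m b d e"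
  unfolding prodI_def Gprime_relab[OF permutes_bij[OF assms]] ell_relab[OF permutes_bij[OF assms]]
    nvert_relab[OF permutes_bij[OF assms]] relab_inj[OF assms] ..

lemma prodI_in_bd:
  assumes "b \<in> diagrams n" "d \<in> bd n m" "prodI x n m b d e \<noteq> 0" shows "e \<in> bd n m"
proof -
  have e: "nvert (Gprime b d) = m" "e = Gprime b d" using assms(3) by (auto simp: prodI_def split: if_splits)
  show ?thesis unfolding e(2)
    by (rule Gprime_bd[OF assms(1) bd_diagrams[OF assms(2)] _ e(1)]) (use assms(2)[unfolded bd_iff] in blast)
qed

lemma prodI_val: "e \<in> bd n m \<Longrightarrow> prodI x n m b d e = (if e = Gprime b d then x ^ ell n b d else 0)"
  by (auto simp: prodI_def bd_def)

lemma EQ_closed: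
  assumes k: "k \<le> m" "k \<le> sum_list lam" shows "mclosed (diagrams n) (EQ x n m lam k)"
  unfolding mclosed_def
proof (intro conjI ballI allI)
  fix F G assume F: "F \<in> mcar (EQ x n m lam k)" and G: "G \<in> mcar (EQ x n m lam k)"
  show "madd (EQ x n m lam k) F G \<in> mcar (EQ x n m lam k)"
    unfolding in_EQ EQ_simps
  proof (intro conjI allI impI ballI)
    show "(F + G) d = 0" if "d \<notin> bd n m" for d
      by (simp only: plus_fun_apply EQ_D(1)[OF F that] EQ_D(1)[OF G that] add_0)
    show "(F + G) d \<in> specht lam" if "d \<in> bd n m" for d
      by (simp only: plus_fun_apply fv.subspace_add[OF specht_subspace EQ_D(2)[OF F that] EQ_D(2)[OF G that]])
    show "(F + G) (relab \<rho> d) = perm_act \<rho> ((F + G) d)" if "\<rho> permutes {1..k}" "d \<in> bd n m" for \<rho> d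
      by (simp only: plus_fun_apply EQ_D(3)[OF F that] EQ_D(3)[OF G that] perm_act_lin)
  qed
next
  fix c F assume F: "F \<in> mcar (EQ x n m lam k)"
  show "msmul (EQ x n m lam k) c F \<in> mcar (EQ x n m lam k)"
    unfolding in_EQ EQ_simps
  proof (intro conjI allI impI ballI)
    show "vsmul c (F d) = 0" if "d \<notin> bd n m" for d by (simp only: EQ_D(1)[OF F that] fv.scale_zero_right)
    show "vsmul c (F d) \<in> specht lam" if "d \<in> bd n m" for d
      by (rule fv.subspace_scale[OF specht_subspace EQ_D(2)[OF F that]])
    show "vsmul c (F (relab \<rho> d)) = perm_act \<rho> (vsmul c (F d))" if "\<rho> permutes {1..k}" "d \<in> bd n m" for \<rho> d
      by (simp only: EQ_D(3)[OF F that] perm_act_lin)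
  qed
next
  fix b F assume b: "b \<in> diagrams n" and F: "F \<in> mcar (EQ x n m lam k)"
  have "(\<Sum>d\<in>bd n m. vsmul (prodI x n m b d e) (F d)) = 0" if "e \<notin> bd n m" for e
    by (rule sum.neutral) (use prodI_in_bd[OF b] that in \<open>metis fv.scale_zero_left\<close>)
  moreover have "(\<Sum>d\<in>bd n m. vsmul (prodI x n m b d e) (F d)) \<in> specht lam" for e
    by (intro fv.subspace_sum[OF specht_subspace] fv.subspace_scale[OF specht_subspace] EQ_D(2)[OF F])
  moreover have "(\<Sum>d\<in>bd n m. vsmul (prodI x n m b d (relab \<rho> e)) (F d)) = perm_act \<rho> (\<Sum>d\<in>bd n m. vsmul (prodI x n m b d e) (F d))"
    if r: "\<rho> permutes {1..k}" for \<rho> e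
  proof -
    have r': "\<rho> permutes {1..m}" by (rule permutes_subset[OF r]) (use k in auto)
    have "(\<Sum>d\<in>bd n m. vsmul (prodI x n m b d (relab \<rho> e)) (F d)) = (\<Sum>d\<in>bd n m. vsmul (prodI x n m b (relab \<rho> d) (relab \<rho> e)) (F (relab \<rho> d)))"
      by (rule sum.reindex_bij_betw[OF relab_bij[OF r'], symmetric])
    also have "\<dots> = (\<Sum>d\<in>bd n m. vsmul (prodI x n m b d e) (perm_act \<rho> (F d)))"
      unfolding prodI_relab[OF r'] by (rule sum.cong[OF refl]) (simp only: EQ_D(3)[OF F r])
    finally show ?thesis unfolding perm_act_lin .
  qed
  ultimately show "mact (EQ x n m lam k) b F \<in> mcar (EQ x n m lam k)"
    unfolding in_EQ EQ_simps by blast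
qed

abbreviation CMod :: "'a::field_char_0 \<Rightarrow> nat \<Rightarrow> nat list \<Rightarrow> (diagram \<Rightarrow> (nat \<Rightarrow> nat) \<Rightarrow> 'a, 'a, diagram) amod" where
  "CMod x n lam \<equiv> EQ x n (sum_list lam) lam (sum_list lam)"

section \<open>The tensor product as a space of equivariant functions\<close>

definition Vsp :: "nat \<Rightarrow> nat \<Rightarrow> (diagram \<Rightarrow> 'a::field) set" where
  "Vsp n m = {f. \<forall>d. f d \<noteq> 0 \<longrightarrow> d \<in> bd n m}"

lemma Vsp_subspace: "fv.subspace (Vsp n m)"
  unfolding fv.subspace_def Vsp_def by (auto simp: vsmul_apply) (metis add.right_neutral)

lemma dlt_Vsp: "d \<in> bd n m \<Longrightarrow> dlt d \<in> Vsp n m"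
  by (simp add: Vsp_def dlt_def)

lemma Vsp_expand:
  assumes "f \<in> Vsp n m" shows "f = (\<Sum>d\<in>bd n m. vsmul (f d) (dlt d))"
proof
  fix e
  have "(\<Sum>d\<in>bd n m. vsmul (f d) (dlt d)) e = (\<Sum>d\<in>bd n m. if d = e then f d else 0)"
    unfolding sum_fun_apply by (rule sum.cong[OF refl]) (simp add: vsmul_apply dlt_def)
  also have "\<dots> = f e" using assms by (auto simp: Vsp_def)
  finally show "f e = (\<Sum>d\<in>bd n m. vsmul (f d) (dlt d)) e" ..
qed

lemma Ibasis_le: assumes "d \<in> Ibasis n m" shows "m \<le> n"
proof -
  have d: "d \<in> diagrams n" "nvert d = m" using assms by (auto simp: Ibasis_def)
  have "{j. \<exists>i. {Top i, Bot j} \<in> d} \<subseteq> {1..n}" using diagram_verts[OF d(1)] by (fastforce simp: verts_def)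
  then have "card {j. \<exists>i. {Top i, Bot j} \<in> d} \<le> card {1..n}" by (intro card_mono) auto
  then show ?thesis using nvert_bots[OF d(1)] d(2) by simp
qed

lemma u_diag_diagrams: assumes "m \<le> n" shows "u_diag m \<in> diagrams n"
proof (rule diagramsI)
  fix e assume "e \<in> u_diag m"
  then obtain i where "e = {Top i, Bot i}" "i \<in> {1..m}" by (auto simp: u_diag_def)
  then show "\<exists>u v. e = {u, v} \<and> u \<noteq> v \<and> u \<in> verts n \<and> v \<in> verts n"
    using assms by (intro exI[of _ "Top i"] exI[of _ "Bot i"]) (auto simp: verts_def)
qed (auto simp: u_diag_def)

lemma Gprime_u: "d \<in> bd n m \<Longrightarrow> Gprime d (u_diag m) = d"
  using Gprime_perm[of d n m id m "u_diag m"] by (simp add: permutes_id u_diag_def inv_id)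

lemma finite_Ibasis: "finite (Ibasis n m)"
  using finite_diagrams by (rule finite_subset[rotated]) (auto simp: Ibasis_def)

lemma bd_Ibasis: "bd n m \<subseteq> Ibasis n m"
  by (auto simp: bd_def Ibasis_def)

text \<open>Here the nonvanishing of \<open>x\<close> enters: multiplying a basis diagram by
  \<open>u_diag m\<close> reproduces it up to a power of \<open>x\<close>, which has to be
  inverted.\<close>

lemma left_ideal_eq:
  fixes x :: "'a::field" assumes x: "x \<noteq> 0" shows "left_ideal x n m = Vsp n m"
proof (intro set_eqI iffI)
  fix v assume "v \<in> left_ideal x n m"
  then obtain f where v: "v = Iright x n m f (u_diag m)" by (auto simp: left_ideal_def)
  have "e \<in> bd n m" if e: "v e \<noteq> 0" for e
  proof -
    obtain d where d: "d \<in> Ibasis n m" "f d * prodI x n m d (u_diag m) e \<noteq> 0"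
      using e unfolding v Iright_def by (metis (no_types, lifting) sum.neutral)
    then have "nvert (Gprime d (u_diag m)) = m" "e = Gprime d (u_diag m)" by (auto simp: prodI_def split: if_splits)
    moreover have "d \<in> diagrams n" using d(1) by (simp add: Ibasis_def)
    moreover have "j \<in> {1..m}" if "Bot j \<in> \<Union>(u_diag m)" for j using that by (auto simp: u_diag_def)
    ultimately show ?thesis using Gprime_bd[OF _ u_diag_diagrams[OF Ibasis_le[OF d(1)]]] by blast
  qed
  then show "v \<in> Vsp n m" by (simp add: Vsp_def)
next
  fix v :: "diagram \<Rightarrow> 'a" assume v: "v \<in> Vsp n m"
  define f where "f d = v d / x ^ ell n d (u_diag m)" for d
  have f0: "f d = 0" if "d \<notin> bd n m" for d using v that by (auto simp: f_def Vsp_def)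
  have "Iright x n m f (u_diag m) e = v e" for e
  proof -
    have "Iright x n m f (u_diag m) e = (\<Sum>d\<in>bd n m. f d * prodI x n m d (u_diag m) e)"
      unfolding Iright_def by (rule sum.mono_neutral_right[OF finite_Ibasis bd_Ibasis]) (auto simp: f0)
    also have "\<dots> = (\<Sum>d\<in>bd n m. if d = e then v d else 0)"
    proof (rule sum.cong[OF refl])
      fix d assume d: "d \<in> bd n m"
      then have "nvert d = m" by (simp add: bd_def)
      then show "f d * prodI x n m d (u_diag m) e = (if d = e then v d else 0)"
        using x Gprime_u[OF d] by (auto simp: prodI_def f_def)
    qed
    also have "\<dots> = v e" using v by (auto simp: Vsp_def)
    finally show ?thesis .
  qed
  then have "v = Iright x n m f (u_diag m)" by (simp add: fun_eq_iff)
  moreover have "f \<in> Ispace n m" using f0 bd_Ibasis by (auto simp: Ispace_def)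
  ultimately show "v \<in> left_ideal x n m" by (auto simp: left_ideal_def)
qed

lemma Iright_perm:
  fixes x :: "'a::field"
  assumes v: "v \<in> Vsp n m" and s: "\<sigma> permutes {1..m}" and mn: "m \<le> n"
  shows "Iright x n m v (perm_diag n \<sigma>) = (\<lambda>e. v (relab \<sigma> e))"
proof
  fix e
  have sn: "\<sigma> permutes {1..n}" by (rule permutes_subset[OF s]) (use mn in auto)
  have v0: "v d = 0" if "d \<notin> bd n m" for d using v that by (auto simp: Vsp_def)
  have "Iright x n m v (perm_diag n \<sigma>) e = (\<Sum>d\<in>bd n m. v d * prodI x n m d (perm_diag n \<sigma>) e)"
    unfolding Iright_def by (rule sum.mono_neutral_right[OF finite_Ibasis bd_Ibasis]) (auto simp: v0)
  also have "\<dots> = (\<Sum>d\<in>bd n m. if d = relab \<sigma> e then v d else 0)"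
  proof (rule sum.cong[OF refl])
    fix d assume d: "d \<in> bd n m"
    have G: "Gprime d (perm_diag n \<sigma>) = relab (inv \<sigma>) d"
      by (rule Gprime_perm[OF d s mn]) (simp add: perm_diag_def)
    have "nvert (relab (inv \<sigma>) d) = m" using relab_bd[OF permutes_inv[OF s] d] by (simp add: bd_def)
    moreover have "e = relab (inv \<sigma>) d \<longleftrightarrow> d = relab \<sigma> e" using relab_inv[OF s] by metis
    ultimately show "v d * prodI x n m d (perm_diag n \<sigma>) e = (if d = relab \<sigma> e then v d else 0)"
      by (simp add: prodI_def G ell_perm[OF sn])
  qed
  also have "\<dots> = v (relab \<sigma> e)" using v0 by auto
  finally show "Iright x n m v (perm_diag n \<sigma>) e = v (relab \<sigma> e)" .
qed

lemma relab_notin: "\<sigma> permutes {1..m} \<Longrightarrow> d \<notin> bd n m \<Longrightarrow> relab \<sigma> d \<notin> bd n m"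
  by (metis permutes_inv relab_bd relab_inv(1))

text \<open>The image of \<open>v \<otimes> w\<close> under the isomorphism from the tensor product to equivariant functions.\<close>

definition bet :: "nat \<Rightarrow> (diagram \<Rightarrow> 'a::field_char_0) \<Rightarrow> ((nat \<Rightarrow> nat) \<Rightarrow> 'a) \<Rightarrow> diagram \<Rightarrow> (nat \<Rightarrow> nat) \<Rightarrow> 'a" where
  "bet m v w d = (\<Sum>\<sigma> | \<sigma> permutes {1..m}. vsmul (v (relab (inv \<sigma>) d)) (perm_act \<sigma> w))"

definition Theta :: "nat \<Rightarrow> ((diagram \<Rightarrow> 'a::field_char_0) \<times> ((nat \<Rightarrow> nat) \<Rightarrow> 'a) \<Rightarrow> 'a) \<Rightarrow> diagram \<Rightarrow> (nat \<Rightarrow> nat) \<Rightarrow> 'a" where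
  "Theta m h d = (\<Sum>p | h p \<noteq> 0. vsmul (h p) (bet m (fst p) (snd p) d))"

lemma Theta_superset:
  assumes "finite S" "{p. h p \<noteq> 0} \<subseteq> S" shows "Theta m h d = (\<Sum>p\<in>S. vsmul (h p) (bet m (fst p) (snd p) d))"
  unfolding Theta_def by (rule sum.mono_neutral_left[OF assms]) auto

lemma Theta_add:
  assumes "finite {p. h p \<noteq> 0}" "finite {p. h' p \<noteq> 0}" shows "Theta m (h + h') d = Theta m h d + Theta m h' d"
proof -
  let ?S = "{p. h p \<noteq> 0} \<union> {p. h' p \<noteq> 0}"
  have S: "finite ?S" using assms by simp
  have "Theta m (h + h') d = (\<Sum>p\<in>?S. vsmul ((h + h') p) (bet m (fst p) (snd p) d))"
    by (rule Theta_superset[OF S]) auto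
  also have "\<dots> = (\<Sum>p\<in>?S. vsmul (h p) (bet m (fst p) (snd p) d)) + (\<Sum>p\<in>?S. vsmul (h' p) (bet m (fst p) (snd p) d))"
    unfolding plus_fun_apply fv.scale_left_distrib sum.distrib ..
  also have "\<dots> = Theta m h d + Theta m h' d"
    using Theta_superset[OF S, of h m d] Theta_superset[OF S, of h' m d] by auto
  finally show ?thesis .
qed

lemma Theta_scale:
  assumes "finite {p. h p \<noteq> 0}" shows "Theta m (vsmul c h) d = vsmul c (Theta m h d)"
proof -
  have "Theta m (vsmul c h) d = (\<Sum>p | h p \<noteq> 0. vsmul (vsmul c h p) (bet m (fst p) (snd p) d))"
    by (rule Theta_superset[OF assms]) (auto simp: vsmul_apply)
  then show ?thesis unfolding Theta_def vsmul_apply[of c h] by (simp only: fv.scale_sum_right fv.scale_scale)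
qed

lemma Theta_pt: "Theta m (pt v w) d = bet m v w d"
proof -
  have "Theta m (pt v w) d = (\<Sum>p\<in>{(v, w)}. vsmul (pt v w p) (bet m (fst p) (snd p) d))"
    by (rule Theta_superset) (auto simp: pt_def)
  then show ?thesis by (simp add: pt_def)
qed

section \<open>The free space on pairs and its map to equivariant functions\<close>

lemma fspace_subspace: "fv.subspace (fspace V W :: ('v \<times> 'w \<Rightarrow> 'a::field) set)"
  unfolding fv.subspace_def
proof (intro conjI ballI allI)
  show "0 \<in> (fspace V W :: ('v \<times> 'w \<Rightarrow> 'a) set)" by (simp add: fspace_def)
  fix h h' :: "'v \<times> 'w \<Rightarrow> 'a" assume h: "h \<in> fspace V W" "h' \<in> fspace V W"
  have "{p. (h + h') p \<noteq> 0} \<subseteq> {p. h p \<noteq> 0} \<union> {p. h' p \<noteq> 0}" by auto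
  then have "finite {p. (h + h') p \<noteq> 0}" using h by (auto simp: fspace_def intro: finite_subset)
  moreover have "fst p \<in> V \<and> snd p \<in> W" if "(h + h') p \<noteq> 0" for p
  proof -
    have "h p \<noteq> 0 \<or> h' p \<noteq> 0" using that by auto
    then show ?thesis using h unfolding fspace_def by blast
  qed
  ultimately show "h + h' \<in> fspace V W" unfolding fspace_def by blast
next
  fix c and h :: "'v \<times> 'w \<Rightarrow> 'a" assume h: "h \<in> fspace V W"
  have "{p. vsmul c h p \<noteq> 0} \<subseteq> {p. h p \<noteq> 0}" by (auto simp: vsmul_apply)
  then have "finite {p. vsmul c h p \<noteq> 0}" using h by (auto simp: fspace_def intro: finite_subset)
  moreover have "fst p \<in> V \<and> snd p \<in> W" if "vsmul c h p \<noteq> 0" for p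
  proof -
    have "h p \<noteq> 0" using that by (auto simp: vsmul_apply)
    then show ?thesis using h unfolding fspace_def by blast
  qed
  ultimately show "vsmul c h \<in> fspace V W" unfolding fspace_def by blast
qed

lemma pt_fspace: "v \<in> V \<Longrightarrow> w \<in> W \<Longrightarrow> pt v w \<in> (fspace V W :: (_ \<Rightarrow> 'a::field) set)"
proof -
  assume "v \<in> V" "w \<in> W"
  moreover have "{p. pt v w p \<noteq> (0::'a)} \<subseteq> {(v, w)}" by (auto simp: pt_def)
  then have "finite {p. pt v w p \<noteq> (0::'a)}" by (rule finite_subset) simp
  ultimately show ?thesis by (auto simp: fspace_def pt_def split: if_splits)
qed

lemma fspace_expand:
  assumes "h \<in> fspace V W" shows "h = (\<Sum>p | h p \<noteq> 0. vsmul (h p) (pt (fst p) (snd p)))"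
proof
  fix q
  have fin: "finite {p. h p \<noteq> 0}" using assms by (simp add: fspace_def)
  have "(\<Sum>p | h p \<noteq> 0. vsmul (h p) (pt (fst p) (snd p))) q = (\<Sum>p | h p \<noteq> 0. if q = p then h p else 0)"
    unfolding sum_fun_apply by (rule sum.cong[OF refl]) (simp add: vsmul_apply pt_def)
  also have "\<dots> = h q" using fin by simp
  finally show "h q = (\<Sum>p | h p \<noteq> 0. vsmul (h p) (pt (fst p) (snd p))) q" ..
qed

text \<open>Several pairs may have the same image under \<open>Lm\<close>, hence the sum in the
  definition; for finite support it is the linear extension from single pairs.\<close>

lemma tact_expand:
  assumes "finite {p. h p \<noteq> 0}"
  shows "tact Lm h = (\<Sum>p | h p \<noteq> 0. vsmul (h p) (pt (Lm (fst p)) (snd p)))"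
proof
  fix q
  have "(\<Sum>p | h p \<noteq> 0. vsmul (h p) (pt (Lm (fst p)) (snd p))) q = (\<Sum>p | h p \<noteq> 0. if (Lm (fst p), snd p) = q then h p else 0)"
    unfolding sum_fun_apply by (rule sum.cong[OF refl]) (auto simp: vsmul_apply pt_def)
  also have "\<dots> = tact Lm h q"
    unfolding tact_def using sum.inter_filter[OF assms, of h "\<lambda>p. (Lm (fst p), snd p) = q"] by simp
  finally show "tact Lm h q = (\<Sum>p | h p \<noteq> 0. vsmul (h p) (pt (Lm (fst p)) (snd p))) q" ..
qed

lemma bet_zero:
  assumes "v \<in> Vsp n m" "d \<notin> bd n m" shows "bet m v w d = 0"
  unfolding bet_def
proof (rule sum.neutral, rule ballI)
  fix \<sigma> assume "\<sigma> \<in> {\<sigma>. \<sigma> permutes {1..m}}"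
  then have "inv \<sigma> permutes {1..m}" using permutes_inv by blast
  then have "relab (inv \<sigma>) d \<notin> bd n m" by (rule relab_notin[OF _ assms(2)])
  then have "v (relab (inv \<sigma>) d) = 0" using assms(1) by (auto simp: Vsp_def)
  then show "vsmul (v (relab (inv \<sigma>) d)) (perm_act \<sigma> w) = 0" by simp
qed

lemma bet_equivariant:
  assumes r: "\<rho> permutes {1..m}" shows "bet m v w (relab \<rho> d) = perm_act \<rho> (bet m v w d)"
proof -
  have "bet m v w (relab \<rho> d) = (\<Sum>\<sigma> | \<sigma> permutes {1..m}. vsmul (v (relab (inv (\<rho> \<circ> \<sigma>)) (relab \<rho> d))) (perm_act (\<rho> \<circ> \<sigma>) w))"
    unfolding bet_def by (rule setum_permutations_compose_left[OF r])
  also have "\<dots> = (\<Sum>\<sigma> | \<sigma> permutes {1..m}. perm_act \<rho> (vsmul (v (relab (inv \<sigma>) d)) (perm_act \<sigma> w)))"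
  proof (rule sum.cong[OF refl])
    fix \<sigma> assume "\<sigma> \<in> {\<sigma>. \<sigma> permutes {1..m}}"
    then have s: "\<sigma> permutes {1..m}" by simp
    have "inv (\<rho> \<circ> \<sigma>) \<circ> \<rho> = inv \<sigma>"
      using permutes_inv_o[OF r] o_inv_distrib[OF permutes_bij[OF r] permutes_bij[OF s]] by (simp add: comp_assoc)
    then show "vsmul (v (relab (inv (\<rho> \<circ> \<sigma>)) (relab \<rho> d))) (perm_act (\<rho> \<circ> \<sigma>) w) = perm_act \<rho> (vsmul (v (relab (inv \<sigma>) d)) (perm_act \<sigma> w))"
      by (simp only: relab_comp perm_act_lin perm_act_comp)
  qed
  finally show ?thesis unfolding bet_def perm_act_lin .
qed

text \<open>Translating the summation variable by \<open>\<rho>\<close> moves the group element from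
  one factor to the other; this makes \<open>bet\<close> factor through the tensor product over the
  group algebra.\<close>

lemma bet_balanced:
  assumes g: "\<rho> permutes {1..m}" shows "bet m (\<lambda>e. v (relab \<rho> e)) w d = bet m v (perm_act \<rho> w) d"
proof -
  have "bet m (\<lambda>e. v (relab \<rho> e)) w d = (\<Sum>\<sigma> | \<sigma> permutes {1..m}. vsmul (v (relab \<rho> (relab (inv (\<sigma> \<circ> \<rho>)) d))) (perm_act (\<sigma> \<circ> \<rho>) w))"
    unfolding bet_def by (rule sum_permutations_compose_right[OF g])
  also have "\<dots> = (\<Sum>\<sigma> | \<sigma> permutes {1..m}. vsmul (v (relab (inv \<sigma>) d)) (perm_act \<sigma> (perm_act \<rho> w)))"
  proof (rule sum.cong[OF refl])
    fix \<sigma> assume "\<sigma> \<in> {\<sigma>. \<sigma> permutes {1..m}}"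
    then have s: "\<sigma> permutes {1..m}" by simp
    have "\<rho> \<circ> inv (\<sigma> \<circ> \<rho>) = inv \<sigma>"
      using permutes_inv_o[OF g] o_inv_distrib[OF permutes_bij[OF s] permutes_bij[OF g]] by (simp add: comp_assoc[symmetric])
    then show "vsmul (v (relab \<rho> (relab (inv (\<sigma> \<circ> \<rho>)) d))) (perm_act (\<sigma> \<circ> \<rho>) w) = vsmul (v (relab (inv \<sigma>) d)) (perm_act \<sigma> (perm_act \<rho> w))"
      by (simp only: relab_comp perm_act_comp)
  qed
  finally show ?thesis unfolding bet_def .
qed

lemma bet_lin:
  "bet m (v + v') w d = bet m v w d + bet m v' w d" "bet m v (w + w') d = bet m v w d + bet m v w' d"
  "bet m (vsmul c v) w d = vsmul c (bet m v w d)" "bet m v (vsmul c w) d = vsmul c (bet m v w d)"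
  unfolding bet_def
  by (simp_all only: plus_fun_apply vsmul_apply[of c v] fv.scale_left_distrib fv.scale_right_distrib sum.distrib perm_act_lin
      fv.scale_sum_right fv.scale_scale mult.commute)

lemma bet_specht:
  "w \<in> specht lam \<Longrightarrow> sum_list lam = m \<Longrightarrow> bet m v w d \<in> specht lam"
  unfolding bet_def
  by (intro fv.subspace_sum[OF specht_subspace] fv.subspace_scale[OF specht_subspace] perm_act_specht) auto

lemma Ileft_Vsp:
  fixes x :: "'a::field_char_0"
  assumes "v \<in> Vsp n m"
  shows "Ileft x n m b v = (\<lambda>e. \<Sum>d\<in>bd n m. v d * prodI x n m b d e)"
  unfolding Ileft_def
  by (rule ext, rule sum.mono_neutral_right[OF finite_Ibasis bd_Ibasis]) (use assms in \<open>auto simp: Vsp_def\<close>)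

lemma Ileft_in_Vsp:
  fixes x :: "'a::field_char_0"
  assumes "b \<in> diagrams n" "v \<in> Vsp n m" shows "Ileft x n m b v \<in> Vsp n m"
proof -
  have "e \<in> bd n m" if ne: "(\<Sum>d\<in>bd n m. v d * prodI x n m b d e) \<noteq> 0" for e
  proof -
    obtain d where d: "d \<in> bd n m" "v d * prodI x n m b d e \<noteq> 0"
      by (rule sum.not_neutral_contains_not_neutral[OF ne])
    have "prodI x n m b d e \<noteq> 0" using d(2) by auto
    then show ?thesis by (rule prodI_in_bd[OF assms(1) d(1)])
  qed
  then show ?thesis unfolding Ileft_Vsp[OF assms(2)] Vsp_def by blast
qed

text \<open>The structure constants are invariant under simultaneous relabelling, so the left action
  commutes with the sum over the group in \<open>bet\<close>.\<close>

lemma bet_Ileft: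
  fixes x :: "'a::field_char_0"
  assumes v: "v \<in> Vsp n m"
  shows "bet m (Ileft x n m b v) w e = (\<Sum>d\<in>bd n m. vsmul (prodI x n m b d e) (bet m v w d))"
proof -
  have "bet m (Ileft x n m b v) w e
      = (\<Sum>\<sigma> | \<sigma> permutes {1..m}. vsmul (\<Sum>d\<in>bd n m. v d * prodI x n m b d (relab (inv \<sigma>) e)) (perm_act \<sigma> w))"
    unfolding bet_def Ileft_Vsp[OF v] ..
  also have "\<dots> = (\<Sum>\<sigma> | \<sigma> permutes {1..m}. \<Sum>d\<in>bd n m. vsmul (prodI x n m b d e) (vsmul (v (relab (inv \<sigma>) d)) (perm_act \<sigma> w)))"
  proof (rule sum.cong[OF refl])
    fix \<sigma> assume "\<sigma> \<in> {\<sigma>. \<sigma> permutes {1..m}}"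
    then have s: "inv \<sigma> permutes {1..m}" using permutes_inv by blast
    have "(\<Sum>d\<in>bd n m. v d * prodI x n m b d (relab (inv \<sigma>) e))
        = (\<Sum>d\<in>bd n m. v (relab (inv \<sigma>) d) * prodI x n m b (relab (inv \<sigma>) d) (relab (inv \<sigma>) e))"
      by (rule sum.reindex_bij_betw[OF relab_bij[OF s], symmetric])
    also have "\<dots> = (\<Sum>d\<in>bd n m. prodI x n m b d e * v (relab (inv \<sigma>) d))"
      unfolding prodI_relab[OF s] by (simp only: mult.commute)
    finally show "vsmul (\<Sum>d\<in>bd n m. v d * prodI x n m b d (relab (inv \<sigma>) e)) (perm_act \<sigma> w)
        = (\<Sum>d\<in>bd n m. vsmul (prodI x n m b d e) (vsmul (v (relab (inv \<sigma>) d)) (perm_act \<sigma> w)))"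
      by (simp only: fv.scale_sum_left fv.scale_scale)
  qed
  also have "\<dots> = (\<Sum>d\<in>bd n m. \<Sum>\<sigma> | \<sigma> permutes {1..m}. vsmul (prodI x n m b d e) (vsmul (v (relab (inv \<sigma>) d)) (perm_act \<sigma> w)))"
    by (rule sum.swap)
  also have "\<dots> = (\<Sum>d\<in>bd n m. vsmul (prodI x n m b d e) (bet m v w d))"
    unfolding bet_def fv.scale_sum_right ..
  finally show ?thesis .
qed

text \<open>Splits the error of a sum into the errors of its terms, for comparing finite sums modulo
  the relations.\<close>

lemma group_telescope: "(a :: 'c::ab_group_add) - (d + e) = (a - (b + c)) + ((b - d) + (c - e))"
  by (simp add: algebra_simps)

definition tens_null :: "'a::field_char_0 \<Rightarrow> nat \<Rightarrow> nat list \<Rightarrow> ((diagram \<Rightarrow> 'a) \<times> ((nat \<Rightarrow> nat) \<Rightarrow> 'a) \<Rightarrow> 'a) set" where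
  "tens_null x n lam = fv.span (tens_rels (Vsp n (sum_list lam)) (specht lam) {\<sigma>. \<sigma> permutes {1..sum_list lam}}
     (\<lambda>v \<sigma>. Iright x n (sum_list lam) v (perm_diag n \<sigma>)) perm_act)"

context
  fixes x :: "'a::field_char_0" and n m :: nat and lam :: "nat list"
  assumes x: "x \<noteq> 0" and lam: "is_partition m lam" and mn: "m \<le> n"
begin

abbreviation "VV \<equiv> Vsp n m :: (diagram \<Rightarrow> 'a) set"
abbreviation "WW \<equiv> specht lam :: ((nat \<Rightarrow> nat) \<Rightarrow> 'a) set"
abbreviation "NN \<equiv> tens_null x n lam"
abbreviation "FF \<equiv> fspace VV WW :: ((diagram \<Rightarrow> 'a) \<times> ((nat \<Rightarrow> nat) \<Rightarrow> 'a) \<Rightarrow> 'a) set"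

lemma slam: "sum_list lam = m" by (rule is_partition_sum[OF lam])

lemma NN_subspace: "fv.subspace NN"
  unfolding tens_null_def by (rule fv.subspace_span)

lemma NN_rels:
  "v \<in> VV \<Longrightarrow> v' \<in> VV \<Longrightarrow> w \<in> WW \<Longrightarrow> pt (v + v') w - (pt v w + pt v' w) \<in> NN"
  "v \<in> VV \<Longrightarrow> w \<in> WW \<Longrightarrow> w' \<in> WW \<Longrightarrow> pt v (w + w') - (pt v w + pt v w') \<in> NN"
  "v \<in> VV \<Longrightarrow> w \<in> WW \<Longrightarrow> pt (vsmul c v) w - vsmul c (pt v w) \<in> NN"
  "v \<in> VV \<Longrightarrow> w \<in> WW \<Longrightarrow> pt v (vsmul c w) - vsmul c (pt v w) \<in> NN"
  "v \<in> VV \<Longrightarrow> w \<in> WW \<Longrightarrow> \<sigma> permutes {1..m} \<Longrightarrow> pt (\<lambda>e. v (relab \<sigma> e)) w - pt v (perm_act \<sigma> w) \<in> NN"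
proof -
  let ?R = "tens_rels VV WW {\<sigma>. \<sigma> permutes {1..m}} (\<lambda>v \<sigma>. Iright x n m v (perm_diag n \<sigma>)) perm_act"
  have base: "r \<in> ?R \<Longrightarrow> r \<in> NN" for r unfolding tens_null_def slam by (rule fv.span_base)
  show "pt (v + v') w - (pt v w + pt v' w) \<in> NN" if "v \<in> VV" "v' \<in> VV" "w \<in> WW" for v v' w
  proof (rule base)
    have "pt (v + v') w - (pt v w + pt v' w) = (\<lambda>p. pt (vadd v v') w p - pt v w p - pt v' w p :: 'a)"
      by (simp add: fun_eq_iff vadd_eq)
    then show "pt (v + v') w - (pt v w + pt v' w) \<in> ?R" unfolding tens_rels_def using that by blast
  qed
  show "pt v (w + w') - (pt v w + pt v w') \<in> NN" if "v \<in> VV" "w \<in> WW" "w' \<in> WW" for v w w'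
  proof (rule base)
    have "pt v (w + w') - (pt v w + pt v w') = (\<lambda>p. pt v (vadd w w') p - pt v w p - pt v w' p :: 'a)"
      by (simp add: fun_eq_iff vadd_eq)
    then show "pt v (w + w') - (pt v w + pt v w') \<in> ?R" unfolding tens_rels_def using that by blast
  qed
  show "pt (vsmul c v) w - vsmul c (pt v w) \<in> NN" if "v \<in> VV" "w \<in> WW" for c v w
  proof (rule base)
    have "pt (vsmul c v) w - vsmul c (pt v w) = (\<lambda>p. pt (vsmul c v) w p - c * pt v w p :: 'a)"
      by (simp add: fun_eq_iff vsmul_apply)
    then show "pt (vsmul c v) w - vsmul c (pt v w) \<in> ?R" unfolding tens_rels_def using that by blast
  qed
  show "pt v (vsmul c w) - vsmul c (pt v w) \<in> NN" if "v \<in> VV" "w \<in> WW" for c v w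
  proof (rule base)
    have "pt v (vsmul c w) - vsmul c (pt v w) = (\<lambda>p. pt v (vsmul c w) p - c * pt v w p :: 'a)"
      by (simp add: fun_eq_iff vsmul_apply)
    then show "pt v (vsmul c w) - vsmul c (pt v w) \<in> ?R" unfolding tens_rels_def using that by blast
  qed
  show "pt (\<lambda>e. v (relab \<sigma> e)) w - pt v (perm_act \<sigma> w) \<in> NN" if "v \<in> VV" "w \<in> WW" "\<sigma> permutes {1..m}" for v w \<sigma>
  proof (rule base)
    have "pt (\<lambda>e. v (relab \<sigma> e)) w - pt v (perm_act \<sigma> w) = (\<lambda>p. pt (Iright x n m v (perm_diag n \<sigma>)) w p - pt v (perm_act \<sigma> w) p :: 'a)"
      unfolding Iright_perm[OF that(1,3) mn] by (simp add: fun_eq_iff)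
    then show "pt (\<lambda>e. v (relab \<sigma> e)) w - pt v (perm_act \<sigma> w) \<in> ?R" unfolding tens_rels_def using that by blast
  qed
qed

lemma fin_FF: "h \<in> FF \<Longrightarrow> finite {p. h p \<noteq> 0}"
  by (simp add: fspace_def)

lemma FF_D: "h \<in> FF \<Longrightarrow> h p \<noteq> 0 \<Longrightarrow> fst p \<in> VV" "h \<in> FF \<Longrightarrow> h p \<noteq> 0 \<Longrightarrow> snd p \<in> WW"
  unfolding fspace_def by blast+

lemma Theta_diff: "h \<in> FF \<Longrightarrow> h' \<in> FF \<Longrightarrow> Theta m (h - h') d = Theta m h d - Theta m h' d"
proof -
  assume h: "h \<in> FF" and h': "h' \<in> FF"
  have "h - h' = h + vsmul (-1) h'" by simp
  then have "Theta m (h - h') d = Theta m h d + Theta m (vsmul (-1) h') d"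
    using Theta_add[OF fin_FF[OF h] fin_FF[OF fv.subspace_scale[OF fspace_subspace h', of "-1"]], of m d] by (simp only:)
  also have "Theta m (vsmul (-1) h') d = vsmul (-1) (Theta m h' d)" by (rule Theta_scale[OF fin_FF[OF h']])
  finally show ?thesis by (simp only: fv.scale_minus_left fv.scale_one diff_conv_add_uminus)
qed

lemma relab_Vsp: "v \<in> VV \<Longrightarrow> \<sigma> permutes {1..m} \<Longrightarrow> (\<lambda>e. v (relab \<sigma> e)) \<in> VV"
  unfolding Vsp_def using relab_notin by blast

text \<open>Bilinearity and balancedness of \<open>bet\<close> are checked on the generating
  relations. Membership in the free space is carried along because \<open>coset\<close> ranges over
  all functions.\<close>

lemma NN_null: assumes "h \<in> NN" shows "h \<in> FF \<and> (\<forall>d. Theta m h d = 0)"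
proof -
  let ?Z = "{h \<in> FF. \<forall>d. Theta m h d = 0}"
  note sub = fspace_subspace[of VV WW, where 'a='a]
  note pf = pt_fspace[of _ VV _ WW, where 'a='a]
  have Zsub: "fv.subspace ?Z"
    unfolding fv.subspace_def
  proof (intro conjI ballI allI)
    show "0 \<in> ?Z" using fv.subspace_0[OF sub] by (simp add: Theta_def)
    fix u v assume u: "u \<in> ?Z" and v: "v \<in> ?Z"
    then show "u + v \<in> ?Z" using fv.subspace_add[OF sub, of u v] Theta_add[OF fin_FF fin_FF, of u v m] by simp
  next
    fix c v assume v: "v \<in> ?Z"
    then show "vsmul c v \<in> ?Z" using fv.subspace_scale[OF sub, of v c] Theta_scale[OF fin_FF, of v m c] by simp
  qed
  note ptlin = Theta_diff Theta_add[OF fin_FF fin_FF] Theta_scale[OF fin_FF] Theta_pt bet_lin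
    and mem = fv.subspace_diff[OF sub] fv.subspace_add[OF sub] fv.subspace_scale[OF sub] pf
  let ?R = "tens_rels VV WW {\<sigma>. \<sigma> permutes {1..m}} (\<lambda>v \<sigma>. Iright x n m v (perm_diag n \<sigma>)) perm_act"
  have R: "r \<in> ?Z" if "r \<in> ?R" for r
  proof -
    note Vs = Vsp_subspace[of n m, where 'a='a] and Ws = specht_subspace[of lam, where 'a='a]
    from that consider
      (a) v v' w where "v \<in> VV" "v' \<in> VV" "w \<in> WW" "r = (\<lambda>p. pt (vadd v v') w p - pt v w p - pt v' w p)"
      | (b) v w w' where "v \<in> VV" "w \<in> WW" "w' \<in> WW" "r = (\<lambda>p. pt v (vadd w w') p - pt v w p - pt v w' p)"
      | (c) c v w where "v \<in> VV" "w \<in> WW" "r = (\<lambda>p. pt (vsmul c v) w p - c * pt v w p)"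
      | (d) c v w where "v \<in> VV" "w \<in> WW" "r = (\<lambda>p. pt v (vsmul c w) p - c * pt v w p)"
      | (e) v w \<sigma> where "v \<in> VV" "w \<in> WW" "\<sigma> permutes {1..m}"
          "r = (\<lambda>p. pt (Iright x n m v (perm_diag n \<sigma>)) w p - pt v (perm_act \<sigma> w) p)"
      unfolding tens_rels_def by blast
    then show ?thesis
    proof cases
      case a
      have r: "r = pt (v + v') w - (pt v w + pt v' w)" unfolding a(4) by (simp add: fun_eq_iff vadd_eq)
      note p = pf[OF fv.subspace_add[OF Vs a(1,2)] a(3)] pf[OF a(1,3)] pf[OF a(2,3)]
      show ?thesis unfolding r using mem(1)[OF p(1) mem(2)[OF p(2,3)]]
        by (simp only: mem_Collect_eq Theta_diff[OF p(1) mem(2)[OF p(2,3)]] Theta_add[OF fin_FF[OF p(2)] fin_FF[OF p(3)]] Theta_pt bet_lin diff_self simp_thms)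
    next
      case b
      have r: "r = pt v (w + w') - (pt v w + pt v w')" unfolding b(4) by (simp add: fun_eq_iff vadd_eq)
      note p = pf[OF b(1) fv.subspace_add[OF Ws b(2,3)]] pf[OF b(1,2)] pf[OF b(1,3)]
      show ?thesis unfolding r using mem(1)[OF p(1) mem(2)[OF p(2,3)]]
        by (simp only: mem_Collect_eq Theta_diff[OF p(1) mem(2)[OF p(2,3)]] Theta_add[OF fin_FF[OF p(2)] fin_FF[OF p(3)]] Theta_pt bet_lin diff_self simp_thms)
    next
      case c
      have r: "r = pt (vsmul c v) w - vsmul c (pt v w)" unfolding c(3) by (simp add: fun_eq_iff vsmul_apply)
      note p = pf[OF fv.subspace_scale[OF Vs c(1)] c(2)] pf[OF c(1,2)]
      show ?thesis unfolding r using mem(1)[OF p(1) mem(3)[OF p(2)]]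
        by (simp only: mem_Collect_eq Theta_diff[OF p(1) mem(3)[OF p(2)]] Theta_scale[OF fin_FF[OF p(2)]] Theta_pt bet_lin diff_self simp_thms)
    next
      case d
      have r: "r = pt v (vsmul c w) - vsmul c (pt v w)" unfolding d(3) by (simp add: fun_eq_iff vsmul_apply)
      note p = pf[OF d(1) fv.subspace_scale[OF Ws d(2)]] pf[OF d(1,2)]
      show ?thesis unfolding r using mem(1)[OF p(1) mem(3)[OF p(2)]]
        by (simp only: mem_Collect_eq Theta_diff[OF p(1) mem(3)[OF p(2)]] Theta_scale[OF fin_FF[OF p(2)]] Theta_pt bet_lin diff_self simp_thms)
    next
      case e
      have r: "r = pt (\<lambda>e. v (relab \<sigma> e)) w - pt v (perm_act \<sigma> w)"
        unfolding e(4) Iright_perm[OF e(1,3) mn] by (simp add: fun_eq_iff)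
      have "perm_act \<sigma> w \<in> WW" using perm_act_specht[of \<sigma> lam w] e(2,3) slam by simp
      note p = pf[OF relab_Vsp[OF e(1,3)] e(2)] pf[OF e(1) this]
      show ?thesis unfolding r using mem(1)[OF p]
        by (simp only: mem_Collect_eq Theta_diff[OF p] Theta_pt bet_balanced[OF e(3)] diff_self simp_thms)
    qed
  qed
  have "NN \<subseteq> ?Z" unfolding tens_null_def slam by (rule fv.span_minimal[OF _ Zsub]) (use R in blast)
  then show ?thesis using assms by blast
qed

lemma pt_sum_left:
  assumes "finite A" "\<And>i. i \<in> A \<Longrightarrow> f i \<in> VV" "w \<in> WW"
  shows "pt (\<Sum>i\<in>A. vsmul (c i) (f i)) w - (\<Sum>i\<in>A. vsmul (c i) (pt (f i) w)) \<in> NN"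
  using assms(1,2)
proof (induction A rule: finite_induct)
  case empty
  \<comment> \<open>The empty sum is an instance of the relation for the scalar
    \<open>0\<close>.\<close>
  have "pt (vsmul 0 0) w - vsmul 0 (pt 0 w) \<in> NN"
    by (rule NN_rels(3)[OF fv.subspace_0[OF Vsp_subspace] assms(3)])
  then show ?case by (simp only: sum.empty fv.scale_zero_left)
next
  case (insert i A)
  let ?S = "\<Sum>i\<in>A. vsmul (c i) (f i)" and ?P = "\<Sum>i\<in>A. vsmul (c i) (pt (f i) w)"
  have S: "?S \<in> VV" using insert.prems by (intro fv.subspace_sum[OF Vsp_subspace] fv.subspace_scale[OF Vsp_subspace]) blast
  have i: "f i \<in> VV" using insert.prems by blast
  have 1: "pt (vsmul (c i) (f i) + ?S) w - (pt (vsmul (c i) (f i)) w + pt ?S w) \<in> NN"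
    by (rule NN_rels(1)[OF fv.subspace_scale[OF Vsp_subspace i] S assms(3)])
  have 2: "pt (vsmul (c i) (f i)) w - vsmul (c i) (pt (f i) w) \<in> NN" by (rule NN_rels(3)[OF i assms(3)])
  have 3: "pt ?S w - ?P \<in> NN" using insert by blast
  have "pt (vsmul (c i) (f i) + ?S) w - (vsmul (c i) (pt (f i) w) + ?P) =
     (pt (vsmul (c i) (f i) + ?S) w - (pt (vsmul (c i) (f i)) w + pt ?S w)) + ((pt (vsmul (c i) (f i)) w - vsmul (c i) (pt (f i) w)) + (pt ?S w - ?P))"
    by (rule group_telescope)
  also have "\<dots> \<in> NN" by (intro fv.subspace_add[OF NN_subspace] 1 2 3)
  finally show ?case unfolding sum.insert[OF insert(1,2)] .
qed

lemma pt_sum_right: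
  assumes "finite A" "\<And>i. i \<in> A \<Longrightarrow> f i \<in> WW" "v \<in> VV"
  shows "pt v (\<Sum>i\<in>A. vsmul (c i) (f i)) - (\<Sum>i\<in>A. vsmul (c i) (pt v (f i))) \<in> NN"
  using assms(1,2)
proof (induction A rule: finite_induct)
  case empty
  have "pt v (vsmul 0 0) - vsmul 0 (pt v 0) \<in> NN"
    by (rule NN_rels(4)[OF assms(3) fv.subspace_0[OF specht_subspace]])
  then show ?case by (simp only: sum.empty fv.scale_zero_left)
next
  case (insert i A)
  let ?S = "\<Sum>i\<in>A. vsmul (c i) (f i)" and ?P = "\<Sum>i\<in>A. vsmul (c i) (pt v (f i))"
  have S: "?S \<in> WW" using insert.prems by (intro fv.subspace_sum[OF specht_subspace] fv.subspace_scale[OF specht_subspace]) blast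
  have i: "f i \<in> WW" using insert.prems by blast
  have 1: "pt v (vsmul (c i) (f i) + ?S) - (pt v (vsmul (c i) (f i)) + pt v ?S) \<in> NN"
    by (rule NN_rels(2)[OF assms(3) fv.subspace_scale[OF specht_subspace i] S])
  have 2: "pt v (vsmul (c i) (f i)) - vsmul (c i) (pt v (f i)) \<in> NN" by (rule NN_rels(4)[OF assms(3) i])
  have 3: "pt v ?S - ?P \<in> NN" using insert by blast
  have "pt v (vsmul (c i) (f i) + ?S) - (vsmul (c i) (pt v (f i)) + ?P) =
     (pt v (vsmul (c i) (f i) + ?S) - (pt v (vsmul (c i) (f i)) + pt v ?S)) + ((pt v (vsmul (c i) (f i)) - vsmul (c i) (pt v (f i))) + (pt v ?S - ?P))"
    by (rule group_telescope)
  also have "\<dots> \<in> NN" by (intro fv.subspace_add[OF NN_subspace] 1 2 3)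
  finally show ?case unfolding sum.insert[OF insert(1,2)] .
qed

lemma perm_act_WW: "w \<in> WW \<Longrightarrow> \<sigma> permutes {1..m} \<Longrightarrow> perm_act \<sigma> w \<in> WW"
  using perm_act_specht[of \<sigma> lam w] slam by simp

text \<open>The vector \<open>v\<close> is expanded in basis diagrams and \<open>\<sigma>\<close> is
  moved across the tensor sign. The left term is the same for every \<open>\<sigma>\<close>, which
  allows summation over the group.\<close>

lemma pt_average:
  assumes v: "v \<in> VV" and w: "w \<in> WW" and s: "\<sigma> permutes {1..m}"
  shows "pt v w - (\<Sum>d\<in>bd n m. vsmul (v (relab (inv \<sigma>) d)) (pt (dlt d) (perm_act \<sigma> w))) \<in> NN"
proof -
  have si: "inv \<sigma> permutes {1..m}" by (rule permutes_inv[OF s])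
  have dd: "(\<lambda>e. dlt d (relab \<sigma> e)) = (dlt (relab (inv \<sigma>) d) :: _ \<Rightarrow> 'a)" for d
    unfolding dlt_def using relab_inv[OF s] by metis
  have 1: "pt v w - (\<Sum>d\<in>bd n m. vsmul (v d) (pt (dlt d) w)) \<in> NN"
    using pt_sum_left[of "bd n m" dlt w v, OF finite_bd dlt_Vsp w] Vsp_expand[OF v, symmetric] by (simp only:)
  have "(\<Sum>d\<in>bd n m. vsmul (v (relab (inv \<sigma>) d)) (pt (dlt (relab (inv \<sigma>) d)) w - pt (dlt d) (perm_act \<sigma> w))) \<in> NN"
    unfolding dd[symmetric]
    by (intro fv.subspace_sum[OF NN_subspace] fv.subspace_scale[OF NN_subspace] NN_rels(5)[OF dlt_Vsp w s])
  then have 2: "(\<Sum>d\<in>bd n m. vsmul (v (relab (inv \<sigma>) d)) (pt (dlt (relab (inv \<sigma>) d)) w))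
     - (\<Sum>d\<in>bd n m. vsmul (v (relab (inv \<sigma>) d)) (pt (dlt d) (perm_act \<sigma> w))) \<in> NN"
    by (simp only: fv.scale_right_diff_distrib sum_subtractf)
  have "(\<Sum>d\<in>bd n m. vsmul (v (relab (inv \<sigma>) d)) (pt (dlt (relab (inv \<sigma>) d)) w)) = (\<Sum>d\<in>bd n m. vsmul (v d) (pt (dlt d) w))"
    by (rule sum.reindex_bij_betw[OF relab_bij[OF si], of "\<lambda>d. vsmul (v d) (pt (dlt d) w)"])
  from fv.subspace_add[OF NN_subspace 1 2[unfolded this]] show ?thesis by (simp only: diff_add_cancel add_diff_eq)
qed

text \<open>Summing \<open>pt_average\<close> over all \<open>\<sigma>\<close> collects the values
  of \<open>Theta\<close> as right factors: up to the factor \<open>fact m\<close>, a tensor is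
  recovered from its image, and \<open>Theta\<close> is injective modulo the relations.\<close>

lemma tensor_reduce:
  assumes h: "h \<in> FF"
  shows "vsmul (of_nat (fact m)) h - (\<Sum>d\<in>bd n m. pt (dlt d) (Theta m h d)) \<in> NN"
proof -
  define S where "S = {p. h p \<noteq> 0}"
  define P where "P = {\<sigma>. \<sigma> permutes {1..m}}"
  have fS: "finite S" unfolding S_def by (rule fin_FF[OF h])
  have fP: "finite P" unfolding P_def by (rule finite_permutations) simp
  have cP: "card P = fact m" unfolding P_def using card_permutations[OF refl, of "{1..m}"] by simp
  have VW: "fst p \<in> VV" "snd p \<in> WW" if "p \<in> S" for p using FF_D[OF h, of p] that by (simp_all add: S_def)
  define cf where "cf = (\<lambda>q d. h (fst q) * fst (fst q) (relab (inv (snd q)) d))"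
  define wf where "wf = (\<lambda>q :: ((diagram \<Rightarrow> 'a) \<times> ((nat \<Rightarrow> nat) \<Rightarrow> 'a)) \<times> (nat \<Rightarrow> nat). perm_act (snd q) (snd (fst q)) :: (nat \<Rightarrow> nat) \<Rightarrow> 'a)"
  have wf: "wf q \<in> WW" if "q \<in> S \<times> P" for q
    unfolding wf_def using that VW perm_act_WW by (auto simp: P_def)
  have Th: "Theta m h d = (\<Sum>q\<in>S \<times> P. vsmul (cf q d) (wf q))" for d
    unfolding Theta_def bet_def fv.scale_sum_right fv.scale_scale S_def[symmetric] P_def[symmetric] sum.cartesian_product
    by (rule sum.cong) (auto simp: cf_def wf_def)
  define B where "B = (\<lambda>d q. vsmul (cf q d) (pt (dlt d :: _ \<Rightarrow> 'a) (wf q)))"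
  have "(\<Sum>d\<in>bd n m. pt (dlt d) (Theta m h d) - (\<Sum>q\<in>S \<times> P. B d q)) \<in> NN"
    unfolding Th B_def
    by (intro fv.subspace_sum[OF NN_subspace] pt_sum_right dlt_Vsp finite_cartesian_product fS fP wf)
  then have 1: "(\<Sum>d\<in>bd n m. pt (dlt d) (Theta m h d)) - (\<Sum>d\<in>bd n m. \<Sum>q\<in>S \<times> P. B d q) \<in> NN"
    by (simp only: sum_subtractf)
  have "(\<Sum>q\<in>S \<times> P. vsmul (h (fst q)) (pt (fst (fst q)) (snd (fst q))) - (\<Sum>d\<in>bd n m. B d q)) \<in> NN"
  proof (rule fv.subspace_sum[OF NN_subspace])
    fix q assume "q \<in> S \<times> P"
    then have q: "fst q \<in> S" "snd q permutes {1..m}" by (auto simp: P_def)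
    have "vsmul (h (fst q)) (pt (fst (fst q)) (snd (fst q)) - (\<Sum>d\<in>bd n m. vsmul (fst (fst q) (relab (inv (snd q)) d)) (pt (dlt d) (perm_act (snd q) (snd (fst q)))))) \<in> NN"
      by (rule fv.subspace_scale[OF NN_subspace pt_average[OF VW[OF q(1)] q(2)]])
    then show "vsmul (h (fst q)) (pt (fst (fst q)) (snd (fst q))) - (\<Sum>d\<in>bd n m. B d q) \<in> NN"
      unfolding B_def cf_def wf_def by (simp only: fv.scale_right_diff_distrib fv.scale_sum_right fv.scale_scale)
  qed
  then have 2: "(\<Sum>q\<in>S \<times> P. vsmul (h (fst q)) (pt (fst (fst q)) (snd (fst q)))) - (\<Sum>q\<in>S \<times> P. \<Sum>d\<in>bd n m. B d q) \<in> NN"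
    by (simp only: sum_subtractf)
  have "(\<Sum>q\<in>S \<times> P. vsmul (h (fst q)) (pt (fst (fst q)) (snd (fst q)))) = (\<Sum>p\<in>S. \<Sum>\<sigma>\<in>P. vsmul (h p) (pt (fst p) (snd p)))"
    unfolding sum.cartesian_product by (rule sum.cong) auto
  also have "\<dots> = vsmul (of_nat (fact m)) (\<Sum>p\<in>S. vsmul (h p) (pt (fst p) (snd p)))"
    unfolding fv_sum_const cP fv.scale_sum_right ..
  also have "\<dots> = vsmul (of_nat (fact m)) h" unfolding S_def using fspace_expand[OF h, symmetric] by (simp only:)
  finally have 3: "(\<Sum>q\<in>S \<times> P. vsmul (h (fst q)) (pt (fst (fst q)) (snd (fst q)))) = vsmul (of_nat (fact m)) h" .
  have 4: "(\<Sum>q\<in>S \<times> P. \<Sum>d\<in>bd n m. B d q) = (\<Sum>d\<in>bd n m. \<Sum>q\<in>S \<times> P. B d q)" by (rule sum.swap)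
  from fv.subspace_diff[OF NN_subspace 2[unfolded 3 4] 1] show ?thesis by (simp only: diff_diff_eq2 diff_add_cancel)
qed

lemma Theta_ker:
  assumes h: "h \<in> FF" and z: "\<And>d. Theta m h d = 0" shows "h \<in> NN"
proof -
  have "(\<Sum>d\<in>bd n m. pt (dlt d) (Theta m h d)) \<in> NN"
  proof (rule fv.subspace_sum[OF NN_subspace])
    fix d assume d: "d \<in> bd n m"
    have "pt (dlt d) (vsmul 0 0) - vsmul 0 (pt (dlt d) 0) \<in> NN"
      by (rule NN_rels(4)[OF dlt_Vsp[OF d] fv.subspace_0[OF specht_subspace]])
    then show "pt (dlt d) (Theta m h d) \<in> NN" unfolding z fv.scale_zero_left diff_zero .
  qed
  from fv.subspace_add[OF NN_subspace tensor_reduce[OF h] this]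
  have "vsmul (of_nat (fact m)) h \<in> NN" by (simp only: diff_add_cancel)
  then show ?thesis by (rule fv_scale_cancel[OF NN_subspace]) simp
qed

lemma Theta_eq_iff:
  assumes "h \<in> FF" "h' \<in> FF" shows "Theta m h = Theta m h' \<longleftrightarrow> h - h' \<in> NN"
proof
  assume "Theta m h = Theta m h'"
  then show "h - h' \<in> NN"
    by (intro Theta_ker fv.subspace_diff[OF fspace_subspace assms]) (simp only: Theta_diff[OF assms] diff_self)
next
  assume "h - h' \<in> NN"
  then have "Theta m h d - Theta m h' d = 0" for d using NN_null Theta_diff[OF assms] by metis
  then show "Theta m h = Theta m h'" by (intro ext) (simp only: right_minus_eq)
qed

lemma Theta_CMod: assumes h: "h \<in> FF" shows "Theta m h \<in> mcar (CMod x n lam)"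
proof -
  have VW: "fst p \<in> VV" "snd p \<in> WW" if "p \<in> {p. h p \<noteq> 0}" for p using FF_D[OF h, of p] that by simp_all
  show ?thesis unfolding in_EQ slam
  proof (intro conjI allI impI ballI)
    show "Theta m h d = 0" if "d \<notin> bd n m" for d
      unfolding Theta_def by (rule sum.neutral, rule ballI) (simp only: bet_zero[OF VW(1) that] fv.scale_zero_right)
    show "Theta m h d \<in> WW" for d
      unfolding Theta_def
      by (intro fv.subspace_sum[OF specht_subspace] fv.subspace_scale[OF specht_subspace] bet_specht[OF VW(2) slam])
    show "Theta m h (relab \<rho> d) = perm_act \<rho> (Theta m h d)" if "\<rho> permutes {1..m}" for \<rho> d
      unfolding Theta_def perm_act_lin bet_equivariant[OF that] ..
  qed
qed

lemma Theta_sum: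
  assumes "finite A" "\<And>i. i \<in> A \<Longrightarrow> f i \<in> FF" shows "Theta m (sum f A) d = (\<Sum>i\<in>A. Theta m (f i) d)"
  using assms
proof (induction A rule: finite_induct)
  case empty show ?case unfolding sum.empty by (simp add: Theta_def)
next
  case (insert i A)
  have i: "f i \<in> FF" and A: "sum f A \<in> FF" using insert.prems by (auto intro: fv.subspace_sum[OF fspace_subspace])
  have IH: "Theta m (sum f A) d = (\<Sum>i\<in>A. Theta m (f i) d)" using insert by blast
  show ?case unfolding sum.insert[OF insert(1,2)] Theta_add[OF fin_FF[OF i] fin_FF[OF A]] IH ..
qed

lemma Theta_surj:
  assumes F: "F \<in> mcar (CMod x n lam)" obtains h where "h \<in> FF" "Theta m h = F"
proof -
  note FD = EQ_D[OF F, unfolded slam]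
  \<comment> \<open>Each of the \<open>fact m\<close> group elements contributes \<open>F e\<close>
    once to the value at \<open>e\<close>, hence this normalisation.\<close>
  define c :: 'a where "c = inverse (of_nat (fact m))"
  define h where "h = (\<Sum>d\<in>bd n m. vsmul c (pt (dlt d :: _ \<Rightarrow> 'a) (F d)))"
  have pf: "pt (dlt d) (F d) \<in> FF" if "d \<in> bd n m" for d by (rule pt_fspace[OF dlt_Vsp[OF that] FD(2)[OF that]])
  have pc: "vsmul c (pt (dlt d) (F d)) \<in> FF" if "d \<in> bd n m" for d by (rule fv.subspace_scale[OF fspace_subspace pf[OF that]])
  have hF: "h \<in> FF" unfolding h_def by (intro fv.subspace_sum[OF fspace_subspace] pc)
  have "Theta m h e = F e" for e
  proof (cases "e \<in> bd n m")
    case False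
    then show ?thesis using EQ_D(1)[OF Theta_CMod[OF hF], unfolded slam] FD(1) by metis
  next
    case True
    have "Theta m h e = (\<Sum>d\<in>bd n m. Theta m (vsmul c (pt (dlt d) (F d))) e)"
      unfolding h_def by (rule Theta_sum[OF finite_bd]) (rule pc)
    also have "\<dots> = (\<Sum>d\<in>bd n m. vsmul c (bet m (dlt d) (F d) e))"
      by (rule sum.cong[OF refl]) (simp only: Theta_scale[OF fin_FF[OF pf]] Theta_pt)
    also have "\<dots> = vsmul c (\<Sum>d\<in>bd n m. \<Sum>\<sigma> | \<sigma> permutes {1..m}. vsmul (dlt d (relab (inv \<sigma>) e)) (perm_act \<sigma> (F d)))"
      unfolding bet_def fv.scale_sum_right ..
    also have "\<dots> = vsmul c (\<Sum>\<sigma> | \<sigma> permutes {1..m}. \<Sum>d\<in>bd n m. vsmul (dlt d (relab (inv \<sigma>) e)) (perm_act \<sigma> (F d)))"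
      by (subst sum.swap) (rule refl)
    also have "(\<Sum>\<sigma> | \<sigma> permutes {1..m}. \<Sum>d\<in>bd n m. vsmul (dlt d (relab (inv \<sigma>) e)) (perm_act \<sigma> (F d))) = (\<Sum>\<sigma> | \<sigma> permutes {1..m}. F e)"
    proof (rule sum.cong[OF refl])
      fix \<sigma> assume "\<sigma> \<in> {\<sigma>. \<sigma> permutes {1..m}}"
      then have s: "\<sigma> permutes {1..m}" and si: "inv \<sigma> permutes {1..m}" using permutes_inv by auto
      have r: "relab (inv \<sigma>) e \<in> bd n m" by (rule relab_bd[OF si True])
      have "(\<Sum>d\<in>bd n m. vsmul (dlt d (relab (inv \<sigma>) e)) (perm_act \<sigma> (F d))) = (\<Sum>d\<in>bd n m. if relab (inv \<sigma>) e = d then perm_act \<sigma> (F d) else 0)"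
        by (rule sum.cong[OF refl]) (simp add: dlt_def)
      also have "\<dots> = perm_act \<sigma> (F (relab (inv \<sigma>) e))" using r by (simp only: sum.delta'[OF finite_bd] if_True)
      also have "\<dots> = F e" unfolding FD(3)[OF si True] by (rule perm_act_inv(2)[OF s])
      finally show "(\<Sum>d\<in>bd n m. vsmul (dlt d (relab (inv \<sigma>) e)) (perm_act \<sigma> (F d))) = F e" .
    qed
    also have "\<dots> = vsmul (of_nat (fact m)) (F e)"
      unfolding fv_sum_const using card_permutations[OF refl, of "{1..m}"] by simp
    finally show ?thesis by (simp add: c_def)
  qed
  then show thesis using that[OF hF] by (metis ext)
qed

lemma tact_FF:
  assumes b: "b \<in> diagrams n" and h: "h \<in> FF"
  shows "tact (Ileft x n m b) h \<in> FF"
    "Theta m (tact (Ileft x n m b) h) = (\<lambda>e. \<Sum>d\<in>bd n m. vsmul (prodI x n m b d e) (Theta m h d))"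
proof -
  have VW: "fst p \<in> VV" "snd p \<in> WW" if "p \<in> {p. h p \<noteq> 0}" for p using FF_D[OF h, of p] that by simp_all
  note fin = fin_FF[OF h]
  have pf: "pt (Ileft x n m b (fst p)) (snd p) \<in> FF" if "p \<in> {p. h p \<noteq> 0}" for p
    by (rule pt_fspace[OF Ileft_in_Vsp[OF b VW(1)[OF that]] VW(2)[OF that]])
  have pc: "vsmul (h p) (pt (Ileft x n m b (fst p)) (snd p)) \<in> FF" if "p \<in> {p. h p \<noteq> 0}" for p
    by (rule fv.subspace_scale[OF fspace_subspace pf[OF that]])
  show "tact (Ileft x n m b) h \<in> FF"
    unfolding tact_expand[OF fin] by (intro fv.subspace_sum[OF fspace_subspace] pc)
  show "Theta m (tact (Ileft x n m b) h) = (\<lambda>e. \<Sum>d\<in>bd n m. vsmul (prodI x n m b d e) (Theta m h d))"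
  proof
    fix e
    have "Theta m (tact (Ileft x n m b) h) e = (\<Sum>p | h p \<noteq> 0. Theta m (vsmul (h p) (pt (Ileft x n m b (fst p)) (snd p))) e)"
      unfolding tact_expand[OF fin] by (rule Theta_sum[OF fin]) (rule pc)
    also have "\<dots> = (\<Sum>p | h p \<noteq> 0. vsmul (h p) (bet m (Ileft x n m b (fst p)) (snd p) e))"
      by (rule sum.cong[OF refl]) (simp only: Theta_scale[OF fin_FF[OF pf]] Theta_pt)
    also have "\<dots> = (\<Sum>p | h p \<noteq> 0. \<Sum>d\<in>bd n m. vsmul (prodI x n m b d e) (vsmul (h p) (bet m (fst p) (snd p) d)))"
      by (rule sum.cong[OF refl]) (simp only: bet_Ileft[OF VW(1)] fv.scale_sum_right fv.scale_scale mult.commute)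
    also have "\<dots> = (\<Sum>d\<in>bd n m. \<Sum>p | h p \<noteq> 0. vsmul (prodI x n m b d e) (vsmul (h p) (bet m (fst p) (snd p) d)))"
      by (rule sum.swap)
    also have "\<dots> = (\<Sum>d\<in>bd n m. vsmul (prodI x n m b d e) (Theta m h d))"
      unfolding Theta_def fv.scale_sum_right ..
    finally show "Theta m (tact (Ileft x n m b) h) e = (\<Sum>d\<in>bd n m. vsmul (prodI x n m b d e) (Theta m h d))" .
  qed
qed

section \<open>Transport of the module structure to equivariant functions\<close>

lemma MA_alt: "MA x n lam =
    \<lparr> mcar = {coset NN h | h. h \<in> FF},
      madd = (\<lambda>C D. {k. \<exists>h\<in>C. \<exists>h'\<in>D. (\<lambda>p. k p - h p - h' p) \<in> NN}),
      mzero = NN,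
      msmul = (\<lambda>c C. {k. \<exists>h\<in>C. (\<lambda>p. k p - c * h p) \<in> NN}),
      mact = (\<lambda>b C. {k. \<exists>h\<in>C. (\<lambda>p. k p - tact (Ileft x n m b) h p) \<in> NN}) \<rparr>"
  unfolding MA_def Let_def lspan_eq left_ideal_eq[OF x] tens_null_def[symmetric] unfolding slam ..

lemma in_coset: "k \<in> coset NN h \<longleftrightarrow> k - h \<in> NN"
  by (simp add: coset_def fun_diff_def)

text \<open>The relations lie in the free space and form the kernel of \<open>Theta\<close> there,
  so a coset is precisely a fibre of \<open>Theta\<close>.\<close>

lemma coset_Theta: "h \<in> FF \<Longrightarrow> k \<in> coset NN h \<longleftrightarrow> k \<in> FF \<and> Theta m k = Theta m h"
proof
  assume h: "h \<in> FF" and "k \<in> coset NN h"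
  then have kh: "k - h \<in> NN" by (simp only: in_coset)
  have "k = (k - h) + h" by simp
  then have "k \<in> FF" using NN_null[OF kh] fv.subspace_add[OF fspace_subspace _ h] by metis
  then show "k \<in> FF \<and> Theta m k = Theta m h" using Theta_eq_iff[OF _ h] kh by blast
next
  assume h: "h \<in> FF" and "k \<in> FF \<and> Theta m k = Theta m h"
  then show "k \<in> coset NN h" using Theta_eq_iff[OF _ h] unfolding in_coset by blast
qed

lemma MA_ops:
  assumes h: "h \<in> FF" and h': "h' \<in> FF"
  shows "madd (MA x n lam) (coset NN h) (coset NN h') = coset NN (h + h')"
    "msmul (MA x n lam) c (coset NN h) = coset NN (vsmul c h)"
    "b \<in> diagrams n \<Longrightarrow> mact (MA x n lam) b (coset NN h) = coset NN (tact (Ileft x n m b) h)"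
proof -
  note sub = fspace_subspace[of VV WW, where 'a='a]
  show "madd (MA x n lam) (coset NN h) (coset NN h') = coset NN (h + h')"
  proof (intro set_eqI iffI)
    fix k assume "k \<in> madd (MA x n lam) (coset NN h) (coset NN h')"
    then obtain a a' where a: "a \<in> coset NN h" "a' \<in> coset NN h'" "(\<lambda>p. k p - a p - a' p) \<in> NN"
      unfolding MA_alt by auto
    have "(\<lambda>p. k p - a p - a' p) + ((a - h) + (a' - h')) \<in> NN"
      using a by (intro fv.subspace_add[OF NN_subspace]) (simp_all only: in_coset)
    moreover have "(\<lambda>p. k p - a p - a' p) + ((a - h) + (a' - h')) = k - (h + h')" by (simp add: fun_eq_iff)
    ultimately show "k \<in> coset NN (h + h')" by (simp only: in_coset)
  next
    fix k assume k: "k \<in> coset NN (h + h')"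
    have "h \<in> coset NN h" "h' \<in> coset NN h'" using fv.subspace_0[OF NN_subspace] by (simp_all only: in_coset diff_self)
    moreover have "(\<lambda>p. k p - h p - h' p) = k - (h + h')" by (simp add: fun_eq_iff)
    then have "(\<lambda>p. k p - h p - h' p) \<in> NN" using k by (simp only: in_coset)
    ultimately show "k \<in> madd (MA x n lam) (coset NN h) (coset NN h')" unfolding MA_alt by auto
  qed
  show "msmul (MA x n lam) c (coset NN h) = coset NN (vsmul c h)"
  proof (intro set_eqI iffI)
    fix k assume "k \<in> msmul (MA x n lam) c (coset NN h)"
    then obtain a where a: "a \<in> coset NN h" "(\<lambda>p. k p - c * a p) \<in> NN" unfolding MA_alt by auto
    have "(\<lambda>p. k p - c * a p) + vsmul c (a - h) \<in> NN"
      using a by (intro fv.subspace_add[OF NN_subspace] fv.subspace_scale[OF NN_subspace]) (simp_all only: in_coset)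
    moreover have "(\<lambda>p. k p - c * a p) + vsmul c (a - h) = k - vsmul c h" by (simp add: fun_eq_iff vsmul_apply algebra_simps)
    ultimately show "k \<in> coset NN (vsmul c h)" by (simp only: in_coset)
  next
    fix k assume k: "k \<in> coset NN (vsmul c h)"
    have "h \<in> coset NN h" using fv.subspace_0[OF NN_subspace] by (simp only: in_coset diff_self)
    moreover have "(\<lambda>p. k p - c * h p) = k - vsmul c h" by (simp add: fun_eq_iff vsmul_apply)
    then have "(\<lambda>p. k p - c * h p) \<in> NN" using k by (simp only: in_coset)
    ultimately show "k \<in> msmul (MA x n lam) c (coset NN h)" unfolding MA_alt by auto
  qed
  show "mact (MA x n lam) b (coset NN h) = coset NN (tact (Ileft x n m b) h)" if b: "b \<in> diagrams n"
  proof (intro set_eqI iffI)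
    fix k assume "k \<in> mact (MA x n lam) b (coset NN h)"
    then obtain a where a: "a \<in> coset NN h" "(\<lambda>p. k p - tact (Ileft x n m b) a p) \<in> NN" unfolding MA_alt by auto
    have aF: "a \<in> FF" "Theta m a = Theta m h" using coset_Theta[OF h] a(1) by auto
    have ka: "k - tact (Ileft x n m b) a \<in> NN" using a(2) by (simp add: fun_diff_def)
    have "tact (Ileft x n m b) a - tact (Ileft x n m b) h \<in> NN"
      using Theta_eq_iff[OF tact_FF(1)[OF b aF(1)] tact_FF(1)[OF b h]] tact_FF(2)[OF b aF(1)] tact_FF(2)[OF b h] aF(2) by simp
    from fv.subspace_add[OF NN_subspace ka this] show "k \<in> coset NN (tact (Ileft x n m b) h)"
      by (simp only: in_coset diff_add_cancel add_diff_eq)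
  next
    fix k assume k: "k \<in> coset NN (tact (Ileft x n m b) h)"
    have "h \<in> coset NN h" using fv.subspace_0[OF NN_subspace] by (simp only: in_coset diff_self)
    moreover have "(\<lambda>p. k p - tact (Ileft x n m b) h p) \<in> NN" using k by (simp add: in_coset fun_diff_def)
    ultimately show "k \<in> mact (MA x n lam) b (coset NN h)" unfolding MA_alt by auto
  qed
qed

text \<open>On the cosets in the carrier, all representatives have the same image, so the choice is
  immaterial.\<close>

definition tensor_map :: "((diagram \<Rightarrow> 'a) \<times> ((nat \<Rightarrow> nat) \<Rightarrow> 'a) \<Rightarrow> 'a) set \<Rightarrow> diagram \<Rightarrow> (nat \<Rightarrow> nat) \<Rightarrow> 'a" where
  "tensor_map C = Theta m (SOME h. h \<in> C)"

lemma tensor_map_coset: assumes "h \<in> FF" shows "tensor_map (coset NN h) = Theta m h"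
proof -
  have "h \<in> coset NN h" using coset_Theta[OF assms] assms by blast
  then have "(SOME k. k \<in> coset NN h) \<in> coset NN h" by (rule someI[where P="\<lambda>k. k \<in> coset NN h"])
  then show ?thesis unfolding tensor_map_def using coset_Theta[OF assms] by blast
qed

lemma MA_car: "C \<in> mcar (MA x n lam) \<longleftrightarrow> (\<exists>h\<in>FF. C = coset NN h)"
  unfolding MA_alt by auto

lemma MA_mzero: "mzero (MA x n lam) = coset NN 0"
  unfolding MA_alt by (simp add: coset_def)

lemma MA_closed: "mclosed (diagrams n) (MA x n lam)"
  unfolding mclosed_def
proof (intro conjI ballI allI)
  note sub = fspace_subspace[of VV WW, where 'a='a]
  fix C D assume "C \<in> mcar (MA x n lam)" "D \<in> mcar (MA x n lam)"
  then show "madd (MA x n lam) C D \<in> mcar (MA x n lam)"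
    unfolding MA_car using MA_ops(1) fv.subspace_add[OF sub] by metis
next
  note sub = fspace_subspace[of VV WW, where 'a='a]
  fix c C assume "C \<in> mcar (MA x n lam)"
  then show "msmul (MA x n lam) c C \<in> mcar (MA x n lam)"
    unfolding MA_car using MA_ops(2) fv.subspace_scale[OF sub] by metis
next
  fix b C assume "b \<in> diagrams n" "C \<in> mcar (MA x n lam)"
  then show "mact (MA x n lam) b C \<in> mcar (MA x n lam)"
    unfolding MA_car using MA_ops(3) tact_FF(1) by metis
qed

text \<open>From here on the quotient construction is replaced by functions. The image of zero is
  recorded separately because kernels are described through it.\<close>

lemma MA_iso:
  "is_hom (diagrams n) (MA x n lam) (CMod x n lam) tensor_map"
  "bij_betw tensor_map (mcar (MA x n lam)) (mcar (CMod x n lam))"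
  "mzero (MA x n lam) \<in> mcar (MA x n lam)" "tensor_map (mzero (MA x n lam)) = 0"
proof -
  note sub = fspace_subspace[of VV WW, where 'a='a]
  show "is_hom (diagrams n) (MA x n lam) (CMod x n lam) tensor_map"
    unfolding is_hom_def
  proof (intro conjI ballI allI)
    fix C assume "C \<in> mcar (MA x n lam)"
    then show "tensor_map C \<in> mcar (CMod x n lam)" unfolding MA_car using tensor_map_coset Theta_CMod by metis
  next
    fix C D assume "C \<in> mcar (MA x n lam)" "D \<in> mcar (MA x n lam)"
    then obtain h h' where h: "h \<in> FF" "h' \<in> FF" "C = coset NN h" "D = coset NN h'" unfolding MA_car by blast
    show "tensor_map (madd (MA x n lam) C D) = madd (CMod x n lam) (tensor_map C) (tensor_map D)"
      unfolding h(3,4) MA_ops(1)[OF h(1,2)] tensor_map_coset[OF fv.subspace_add[OF sub h(1,2)]] tensor_map_coset[OF h(1)] tensor_map_coset[OF h(2)] EQ_simps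
      by (rule ext) (simp only: Theta_add[OF fin_FF[OF h(1)] fin_FF[OF h(2)]] plus_fun_apply)
  next
    fix c C assume "C \<in> mcar (MA x n lam)"
    then obtain h where h: "h \<in> FF" "C = coset NN h" unfolding MA_car by blast
    show "tensor_map (msmul (MA x n lam) c C) = msmul (CMod x n lam) c (tensor_map C)"
      unfolding h(2) MA_ops(2)[OF h(1) h(1)] tensor_map_coset[OF fv.subspace_scale[OF sub h(1)]] tensor_map_coset[OF h(1)] EQ_simps
      by (rule ext) (rule Theta_scale[OF fin_FF[OF h(1)]])
  next
    fix b C assume b: "b \<in> diagrams n" and "C \<in> mcar (MA x n lam)"
    then obtain h where h: "h \<in> FF" "C = coset NN h" unfolding MA_car by blast
    show "tensor_map (mact (MA x n lam) b C) = mact (CMod x n lam) b (tensor_map C)"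
      unfolding h(2) MA_ops(3)[OF h(1) h(1) b] tensor_map_coset[OF tact_FF(1)[OF b h(1)]] tensor_map_coset[OF h(1)] EQ_simps slam
      by (rule tact_FF(2)[OF b h(1)])
  qed
  show "bij_betw tensor_map (mcar (MA x n lam)) (mcar (CMod x n lam))"
    unfolding bij_betw_def
  proof
    show "inj_on tensor_map (mcar (MA x n lam))"
    proof (rule inj_onI)
      fix C D assume "C \<in> mcar (MA x n lam)" "D \<in> mcar (MA x n lam)" and e: "tensor_map C = tensor_map D"
      then obtain h h' where h: "h \<in> FF" "h' \<in> FF" "C = coset NN h" "D = coset NN h'" unfolding MA_car by blast
      have t: "Theta m h = Theta m h'" using e unfolding h(3,4) tensor_map_coset[OF h(1)] tensor_map_coset[OF h(2)] .
      show "C = D" unfolding h(3,4) by (rule set_eqI) (simp only: coset_Theta[OF h(1)] coset_Theta[OF h(2)] t)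
    qed
    show "tensor_map ` mcar (MA x n lam) = mcar (CMod x n lam)"
    proof (intro set_eqI iffI)
      fix F assume "F \<in> tensor_map ` mcar (MA x n lam)"
      then obtain C where C: "F = tensor_map C" "C \<in> mcar (MA x n lam)" by (elim imageE)
      then obtain h where h: "h \<in> FF" "C = coset NN h" unfolding MA_car by blast
      show "F \<in> mcar (CMod x n lam)" unfolding C(1) h(2) tensor_map_coset[OF h(1)] by (rule Theta_CMod[OF h(1)])
    next
      fix F assume "F \<in> mcar (CMod x n lam)"
      then obtain h where h: "h \<in> FF" "Theta m h = F" by (rule Theta_surj)
      have "coset NN h \<in> mcar (MA x n lam)" using h(1) MA_car by blast
      then show "F \<in> tensor_map ` mcar (MA x n lam)" by (rule image_eqI[rotated]) (simp only: tensor_map_coset[OF h(1)] h(2))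
    qed
  qed
  have z: "0 \<in> FF" by (rule fv.subspace_0[OF sub])
  show "mzero (MA x n lam) \<in> mcar (MA x n lam)" unfolding MA_mzero MA_car using z by blast
  show "tensor_map (mzero (MA x n lam)) = 0" unfolding MA_mzero tensor_map_coset[OF z]
    by (rule ext) (simp add: Theta_def)
qed

end

section \<open>Adding a vertical arc\<close>

text \<open>Exchanging two vertices rather than moving one keeps the map bijective. The position
  \<open>z\<close> has to be free in the diagram but may lie beyond the bottom row.\<close>

definition swap_vtx :: "nat \<Rightarrow> nat \<Rightarrow> vtx \<Rightarrow> vtx" where
  "swap_vtx n z = transpose (Top (Suc n)) (Bot z)"

lemma swap_vtx_simps [simp]: "swap_vtx n z (Top (Suc n)) = Bot z" "swap_vtx n z (Bot z) = Top (Suc n)"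
  by (simp_all add: swap_vtx_def)

lemma swap_vtx_other: "u \<noteq> Top (Suc n) \<Longrightarrow> u \<noteq> Bot z \<Longrightarrow> swap_vtx n z u = u"
  by (simp add: swap_vtx_def transpose_def)

lemma swap_vtx_swv [simp]: "swap_vtx n z (swap_vtx n z u) = u" by (simp add: swap_vtx_def)

lemma swap_vtx_bij: "bij (swap_vtx n z)" by (rule o_bij[of "swap_vtx n z"]) (auto simp: fun_eq_iff)

lemma swap_vtx_inj: "inj (swap_vtx n z)" using swap_vtx_bij by (rule bij_is_inj)

lemma vmap_swv_swv [simp]: "vmap (swap_vtx n z) (vmap (swap_vtx n z) d) = d"
  by (simp add: vmap_comp comp_def)

lemma vmap_swv_fix: "Top (Suc n) \<notin> \<Union>d \<Longrightarrow> Bot z \<notin> \<Union>d \<Longrightarrow> vmap (swap_vtx n z) d = d"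
  using vmap_cong[of d "swap_vtx n z" "\<lambda>u. u"] swap_vtx_other by (metis vmap_id(2))

lemma verts_Suc: "u \<in> verts n \<Longrightarrow> u \<in> verts (Suc n)" by (auto simp: verts_def)

lemma Top_Suc_notin: "b \<in> diagrams n \<Longrightarrow> Top (Suc n) \<notin> \<Union>b"
  using diagram_Union by (fastforce simp: verts_def)

lemma Bot_Suc_notin: "b \<in> diagrams n \<Longrightarrow> Bot (Suc n) \<notin> \<Union>b"
  using diagram_Union by (fastforce simp: verts_def)

lemma eps_diagrams: assumes "b \<in> diagrams n" shows "eps (Suc n) b \<in> diagrams (Suc n)"
proof (rule diagramsI)
  fix e assume "e \<in> eps (Suc n) b"
  then consider "e = {Top (Suc n), Bot (Suc n)}" | "e \<in> b" by (auto simp: eps_def)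
  then show "\<exists>u v. e = {u, v} \<and> u \<noteq> v \<and> u \<in> verts (Suc n) \<and> v \<in> verts (Suc n)"
  proof cases
    case 1 then show ?thesis by (intro exI[of _ "Top (Suc n)"] exI[of _ "Bot (Suc n)"]) (auto simp: verts_def)
  next
    case 2 then show ?thesis using diagram_edge[OF assms 2] verts_Suc by metis
  qed
next
  fix e e' u assume e: "e \<in> eps (Suc n) b" "e' \<in> eps (Suc n) b" "u \<in> e" "u \<in> e'"
  have new: "Top (Suc n) \<notin> f" "Bot (Suc n) \<notin> f" if "f \<in> b" for f
    using that Top_Suc_notin[OF assms] Bot_Suc_notin[OF assms] by blast+
  from e show "e = e'" using new diagram_edge_eq[OF assms, of e e' u] unfolding eps_def by auto
qed

text \<open>Contracting the path \<open>U (Suc n), Mid (Suc n)\<close> that \<open>eps\<close> adds to the stacked graph identifies this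
  graph with the one in which the top vertex \<open>Suc n\<close> of \<open>d\<close> has been moved to the bottom position \<open>z\<close>.\<close>

definition push_stack :: "nat \<Rightarrow> nat \<Rightarrow> v3 \<Rightarrow> v3" where
  "push_stack n z p = (if p = U (Suc n) \<or> p = Mid (Suc n) then L z else if p = L z then U (Suc n) else p)"

text \<open>Inverse to \<open>push_stack\<close> up to connectivity: of the two vertices contracted
  to \<open>L z\<close>, the middle one is picked.\<close>

definition pull_stack :: "nat \<Rightarrow> nat \<Rightarrow> v3 \<Rightarrow> v3" where
  "pull_stack n z p = (if p = L z then Mid (Suc n) else if p = U (Suc n) then L z else p)"

lemma upper_fix: assumes "u \<in> verts n" shows "push_stack n z (upper u) = upper u" "pull_stack n z (upper u) = upper u"
  using assms by (cases u; auto simp: push_stack_def pull_stack_def verts_def)+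

lemma lower_sw: assumes "u \<noteq> Bot z" shows "push_stack n z (lower u) = lower (swap_vtx n z u)" "pull_stack n z (lower (swap_vtx n z u)) = lower u"
proof -
  show "push_stack n z (lower u) = lower (swap_vtx n z u)"
  proof (cases "u = Top (Suc n)")
    case False
    then show ?thesis using assms by (cases u) (auto simp: push_stack_def swap_vtx_other)
  qed (simp add: push_stack_def)
  show "pull_stack n z (lower (swap_vtx n z u)) = lower u"
  proof (cases "u = Top (Suc n)")
    case False
    then show ?thesis using assms by (cases u) (auto simp: pull_stack_def swap_vtx_other)
  qed (simp add: pull_stack_def)
qed

context
  fixes n z :: nat and b d :: diagram
  assumes b: "b \<in> diagrams n" and z: "Bot z \<notin> \<Union>d"
begin

lemma push_stack_edge:
  assumes "(x, y) \<in> stack_rel (eps (Suc n) b) d" shows "(push_stack n z x, push_stack n z y) \<in> (stack_rel b (vmap (swap_vtx n z) d))\<^sup>*"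
  using assms unfolding stack_rel_iff
proof
  assume "\<exists>u v. {u, v} \<in> eps (Suc n) b \<and> x = upper u \<and> y = upper v"
  then obtain u v where uv: "{u, v} \<in> eps (Suc n) b" "x = upper u" "y = upper v" by blast
  show ?thesis
  proof (cases "{u, v} \<in> b")
    case True
    then have "u \<in> verts n" "v \<in> verts n" using diagram_verts[OF b] by blast+
    then show ?thesis using stack_upper[OF True] upper_fix uv by (simp add: r_into_rtrancl)
  next
    case False
    then have "{u, v} = {Top (Suc n), Bot (Suc n)}" using uv(1) by (auto simp: eps_def)
    then have "push_stack n z x = push_stack n z y" using uv by (auto simp: doubleton_eq_iff push_stack_def)
    then show ?thesis by simp
  qed
next
  assume "\<exists>u v. {u, v} \<in> d \<and> x = lower u \<and> y = lower v"
  then obtain u v where uv: "{u, v} \<in> d" "x = lower u" "y = lower v" by blast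
  then have "u \<noteq> Bot z" "v \<noteq> Bot z" using z by auto
  moreover have "{swap_vtx n z u, swap_vtx n z v} \<in> vmap (swap_vtx n z) d" using uv(1) by (simp add: vmap_iff[OF swap_vtx_inj])
  ultimately show ?thesis using stack_lower lower_sw(1) uv(2,3) by (metis r_into_rtrancl)
qed

lemma pull_stack_edge:
  assumes "(x, y) \<in> stack_rel b (vmap (swap_vtx n z) d)" shows "(pull_stack n z x, pull_stack n z y) \<in> (stack_rel (eps (Suc n) b) d)\<^sup>*"
  using assms unfolding stack_rel_iff
proof
  assume "\<exists>u v. {u, v} \<in> b \<and> x = upper u \<and> y = upper v"
  then obtain u v where uv: "{u, v} \<in> b" "x = upper u" "y = upper v" by blast
  then have "u \<in> verts n" "v \<in> verts n" using diagram_verts[OF b] by blast+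
  moreover have "{u, v} \<in> eps (Suc n) b" using uv(1) by (simp add: eps_def)
  ultimately show ?thesis using stack_upper upper_fix uv(2,3) by (metis r_into_rtrancl)
next
  assume "\<exists>u v. {u, v} \<in> vmap (swap_vtx n z) d \<and> x = lower u \<and> y = lower v"
  then obtain u v where uv: "{u, v} \<in> d" "x = lower (swap_vtx n z u)" "y = lower (swap_vtx n z v)"
    unfolding vmap_mem_iff[OF swap_vtx_inj] by blast
  then have "u \<noteq> Bot z" "v \<noteq> Bot z" using z by auto
  then show ?thesis using stack_lower[OF uv(1)] lower_sw(2) uv(2,3) by (metis r_into_rtrancl)
qed

lemma UN_Mid: "(U (Suc n), Mid (Suc n)) \<in> stack_rel (eps (Suc n) b) d"
  using stack_upper[of "Top (Suc n)" "Bot (Suc n)" "eps (Suc n) b" d] by (simp add: eps_def)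

text \<open>Multiplication by \<open>eps (Suc n) b\<close> becomes multiplication by
  \<open>b\<close> once the last top vertex is bent into the bottom row, which left multiplication
  leaves alone.\<close>

lemma Gprime_eps: "Gprime (eps (Suc n) b) d = vmap (swap_vtx n z) (Gprime b (vmap (swap_vtx n z) d))"
proof -
  have "Gprime b (vmap (swap_vtx n z) d) = vmap (swap_vtx n z) (Gprime (eps (Suc n) b) d)"
  proof (rule Gprime_transfer[OF swap_vtx_bij push_stack_edge pull_stack_edge])
    fix u
    show "push_stack n z (inn u) = inn (swap_vtx n z u)"
    proof (cases "u = Top (Suc n) \<or> u = Bot z")
      case True then show ?thesis by (auto simp: push_stack_def)
    next
      case False then show ?thesis by (cases u) (auto simp: push_stack_def swap_vtx_other)
    qed
    show "(pull_stack n z (inn (swap_vtx n z u)), inn u) \<in> (stack_rel (eps (Suc n) b) d)\<^sup>*"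
    proof (cases "u = Top (Suc n)")
      case True
      then show ?thesis using stack_rtrancl_sym[OF r_into_rtrancl[OF UN_Mid]] by (simp add: pull_stack_def)
    next
      case False
      have "pull_stack n z (inn (swap_vtx n z u)) = inn u"
      proof (cases "u = Bot z")
        case True then show ?thesis by (simp add: pull_stack_def)
      next
        case F: False then show ?thesis using False by (cases u) (auto simp: pull_stack_def swap_vtx_other)
      qed
      then show ?thesis by simp
    qed
  qed
  then show ?thesis by simp
qed

text \<open>The additional middle vertex is joined to the top vertex \<open>Suc n\<close>, so its
  component never lies entirely in the middle row.\<close>

lemma ell_eps: "ell (Suc n) (eps (Suc n) b) d = ell n b (vmap (swap_vtx n z) d)"
proof (rule ell_transfer[where J="UNIV - {Suc n}", OF push_stack_edge pull_stack_edge])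
  show "push_stack n z (Mid i) = Mid i" "pull_stack n z (Mid i) = Mid i" if "i \<in> UNIV - {Suc n}" for i
    using that by (auto simp: push_stack_def pull_stack_def)
  show "p \<in> Mid ` (UNIV - {Suc n})" if "push_stack n z p \<in> range Mid" for p
    using that by (cases p) (auto simp: push_stack_def split: if_splits)
  show "p \<in> Mid ` (UNIV - {Suc n})" if "pull_stack n z p \<in> Mid ` (UNIV - {Suc n})" for p
    using that by (cases p) (auto simp: pull_stack_def split: if_splits)
  fix i assume i: "i \<in> {1..Suc n}" and c: "conn (eps (Suc n) b) d (Mid i) \<subseteq> range Mid"
  have no: "Mid (Suc n) \<notin> conn (eps (Suc n) b) d (Mid i)"
  proof
    assume "Mid (Suc n) \<in> conn (eps (Suc n) b) d (Mid i)"
    then have "(Mid i, U (Suc n)) \<in> (stack_rel (eps (Suc n) b) d)\<^sup>*"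
      using stack_rtrancl_sym[OF r_into_rtrancl[OF UN_Mid]] unfolding conn_def by (auto intro: rtrancl_trans)
    then show False using c unfolding conn_def by auto
  qed
  have "i \<noteq> Suc n" using no by (auto simp: conn_def)
  then show "i \<in> {1..n} \<and> conn (eps (Suc n) b) d (Mid i) \<subseteq> Mid ` (UNIV - {Suc n})" using i c no by auto
qed auto

end

text \<open>The two bottom vertices are isolated in the stacked graph, so the new arc is a component
  of its own.\<close>

lemma stack_arc:
  assumes y: "Bot y \<notin> \<Union>d" "Bot z \<notin> \<Union>d"
  shows "(p, q) \<in> (stack_rel b (insert {Bot y, Bot z} d))\<^sup>* \<longleftrightarrow> (p, q) \<in> (stack_rel b d)\<^sup>* \<or> (p \<in> {L y, L z} \<and> q \<in> {L y, L z})"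
proof
  have iso: "(L j, w) \<notin> stack_rel b d" if "Bot j \<notin> \<Union>d" for j w
  proof
    assume "(L j, w) \<in> stack_rel b d"
    moreover have "upper u \<noteq> L j" for u by (cases u) auto
    ultimately obtain u v where "{u, v} \<in> d" "L j = lower u" unfolding stack_rel_iff by metis
    moreover from this have "u = Bot j" by (cases u) auto
    ultimately show False using that by auto
  qed
  have isor: "p = L j" if "(p, L j) \<in> (stack_rel b d)\<^sup>*" "Bot j \<notin> \<Union>d" for p j
    using stack_rtrancl_sym[OF that(1)] iso[OF that(2)] by (metis converse_rtranclE)
  have new: "(x, w) \<in> stack_rel b d \<or> (x \<in> {L y, L z} \<and> w \<in> {L y, L z})" if "(x, w) \<in> stack_rel b (insert {Bot y, Bot z} d)" for x w
    using that unfolding stack_rel_iff by (auto simp: doubleton_eq_iff)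
  show "(p, q) \<in> (stack_rel b d)\<^sup>* \<or> (p \<in> {L y, L z} \<and> q \<in> {L y, L z})" if "(p, q) \<in> (stack_rel b (insert {Bot y, Bot z} d))\<^sup>*"
    using that
  proof (induction rule: rtrancl_induct)
    case (step x w)
    from new[OF step(2)] step(3) iso[OF y(1)] iso[OF y(2)] isor[OF _ y(1)] isor[OF _ y(2)] show ?case
      by (auto intro: rtrancl_into_rtrancl)
  qed simp
  have "stack_rel b d \<subseteq> stack_rel b (insert {Bot y, Bot z} d)" by (auto simp: stack_rel_def)
  from rtrancl_mono[OF this]
  show "(p, q) \<in> (stack_rel b (insert {Bot y, Bot z} d))\<^sup>*" if "(p, q) \<in> (stack_rel b d)\<^sup>* \<or> (p \<in> {L y, L z} \<and> q \<in> {L y, L z})"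
  proof -
    have "(lower (Bot y), lower (Bot z)) \<in> stack_rel b (insert {Bot y, Bot z} d)" by (rule stack_lower) simp
    then have "(L y, L z) \<in> (stack_rel b (insert {Bot y, Bot z} d))\<^sup>*" by auto
    then show ?thesis using that \<open>(stack_rel b d)\<^sup>* \<subseteq> _\<close> stack_rtrancl_sym by auto
  qed
qed

lemma Gprime_arc:
  assumes y: "Bot y \<notin> \<Union>d" "Bot z \<notin> \<Union>d" "y \<noteq> z"
  shows "Gprime b (insert {Bot y, Bot z} d) = insert {Bot y, Bot z} (Gprime b d)"
proof (intro set_eqI iffI)
  fix e assume "e \<in> Gprime b (insert {Bot y, Bot z} d)"
  then obtain u v where uv: "e = {u, v}" "u \<noteq> v" "(inn u, inn v) \<in> (stack_rel b (insert {Bot y, Bot z} d))\<^sup>*"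
    by (rule Gprime_edge)
  from uv(3)[unfolded stack_arc[OF y(1,2)]] show "e \<in> insert {Bot y, Bot z} (Gprime b d)"
  proof
    assume "(inn u, inn v) \<in> (stack_rel b d)\<^sup>*"
    then show ?thesis using uv Gprime_iff by blast
  next
    assume "inn u \<in> {L y, L z} \<and> inn v \<in> {L y, L z}"
    then have "u \<in> {Bot y, Bot z}" "v \<in> {Bot y, Bot z}" by (cases u; cases v; auto)+
    then show ?thesis using uv by auto
  qed
next
  fix e assume e: "e \<in> insert {Bot y, Bot z} (Gprime b d)"
  show "e \<in> Gprime b (insert {Bot y, Bot z} d)"
  proof (cases "e = {Bot y, Bot z}")
    case True
    then show ?thesis using y(3) by (simp add: Gprime_iff stack_arc[OF y(1,2)])
  next
    case False
    then obtain u v where "e = {u, v}" "u \<noteq> v" "(inn u, inn v) \<in> (stack_rel b d)\<^sup>*" using e Gprime_edge by blast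
    then show ?thesis by (simp add: Gprime_iff stack_arc[OF y(1,2)])
  qed
qed

lemma ell_arc:
  assumes "Bot y \<notin> \<Union>d" "Bot z \<notin> \<Union>d" shows "ell n b (insert {Bot y, Bot z} d) = ell n b d"
proof -
  have "conn b (insert {Bot y, Bot z} d) (Mid i) = conn b d (Mid i)" for i
    unfolding conn_def stack_arc[OF assms] by simp
  then show ?thesis by (simp add: ell_def)
qed

section \<open>The three kinds of diagrams\<close>

lemma diagrams_Suc: "d \<in> diagrams n \<Longrightarrow> d \<in> diagrams (Suc n)"
  using vmap_diagrams[of id d n "Suc n"] diagram_Union verts_Suc by (metis inj_on_id id_apply vmap_id(1))

lemma verts_cases: "u \<in> verts (Suc n) \<Longrightarrow> u \<in> verts n \<or> u = Top (Suc n) \<or> u = Bot (Suc n)"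
  by (auto simp: verts_def le_Suc_eq)

lemma diagrams_restrict:
  assumes "d \<in> diagrams (Suc n)" "Top (Suc n) \<notin> \<Union>d" "Bot (Suc n) \<notin> \<Union>d" shows "d \<in> diagrams n"
proof -
  have "vmap id d \<in> diagrams n"
    by (rule vmap_diagrams[OF inj_on_id assms(1)]) (use assms diagram_Union[OF assms(1)] verts_cases in \<open>metis id_apply\<close>)
  then show ?thesis by simp
qed

text \<open>The bound \<open>m \<le> n\<close> keeps the bottom vertex \<open>Suc n\<close> free, so
  only the last top vertex separates the two sizes of diagrams.\<close>

lemma typeA: assumes "m \<le> n" shows "d \<in> bd n m \<longleftrightarrow> d \<in> bd (Suc n) m \<and> Top (Suc n) \<notin> \<Union>d"
proof
  assume "d \<in> bd n m"
  then show "d \<in> bd (Suc n) m \<and> Top (Suc n) \<notin> \<Union>d"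
    using diagrams_Suc Top_Suc_notin unfolding bd_def by blast
next
  assume d: "d \<in> bd (Suc n) m \<and> Top (Suc n) \<notin> \<Union>d"
  then have bots: "\<forall>j. Bot j \<in> \<Union>d \<longrightarrow> j \<in> {1..m}" by (simp add: bd_def)
  have "Bot (Suc n) \<notin> \<Union>d"
  proof
    assume "Bot (Suc n) \<in> \<Union>d"
    then have "Suc n \<in> {1..m}" using bots by blast
    then show False using assms by simp
  qed
  then show "d \<in> bd n m" using diagrams_restrict d unfolding bd_def by blast
qed

text \<open>The first free bottom position is used: a horizontal arc at the last top vertex becomes
  a vertical arc ending at \<open>Suc m\<close>, and the occupied positions remain an initial
  segment.\<close>

definition bend_top :: "nat \<Rightarrow> nat \<Rightarrow> diagram \<Rightarrow> diagram" where
  "bend_top n m d = vmap (swap_vtx n (Suc m)) d"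

lemma bend_top_ec [simp]: "bend_top n m (bend_top n m d) = d" by (simp add: bend_top_def)

lemma bd_botD: "d \<in> bd n m \<Longrightarrow> Bot j \<in> \<Union>d \<Longrightarrow> j \<in> {1..m}"
  unfolding bd_def by blast

lemma bd_topD: assumes "d \<in> bd n m" "j \<in> {1..m}" obtains i where "{Top i, Bot j} \<in> d"
  using assms unfolding bd_iff by blast

lemma typeC_ec:
  assumes d: "d \<in> bd n (Suc m)"
  shows "bend_top n m d \<in> bd (Suc n) m" "\<exists>j. {Top (Suc n), Top j} \<in> bend_top n m d" "Bot (Suc m) \<notin> \<Union>(bend_top n m d)"
proof -
  have dd: "d \<in> diagrams n" by (rule bd_diagrams[OF d])
  note nt = Top_Suc_notin[OF dd]
  show nb: "Bot (Suc m) \<notin> \<Union>(bend_top n m d)"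
  proof
    assume "Bot (Suc m) \<in> \<Union>(bend_top n m d)"
    then obtain u where "u \<in> \<Union>d" "swap_vtx n (Suc m) u = Bot (Suc m)" unfolding bend_top_def vmap_Union by (metis imageE)
    then have "Top (Suc n) \<in> \<Union>d" by (metis swap_vtx_simps(2) swap_vtx_swv)
    then show False using nt by blast
  qed
  have dg: "bend_top n m d \<in> diagrams (Suc n)"
    unfolding bend_top_def
  proof (rule vmap_diagrams[OF swap_vtx_inj dd])
    fix u assume u: "u \<in> \<Union>d"
    show "swap_vtx n (Suc m) u \<in> verts (Suc n)"
    proof (cases "u = Bot (Suc m)")
      case True then show ?thesis by (simp add: verts_def)
    next
      case False
      then have "swap_vtx n (Suc m) u = u" using u nt by (intro swap_vtx_other) blast+
      then show ?thesis using verts_Suc[OF diagram_Union[OF dd u]] by simp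
    qed
  qed
  have fixT: "swap_vtx n (Suc m) (Top i) = Top i" if "Top i \<in> \<Union>d" for i
    using that nt by (intro swap_vtx_other) auto
  have "\<exists>i. {Top i, Bot j} \<in> bend_top n m d" if j: "j \<in> {1..m}" for j
  proof -
    have "j \<in> {1..Suc m}" using j by auto
    then obtain i where i: "{Top i, Bot j} \<in> d" by (rule bd_topD[OF d])
    have "{swap_vtx n (Suc m) (Top i), swap_vtx n (Suc m) (Bot j)} \<in> bend_top n m d" unfolding bend_top_def vmap_iff[OF swap_vtx_inj] by (rule i)
    moreover have "swap_vtx n (Suc m) (Top i) = Top i" using i by (intro fixT) blast
    moreover have "swap_vtx n (Suc m) (Bot j) = Bot j" using j by (intro swap_vtx_other) auto
    ultimately show ?thesis by auto
  qed
  moreover have "j \<in> {1..m}" if jj: "Bot j \<in> \<Union>(bend_top n m d)" for j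
  proof -
    have ne: "j \<noteq> Suc m" using jj nb by auto
    obtain u where u: "u \<in> \<Union>d" "swap_vtx n (Suc m) u = Bot j" using jj unfolding bend_top_def vmap_Union by (metis imageE)
    then have "u = swap_vtx n (Suc m) (Bot j)" by (metis swap_vtx_swv)
    also have "\<dots> = Bot j" using ne by (intro swap_vtx_other) auto
    finally show ?thesis using bd_botD[OF d] u(1) ne by fastforce
  qed
  ultimately show "bend_top n m d \<in> bd (Suc n) m" using dg by (simp add: bd_iff)
  have "Suc m \<in> {1..Suc m}" by simp
  then obtain i where i: "{Top i, Bot (Suc m)} \<in> d" by (rule bd_topD[OF d])
  have "{swap_vtx n (Suc m) (Top i), swap_vtx n (Suc m) (Bot (Suc m))} \<in> bend_top n m d" unfolding bend_top_def vmap_iff[OF swap_vtx_inj] by (rule i)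
  moreover have "swap_vtx n (Suc m) (Top i) = Top i" using i by (intro fixT) blast
  ultimately show "\<exists>j. {Top (Suc n), Top j} \<in> bend_top n m d" by (auto simp: insert_commute)
qed

lemma typeC_inv:
  assumes d: "d \<in> bd (Suc n) m" and t: "{Top (Suc n), Top t} \<in> d" and mn: "m \<le> n"
  shows "bend_top n m d \<in> bd n (Suc m)"
proof -
  have dd: "d \<in> diagrams (Suc n)" by (rule bd_diagrams[OF d])
  have tv: "Top t \<in> verts (Suc n)" "t \<noteq> Suc n" using diagram_verts[OF dd t] by auto
  have nz: "Bot (Suc m) \<notin> \<Union>d"
  proof
    assume "Bot (Suc m) \<in> \<Union>d"
    from bd_botD[OF d this] show False by simp
  qed
  have "\<forall>j\<in>{1..m}. \<exists>i. {Top i, Bot j} \<in> d" using d by (simp add: bd_iff)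
  from bchoice[OF this] obtain f where f: "\<And>j. j \<in> {1..m} \<Longrightarrow> {Top (f j), Bot j} \<in> d" by blast
  have "inj_on f {1..m}"
  proof (rule inj_onI)
    fix i j assume "i \<in> {1..m}" "j \<in> {1..m}" "f i = f j"
    then have "Bot i = Bot j" using f diagram_partner[OF dd] by metis
    then show "i = j" by simp
  qed
  moreover have "f ` {1..m} \<subseteq> {1..n} - {t}"
  proof
    fix i assume "i \<in> f ` {1..m}"
    then obtain j where j: "j \<in> {1..m}" "i = f j" by blast
    have e: "{Top i, Bot j} \<in> d" using f j by blast
    have "i \<noteq> Suc n" using e t diagram_partner[OF dd] by (metis vtx.distinct(1))
    moreover have "i \<noteq> t" using e t diagram_partner[OF dd] by (metis insert_commute vtx.distinct(1))
    moreover have "i \<in> {1..Suc n}" using diagram_verts[OF dd e] by (auto simp: verts_def)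
    ultimately show "i \<in> {1..n} - {t}" by auto
  qed
  ultimately have "card {1..m} \<le> card ({1..n} - {t})" by (intro card_inj_on_le) auto
  moreover have "t \<in> {1..n}" using tv by (auto simp: verts_def)
  \<comment> \<open>The \<open>m\<close> vertical arcs start at top vertices other than
    \<open>t\<close> and \<open>Suc n\<close>; this leaves room for the bottom position
    \<open>Suc m\<close>.\<close>
  ultimately have sm: "Suc m \<le> n" by auto
  have dg: "bend_top n m d \<in> diagrams n"
    unfolding bend_top_def
  proof (rule vmap_diagrams[OF swap_vtx_inj dd])
    fix u assume u: "u \<in> \<Union>d"
    show "swap_vtx n (Suc m) u \<in> verts n"
    proof (cases "u = Top (Suc n)")
      case True then show ?thesis using sm by (simp add: verts_def)
    next
      case False
      then have "swap_vtx n (Suc m) u = u" using u nz by (intro swap_vtx_other) blast+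
      moreover have "u \<noteq> Bot (Suc n)" using bd_botD[OF d] u mn by fastforce
      ultimately show ?thesis using verts_cases[OF diagram_Union[OF dd u]] False by simp
    qed
  qed
  have "\<exists>i. {Top i, Bot j} \<in> bend_top n m d" if j: "j \<in> {1..Suc m}" for j
  proof (cases "j = Suc m")
    case True
    have "{swap_vtx n (Suc m) (Top (Suc n)), swap_vtx n (Suc m) (Top t)} \<in> bend_top n m d" unfolding bend_top_def vmap_iff[OF swap_vtx_inj] by (rule t)
    moreover have "swap_vtx n (Suc m) (Top t) = Top t" using tv by (intro swap_vtx_other) auto
    ultimately show ?thesis using True by (auto simp: insert_commute)
  next
    case False
    then have jm: "j \<in> {1..m}" using j by auto
    have "f j \<noteq> Suc n" using f[OF jm] t diagram_partner[OF dd] by (metis vtx.distinct(1))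
    then have "swap_vtx n (Suc m) (Top (f j)) = Top (f j)" by (intro swap_vtx_other) auto
    moreover have "swap_vtx n (Suc m) (Bot j) = Bot j" using False by (intro swap_vtx_other) auto
    moreover have "{swap_vtx n (Suc m) (Top (f j)), swap_vtx n (Suc m) (Bot j)} \<in> bend_top n m d"
      unfolding bend_top_def vmap_iff[OF swap_vtx_inj] by (rule f[OF jm])
    ultimately show ?thesis by auto
  qed
  moreover have "j \<in> {1..Suc m}" if jj: "Bot j \<in> \<Union>(bend_top n m d)" for j
  proof (cases "j = Suc m")
    case False
    obtain u where u: "u \<in> \<Union>d" "swap_vtx n (Suc m) u = Bot j" using jj unfolding bend_top_def vmap_Union by (metis imageE)
    then have "u = swap_vtx n (Suc m) (Bot j)" by (metis swap_vtx_swv)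
    also have "\<dots> = Bot j" using False by (intro swap_vtx_other) auto
    finally have "Bot j \<in> \<Union>d" using u(1) by simp
    from bd_botD[OF d this] show ?thesis by simp
  qed simp
  ultimately show ?thesis using dg by (simp add: bd_iff)
qed

text \<open>Builds the normal form of a diagram with its last top vertex on a vertical arc: that arc
  ends at the last occupied bottom vertex, and only permutations of the earlier ones preserve this
  form.\<close>

definition add_arc :: "nat \<Rightarrow> nat \<Rightarrow> diagram \<Rightarrow> diagram" where
  "add_arc n m d = insert {Top (Suc n), Bot m} d"

lemma typeB_eb:
  assumes d: "d \<in> bd n m" shows "add_arc n (Suc m) d \<in> bd (Suc n) (Suc m)"
proof -
  have dd: "d \<in> diagrams n" by (rule bd_diagrams[OF d])
  note nt = Top_Suc_notin[OF dd]
  have nb: "Bot (Suc m) \<notin> \<Union>d"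
  proof
    assume "Bot (Suc m) \<in> \<Union>d"
    from bd_botD[OF d this] show False by simp
  qed
  have "add_arc n (Suc m) d \<in> diagrams (Suc n)"
  proof (rule diagramsI)
    fix e assume "e \<in> add_arc n (Suc m) d"
    then consider "e = {Top (Suc n), Bot (Suc m)}" | "e \<in> d" by (auto simp: add_arc_def)
    then show "\<exists>u v. e = {u, v} \<and> u \<noteq> v \<and> u \<in> verts (Suc n) \<and> v \<in> verts (Suc n)"
    proof cases
      case 1 then show ?thesis using bd_le[OF d] by (intro exI[of _ "Top (Suc n)"] exI[of _ "Bot (Suc m)"]) (auto simp: verts_def)
    next
      case 2 then show ?thesis using diagram_edge[OF dd 2] verts_Suc by metis
    qed
  next
    fix e e' u assume e: "e \<in> add_arc n (Suc m) d" "e' \<in> add_arc n (Suc m) d" "u \<in> e" "u \<in> e'"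
    have new: "Top (Suc n) \<notin> f" "Bot (Suc m) \<notin> f" if "f \<in> d" for f using that nt nb by blast+
    from e show "e = e'" using new diagram_edge_eq[OF dd, of e e' u] unfolding add_arc_def by auto
  qed
  moreover have "\<exists>i. {Top i, Bot j} \<in> add_arc n (Suc m) d" if "j \<in> {1..Suc m}" for j
  proof (cases "j = Suc m")
    case False
    then have "j \<in> {1..m}" using that by auto
    then show ?thesis using bd_topD[OF d] unfolding add_arc_def by (metis insertCI)
  qed (auto simp: add_arc_def)
  moreover have "j \<in> {1..Suc m}" if "Bot j \<in> \<Union>(add_arc n (Suc m) d)" for j
  proof (cases "j = Suc m")
    case False
    then have "Bot j \<in> \<Union>d" using that by (auto simp: add_arc_def)
    from bd_botD[OF d this] show ?thesis by simp
  qed simp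
  ultimately show ?thesis by (simp add: bd_iff)
qed

lemma typeB_inv:
  assumes d: "d \<in> bd (Suc n) (Suc m)" and e: "{Top (Suc n), Bot (Suc m)} \<in> d"
  shows "d - {{Top (Suc n), Bot (Suc m)}} \<in> bd n m" "add_arc n (Suc m) (d - {{Top (Suc n), Bot (Suc m)}}) = d"
proof -
  let ?e = "{Top (Suc n), Bot (Suc m)}"
  have dd: "d \<in> diagrams (Suc n)" by (rule bd_diagrams[OF d])
  have out: "Top (Suc n) \<notin> \<Union>(d - {?e})" "Bot (Suc m) \<notin> \<Union>(d - {?e})"
    using diagram_edge_eq[OF dd _ e] by blast+
  have bots: "j \<in> {1..m}" if "Bot j \<in> \<Union>(d - {?e})" for j
  proof -
    have "j \<in> {1..Suc m}" using bd_botD[OF d] that by blast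
    moreover have "j \<noteq> Suc m" using that out(2) by auto
    ultimately show ?thesis by auto
  qed
  have "d - {?e} \<in> diagrams (Suc n)"
    by (rule diagramsI) (use diagram_edge[OF dd] diagram_edge_eq[OF dd] in \<open>blast+\<close>)
  moreover have "Bot (Suc n) \<notin> \<Union>(d - {?e})" using bots bd_le[OF d] by fastforce
  ultimately have "d - {?e} \<in> diagrams n" using diagrams_restrict out(1) by blast
  moreover have "\<exists>i. {Top i, Bot j} \<in> d - {?e}" if "j \<in> {1..m}" for j
  proof -
    have "j \<in> {1..Suc m}" using that by auto
    then obtain i where "{Top i, Bot j} \<in> d" by (rule bd_topD[OF d])
    moreover have "{Top i, Bot j} \<noteq> ?e" using that by (auto simp: doubleton_eq_iff)
    ultimately show ?thesis by blast
  qed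
  ultimately show "d - {?e} \<in> bd n m" using bots by (simp add: bd_iff)
  show "add_arc n (Suc m) (d - {?e}) = d" using e by (auto simp: add_arc_def)
qed

lemma type_cases:
  assumes "d \<in> bd (Suc n) m"
  obtains (A) "Top (Suc n) \<notin> \<Union>d" | (B) j where "j \<in> {1..m}" "{Top (Suc n), Bot j} \<in> d" | (C) j where "{Top (Suc n), Top j} \<in> d"
proof (cases "Top (Suc n) \<in> \<Union>d")
  case True
  then obtain e where e: "e \<in> d" "Top (Suc n) \<in> e" by blast
  obtain v where v: "e = {Top (Suc n), v}"
    using diagram_edge[OF bd_diagrams[OF assms] e(1)] e(2) by (metis insertE insert_commute singletonD)
  show thesis
  proof (cases v)
    case (Top j) then show thesis using C e v by blast
  next
    case (Bot j)
    then have "Bot j \<in> \<Union>d" using e v by blast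
    then show thesis using B bd_botD[OF assms] e v Bot by blast
  qed
qed (rule A)

subsection \<open>Products\<close>

context
  fixes n :: nat and b :: diagram
  assumes b: "b \<in> diagrams n"
begin

lemma Gprime_no_Top: "d \<in> diagrams n \<Longrightarrow> Top (Suc n) \<notin> \<Union>(Gprime b d)"
  by (rule Top_Suc_notin[OF Gprime_diagrams[OF b]])

lemma prod_A:
  assumes "d \<in> bd n m" shows "Gprime (eps (Suc n) b) d = Gprime b d" "ell (Suc n) (eps (Suc n) b) d = ell n b d"
proof -
  have dd: "d \<in> diagrams n" by (rule bd_diagrams[OF assms])
  have nb: "Bot (Suc m) \<notin> \<Union>d"
  proof
    assume "Bot (Suc m) \<in> \<Union>d"
    from bd_botD[OF assms this] show False by simp
  qed
  have sw: "vmap (swap_vtx n (Suc m)) d = d" by (rule vmap_swv_fix[OF Top_Suc_notin[OF dd] nb])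
  have "Bot (Suc m) \<notin> \<Union>(Gprime b d)" using Gprime_bot nb by blast
  then have "vmap (swap_vtx n (Suc m)) (Gprime b d) = Gprime b d" by (rule vmap_swv_fix[OF Gprime_no_Top[OF dd]])
  then show "Gprime (eps (Suc n) b) d = Gprime b d" using Gprime_eps[OF b nb] sw by simp
  show "ell (Suc n) (eps (Suc n) b) d = ell n b d" using ell_eps[OF b nb] sw by simp
qed

lemma prod_C:
  assumes "d \<in> bd n (Suc m)"
  shows "Gprime (eps (Suc n) b) (bend_top n m d) = bend_top n m (Gprime b d)" "ell (Suc n) (eps (Suc n) b) (bend_top n m d) = ell n b d"
  using Gprime_eps[OF b typeC_ec(3)[OF assms]] ell_eps[OF b typeC_ec(3)[OF assms]] by (simp_all add: bend_top_def)

text \<open>Position \<open>Suc m\<close> is taken by the added arc, so the last top vertex is bent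
  to \<open>Suc (Suc m)\<close>. The arc then joins two bottom vertices that are otherwise free and
  passes through the product unchanged.\<close>

lemma prod_B:
  assumes "d \<in> bd n m"
  shows "Gprime (eps (Suc n) b) (add_arc n (Suc m) d) = add_arc n (Suc m) (Gprime b d)" "ell (Suc n) (eps (Suc n) b) (add_arc n (Suc m) d) = ell n b d"
proof -
  let ?z = "Suc (Suc m)"
  have dd: "d \<in> diagrams n" by (rule bd_diagrams[OF assms])
  have nb: "Bot ?z \<notin> \<Union>d" "Bot (Suc m) \<notin> \<Union>d"
    using bd_botD[OF assms, of ?z] bd_botD[OF assms, of "Suc m"] by auto
  have nz: "Bot ?z \<notin> \<Union>(add_arc n (Suc m) d)" using nb by (auto simp: add_arc_def)
  have sw: "vmap (swap_vtx n ?z) d = d" by (rule vmap_swv_fix[OF Top_Suc_notin[OF dd] nb(1)])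
  have fixb: "swap_vtx n ?z (Bot (Suc m)) = Bot (Suc m)" by (rule swap_vtx_other) auto
  have eb1: "vmap (swap_vtx n ?z) (add_arc n (Suc m) d) = insert {Bot ?z, Bot (Suc m)} d"
    using sw fixb by (simp add: add_arc_def vmap_def)
  have "Bot ?z \<notin> \<Union>(Gprime b d)" using Gprime_bot nb by blast
  then have sw2: "vmap (swap_vtx n ?z) (Gprime b d) = Gprime b d" by (rule vmap_swv_fix[OF Gprime_no_Top[OF dd]])
  have "Gprime (eps (Suc n) b) (add_arc n (Suc m) d) = vmap (swap_vtx n ?z) (insert {Bot ?z, Bot (Suc m)} (Gprime b d))"
    unfolding Gprime_eps[OF b nz] eb1 by (subst Gprime_arc[OF nb]) auto
  also have "\<dots> = add_arc n (Suc m) (Gprime b d)" using sw2 fixb by (simp add: add_arc_def vmap_def)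
  finally show "Gprime (eps (Suc n) b) (add_arc n (Suc m) d) = add_arc n (Suc m) (Gprime b d)" .
  show "ell (Suc n) (eps (Suc n) b) (add_arc n (Suc m) d) = ell n b d"
    unfolding ell_eps[OF b nz] eb1 by (rule ell_arc[OF nb])
qed

text \<open>The path through such an arc meets only the added identity arc of
  \<open>eps (Suc n) b\<close>, which prolongs it to the top.\<close>

lemma vertical_persists:
  assumes "{Top (Suc n), Bot j} \<in> d" shows "{Top (Suc n), Bot j} \<in> Gprime (eps (Suc n) b) d"
proof -
  have "(lower (Top (Suc n)), lower (Bot j)) \<in> stack_rel (eps (Suc n) b) d" by (rule stack_lower[OF assms])
  then have "(U (Suc n), L j) \<in> (stack_rel (eps (Suc n) b) d)\<^sup>*"
    using stack_upper[of "Top (Suc n)" "Bot (Suc n)" "eps (Suc n) b" d] by (auto simp: eps_def intro: rtrancl_trans)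
  then show ?thesis by (simp add: Gprime_iff)
qed

lemma prodI_A:
  fixes x :: "'a::field"
  assumes "m \<le> n" "d \<in> bd n m" "e \<in> bd n m"
  shows "prodI x (Suc n) m (eps (Suc n) b) d e = prodI x n m b d e"
proof -
  have "e \<in> bd (Suc n) m" using typeA[OF assms(1)] assms(3) by blast
  then show ?thesis by (simp add: prodI_val assms(3) prod_A[OF assms(2)])
qed

lemma prodI_C:
  fixes x :: "'a::field"
  assumes "d \<in> bd n (Suc m)" "e \<in> bd n (Suc m)"
  shows "prodI x (Suc n) m (eps (Suc n) b) (bend_top n m d) (bend_top n m e) = prodI x n (Suc m) b d e"
proof -
  have "bend_top n m e = bend_top n m (Gprime b d) \<longleftrightarrow> e = Gprime b d" by (metis bend_top_ec)
  then show ?thesis by (simp add: prodI_val[OF typeC_ec(1)[OF assms(2)]] prodI_val[OF assms(2)] prod_C[OF assms(1)])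
qed

lemma prodI_B:
  fixes x :: "'a::field"
  assumes "d \<in> bd n m" "e \<in> bd n m"
  shows "prodI x (Suc n) (Suc m) (eps (Suc n) b) (add_arc n (Suc m) d) (add_arc n (Suc m) e) = prodI x n m b d e"
proof -
  have "{Top (Suc n), Bot (Suc m)} \<notin> e" using Top_Suc_notin[OF bd_diagrams[OF assms(2)]] by blast
  moreover have "{Top (Suc n), Bot (Suc m)} \<notin> Gprime b d" using Gprime_no_Top[OF bd_diagrams[OF assms(1)]] by blast
  ultimately have "add_arc n (Suc m) e = add_arc n (Suc m) (Gprime b d) \<longleftrightarrow> e = Gprime b d" unfolding add_arc_def by (simp add: insert_ident)
  then show ?thesis by (simp add: prodI_val[OF typeB_eb[OF assms(2)]] prodI_val[OF assms(2)] prod_B[OF assms(1)])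
qed

end

section \<open>Isomorphisms and exact sequences of modules\<close>

lemma is_homD:
  assumes "is_hom D M N f"
  shows "v \<in> mcar M \<Longrightarrow> f v \<in> mcar N" "u \<in> mcar M \<Longrightarrow> v \<in> mcar M \<Longrightarrow> f (madd M u v) = madd N (f u) (f v)"
    "v \<in> mcar M \<Longrightarrow> f (msmul M c v) = msmul N c (f v)" "d \<in> D \<Longrightarrow> v \<in> mcar M \<Longrightarrow> f (mact M d v) = mact N d (f v)"
  using assms unfolding is_hom_def by blast+

lemma is_homI:
  assumes "\<And>v. v \<in> mcar M \<Longrightarrow> f v \<in> mcar N" "\<And>u v. u \<in> mcar M \<Longrightarrow> v \<in> mcar M \<Longrightarrow> f (madd M u v) = madd N (f u) (f v)"
    "\<And>c v. v \<in> mcar M \<Longrightarrow> f (msmul M c v) = msmul N c (f v)" "\<And>d v. d \<in> D \<Longrightarrow> v \<in> mcar M \<Longrightarrow> f (mact M d v) = mact N d (f v)"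
  shows "is_hom D M N f"
  using assms unfolding is_hom_def by blast

lemma mclosedD:
  assumes "mclosed D M"
  shows "u \<in> mcar M \<Longrightarrow> v \<in> mcar M \<Longrightarrow> madd M u v \<in> mcar M" "v \<in> mcar M \<Longrightarrow> msmul M c v \<in> mcar M"
    "d \<in> D \<Longrightarrow> v \<in> mcar M \<Longrightarrow> mact M d v \<in> mcar M"
  using assms unfolding mclosed_def by blast+

lemma is_hom_comp:
  assumes f: "is_hom D M N f" and g: "is_hom D N P g" shows "is_hom D M P (g \<circ> f)"
  by (rule is_homI) (simp_all add: is_homD[OF f] is_homD[OF g])

lemma is_hom_inv:
  assumes f: "is_hom D M N f" and b: "bij_betw f (mcar M) (mcar N)" and c: "mclosed D M"
  shows "is_hom D N M (inv_into (mcar M) f)"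
proof -
  let ?g = "inv_into (mcar M) f"
  have g: "?g v \<in> mcar M" "f (?g v) = v" if "v \<in> mcar N" for v
    using that b by (auto simp: bij_betw_def intro: inv_into_into f_inv_into_f)
  have l: "?g (f u) = u" if "u \<in> mcar M" for u using that b by (simp add: bij_betw_def)
  show ?thesis
  proof (rule is_homI)
    show "?g v \<in> mcar M" if "v \<in> mcar N" for v by (rule g(1)[OF that])
    show "?g (madd N u v) = madd M (?g u) (?g v)" if "u \<in> mcar N" "v \<in> mcar N" for u v
      using l[OF mclosedD(1)[OF c g(1)[OF that(1)] g(1)[OF that(2)]]] is_homD(2)[OF f g(1)[OF that(1)] g(1)[OF that(2)]]
      by (simp add: g(2) that)
    show "?g (msmul N k v) = msmul M k (?g v)" if "v \<in> mcar N" for k v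
      using l[OF mclosedD(2)[OF c g(1)[OF that], of k]] is_homD(3)[OF f g(1)[OF that], of k] by (simp add: g(2) that)
    show "?g (mact N d v) = mact M d (?g v)" if "d \<in> D" "v \<in> mcar N" for d v
      using l[OF mclosedD(3)[OF c that(1) g(1)[OF that(2)]]] is_homD(4)[OF f that(1) g(1)[OF that(2)]] by (simp add: g(2) that)
  qed
qed

lemma dsum_simps [simp]:
  "mcar (dsum I Ms) = PiE I (\<lambda>i. mcar (Ms i))" "madd (dsum I Ms) \<phi> \<psi> = restrict (\<lambda>i. madd (Ms i) (\<phi> i) (\<psi> i)) I"
  "mzero (dsum I Ms) = restrict (\<lambda>i. mzero (Ms i)) I" "msmul (dsum I Ms) c \<phi> = restrict (\<lambda>i. msmul (Ms i) c (\<phi> i)) I"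
  "mact (dsum I Ms) d \<phi> = restrict (\<lambda>i. mact (Ms i) d (\<phi> i)) I"
  by (simp_all add: dsum_def)

lemma mclosed_dsum: "(\<And>i. i \<in> I \<Longrightarrow> mclosed D (Ms i)) \<Longrightarrow> mclosed D (dsum I Ms)"
  unfolding mclosed_def by (auto simp: PiE_iff)

lemma dsum_hom:
  assumes "\<And>i. i \<in> I \<Longrightarrow> is_hom D (Ms i) (Ns i) (k i)"
  shows "is_hom D (dsum I Ms) (dsum I Ns) (\<lambda>\<phi>. restrict (\<lambda>i. k i (\<phi> i)) I)"
  by (rule is_homI) (auto simp: PiE_iff is_homD[OF assms] intro!: restrict_ext)

lemma dsum_bij:
  assumes b: "\<And>i. i \<in> I \<Longrightarrow> bij_betw (k i) (mcar (Ms i)) (mcar (Ns i))"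
  shows "bij_betw (\<lambda>\<phi>. restrict (\<lambda>i. k i (\<phi> i)) I) (mcar (dsum I Ms)) (mcar (dsum I Ns))"
proof -
  have g: "inv_into (mcar (Ms i)) (k i) v \<in> mcar (Ms i)" "k i (inv_into (mcar (Ms i)) (k i) v) = v" if "i \<in> I" "v \<in> mcar (Ns i)" for i v
    using that b[OF that(1)] by (auto simp: bij_betw_def intro: inv_into_into f_inv_into_f)
  have l: "inv_into (mcar (Ms i)) (k i) (k i v) = v" "k i v \<in> mcar (Ns i)" if "i \<in> I" "v \<in> mcar (Ms i)" for i v
    using that b[OF that(1)] by (auto simp: bij_betw_def)
  show ?thesis
  proof (rule bij_betwI[where g="\<lambda>\<phi>. restrict (\<lambda>i. inv_into (mcar (Ms i)) (k i) (\<phi> i)) I"])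
    fix \<phi> assume f: "\<phi> \<in> mcar (dsum I Ms)"
    then have e: "\<phi> \<in> extensional I" by (simp add: PiE_iff)
    have p: "\<phi> i \<in> mcar (Ms i)" if "i \<in> I" for i using f that by (auto simp: PiE_iff)
    show "restrict (\<lambda>i. inv_into (mcar (Ms i)) (k i) (restrict (\<lambda>i. k i (\<phi> i)) I i)) I = \<phi>"
      by (rule extensionalityI[OF restrict_extensional e]) (simp add: l p)
  next
    fix \<phi> assume f: "\<phi> \<in> mcar (dsum I Ns)"
    then have e: "\<phi> \<in> extensional I" by (simp add: PiE_iff)
    have p: "\<phi> i \<in> mcar (Ns i)" if "i \<in> I" for i using f that by (auto simp: PiE_iff)
    show "restrict (\<lambda>i. k i (restrict (\<lambda>i. inv_into (mcar (Ms i)) (k i) (\<phi> i)) I i)) I = \<phi>"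
      by (rule extensionalityI[OF restrict_extensional e]) (simp add: g p)
  qed (auto simp: PiE_iff l g)
qed

lemma restr_simps [simp]:
  "mcar (restr n M) = mcar M" "madd (restr n M) = madd M" "mzero (restr n M) = mzero M"
  "msmul (restr n M) = msmul M" "mact (restr n M) d = mact M (eps n d)"
  by (simp_all add: restr_def)

lemma restr_hom: "is_hom (diagrams (Suc n)) M N f \<Longrightarrow> is_hom (diagrams n) (restr (Suc n) M) (restr (Suc n) N) f"
  unfolding is_hom_def by (simp add: eps_diagrams)

lemma restr_closed: "mclosed (diagrams (Suc n)) M \<Longrightarrow> mclosed (diagrams n) (restr (Suc n) M)"
  unfolding mclosed_def by (simp add: eps_diagrams)

text \<open>The sequence given by the kernel \<open>K\<close> of \<open>r\<close>, the module
  \<open>B'\<close> and the target \<open>E\<close> is moved along isomorphisms at all three places.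
  Some of these have to be inverted, which is where closedness of the carriers is used.\<close>

lemma short_exact_transfer:
  assumes H: "is_hom D B B' H" "bij_betw H (mcar B) (mcar B')" "mclosed D B"
    and r: "is_hom D B' E r" "r ` mcar B' = mcar E" and B': "mclosed D B'"
    and E: "madd E (mzero E) (mzero E) = mzero E" "\<And>c. msmul E c (mzero E) = mzero E" "\<And>d. d \<in> D \<Longrightarrow> mact E d (mzero E) = mzero E"
    and K: "K = B'\<lparr>mcar := {v \<in> mcar B'. r v = mzero E}\<rparr>" "is_hom D K A' k" "bij_betw k (mcar K) (mcar A')"
    and A: "is_hom D A A' a" "bij_betw a (mcar A) (mcar A')"
    and C: "is_hom D C E c" "bij_betw c (mcar C) (mcar E)" "mclosed D C" "mzero C \<in> mcar C" "c (mzero C) = mzero E"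
  shows "\<exists>f g. short_exact D A B C f g"
proof (intro exI)
  let ?k = "inv_into (mcar K) k" and ?H = "inv_into (mcar B) H" and ?c = "inv_into (mcar C) c"
  let ?f = "?H \<circ> (?k \<circ> a)" and ?g = "?c \<circ> (r \<circ> H)"
  have Kc: "mclosed D K" unfolding mclosed_def K(1) using mclosedD[OF B'] is_homD[OF r(1)] E by simp
  have incl: "is_hom D K B' id" unfolding is_hom_def K(1) by simp
  have hk: "is_hom D A' K ?k" by (rule is_hom_inv[OF K(2,3) Kc])
  have hH: "is_hom D B' B ?H" by (rule is_hom_inv[OF H])
  have "is_hom D A B' (?k \<circ> a)" using is_hom_comp[OF is_hom_comp[OF A(1) hk] incl] by simp
  then have f: "is_hom D A B ?f" using hH by (rule is_hom_comp)
  have g: "is_hom D B C ?g" by (rule is_hom_comp[OF is_hom_comp[OF H(1) r(1)] is_hom_inv[OF C(1-3)]])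
  have bk: "bij_betw (?k \<circ> a) (mcar A) (mcar K)" by (rule bij_betw_trans[OF A(2) bij_betw_inv_into[OF K(3)]])
  have bH: "bij_betw ?H (mcar B') (mcar B)" by (rule bij_betw_inv_into[OF H(2)])
  have KB: "mcar K \<subseteq> mcar B'" by (auto simp: K(1))
  have inj: "inj_on ?f (mcar A)"
    by (rule comp_inj_on) (use bk bH KB in \<open>auto simp: bij_betw_def intro: inj_on_subset\<close>)
  have Hl: "H (?H v) = v" "?H v \<in> mcar B" if "v \<in> mcar B'" for v
    using that H(2) by (auto simp: bij_betw_def intro: inv_into_into f_inv_into_f)
  have Hr: "?H (H v) = v" "H v \<in> mcar B'" if "v \<in> mcar B" for v using that H(2) by (auto simp: bij_betw_def)
  have cz: "?c v = mzero C \<longleftrightarrow> v = mzero E" if "v \<in> mcar E" for v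
  proof -
    have "c (?c v) = v" using that C(2) by (auto simp: bij_betw_def intro: f_inv_into_f)
    moreover have "?c (mzero E) = mzero C" using C(2,4,5) inv_into_f_f unfolding bij_betw_def by metis
    ultimately show ?thesis using C(5) by auto
  qed
  have "?f ` mcar A = ?H ` mcar K" using bk unfolding bij_betw_def image_comp[symmetric] by simp
  also have "\<dots> = {v \<in> mcar B. ?g v = mzero C}"
  proof (intro set_eqI iffI)
    fix v assume "v \<in> ?H ` mcar K"
    then obtain w where w: "v = ?H w" "w \<in> mcar B'" "r w = mzero E" by (auto simp: K(1))
    then show "v \<in> {v \<in> mcar B. ?g v = mzero C}" using Hl cz[of "r w"] is_homD(1)[OF r(1), of w] by simp
  next
    fix v assume v: "v \<in> {v \<in> mcar B. ?g v = mzero C}"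
    then have "H v \<in> mcar B'" using Hr by simp
    moreover from this have "r (H v) = mzero E" using v cz[of "r (H v)"] is_homD(1)[OF r(1)] by simp
    ultimately have "H v \<in> mcar K" by (simp add: K(1))
    then show "v \<in> ?H ` mcar K" using Hr(1) v by (metis (no_types, lifting) image_eqI mem_Collect_eq)
  qed
  finally have ker: "?f ` mcar A = {v \<in> mcar B. ?g v = mzero C}" .
  have "?g ` mcar B = ?c ` r ` H ` mcar B" by (simp only: image_comp comp_assoc)
  also have "\<dots> = mcar C" using H(2) r(2) bij_betw_inv_into[OF C(2)] by (simp add: bij_betw_def)
  finally show "short_exact D A B C ?f ?g" unfolding short_exact_def using f g inj ker by blast
qed

section \<open>The action on the three kinds of diagrams\<close>

text \<open>The permutation fixes \<open>Suc m\<close>, the position to which the top vertex is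
  bent.\<close>

lemma relab_ec:
  assumes "\<rho> permutes {1..m}" shows "relab \<rho> (bend_top n m d) = bend_top n m (relab \<rho> d)"
proof -
  have "mb \<rho> (swap_vtx n (Suc m) u) = swap_vtx n (Suc m) (mb \<rho> u)" for u
  proof (cases "u = Top (Suc n) \<or> u = Bot (Suc m)")
    case True then show ?thesis by (auto simp: permutes_fix_Suc[OF assms])
  next
    case False
    have "mb \<rho> u \<noteq> Bot (Suc m)"
    proof
      assume e: "mb \<rho> u = Bot (Suc m)"
      then obtain j where j: "u = Bot j" by (cases u) auto
      then have "\<rho> j = \<rho> (Suc m)" using e permutes_fix_Suc[OF assms] by simp
      then show False using permutes_inj[OF assms] False j by (auto dest: injD)
    qed
    moreover have "mb \<rho> u \<noteq> Top (Suc n)" using False by (cases u) auto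
    ultimately show ?thesis using False by (simp add: swap_vtx_other)
  qed
  then have "mb \<rho> \<circ> swap_vtx n (Suc m) = swap_vtx n (Suc m) \<circ> mb \<rho>" by (simp add: fun_eq_iff)
  then show ?thesis by (simp add: relab_def bend_top_def vmap_comp)
qed

lemma relab_eb:
  assumes "\<rho> permutes {1..m}" shows "relab \<rho> (add_arc n (Suc m) d) = add_arc n (Suc m) (relab \<rho> d)"
  using permutes_fix_Suc[OF assms] by (simp add: relab_def add_arc_def vmap_def)

lemma relab_arc: "{Top i, Bot j} \<in> d \<Longrightarrow> {Top i, Bot (\<rho> j)} \<in> relab \<rho> d"
proof -
  assume "{Top i, Bot j} \<in> d"
  then have "mb \<rho> ` {Top i, Bot j} \<in> relab \<rho> d" unfolding relab_def vmap_def by (rule imageI)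
  then show ?thesis by simp
qed

lemma add_arc_inj:
  assumes "d \<in> diagrams n" "e \<in> diagrams n" "add_arc n m d = add_arc n m e" shows "d = e"
proof -
  have "{Top (Suc n), Bot m} \<notin> d" "{Top (Suc n), Bot m} \<notin> e" using Top_Suc_notin assms by blast+
  then show ?thesis using assms(3) unfolding add_arc_def by (simp add: insert_ident)
qed

context
  fixes n m :: nat and b :: diagram and x :: "'a::field_char_0" and F :: "diagram \<Rightarrow> (nat \<Rightarrow> nat) \<Rightarrow> 'a"
  assumes b: "b \<in> diagrams n" and mn: "m \<le> n"
begin

abbreviation (input) PP where "PP d e \<equiv> prodI x (Suc n) m (eps (Suc n) b) d e"

lemma PP_zero: "e \<in> bd (Suc n) m \<Longrightarrow> e \<noteq> Gprime (eps (Suc n) b) d \<Longrightarrow> vsmul (PP d e) (F d) = 0"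
  by (simp add: prodI_val fv.scale_zero_left)

text \<open>A last top vertex that is isolated or on a vertical arc stays so under
  \<open>eps (Suc n) b\<close>. Only diagrams of the third kind can produce one of the third kind,
  which makes them a quotient.\<close>

lemma act_C:
  assumes e: "e \<in> bd n (Suc m)"
  shows "(\<Sum>d\<in>bd (Suc n) m. vsmul (PP d (bend_top n m e)) (F d)) = (\<Sum>d\<in>bd n (Suc m). vsmul (prodI x n (Suc m) b d e) (F (bend_top n m d)))"
proof -
  let ?S = "bend_top n m ` bd n (Suc m)"
  note ee = typeC_ec[OF e]
  obtain t where t: "{Top (Suc n), Top t} \<in> bend_top n m e" using ee(2) by blast
  have "(\<Sum>d\<in>bd (Suc n) m. vsmul (PP d (bend_top n m e)) (F d)) = (\<Sum>d\<in>?S. vsmul (PP d (bend_top n m e)) (F d))"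
  proof (rule sum.mono_neutral_right[OF finite_bd])
    show "?S \<subseteq> bd (Suc n) m" using typeC_ec(1) by blast
    show "\<forall>d\<in>bd (Suc n) m - ?S. vsmul (PP d (bend_top n m e)) (F d) = 0"
    proof
      fix d assume d: "d \<in> bd (Suc n) m - ?S"
      then have db: "d \<in> bd (Suc n) m" by blast
      from db show "vsmul (PP d (bend_top n m e)) (F d) = 0"
      proof (cases rule: type_cases)
        case A
        then have dn: "d \<in> bd n m" using typeA[OF mn] db by blast
        have "Top (Suc n) \<notin> \<Union>(Gprime (eps (Suc n) b) d)"
          unfolding prod_A(1)[OF b dn] by (rule Gprime_no_Top[OF b bd_diagrams[OF dn]])
        then have "bend_top n m e \<noteq> Gprime (eps (Suc n) b) d" using t by blast
        then show ?thesis by (rule PP_zero[OF ee(1)])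
      next
        case (B j)
        have "{Top (Suc n), Bot j} \<in> Gprime (eps (Suc n) b) d" by (rule vertical_persists[OF b B(2)])
        moreover have "{Top (Suc n), Bot j} \<notin> bend_top n m e" using diagram_partner[OF bd_diagrams[OF ee(1)] t] by blast
        ultimately have "bend_top n m e \<noteq> Gprime (eps (Suc n) b) d" by blast
        then show ?thesis by (rule PP_zero[OF ee(1)])
      next
        case (C j)
        have "d = bend_top n m (bend_top n m d)" by simp
        moreover have "bend_top n m d \<in> bd n (Suc m)" by (rule typeC_inv[OF db C mn])
        ultimately have "d \<in> ?S" by (rule image_eqI)
        then show ?thesis using d by blast
      qed
    qed
  qed
  also have "\<dots> = (\<Sum>d\<in>bd n (Suc m). vsmul (PP (bend_top n m d) (bend_top n m e)) (F (bend_top n m d)))"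
    by (rule sum.reindex[unfolded comp_def]) (metis inj_onI bend_top_ec)
  also have "\<dots> = (\<Sum>d\<in>bd n (Suc m). vsmul (prodI x n (Suc m) b d e) (F (bend_top n m d)))"
    by (rule sum.cong[OF refl]) (simp only: prodI_C[OF b _ e])
  finally show ?thesis .
qed

lemma vanish_C:
  assumes "\<And>d. d \<in> bd n (Suc m) \<Longrightarrow> F (bend_top n m d) = 0" "d \<in> bd (Suc n) m" "{Top (Suc n), Top j} \<in> d"
  shows "F d = 0"
  using assms(1)[OF typeC_inv[OF assms(2,3) mn]] by simp

text \<open>Diagrams of the third kind can turn into the other two, so \<open>F\<close> is assumed
  to vanish on them; the two remaining kinds do not mix.\<close>

lemma act_A:
  assumes van: "\<And>d. d \<in> bd n (Suc m) \<Longrightarrow> F (bend_top n m d) = 0" and e: "e \<in> bd n m"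
  shows "(\<Sum>d\<in>bd (Suc n) m. vsmul (PP d e) (F d)) = (\<Sum>d\<in>bd n m. vsmul (prodI x n m b d e) (F d))"
proof -
  have ee: "e \<in> bd (Suc n) m" and nt: "Top (Suc n) \<notin> \<Union>e" using typeA[OF mn] e by blast+
  have "(\<Sum>d\<in>bd (Suc n) m. vsmul (PP d e) (F d)) = (\<Sum>d\<in>bd n m. vsmul (PP d e) (F d))"
  proof (rule sum.mono_neutral_right[OF finite_bd])
    show "bd n m \<subseteq> bd (Suc n) m" using typeA[OF mn] by blast
    show "\<forall>d\<in>bd (Suc n) m - bd n m. vsmul (PP d e) (F d) = 0"
    proof
      fix d assume d: "d \<in> bd (Suc n) m - bd n m"
      then have db: "d \<in> bd (Suc n) m" by blast
      from db show "vsmul (PP d e) (F d) = 0"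
      proof (cases rule: type_cases)
        case A then show ?thesis using typeA[OF mn] d by blast
      next
        case (B j)
        have "{Top (Suc n), Bot j} \<in> Gprime (eps (Suc n) b) d" by (rule vertical_persists[OF b B(2)])
        then have "e \<noteq> Gprime (eps (Suc n) b) d" using nt by blast
        then show ?thesis by (rule PP_zero[OF ee])
      next
        case (C j) then show ?thesis using vanish_C[OF van db] by (simp add: fv.scale_zero_right)
      qed
    qed
  qed
  also have "\<dots> = (\<Sum>d\<in>bd n m. vsmul (prodI x n m b d e) (F d))"
    by (rule sum.cong[OF refl]) (simp only: prodI_A[OF b mn _ e])
  finally show ?thesis .
qed

text \<open>The bottom end of the arc at the last top vertex is preserved as well, so the diagrams
  with this end at \<open>m\<close> can be treated on their own.\<close>

lemma act_B:
  assumes m: "m = Suc m'" and van: "\<And>d. d \<in> bd n (Suc m) \<Longrightarrow> F (bend_top n m d) = 0" and e: "e \<in> bd n m'"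
  shows "(\<Sum>d\<in>bd (Suc n) m. vsmul (PP d (add_arc n m e)) (F d)) = (\<Sum>d\<in>bd n m'. vsmul (prodI x n m' b d e) (F (add_arc n m d)))"
proof -
  let ?S = "add_arc n m ` bd n m'"
  have ee: "add_arc n m e \<in> bd (Suc n) m" unfolding m by (rule typeB_eb[OF e])
  have ae: "{Top (Suc n), Bot m} \<in> add_arc n m e" by (simp add: add_arc_def)
  have "(\<Sum>d\<in>bd (Suc n) m. vsmul (PP d (add_arc n m e)) (F d)) = (\<Sum>d\<in>?S. vsmul (PP d (add_arc n m e)) (F d))"
  proof (rule sum.mono_neutral_right[OF finite_bd])
    show "?S \<subseteq> bd (Suc n) m" unfolding m using typeB_eb by blast
    show "\<forall>d\<in>bd (Suc n) m - ?S. vsmul (PP d (add_arc n m e)) (F d) = 0"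
    proof
      fix d assume d: "d \<in> bd (Suc n) m - ?S"
      then have db: "d \<in> bd (Suc n) m" by blast
      from db show "vsmul (PP d (add_arc n m e)) (F d) = 0"
      proof (cases rule: type_cases)
        case A
        then have dn: "d \<in> bd n m" using typeA[OF mn] db by blast
        have "Top (Suc n) \<notin> \<Union>(Gprime (eps (Suc n) b) d)"
          unfolding prod_A(1)[OF b dn] by (rule Gprime_no_Top[OF b bd_diagrams[OF dn]])
        then have "add_arc n m e \<noteq> Gprime (eps (Suc n) b) d" using ae by blast
        then show ?thesis by (rule PP_zero[OF ee])
      next
        case (B j)
        have "j \<noteq> m"
        proof
          assume "j = m"
          then have "d \<in> ?S" using typeB_inv[of d n m'] db B(2) unfolding m by (metis image_eqI)
          then show False using d by blast
        qed
        moreover have "{Top (Suc n), Bot j} \<in> Gprime (eps (Suc n) b) d" by (rule vertical_persists[OF b B(2)])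
        ultimately have "add_arc n m e \<noteq> Gprime (eps (Suc n) b) d" using diagram_partner[OF bd_diagrams[OF ee] ae] by blast
        then show ?thesis by (rule PP_zero[OF ee])
      next
        case (C j) then show ?thesis using vanish_C[OF van db] by (simp add: fv.scale_zero_right)
      qed
    qed
  qed
  also have "\<dots> = (\<Sum>d\<in>bd n m'. vsmul (PP (add_arc n m d) (add_arc n m e)) (F (add_arc n m d)))"
    by (rule sum.reindex[unfolded comp_def]) (meson inj_onI add_arc_inj bd_diagrams)
  also have "\<dots> = (\<Sum>d\<in>bd n m'. vsmul (prodI x n m' b d e) (F (add_arc n m d)))"
    unfolding m by (rule sum.cong[OF refl]) (simp only: prodI_B[OF b _ e])
  finally show ?thesis .
qed

end

section \<open>Restricting to diagrams with a horizontal arc at the last top vertex\<close>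

definition restrict_horizontal :: "nat \<Rightarrow> nat \<Rightarrow> (diagram \<Rightarrow> (nat \<Rightarrow> nat) \<Rightarrow> 'a) \<Rightarrow> diagram \<Rightarrow> (nat \<Rightarrow> nat) \<Rightarrow> 'a::field_char_0" where
  "restrict_horizontal n m F d = (if d \<in> bd n (Suc m) then F (bend_top n m d) else 0)"

lemma specht_0: "0 \<in> specht lam" by (rule fv.subspace_0[OF specht_subspace])

text \<open>Bending singles out position \<open>Suc m\<close>, so the target keeps equivariance only
  under permutations of the first \<open>m\<close> bottom vertices. With \<open>Suc m\<close> arcs
  present, this is where induction to the larger group comes from.\<close>

lemma restrict_horizontal_hom:
  fixes x :: "'a::field_char_0"
  assumes m: "sum_list lam = m" and mn: "m \<le> n"
  shows "is_hom (diagrams n) (restr (Suc n) (CMod x (Suc n) lam)) (EQ x n (Suc m) lam m) (restrict_horizontal n m)"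
  unfolding m
proof (rule is_homI; unfold restr_simps EQ_simps)
  fix F assume F: "F \<in> mcar (EQ x (Suc n) m lam m)"
  show "restrict_horizontal n m F \<in> mcar (EQ x n (Suc m) lam m)"
    unfolding in_EQ
  proof (intro conjI allI impI ballI)
    show "restrict_horizontal n m F d = 0" if "d \<notin> bd n (Suc m)" for d using that by (simp add: restrict_horizontal_def)
    show "restrict_horizontal n m F d \<in> specht lam" if "d \<in> bd n (Suc m)" for d
      using EQ_D(2)[OF F typeC_ec(1)[OF that]] that by (simp add: restrict_horizontal_def)
    fix \<rho> d assume r: "\<rho> permutes {1..m}" and d: "d \<in> bd n (Suc m)"
    have "F (bend_top n m (relab \<rho> d)) = perm_act \<rho> (F (bend_top n m d))"
      unfolding relab_ec[OF r, symmetric] by (rule EQ_D(3)[OF F r typeC_ec(1)[OF d]])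
    then show "restrict_horizontal n m F (relab \<rho> d) = perm_act \<rho> (restrict_horizontal n m F d)"
      using d relab_bd[OF permutes_Suc[OF r] d] by (simp add: restrict_horizontal_def)
  qed
  show "restrict_horizontal n m (\<lambda>d. vsmul c (F d)) = (\<lambda>d. vsmul c (restrict_horizontal n m F d))" for c
    by (rule ext) (simp add: restrict_horizontal_def fv.scale_zero_right)
  show "restrict_horizontal n m (F + G) = restrict_horizontal n m F + restrict_horizontal n m G" for G by (rule ext) (simp add: restrict_horizontal_def)
  fix b assume b: "b \<in> diagrams n"
  show "restrict_horizontal n m (\<lambda>e. \<Sum>d\<in>bd (Suc n) m. vsmul (prodI x (Suc n) m (eps (Suc n) b) d e) (F d)) =
    (\<lambda>e. \<Sum>d\<in>bd n (Suc m). vsmul (prodI x n (Suc m) b d e) (restrict_horizontal n m F d))"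
  proof (rule ext)
    fix e
    show "restrict_horizontal n m (\<lambda>e. \<Sum>d\<in>bd (Suc n) m. vsmul (prodI x (Suc n) m (eps (Suc n) b) d e) (F d)) e =
      (\<Sum>d\<in>bd n (Suc m). vsmul (prodI x n (Suc m) b d e) (restrict_horizontal n m F d))"
    proof (cases "e \<in> bd n (Suc m)")
      case True
      have "(\<Sum>d\<in>bd n (Suc m). vsmul (prodI x n (Suc m) b d e) (F (bend_top n m d)))
        = (\<Sum>d\<in>bd n (Suc m). vsmul (prodI x n (Suc m) b d e) (restrict_horizontal n m F d))"
        by (rule sum.cong[OF refl]) (simp only: restrict_horizontal_def if_True)
      then show ?thesis unfolding restrict_horizontal_def[of n m _ e] act_C[OF b mn True] using True by (simp only: if_True)
    next
      case False
      have "(\<Sum>d\<in>bd n (Suc m). vsmul (prodI x n (Suc m) b d e) (restrict_horizontal n m F d)) = 0"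
      proof (rule sum.neutral, rule ballI)
        fix d assume "d \<in> bd n (Suc m)"
        then have "prodI x n (Suc m) b d e = 0" using prodI_in_bd[OF b] False by metis
        then show "vsmul (prodI x n (Suc m) b d e) (restrict_horizontal n m F d) = 0" by (simp only: fv.scale_zero_left)
      qed
      then show ?thesis unfolding restrict_horizontal_def[of n m _ e] using False by (simp only: if_False)
    qed
  qed
qed

lemma restrict_horizontal_surj:
  fixes x :: "'a::field_char_0"
  assumes m: "sum_list lam = m" and mn: "m \<le> n"
  shows "restrict_horizontal n m ` mcar (CMod x (Suc n) lam) = mcar (EQ x n (Suc m) lam m)"
proof (intro equalityI subsetI)
  fix G assume "G \<in> restrict_horizontal n m ` mcar (CMod x (Suc n) lam)"
  then show "G \<in> mcar (EQ x n (Suc m) lam m)" using is_homD(1)[OF restrict_horizontal_hom[OF m mn, of x]] by auto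
next
  fix G :: "diagram \<Rightarrow> (nat \<Rightarrow> nat) \<Rightarrow> 'a" assume G: "G \<in> mcar (EQ x n (Suc m) lam m)"
  \<comment> \<open>Extension by zero to the other two kinds of diagrams; equivariance is preserved,
    which is all that a preimage has to satisfy.\<close>
  define F where "F d = (if bend_top n m d \<in> bd n (Suc m) then G (bend_top n m d) else 0)" for d
  have "F \<in> mcar (EQ x (Suc n) m lam m)"
    unfolding in_EQ
  proof (intro conjI allI impI ballI)
    show "F d = 0" if "d \<notin> bd (Suc n) m" for d
    proof -
      have "bend_top n m d \<notin> bd n (Suc m)" using typeC_ec(1)[of "bend_top n m d" n m] that by auto
      then show ?thesis by (simp add: F_def)
    qed
    show "F d \<in> specht lam" for d using EQ_D(2)[OF G] by (simp add: F_def specht_0)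
    fix \<rho> d assume r: "\<rho> permutes {1..m}"
    show "F (relab \<rho> d) = perm_act \<rho> (F d)"
    proof (cases "bend_top n m d \<in> bd n (Suc m)")
      case True
      then show ?thesis using relab_bd[OF permutes_Suc[OF r] True] EQ_D(3)[OF G r True] by (simp add: F_def relab_ec[OF r, symmetric])
    next
      case False
      then show ?thesis using relab_notin[OF permutes_Suc[OF r] False]
        by (simp add: F_def relab_ec[OF r, symmetric] perm_act_lin(3))
    qed
  qed
  moreover have "restrict_horizontal n m F = G"
    by (rule ext) (simp add: restrict_horizontal_def F_def EQ_D(1)[OF G])
  ultimately show "G \<in> restrict_horizontal n m ` mcar (CMod x (Suc n) lam)" unfolding m by blast
qed

section \<open>The quotient\<close>

definition induce_map :: "nat list \<Rightarrow> nat list set \<Rightarrow> (nat list \<Rightarrow> diagram \<Rightarrow> (nat \<Rightarrow> nat) \<Rightarrow> 'a) \<Rightarrow> diagram \<Rightarrow> (nat \<Rightarrow> nat) \<Rightarrow> 'a::field_char_0" where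
  "induce_map lam I \<phi> d = (\<Sum>be\<in>I. psi be lam (\<phi> be d))"

context
  fixes x :: "'a::field_char_0" and lam :: "nat list" and m n :: nat
  assumes lam: "is_partition m lam"
begin

abbreviation (input) "UP \<equiv> {be. removes_box lam be \<and> sum_list be \<le> n}"

lemma UP_sum: "be \<in> UP \<Longrightarrow> be \<in> up lam \<and> is_partition (Suc m) be \<and> sum_list be = Suc m \<and> lam \<in> down be"
  using up_partition[OF lam, of be] is_partition_sum by (auto simp: in_up in_down)

text \<open>In the opposite case \<open>Suc m > n\<close> the index set is empty, but so is
  \<open>bd n (Suc m)\<close>, and the empty direct sum matches the zero space of functions.\<close>

lemma UP_eq: assumes "Suc m \<le> n" shows "UP = up lam"
  using up_partition[OF lam] is_partition_sum assms by (fastforce simp: in_up)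

lemma dsum_UP:
  assumes "\<phi> \<in> mcar (dsum UP (\<lambda>be. CMod x n be))" "be \<in> UP" shows "\<phi> be \<in> mcar (EQ x n (Suc m) be (Suc m))"
proof -
  have "\<phi> be \<in> mcar (CMod x n be)" using assms unfolding dsum_simps by (rule PiE_mem)
  then show ?thesis using UP_sum[OF assms(2)] by simp
qed

lemma induce_map_restrict: "induce_map lam UP (restrict \<phi> UP) = induce_map lam UP \<phi>"
  unfolding induce_map_def[abs_def] by (rule ext, rule sum.cong[OF refl]) (simp only: restrict_apply if_True)

lemma induce_map_hom: "is_hom (diagrams n) (dsum UP (\<lambda>be. CMod x n be)) (EQ x n (Suc m) lam m) (induce_map lam UP)"
proof (rule is_homI)
  fix \<phi> assume p: "\<phi> \<in> mcar (dsum UP (\<lambda>be. CMod x n be))"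
  note pb = dsum_UP[OF p]
  show "induce_map lam UP \<phi> \<in> mcar (EQ x n (Suc m) lam m)"
    unfolding in_EQ
  proof (intro conjI allI impI ballI)
    show "induce_map lam UP \<phi> d = 0" if d: "d \<notin> bd n (Suc m)" for d
      unfolding induce_map_def
    proof (rule sum.neutral, rule ballI)
      fix be assume "be \<in> UP"
      from EQ_D(1)[OF pb[OF this] d] show "psi be lam (\<phi> be d) = 0" by (simp only: flin_0[OF flin_psi])
    qed
    show "induce_map lam UP \<phi> d \<in> specht lam" if d: "d \<in> bd n (Suc m)" for d
      unfolding induce_map_def
    proof (rule fv.subspace_sum[OF specht_subspace])
      fix be assume be: "be \<in> UP"
      show "psi be lam (\<phi> be d) \<in> specht lam"
        by (rule psi_specht[where m=m]) (use UP_sum[OF be] EQ_D(2)[OF pb[OF be] d] in auto)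
    qed
    fix \<rho> d assume r: "\<rho> permutes {1..m}" and d: "d \<in> bd n (Suc m)"
    have r': "\<rho> permutes {1..sum_list lam}" using r is_partition_sum[OF lam] by simp
    show "induce_map lam UP \<phi> (relab \<rho> d) = perm_act \<rho> (induce_map lam UP \<phi> d)"
      unfolding induce_map_def perm_act_lin(5)
      by (rule sum.cong[OF refl]) (simp only: EQ_D(3)[OF pb permutes_Suc[OF r] d] psi_perm_act[OF r'])
  qed
  show "induce_map lam UP (msmul (dsum UP (\<lambda>be. CMod x n be)) c \<phi>) = msmul (EQ x n (Suc m) lam m) c (induce_map lam UP \<phi>)" for c
    unfolding dsum_simps EQ_simps induce_map_restrict unfolding induce_map_def[abs_def]
    by (rule ext) (simp only: flin_scale[OF flin_psi] fv.scale_sum_right)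
  show "induce_map lam UP (madd (dsum UP (\<lambda>be. CMod x n be)) \<phi> \<psi>) = madd (EQ x n (Suc m) lam m) (induce_map lam UP \<phi>) (induce_map lam UP \<psi>)" for \<psi>
    unfolding dsum_simps EQ_simps induce_map_restrict
    by (rule ext) (simp only: induce_map_def plus_fun_apply flin_add[OF flin_psi] sum.distrib)
  fix b assume b: "b \<in> diagrams n"
  show "induce_map lam UP (mact (dsum UP (\<lambda>be. CMod x n be)) b \<phi>) = mact (EQ x n (Suc m) lam m) b (induce_map lam UP \<phi>)"
    unfolding dsum_simps EQ_simps induce_map_restrict
  proof (rule ext)
    fix e
    have "induce_map lam UP (\<lambda>be e. \<Sum>d\<in>bd n (sum_list be). vsmul (prodI x n (sum_list be) b d e) (\<phi> be d)) e
      = (\<Sum>be\<in>UP. \<Sum>d\<in>bd n (Suc m). vsmul (prodI x n (Suc m) b d e) (psi be lam (\<phi> be d)))"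
      unfolding induce_map_def
    proof (rule sum.cong[OF refl])
      fix be assume "be \<in> UP"
      then have s: "sum_list be = Suc m" using UP_sum by blast
      show "psi be lam (\<Sum>d\<in>bd n (sum_list be). vsmul (prodI x n (sum_list be) b d e) (\<phi> be d))
        = (\<Sum>d\<in>bd n (Suc m). vsmul (prodI x n (Suc m) b d e) (psi be lam (\<phi> be d)))"
        unfolding s flin_sum[OF flin_psi] flin_scale[OF flin_psi] ..
    qed
    also have "\<dots> = (\<Sum>d\<in>bd n (Suc m). vsmul (prodI x n (Suc m) b d e) (induce_map lam UP \<phi> d))"
      unfolding induce_map_def fv.scale_sum_right by (rule sum.swap)
    finally show "induce_map lam UP (\<lambda>be e. \<Sum>d\<in>bd n (sum_list be). vsmul (prodI x n (sum_list be) b d e) (\<phi> be d)) e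
      = (\<Sum>d\<in>bd n (Suc m). vsmul (prodI x n (Suc m) b d e) (induce_map lam UP \<phi> d))" .
  qed
qed

text \<open>Equivariance turns the values at relabelled diagrams into translates of the value at
  \<open>d\<close>, so the injectivity of the induction rule applies at each \<open>d\<close>
  separately.\<close>

lemma induce_map_inj: "inj_on (induce_map lam UP) (mcar (dsum UP (\<lambda>be. CMod x n be)))"
proof (rule inj_onI)
  fix \<phi> \<psi> assume p: "\<phi> \<in> mcar (dsum UP (\<lambda>be. CMod x n be))" and q: "\<psi> \<in> mcar (dsum UP (\<lambda>be. CMod x n be))"
    and e: "induce_map lam UP \<phi> = induce_map lam UP \<psi>"
  note pb = dsum_UP[OF p] and qb = dsum_UP[OF q]
  have "\<phi> be d = \<psi> be d" if be: "be \<in> UP" and d: "d \<in> bd n (Suc m)" for be d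
  proof -
    note U = UP_eq[OF bd_le[OF d]]
    have "(\<lambda>be. \<phi> be d - \<psi> be d) be = 0"
    proof (rule psi_ind_inj[OF lam])
      show "\<phi> be d - \<psi> be d \<in> specht be" if "be \<in> up lam" for be
        by (rule fv.subspace_diff[OF specht_subspace EQ_D(2)[OF pb d] EQ_D(2)[OF qb d]]) (use that U in blast)+
      show "be \<in> up lam" using be U by blast
      fix \<tau> assume t: "\<tau> permutes {1..Suc m}"
      have "(\<Sum>be\<in>UP. psi be lam (perm_act \<tau> (\<phi> be d - \<psi> be d))) = (\<Sum>be\<in>UP. psi be lam (\<phi> be (relab \<tau> d)) - psi be lam (\<psi> be (relab \<tau> d)))"
        by (rule sum.cong[OF refl])
          (simp only: perm_act_lin(4) flin_diff[OF flin_psi] EQ_D(3)[OF pb t d] EQ_D(3)[OF qb t d])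
      also have "\<dots> = induce_map lam UP \<phi> (relab \<tau> d) - induce_map lam UP \<psi> (relab \<tau> d)" unfolding induce_map_def by (rule sum_subtractf)
      also have "\<dots> = 0" unfolding e by (rule diff_self)
      finally show "(\<Sum>be\<in>up lam. psi be lam (perm_act \<tau> (\<phi> be d - \<psi> be d))) = 0" unfolding U .
    qed
    then show ?thesis by simp
  qed
  note on = this
  have "\<phi> be = \<psi> be" if be: "be \<in> UP" for be
  proof (rule ext)
    fix d
    show "\<phi> be d = \<psi> be d"
      by (cases "d \<in> bd n (Suc m)") (simp_all only: on[OF be] EQ_D(1)[OF pb[OF be]] EQ_D(1)[OF qb[OF be]] not_False_eq_True)
  qed
  then show "\<phi> = \<psi>" by (rule PiE_ext[OF p[unfolded dsum_simps] q[unfolded dsum_simps]])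
qed

lemma induce_map_surj:
  assumes G: "G \<in> mcar (EQ x n (Suc m) lam m)"
  shows "G \<in> induce_map lam UP ` mcar (dsum UP (\<lambda>be. CMod x n be))"
proof -
  \<comment> \<open>The induction rule is solved at each diagram independently of the other diagrams
    in its orbit.\<close>
  have "\<exists>w. (\<forall>be\<in>up lam. w be \<in> specht be) \<and> (\<forall>\<tau>. \<tau> permutes {1..Suc m} \<longrightarrow> G (relab \<tau> d) = (\<Sum>be\<in>up lam. psi be lam (perm_act \<tau> (w be))))"
    if d: "d \<in> bd n (Suc m)" for d
  proof -
    have c1: "G (relab \<tau> d) \<in> specht lam" if "\<tau> permutes {1..Suc m}" for \<tau> by (rule EQ_D(2)[OF G relab_bd[OF that d]])
    have c2: "G (relab (\<rho> \<circ> \<tau>) d) = perm_act \<rho> (G (relab \<tau> d))" if "\<rho> permutes {1..m}" "\<tau> permutes {1..Suc m}" for \<rho> \<tau>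
      unfolding relab_comp[symmetric] by (rule EQ_D(3)[OF G that(1) relab_bd[OF that(2) d]])
    show ?thesis
    proof (rule psi_ind_surj[where \<chi>="\<lambda>\<tau>. G (relab \<tau> d)", OF lam])
      fix w assume w: "\<And>be. be \<in> up lam \<Longrightarrow> w be \<in> specht be"
        "\<And>\<tau>. \<tau> permutes {1..Suc m} \<Longrightarrow> G (relab \<tau> d) = (\<Sum>be\<in>up lam. psi be lam (perm_act \<tau> (w be)))"
      show ?thesis by (rule exI[of _ w]) (intro conjI ballI allI impI w)
    qed (fact c1, fact c2)
  qed
  then have "\<forall>d\<in>bd n (Suc m). \<exists>w. (\<forall>be\<in>up lam. w be \<in> specht be) \<and>
      (\<forall>\<tau>. \<tau> permutes {1..Suc m} \<longrightarrow> G (relab \<tau> d) = (\<Sum>be\<in>up lam. psi be lam (perm_act \<tau> (w be))))" by (rule ballI)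
  from bchoice[OF this] obtain W where W: "\<forall>d\<in>bd n (Suc m). (\<forall>be\<in>up lam. W d be \<in> specht be) \<and>
      (\<forall>\<tau>. \<tau> permutes {1..Suc m} \<longrightarrow> G (relab \<tau> d) = (\<Sum>be\<in>up lam. psi be lam (perm_act \<tau> (W d be))))" by (rule exE)
  have W1: "W d be \<in> specht be" if "d \<in> bd n (Suc m)" "be \<in> up lam" for d be
    using bspec[OF conjunct1[OF bspec[OF W that(1)]] that(2)] .
  have W2: "G (relab \<tau> d) = (\<Sum>be\<in>up lam. psi be lam (perm_act \<tau> (W d be)))" if "d \<in> bd n (Suc m)" "\<tau> permutes {1..Suc m}" for d \<tau>
    using mp[OF spec[OF conjunct2[OF bspec[OF W that(1)]]] that(2)] .
  \<comment> \<open>Both sides solve the same instance of the induction rule, so its injectivity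
    makes the independent choices equivariant.\<close>
  have We: "W (relab \<sigma> d) be = perm_act \<sigma> (W d be)" if s: "\<sigma> permutes {1..Suc m}" and d: "d \<in> bd n (Suc m)" and be: "be \<in> up lam" for \<sigma> d be
  proof -
    note rd = relab_bd[OF s d]
    have "(\<lambda>be. W (relab \<sigma> d) be - perm_act \<sigma> (W d be)) be = 0"
    proof (rule psi_ind_inj[OF lam _ _ be])
      fix be' assume be': "be' \<in> up lam"
      have "\<sigma> permutes {1..sum_list be'}" using s is_partition_sum[OF up_partition[OF lam be']] by simp
      then have "perm_act \<sigma> (W d be') \<in> specht be'" by (rule perm_act_specht) (rule W1[OF d be'])
      then show "W (relab \<sigma> d) be' - perm_act \<sigma> (W d be') \<in> specht be'"
        by (rule fv.subspace_diff[OF specht_subspace W1[OF rd be']])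
    next
      fix \<tau> assume t: "\<tau> permutes {1..Suc m}"
      have "(\<Sum>be\<in>up lam. psi be lam (perm_act \<tau> (W (relab \<sigma> d) be - perm_act \<sigma> (W d be))))
        = (\<Sum>be\<in>up lam. psi be lam (perm_act \<tau> (W (relab \<sigma> d) be)) - psi be lam (perm_act (\<tau> \<circ> \<sigma>) (W d be)))"
        by (rule sum.cong[OF refl]) (simp only: perm_act_lin(4) flin_diff[OF flin_psi] perm_act_comp)
      also have "\<dots> = G (relab \<tau> (relab \<sigma> d)) - G (relab (\<tau> \<circ> \<sigma>) d)"
        unfolding W2[OF rd t] W2[OF d permutes_compose[OF s t]] by (rule sum_subtractf)
      also have "\<dots> = 0" unfolding relab_comp by (rule diff_self)
      finally show "(\<Sum>be\<in>up lam. psi be lam (perm_act \<tau> (W (relab \<sigma> d) be - perm_act \<sigma> (W d be)))) = 0" .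
    qed
    then show ?thesis by simp
  qed
  define \<phi> where "\<phi> = restrict (\<lambda>be d. if d \<in> bd n (Suc m) then W d be else 0) UP"
  have "\<phi> \<in> mcar (dsum UP (\<lambda>be. CMod x n be))"
    unfolding dsum_simps \<phi>_def
  proof (rule restrict_PiE_iff[THEN iffD2], rule ballI)
    fix be assume be: "be \<in> UP"
    then have u: "be \<in> up lam" and s: "sum_list be = Suc m" using UP_sum by blast+
    show "(\<lambda>d. if d \<in> bd n (Suc m) then W d be else 0) \<in> mcar (CMod x n be)"
      unfolding s in_EQ using W1[OF _ u] We[OF _ _ u] relab_bd by auto
  qed
  moreover have "induce_map lam UP \<phi> = G"
  proof (rule ext)
    fix d
    show "induce_map lam UP \<phi> d = G d"
    proof (cases "d \<in> bd n (Suc m)")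
      case True
      have "induce_map lam UP \<phi> d = (\<Sum>be\<in>UP. psi be lam (perm_act id (W d be)))"
        unfolding \<phi>_def induce_map_restrict unfolding induce_map_def by (rule sum.cong[OF refl]) (simp only: True if_True perm_act_id)
      also have "\<dots> = G (relab id d)" unfolding UP_eq[OF bd_le[OF True]] by (rule W2[OF True permutes_id, symmetric])
      finally show ?thesis by simp
    next
      case False
      have "induce_map lam UP \<phi> d = 0"
        unfolding \<phi>_def induce_map_restrict unfolding induce_map_def by (rule sum.neutral, rule ballI) (simp only: False if_False flin_0[OF flin_psi])
      then show ?thesis by (simp add: EQ_D(1)[OF G False])
    qed
  qed
  ultimately show ?thesis by blast
qed

lemma induce_map_bij: "bij_betw (induce_map lam UP) (mcar (dsum UP (\<lambda>be. CMod x n be))) (mcar (EQ x n (Suc m) lam m))"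
  unfolding bij_betw_def using induce_map_inj induce_map_surj is_homD(1)[OF induce_map_hom] by blast

lemma induce_map_zero: "induce_map lam UP (mzero (dsum UP (\<lambda>be. CMod x n be))) = 0"
  unfolding dsum_simps EQ_simps induce_map_restrict unfolding induce_map_def[abs_def]
  by (rule ext) (simp only: zero_fun_apply flin_0[OF flin_psi] sum.neutral_const)

end

section \<open>The kernel\<close>

text \<open>The case \<open>al = lam\<close> reads the diagrams of the first kind. For a smaller
  shape only those of the second kind in normal form are read, as equivariance determines the values
  at the others; \<open>psi\<close> then splits the restricted Specht module.\<close>

definition kernel_component :: "nat \<Rightarrow> nat list \<Rightarrow> (diagram \<Rightarrow> (nat \<Rightarrow> nat) \<Rightarrow> 'a) \<Rightarrow> nat list \<Rightarrow> diagram \<Rightarrow> (nat \<Rightarrow> nat) \<Rightarrow> 'a::field_char_0" where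
  "kernel_component n lam F al d = (if d \<in> bd n (sum_list al)
      then if al = lam then F d else psi lam al (F (add_arc n (sum_list lam) d)) else 0)"

context
  fixes x :: "'a::field_char_0" and lam :: "nat list" and m n :: nat
  assumes lam: "is_partition m lam" and mn: "m \<le> n"
begin

abbreviation (input) "DN \<equiv> {al. part_le al lam}"

abbreviation (input) "KK \<equiv> (restr (Suc n) (CMod x (Suc n) lam))\<lparr>mcar := {v \<in> mcar (restr (Suc n) (CMod x (Suc n) lam)).
  restrict_horizontal n m v = mzero (EQ x n (Suc m) lam m)}\<rparr>"

lemma sum_lam: "sum_list lam = m" by (rule is_partition_sum[OF lam])

lemma DN_cases:
  assumes "al \<in> DN"
  obtains "al = lam" | m' where "al \<noteq> lam" "m = Suc m'" "al \<in> down lam" "is_partition m' al" "sum_list al = m'"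
proof (cases "al = lam")
  case False
  then have d: "al \<in> down lam" using assms by (simp add: part_le_def in_down)
  then have "m = Suc (sum_list al)" using removes_boxD(5)[of al lam] sum_lam by (simp add: in_down)
  then show thesis using that(2)[OF False _ d] removes_boxD(1)[of al lam] d by (simp add: in_down)
qed (rule that(1))

lemma down_DN: assumes "al \<in> down lam" shows "al \<in> DN" "al \<noteq> lam"
  using assms removes_boxD(5)[of al lam] by (auto simp: part_le_def in_down)

lemma KK_iff: "F \<in> mcar KK \<longleftrightarrow> F \<in> mcar (EQ x (Suc n) m lam m) \<and> (\<forall>d\<in>bd n (Suc m). F (bend_top n m d) = 0)"
proof -
  have "restrict_horizontal n m F = 0 \<longleftrightarrow> (\<forall>d\<in>bd n (Suc m). F (bend_top n m d) = 0)"
  proof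
    assume r: "restrict_horizontal n m F = 0"
    have "restrict_horizontal n m F d = 0" for d unfolding r by simp
    then show "\<forall>d\<in>bd n (Suc m). F (bend_top n m d) = 0" unfolding restrict_horizontal_def by metis
  next
    assume r: "\<forall>d\<in>bd n (Suc m). F (bend_top n m d) = 0"
    show "restrict_horizontal n m F = 0" by (rule ext) (use r in \<open>simp add: restrict_horizontal_def\<close>)
  qed
  then show ?thesis by (simp add: sum_lam)
qed

lemma kernel_component_lam: "d \<in> bd n m \<Longrightarrow> kernel_component n lam F lam d = F d" by (simp add: kernel_component_def sum_lam)

lemma kernel_component_down: "al \<noteq> lam \<Longrightarrow> d \<in> bd n (sum_list al) \<Longrightarrow> kernel_component n lam F al d = psi lam al (F (add_arc n m d))"
  by (simp add: kernel_component_def sum_lam)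

lemma kernel_component_out: "d \<notin> bd n (sum_list al) \<Longrightarrow> kernel_component n lam F al d = 0" by (simp add: kernel_component_def)

lemma kernel_component_car:
  assumes F: "F \<in> mcar KK" and al: "al \<in> DN" shows "kernel_component n lam F al \<in> mcar (CMod x n al)"
proof -
  have FF: "F \<in> mcar (EQ x (Suc n) m lam m)" using F unfolding KK_iff by blast
  from al show ?thesis
  proof (cases rule: DN_cases)
    case 1
    show ?thesis unfolding 1 sum_lam in_EQ
    proof (intro conjI allI impI ballI)
      show "kernel_component n lam F lam d = 0" if "d \<notin> bd n m" for d using that by (intro kernel_component_out) (simp add: sum_lam)
      show "kernel_component n lam F lam d \<in> specht lam" if "d \<in> bd n m" for d
        unfolding kernel_component_lam[OF that] by (rule EQ_D(2)[OF FF]) (use that typeA[OF mn] in blast)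
      fix \<rho> d assume r: "\<rho> permutes {1..m}" and d: "d \<in> bd n m"
      show "kernel_component n lam F lam (relab \<rho> d) = perm_act \<rho> (kernel_component n lam F lam d)"
        unfolding kernel_component_lam[OF d] kernel_component_lam[OF relab_bd[OF r d]] by (rule EQ_D(3)[OF FF r]) (use d typeA[OF mn] in blast)
    qed
  next
    case (2 m')
    note lam' = lam[unfolded 2(2)]
    have k: "kernel_component n lam F al d = psi lam al (F (add_arc n (Suc m') d))" if "d \<in> bd n m'" for d
      using kernel_component_down[OF 2(1)] that unfolding 2(5) 2(2) .
    show ?thesis unfolding 2(5) in_EQ
    proof (intro conjI allI impI ballI)
      show "kernel_component n lam F al d = 0" if "d \<notin> bd n m'" for d using that by (intro kernel_component_out) (simp add: 2(5))
      show "kernel_component n lam F al d \<in> specht al" if "d \<in> bd n m'" for d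
        unfolding k[OF that] by (rule psi_specht[OF lam' 2(3)]) (rule EQ_D(2)[OF FF[unfolded 2(2)] typeB_eb[OF that]])
      fix \<rho> d assume r: "\<rho> permutes {1..m'}" and d: "d \<in> bd n m'"
      have r': "\<rho> permutes {1..sum_list al}" using r 2(5) by simp
      show "kernel_component n lam F al (relab \<rho> d) = perm_act \<rho> (kernel_component n lam F al d)"
        unfolding k[OF d] k[OF relab_bd[OF r d]] relab_eb[OF r, symmetric]
          EQ_D(3)[OF FF[unfolded 2(2)] permutes_Suc[OF r] typeB_eb[OF d]] by (rule psi_perm_act[OF r'])
    qed
  qed
qed

lemma kernel_component_act:
  assumes F: "F \<in> mcar KK" and al: "al \<in> DN" and b: "b \<in> diagrams n"
  shows "kernel_component n lam (mact (EQ x (Suc n) m lam m) (eps (Suc n) b) F) al = mact (CMod x n al) b (kernel_component n lam F al)"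
proof (rule ext)
  fix e
  have van: "F (bend_top n m d) = 0" if "d \<in> bd n (Suc m)" for d using F that unfolding KK_iff by blast
  show "kernel_component n lam (mact (EQ x (Suc n) m lam m) (eps (Suc n) b) F) al e = mact (CMod x n al) b (kernel_component n lam F al) e"
  proof (cases "e \<in> bd n (sum_list al)")
    case False
    have "mact (CMod x n al) b (kernel_component n lam F al) e = 0"
      unfolding EQ_simps
    proof (rule sum.neutral, rule ballI)
      fix d assume "d \<in> bd n (sum_list al)"
      then have "prodI x n (sum_list al) b d e = 0" using prodI_in_bd[OF b] False by metis
      then show "vsmul (prodI x n (sum_list al) b d e) (kernel_component n lam F al d) = 0" by (simp only: fv.scale_zero_left)
    qed
    then show ?thesis by (simp only: kernel_component_out[OF False])
  next
    case True
    from al show ?thesis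
    proof (cases rule: DN_cases)
      case 1
      have e: "e \<in> bd n m" using True 1 sum_lam by simp
      have a: "mact (EQ x (Suc n) m lam m) (eps (Suc n) b) F e = (\<Sum>d\<in>bd n m. vsmul (prodI x n m b d e) (F d))"
        unfolding EQ_simps by (rule act_A[OF b mn _ e]) (rule van)
      show ?thesis unfolding 1 sum_lam kernel_component_lam[OF e] a unfolding EQ_simps by (rule sum.cong[OF refl]) (simp only: kernel_component_lam)
    next
      case (2 m')
      have e: "e \<in> bd n m'" using True 2(5) by simp
      have a: "mact (EQ x (Suc n) m lam m) (eps (Suc n) b) F (add_arc n m e) = (\<Sum>d\<in>bd n m'. vsmul (prodI x n m' b d e) (F (add_arc n m d)))"
        unfolding EQ_simps by (rule act_B[OF b mn 2(2) _ e]) (rule van)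
      show ?thesis unfolding kernel_component_down[OF 2(1) True] a unfolding 2(5) EQ_simps flin_sum[OF flin_psi] flin_scale[OF flin_psi]
        by (rule sum.cong[OF refl]) (simp only: kernel_component_down[OF 2(1), unfolded 2(5)])
    qed
  qed
qed

definition kernel_map :: "(diagram \<Rightarrow> (nat \<Rightarrow> nat) \<Rightarrow> 'a) \<Rightarrow> nat list \<Rightarrow> diagram \<Rightarrow> (nat \<Rightarrow> nat) \<Rightarrow> 'a" where
  "kernel_map F = restrict (kernel_component n lam F) DN"

lemma kernel_map_hom: "is_hom (diagrams n) KK (dsum DN (\<lambda>al. CMod x n al)) kernel_map"
proof (rule is_homI; unfold dsum_simps kernel_map_def)
  fix F assume F: "F \<in> mcar KK"
  show "restrict (kernel_component n lam F) DN \<in> (\<Pi>\<^sub>E al\<in>DN. mcar (CMod x n al))"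
    by (rule restrict_PiE_iff[THEN iffD2], rule ballI) (rule kernel_component_car[OF F])
  show "restrict (kernel_component n lam (msmul KK c F)) DN = (\<lambda>al\<in>DN. msmul (CMod x n al) c (restrict (kernel_component n lam F) DN al))" for c
  proof (rule restrict_ext)
    fix al assume al: "al \<in> DN"
    have "kernel_component n lam (\<lambda>d. vsmul c (F d)) al = (\<lambda>d. vsmul c (kernel_component n lam F al d))"
      by (rule ext) (simp add: kernel_component_def flin_scale[OF flin_psi] fv.scale_zero_right)
    then show "kernel_component n lam (msmul KK c F) al = msmul (CMod x n al) c (restrict (kernel_component n lam F) DN al)" using al by simp
  qed
  show "restrict (kernel_component n lam (madd KK F G)) DN = (\<lambda>al\<in>DN. madd (CMod x n al) (restrict (kernel_component n lam F) DN al) (restrict (kernel_component n lam G) DN al))" for G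
  proof (rule restrict_ext)
    fix al assume al: "al \<in> DN"
    have "kernel_component n lam (F + G) al = kernel_component n lam F al + kernel_component n lam G al"
      by (rule ext) (simp add: kernel_component_def flin_add[OF flin_psi])
    then show "kernel_component n lam (madd KK F G) al = madd (CMod x n al) (restrict (kernel_component n lam F) DN al) (restrict (kernel_component n lam G) DN al)" using al by simp
  qed
  fix b assume b: "b \<in> diagrams n"
  show "restrict (kernel_component n lam (mact KK b F)) DN = (\<lambda>al\<in>DN. mact (CMod x n al) b (restrict (kernel_component n lam F) DN al))"
  proof (rule restrict_ext)
    fix al assume al: "al \<in> DN"
    have "mact KK b F = mact (EQ x (Suc n) m lam m) (eps (Suc n) b) F" by (simp add: sum_lam)
    then show "kernel_component n lam (mact KK b F) al = mact (CMod x n al) b (restrict (kernel_component n lam F) DN al)"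
      using kernel_component_act[OF F al b] al by (simp only: restrict_apply if_True)
  qed
qed

text \<open>A single transposition brings any vertical arc at the last top vertex into the normal
  position.\<close>

lemma typeB_move:
  assumes d: "d \<in> bd (Suc n) m" and j: "j \<in> {1..m}" "{Top (Suc n), Bot j} \<in> d"
  shows "transpose j m permutes {1..m}" "relab (transpose j m) d \<in> bd (Suc n) m" "{Top (Suc n), Bot m} \<in> relab (transpose j m) d"
proof -
  show p: "transpose j m permutes {1..m}" using j(1) by (intro permutes_swap_id) auto
  show "relab (transpose j m) d \<in> bd (Suc n) m" by (rule relab_bd[OF p d])
  show "{Top (Suc n), Bot m} \<in> relab (transpose j m) d" using relab_arc[OF j(2), of "transpose j m"] by simp
qed

lemma kernel_map_inj: "inj_on kernel_map (mcar KK)"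
proof (rule inj_onI)
  fix F G assume F: "F \<in> mcar KK" and G: "G \<in> mcar KK" and e: "kernel_map F = kernel_map G"
  have FF: "F \<in> mcar (EQ x (Suc n) m lam m)" and GG: "G \<in> mcar (EQ x (Suc n) m lam m)"
    and vF: "\<And>d. d \<in> bd n (Suc m) \<Longrightarrow> F (bend_top n m d) = 0" and vG: "\<And>d. d \<in> bd n (Suc m) \<Longrightarrow> G (bend_top n m d) = 0"
    using F G unfolding KK_iff by blast+
  have eq: "kernel_component n lam F al d = kernel_component n lam G al d" if "al \<in> DN" for al d
    using fun_cong[OF fun_cong[OF e, of al], of d] that by (simp add: kernel_map_def)
  show "F = G"
  proof (rule ext)
    fix d
    show "F d = G d"
    proof (cases "d \<in> bd (Suc n) m")
      case False then show ?thesis by (simp only: EQ_D(1)[OF FF False] EQ_D(1)[OF GG False])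
    next
      case True
      then show ?thesis
      proof (cases rule: type_cases)
        case A
        then have "d \<in> bd n m" using typeA[OF mn] True by blast
        moreover have "lam \<in> DN" by (simp add: part_le_def)
        ultimately show ?thesis using eq[of lam d] by (simp only: kernel_component_lam)
      next
        case (C j) then show ?thesis using vF[OF typeC_inv[OF True C mn]] vG[OF typeC_inv[OF True C mn]] by simp
      next
        case (B j)
        define \<tau> where "\<tau> = transpose j m"
        note mv = typeB_move[OF True B, folded \<tau>_def]
        obtain m' where m': "m = Suc m'" using B(1) by (cases m) auto
        note inv = typeB_inv[OF mv(2,3)[unfolded m']]
        let ?d = "relab \<tau> d - {{Top (Suc n), Bot (Suc m')}}"
        have FS: "F (relab \<tau> d) \<in> specht lam" "G (relab \<tau> d) \<in> specht lam" using EQ_D(2)[OF FF mv(2)] EQ_D(2)[OF GG mv(2)] .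
        \<comment> \<open>The values are compared in normal position, where a vector of the Specht
          module is determined by its projections to the smaller shapes.\<close>
        have "F (relab \<tau> d) - G (relab \<tau> d) = 0"
        proof (rule psi_inj[OF lam[unfolded m'] fv.subspace_diff[OF specht_subspace FS]])
          fix al assume al: "al \<in> down lam"
          have s: "sum_list al = m'" by (rule is_partition_sum[OF down_partition[OF lam[unfolded m'] al]])
          have "psi lam al (F (relab \<tau> d)) = psi lam al (G (relab \<tau> d))"
            using eq[OF down_DN(1)[OF al], of ?d]
            unfolding kernel_component_down[OF down_DN(2)[OF al], unfolded s, OF inv(1)] unfolding m' inv(2) .
          then show "psi lam al (F (relab \<tau> d) - G (relab \<tau> d)) = 0" unfolding flin_diff[OF flin_psi] by simp
        qed
        then have "perm_act \<tau> (F d) = perm_act \<tau> (G d)"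
          unfolding EQ_D(3)[OF FF mv(1) True] EQ_D(3)[OF GG mv(1) True] by simp
        then show ?thesis using perm_act_inv(1)[OF mv(1)] by metis
      qed
    qed
  qed
qed

lemma kernel_map_surj:
  assumes \<phi>: "\<phi> \<in> mcar (dsum DN (\<lambda>al. CMod x n al))" shows "\<phi> \<in> kernel_map ` mcar KK"
proof -
  have ph: "\<phi> al \<in> mcar (CMod x n al)" if "al \<in> DN" for al using \<phi> that unfolding dsum_simps by (rule PiE_mem)
  have lD: "lam \<in> DN" by (simp add: part_le_def)
  have pl: "\<phi> lam \<in> mcar (EQ x n m lam m)" using ph[OF lD] sum_lam by simp
  define arc where "arc = {Top (Suc n), Bot m}"
  \<comment> \<open>Values at the diagrams in normal form. Their equivariance under permutations
    fixing \<open>m\<close> follows, as for the quotient, from uniqueness of a vector with given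
    projections.\<close>
  have "\<exists>v. \<forall>d. d \<in> bd (Suc n) m \<longrightarrow> arc \<in> d \<longrightarrow> v d \<in> specht lam \<and> (\<forall>al\<in>down lam. psi lam al (v d) = \<phi> al (d - {arc}))
      \<and> (\<forall>\<sigma>. \<sigma> permutes {1..m} \<longrightarrow> \<sigma> m = m \<longrightarrow> v (relab \<sigma> d) = perm_act \<sigma> (v d))"
  proof (cases m)
    \<comment> \<open>Bottom vertices are numbered from \<open>1\<close>, so without vertical arcs
      no diagram in question contains \<open>arc\<close>.\<close>
    case 0
    have "arc \<notin> d" if "d \<in> bd (Suc n) m" for d
      using bd_botD[OF that, of 0] unfolding arc_def 0 by auto
    then show ?thesis by blast
  next
    case (Suc m')
    note lam' = lam[unfolded Suc]
    have s: "sum_list al = m'" if "al \<in> down lam" for al by (rule is_partition_sum[OF down_partition[OF lam' that]])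
    have pd: "\<phi> al \<in> mcar (EQ x n m' al m')" if "al \<in> down lam" for al using ph[OF down_DN(1)[OF that]] s[OF that] by simp
    have "\<exists>v. v \<in> specht lam \<and> (\<forall>al\<in>down lam. psi lam al v = \<phi> al (d - {arc}))" if d: "d \<in> {d \<in> bd (Suc n) m. arc \<in> d}" for d
    proof -
      have "d - {arc} \<in> bd n m'" using typeB_inv(1)[of d n m'] d unfolding arc_def Suc by blast
      then have w: "\<phi> al (d - {arc}) \<in> specht al" if "al \<in> down lam" for al by (rule EQ_D(2)[OF pd[OF that]])
      show ?thesis
      proof (rule psi_surj[where w="\<lambda>al. \<phi> al (d - {arc})", OF lam'])
        fix v assume v: "v \<in> specht lam" "\<And>al. al \<in> down lam \<Longrightarrow> psi lam al v = \<phi> al (d - {arc})"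
        show ?thesis by (rule exI[of _ v]) (intro conjI ballI v)
      qed (fact w)
    qed
    then have "\<forall>d\<in>{d \<in> bd (Suc n) m. arc \<in> d}. \<exists>v. v \<in> specht lam \<and> (\<forall>al\<in>down lam. psi lam al v = \<phi> al (d - {arc}))" by (rule ballI)
    from bchoice[OF this] obtain v where v: "\<forall>d\<in>{d \<in> bd (Suc n) m. arc \<in> d}. v d \<in> specht lam \<and> (\<forall>al\<in>down lam. psi lam al (v d) = \<phi> al (d - {arc}))"
      by (rule exE)
    have v1: "v d \<in> specht lam" if "d \<in> bd (Suc n) m" "arc \<in> d" for d
      by (rule conjunct1[OF bspec[OF v]]) (use that in simp)
    have v2: "psi lam al (v d) = \<phi> al (d - {arc})" if "d \<in> bd (Suc n) m" "arc \<in> d" "al \<in> down lam" for d al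
      by (rule bspec[OF conjunct2[OF bspec[OF v]]]) (use that in simp_all)
    have v3: "v (relab \<sigma> d) = perm_act \<sigma> (v d)" if d: "d \<in> bd (Suc n) m" "arc \<in> d" and sg: "\<sigma> permutes {1..m}" "\<sigma> m = m" for \<sigma> d
    proof -
      have sg': "\<sigma> permutes {1..m'}"
        by (rule permutes_superset[OF sg(1)]) (use sg(2) Suc in \<open>auto simp: le_Suc_eq\<close>)
      have rd: "relab \<sigma> d \<in> bd (Suc n) m" by (rule relab_bd[OF sg(1) d(1)])
      have ra: "arc \<in> relab \<sigma> d" using relab_arc[of "Suc n" m d \<sigma>] d(2) sg(2) by (simp add: arc_def)
      have d0: "d - {arc} \<in> bd n m'" and e0: "add_arc n (Suc m') (d - {arc}) = d"
        using typeB_inv[of d n m'] d unfolding arc_def Suc by blast+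
      have "arc \<notin> relab \<sigma> (d - {arc})"
        using Top_Suc_notin[OF bd_diagrams[OF relab_bd[OF sg' d0]]] unfolding arc_def by blast
      moreover have "relab \<sigma> d = insert arc (relab \<sigma> (d - {arc}))"
        using relab_eb[OF sg', of n "d - {arc}"] unfolding e0 by (simp add: add_arc_def arc_def Suc)
      ultimately have rm: "relab \<sigma> d - {arc} = relab \<sigma> (d - {arc})" by simp
      have sgl: "\<sigma> permutes {1..sum_list lam}" using sg(1) sum_lam by simp
      have "v (relab \<sigma> d) - perm_act \<sigma> (v d) = 0"
      proof (rule psi_inj[OF lam' fv.subspace_diff[OF specht_subspace v1[OF rd ra] perm_act_specht[OF sgl v1[OF d]]]])
        fix al assume al: "al \<in> down lam"
        have sga: "\<sigma> permutes {1..sum_list al}" using sg' s[OF al] by simp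
        have "psi lam al (v (relab \<sigma> d)) = psi lam al (perm_act \<sigma> (v d))"
          unfolding v2[OF rd ra al] psi_perm_act[OF sga] v2[OF d al] rm by (rule EQ_D(3)[OF pd[OF al] sg' d0])
        then show "psi lam al (v (relab \<sigma> d) - perm_act \<sigma> (v d)) = 0" unfolding flin_diff[OF flin_psi] by simp
      qed
      then show ?thesis by simp
    qed
    show ?thesis by (rule exI[of _ v]) (intro allI impI conjI ballI v1 v2 v3)
  qed
  then obtain v where v: "\<forall>d. d \<in> bd (Suc n) m \<longrightarrow> arc \<in> d \<longrightarrow> v d \<in> specht lam \<and> (\<forall>al\<in>down lam. psi lam al (v d) = \<phi> al (d - {arc}))
      \<and> (\<forall>\<sigma>. \<sigma> permutes {1..m} \<longrightarrow> \<sigma> m = m \<longrightarrow> v (relab \<sigma> d) = perm_act \<sigma> (v d))" by (rule exE)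
  note v' = mp[OF mp[OF spec[OF v]]]
  have v1: "v d \<in> specht lam" if "d \<in> bd (Suc n) m" "arc \<in> d" for d
    by (rule conjunct1[OF v'[OF that]])
  have v2: "psi lam al (v d) = \<phi> al (d - {arc})" if "d \<in> bd (Suc n) m" "arc \<in> d" "al \<in> down lam" for d al
    by (rule bspec[OF conjunct1[OF conjunct2[OF v'[OF that(1,2)]]] that(3)])
  have v3: "v (relab \<sigma> d) = perm_act \<sigma> (v d)" if "d \<in> bd (Suc n) m" "arc \<in> d" "\<sigma> permutes {1..m}" "\<sigma> m = m" for \<sigma> d
    by (rule mp[OF mp[OF spec[OF conjunct2[OF conjunct2[OF v'[OF that(1,2)]]]] that(3)] that(4)])
  \<comment> \<open>An arc ending at \<open>j\<close> is brought to \<open>m\<close> by a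
    transposition; being its own inverse, the same transposition carries the value back.\<close>
  define F where "F d = (if d \<in> bd n m then \<phi> lam d else if d \<in> bd (Suc n) m \<and> (\<exists>j\<in>{1..m}. {Top (Suc n), Bot j} \<in> d)
    then let j = (THE j. {Top (Suc n), Bot j} \<in> d) in perm_act (transpose j m) (v (relab (transpose j m) d)) else 0)" for d
  have FA: "F d = \<phi> lam d" if "d \<in> bd n m" for d using that by (simp add: F_def)
  have FB: "F d = perm_act (transpose j m) (v (relab (transpose j m) d))" if "d \<in> bd (Suc n) m" "j \<in> {1..m}" "{Top (Suc n), Bot j} \<in> d" for d j
  proof -
    have "d \<notin> bd n m" using typeA[OF mn] that(3) by blast
    moreover have "(THE j. {Top (Suc n), Bot j} \<in> d) = j"
      by (rule the_equality) (use that diagram_partner[OF bd_diagrams[OF that(1)]] in blast)+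
    moreover have "\<exists>j\<in>{1..m}. {Top (Suc n), Bot j} \<in> d" using that by blast
    ultimately show ?thesis using that(1) by (simp add: F_def)
  qed
  have FC: "F d = 0" if "d \<in> bd (Suc n) m" "{Top (Suc n), Top j} \<in> d" for d j
  proof -
    have "d \<notin> bd n m" using typeA[OF mn] that(2) by blast
    moreover have "{Top (Suc n), Bot i} \<notin> d" for i using diagram_partner[OF bd_diagrams[OF that(1)] that(2)] by blast
    ultimately show ?thesis by (simp add: F_def)
  qed
  have out: "F d = 0" if "d \<notin> bd (Suc n) m" for d
  proof -
    have "d \<notin> bd n m" using that typeA[OF mn] by blast
    then show ?thesis using that by (simp add: F_def)
  qed
  have "F \<in> mcar (EQ x (Suc n) m lam m)"
    unfolding in_EQ
  proof (intro conjI allI impI ballI)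
    show "F d = 0" if "d \<notin> bd (Suc n) m" for d by (rule out[OF that])
    show "F d \<in> specht lam" if d: "d \<in> bd (Suc n) m" for d
      using d
    proof (cases rule: type_cases)
      case A
      then have dn: "d \<in> bd n m" using typeA[OF mn] d by blast
      show ?thesis unfolding FA[OF dn] by (rule EQ_D(2)[OF pl dn])
    next
      case (B j)
      note mv = typeB_move[OF d B]
      show ?thesis unfolding FB[OF d B]
        by (rule perm_act_specht[OF _ v1[OF mv(2)]]) (use mv sum_lam in \<open>simp_all add: arc_def\<close>)
    next
      case (C j) show ?thesis unfolding FC[OF d C] by (rule specht_0)
    qed
    fix \<rho> d assume r: "\<rho> permutes {1..m}" and d: "d \<in> bd (Suc n) m"
    note rd = relab_bd[OF r d]
    show "F (relab \<rho> d) = perm_act \<rho> (F d)"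
      using d
    proof (cases rule: type_cases)
      case A
      then have dn: "d \<in> bd n m" using typeA[OF mn] d by blast
      show ?thesis unfolding FA[OF dn] FA[OF relab_bd[OF r dn]] by (rule EQ_D(3)[OF pl r dn])
    next
      case (C j)
      have "mb \<rho> ` {Top (Suc n), Top j} \<in> relab \<rho> d" unfolding relab_def vmap_def by (rule imageI[OF C])
      then have "{Top (Suc n), Top j} \<in> relab \<rho> d" by simp
      from FC[OF rd this] show ?thesis unfolding FC[OF d C] perm_act_lin(3) .
    next
      case (B j)
      let ?i = "\<rho> j"
      have i: "?i \<in> {1..m}" using permutes_in_image[OF r] B(1) by blast
      have ia: "{Top (Suc n), Bot ?i} \<in> relab \<rho> d" by (rule relab_arc[OF B(2)])
      note mv = typeB_move[OF d B] and mvi = typeB_move[OF rd i ia]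
      \<comment> \<open>Compares the normal positions before and after relabelling by
        \<open>\<rho>\<close>; it fixes \<open>m\<close>, so the equivariance of \<open>v\<close>
        applies to it.\<close>
      define \<sigma> where "\<sigma> = transpose ?i m \<circ> \<rho> \<circ> transpose j m"
      have sg: "\<sigma> permutes {1..m}" unfolding \<sigma>_def by (intro permutes_compose mv(1) mvi(1) r)
      have sm: "\<sigma> m = m" by (simp add: \<sigma>_def)
      have c1: "transpose ?i m \<circ> \<rho> = \<sigma> \<circ> transpose j m" by (simp add: \<sigma>_def fun_eq_iff)
      have c2: "transpose ?i m \<circ> \<sigma> = \<rho> \<circ> transpose j m" by (simp add: \<sigma>_def fun_eq_iff)
      have "v (relab (transpose ?i m) (relab \<rho> d)) = perm_act \<sigma> (v (relab (transpose j m) d))"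
        unfolding relab_comp c1 unfolding relab_comp[symmetric] by (rule v3[OF mv(2) mv(3)[folded arc_def] sg sm])
      then show ?thesis unfolding FB[OF rd i ia] FB[OF d B] by (simp only: perm_act_comp c2)
    qed
  qed
  moreover have "F (bend_top n m d) = 0" if d: "d \<in> bd n (Suc m)" for d
  proof -
    obtain j where "{Top (Suc n), Top j} \<in> bend_top n m d" using typeC_ec(2)[OF d] by (rule exE)
    then show ?thesis by (rule FC[OF typeC_ec(1)[OF d]])
  qed
  ultimately have FK: "F \<in> mcar KK" unfolding KK_iff by blast
  have "kernel_map F = \<phi>"
  proof (rule PiE_ext)
    show "kernel_map F \<in> (\<Pi>\<^sub>E al\<in>DN. mcar (CMod x n al))" using is_homD(1)[OF kernel_map_hom FK] unfolding dsum_simps .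
    show "\<phi> \<in> (\<Pi>\<^sub>E al\<in>DN. mcar (CMod x n al))" using \<phi> unfolding dsum_simps .
    fix al assume al: "al \<in> DN"
    have "kernel_component n lam F al d = \<phi> al d" for d
    proof (cases "d \<in> bd n (sum_list al)")
      case False show ?thesis unfolding kernel_component_out[OF False] EQ_D(1)[OF ph[OF al] False] ..
    next
      case True
      from al show ?thesis
      proof (cases rule: DN_cases)
        case 1
        have d: "d \<in> bd n m" using True 1 sum_lam by simp
        show ?thesis unfolding 1 kernel_component_lam[OF d] by (rule FA[OF d])
      next
        case (2 m')
        have d: "d \<in> bd n m'" using True 2(5) by simp
        have e: "add_arc n m d \<in> bd (Suc n) m" unfolding 2(2) by (rule typeB_eb[OF d])
        have a: "arc \<in> add_arc n m d" by (simp add: add_arc_def arc_def)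
        have "arc \<notin> d" using Top_Suc_notin[OF bd_diagrams[OF d]] unfolding arc_def by blast
        then have rm: "add_arc n m d - {arc} = d" by (simp add: add_arc_def arc_def)
        have "F (add_arc n m d) = v (add_arc n m d)"
          using FB[OF e _ a[unfolded arc_def]] 2(2) by simp
        then show ?thesis unfolding kernel_component_down[OF 2(1) True] using v2[OF e a 2(3)] rm by simp
      qed
    qed
    then have "kernel_component n lam F al = \<phi> al" by (rule ext)
    then show "kernel_map F al = \<phi> al" using al by (simp only: kernel_map_def restrict_apply if_True)
  qed
  then show ?thesis using imageI[OF FK, of kernel_map] by (simp only:)
qed

lemma kernel_map_bij: "bij_betw kernel_map (mcar KK) (mcar (dsum DN (\<lambda>al. CMod x n al)))"
  unfolding bij_betw_def
  by (intro conjI kernel_map_inj equalityI subsetI image_subsetI kernel_map_surj) (rule is_homD(1)[OF kernel_map_hom])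

end

theorem theorem3p2:
  fixes x :: "'a::field_char_0" and n t :: nat and lam :: "nat list"
  assumes "x \<noteq> 0" and "1 \<le> t" and "t \<le> n" and "is_partition (n - t) lam"
  shows "\<exists>f g. short_exact (diagrams (n - 1))
            (dsum {al. part_le al lam} (\<lambda>al. MA x (n - 1) al))
            (restr n (MA x n lam))
            (dsum {be. removes_box lam be \<and> sum_list be \<le> n - 1} (\<lambda>be. MA x (n - 1) be))
            f g"
proof -
  \<comment> \<open>Both bounds on \<open>t\<close> together make \<open>n\<close> positive, so the
    smaller algebra has index \<open>N\<close> and the results for \<open>Suc N\<close>
    apply.\<close>
  obtain N where n: "n = Suc N" using assms(2,3) by (cases n) auto
  define m where "m = n - t"
  have lam: "is_partition m lam" using assms(4) by (simp add: m_def)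
  \<comment> \<open>Since \<open>t\<close> is at least \<open>1\<close>, the number of vertical arcs
    does not exceed \<open>n - 1\<close>, so \<open>lam\<close> itself may occur as a summand on the
    left.\<close>
  have mN: "m \<le> N" using assms(2) n by (simp add: m_def)
  have sum_lam: "sum_list lam = m" by (rule is_partition_sum[OF lam])
  let ?D = "diagrams N" and ?dn = "{al. part_le al lam}" and ?up = "{be. removes_box lam be \<and> sum_list be \<le> N}"
  \<comment> \<open>One more vertical arc than the shape has cells: the common target of the
    restriction map and of the direct sum over the larger shapes.\<close>
  let ?E = "EQ x N (Suc m) lam m"
  have dn: "is_partition (sum_list al) al \<and> sum_list al \<le> N" if "al \<in> ?dn" for al
    using that lam mN sum_lam removes_boxD(1,5)[of al lam] unfolding part_le_def by auto
  have up: "is_partition (sum_list be) be \<and> sum_list be \<le> N" if "be \<in> ?up" for be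
    using that removes_boxD(2)[of lam be] by simp
  have mn: "m \<le> n" using mN n by simp
  have "\<exists>f g. short_exact ?D (dsum ?dn (\<lambda>al. MA x N al)) (restr (Suc N) (MA x (Suc N) lam)) (dsum ?up (\<lambda>be. MA x N be)) f g"
  proof (rule short_exact_transfer)
    show "is_hom ?D (restr (Suc N) (MA x (Suc N) lam)) (restr (Suc N) (CMod x (Suc N) lam)) (tensor_map m)"
      using MA_iso(1)[OF assms(1) lam mn] unfolding n by (rule restr_hom)
    show "bij_betw (tensor_map m) (mcar (restr (Suc N) (MA x (Suc N) lam))) (mcar (restr (Suc N) (CMod x (Suc N) lam)))"
      using MA_iso(2)[OF assms(1) lam mn] unfolding n restr_simps .
    show "mclosed ?D (restr (Suc N) (MA x (Suc N) lam))"
      using MA_closed[OF assms(1) lam mn] unfolding n by (rule restr_closed)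
    show "is_hom ?D (restr (Suc N) (CMod x (Suc N) lam)) ?E (restrict_horizontal N m)" by (rule restrict_horizontal_hom[OF sum_lam mN])
    show "restrict_horizontal N m ` mcar (restr (Suc N) (CMod x (Suc N) lam)) = mcar ?E" unfolding restr_simps by (rule restrict_horizontal_surj[OF sum_lam mN])
    show "mclosed ?D (restr (Suc N) (CMod x (Suc N) lam))" by (rule restr_closed[OF EQ_closed]) simp_all
    show "madd ?E (mzero ?E) (mzero ?E) = mzero ?E" by simp
    show "msmul ?E c (mzero ?E) = mzero ?E" for c by (rule ext) (simp add: fv.scale_zero_right)
    show "mact ?E d (mzero ?E) = mzero ?E" for d by (rule ext) (simp add: fv.scale_zero_right)
    show "is_hom ?D ((restr (Suc N) (CMod x (Suc N) lam))\<lparr>mcar := {v \<in> mcar (restr (Suc N) (CMod x (Suc N) lam)).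
        restrict_horizontal N m v = mzero ?E}\<rparr>) (dsum ?dn (\<lambda>al. CMod x N al)) (kernel_map lam N)" by (rule kernel_map_hom[OF lam mN])
    show "bij_betw (kernel_map lam N) (mcar ((restr (Suc N) (CMod x (Suc N) lam))\<lparr>mcar := {v \<in> mcar (restr (Suc N) (CMod x (Suc N) lam)).
        restrict_horizontal N m v = mzero ?E}\<rparr>)) (mcar (dsum ?dn (\<lambda>al. CMod x N al)))" by (rule kernel_map_bij[OF lam mN])
    show "is_hom ?D (dsum ?dn (\<lambda>al. MA x N al)) (dsum ?dn (\<lambda>al. CMod x N al)) (\<lambda>\<phi>. restrict (\<lambda>al. tensor_map (sum_list al) (\<phi> al)) ?dn)"
      by (rule dsum_hom) (use MA_iso(1)[OF assms(1)] dn in blast)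
    show "bij_betw (\<lambda>\<phi>. restrict (\<lambda>al. tensor_map (sum_list al) (\<phi> al)) ?dn) (mcar (dsum ?dn (\<lambda>al. MA x N al))) (mcar (dsum ?dn (\<lambda>al. CMod x N al)))"
      by (rule dsum_bij) (use MA_iso(2)[OF assms(1)] dn in blast)
    let ?T = "\<lambda>\<phi>. restrict (\<lambda>be. tensor_map (sum_list be) (\<phi> be)) ?up"
    have Th: "is_hom ?D (dsum ?up (\<lambda>be. MA x N be)) (dsum ?up (\<lambda>be. CMod x N be)) ?T"
      by (rule dsum_hom) (use MA_iso(1)[OF assms(1)] up in blast)
    have Tb: "bij_betw ?T (mcar (dsum ?up (\<lambda>be. MA x N be))) (mcar (dsum ?up (\<lambda>be. CMod x N be)))"
      by (rule dsum_bij) (use MA_iso(2)[OF assms(1)] up in blast)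
    show "is_hom ?D (dsum ?up (\<lambda>be. MA x N be)) ?E (induce_map lam ?up \<circ> ?T)" by (rule is_hom_comp[OF Th induce_map_hom[OF lam]])
    show "bij_betw (induce_map lam ?up \<circ> ?T) (mcar (dsum ?up (\<lambda>be. MA x N be))) (mcar ?E)" by (rule bij_betw_trans[OF Tb induce_map_bij[OF lam]])
    show "mclosed ?D (dsum ?up (\<lambda>be. MA x N be))" by (rule mclosed_dsum) (use MA_closed[OF assms(1)] up in blast)
    show "mzero (dsum ?up (\<lambda>be. MA x N be)) \<in> mcar (dsum ?up (\<lambda>be. MA x N be))"
      unfolding dsum_simps by (rule restrict_PiE_iff[THEN iffD2], rule ballI) (use MA_iso(3)[OF assms(1)] up in blast)
    have "?T (mzero (dsum ?up (\<lambda>be. MA x N be))) = mzero (dsum ?up (\<lambda>be. CMod x N be))"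
      unfolding dsum_simps
    proof (rule restrict_ext)
      fix be assume be: "be \<in> ?up"
      have "tensor_map (sum_list be) (mzero (MA x N be)) = 0" by (rule MA_iso(4)[OF assms(1)]) (use up[OF be] in blast)+
      then show "tensor_map (sum_list be) (restrict (\<lambda>be. mzero (MA x N be)) ?up be) = mzero (CMod x N be)"
        using be by (simp only: restrict_apply if_True EQ_simps)
    qed
    then show "(induce_map lam ?up \<circ> ?T) (mzero (dsum ?up (\<lambda>be. MA x N be))) = mzero ?E"
      using induce_map_zero[OF lam, of N x] by (simp only: comp_apply EQ_simps)
  qed (rule refl)
  then show ?thesis unfolding n by simp
qed

end
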